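(* Let $n\ge 6$ and let $M\in\mathrm{CM}(B_{3,n})$ be indecomposable of rank $3$. Then $q(M)\in\{0,2\}$ and $\varphi(M)$ is a real or imaginary root of $J_{3,n}$.
   Context: Category. $k=3$, $[n]=\{1,\dots,n\}$. Let $Q_C$ be the quiver with vertex set $\mathbb{Z}/n$ and arrows $x_i:i-1\to i$, $y_i:i\to i-1$. $B_{k,n}$ is the quotient of the completed path algebra $\widehat{\mathbb{C}Q_C}$ by the ideal generated by the relations $xy=yx$ and $x^k=y^{n-k}$ at each vertex. Its centre is $Z=\mathbb{C}[[t]]$, $t=\sum_i x_iy_i$. $\mathrm{CM}(B_{k,n})$ is the category of $B_{k,n}$-modules $M=(M_i)$ with all $M_i$ free $Z$-modules of the same finite rank, which is the rank of $M$. For a $k$-subset $I\subset[n]$, $L_I$ is the rank 1 module with $\mathbb{C}[[t]]$ at each vertex, $x_i$ acting as $1$ if $i\in I$ and $t$ if $i\notin I$, $y_i$ acting as $t$ if $i\in I$ and $1$ if $i\notin I$. Every rank 1 module is some $L_I$, and every rank $m$ module has a filtration with $m$ rank 1 factors $L_{I_1},\dots,L_{I_m}$. Roots. $J_{k,n}$ is the graph with nodes $1,\dots,n-1$ on a line and a node $n$ attached to node $k$; also the corresponding Kac–Moody root system with simple roots $\alpha_1,\dots,\alpha_{n-1},\beta=\alpha_n$. Its root lattice is identified with $\{x\in\mathbb{Z}^n: k\mid\sum x_i\}$ via $\alpha_i=-e_i+e_{i+1}$, $\beta=e_1+\dots+e_k$, with quadratic form $q(x)=\sum_i x_i^2+\frac{2-k}{k^2}(\sum_i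 x_i)^2$. Real roots are the Weyl group conjugates of simple roots; the other roots are imaginary. For $M$ with a filtration with factors $L_{I_1},\dots,L_{I_m}$, let $x(M)\in\mathbb{Z}^n$ have $i$-th entry the number of $j$ with $i\in I_j$, let $\varphi(M)$ be the corresponding element of the root lattice, and $q(M)=q(x(M))$. *)

theory Defs
  imports
    "Graph_Theory.Arc_Walk"
    "HOL-Algebra.QuotRing"
    "HOL-Algebra.Module"
    "HOL-Computational_Algebra.Formal_Power_Series"
begin

section \<open>The completed path algebra of a quiver\<close>

text \<open>
  A quiver is a \<open>pre_digraph\<close>. A path is its start vertex together with the list of its arrows in
  the order in which they are traversed; \<open>(v, [])\<close> is the trivial path at \<open>v\<close>. An element of the
  completed path algebra over the complex numbers is an arbitrary (formal, possibly infinite) linear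
  combination of paths, i.e. its coefficient function.
\<close>

definition quiver_paths :: "('v, 'e) pre_digraph \<Rightarrow> ('v \<times> 'e list) set" where
  "quiver_paths G = {(v, w). \<exists>u. pre_digraph.awalk G v w u}"

definition path_end :: "('v, 'e) pre_digraph \<Rightarrow> 'v \<times> 'e list \<Rightarrow> 'v" where
  "path_end G p = last (pre_digraph.awalk_verts G (fst p) (snd p))"

text \<open>
  Products of paths are written like compositions of maps: \<open>a b\<close> is "first \<open>b\<close>, then \<open>a\<close>", so that
  left modules are representations of the quiver.
\<close>

definition cpath_algebra :: "('v, 'e) pre_digraph \<Rightarrow> ('v \<times> 'e list \<Rightarrow> complex) ring" where
  "cpath_algebra G =
    \<lparr>carrier = {a. \<forall>p. p \<notin> quiver_paths G \<longrightarrow> a p = 0},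
     monoid.mult = (\<lambda>a b (v, w). \<Sum>j\<le>length w.
       a (path_end G (v, take j w), drop j w) * b (v, take j w)),
     one = (\<lambda>(v, w). if v \<in> verts G \<and> w = [] then 1 else 0),
     zero = (\<lambda>_. 0),
     add = (\<lambda>a b p. a p + b p)\<rparr>"

text \<open>Closure in the arrow-ideal-adic topology.\<close>

definition adic_closure ::
  "('v, 'e) pre_digraph \<Rightarrow> ('v \<times> 'e list \<Rightarrow> complex) set \<Rightarrow> ('v \<times> 'e list \<Rightarrow> complex) set" where
  "adic_closure G S = {a \<in> carrier (cpath_algebra G).
     \<forall>N. \<exists>b\<in>S. \<forall>p. length (snd p) < N \<longrightarrow> a p = b p}"

text \<open>
  The value \<open>f(a)\<close> of a power series at an element \<open>a\<close> of the closed ideal generated by the arrows: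
  there \<open>a^j\<close> has no component on paths of length less than \<open>j\<close>, which is why the sum may be cut off.
\<close>

definition power_series_at ::
  "('v, 'e) pre_digraph \<Rightarrow> complex fps \<Rightarrow> ('v \<times> 'e list \<Rightarrow> complex) \<Rightarrow> ('v \<times> 'e list \<Rightarrow> complex)" where
  "power_series_at G f a =
     (\<lambda>p. \<Sum>j\<le>length (snd p). fps_nth f j * (a [^]\<^bsub>cpath_algebra G\<^esub> j) p)"

lemma path_end_Nil [simp]: "path_end G (v, []) = v"
  by (simp add: path_end_def pre_digraph.awalk_verts.simps)

lemma path_end_append: "path_end G (v, p @ q) = path_end G (path_end G (v, p), q)"
  by (auto simp: path_end_def pre_digraph.awalk_verts_conv)

lemma quiver_paths_append:
  assumes "wf_digraph G"
  shows "(v, p @ q) \<in> quiver_paths G \<longleftrightarrow>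
    (v, p) \<in> quiver_paths G \<and> (path_end G (v, p), q) \<in> quiver_paths G"
proof -
  interpret wf_digraph G by fact
  show ?thesis
    by (auto simp: quiver_paths_def path_end_def awalk_append_iff)
qed

lemma Nil_in_quiver_paths [simp]: "(v, []) \<in> quiver_paths G \<longleftrightarrow> v \<in> verts G"
  by (auto simp: quiver_paths_def pre_digraph.awalk_def intro: pre_digraph.cas.simps(1)[THEN iffD2])

lemma cpath_mult_assoc:
  fixes G :: "('v, 'e) pre_digraph"
  shows "(a \<otimes>\<^bsub>cpath_algebra G\<^esub> b) \<otimes>\<^bsub>cpath_algebra G\<^esub> c = a \<otimes>\<^bsub>cpath_algebra G\<^esub> (b \<otimes>\<^bsub>cpath_algebra G\<^esub> c)"
proof (rule ext, clarify)
  fix v :: 'v and w :: "'e list"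
  let ?e = "path_end G"
  let ?L = "length w"
  let ?f = "\<lambda>j i. a (?e (v, take (j + i) w), drop (j + i) w)
        * b (?e (v, take j w), take i (drop j w)) * c (v, take j w)"
  let ?g = "\<lambda>m j. a (?e (v, take m w), drop m w)
        * b (?e (v, take j w), drop j (take m w)) * c (v, take j w)"
  have e: "?e (?e (v, take j w), take i (drop j w)) = ?e (v, take (j + i) w)" for i j
    by (simp add: path_end_append[symmetric] take_add)
  have "((a \<otimes>\<^bsub>cpath_algebra G\<^esub> b) \<otimes>\<^bsub>cpath_algebra G\<^esub> c) (v, w)
      = (\<Sum>j\<le>?L. \<Sum>i\<le>?L - j. ?f j i)"
    by (simp add: cpath_algebra_def e sum_distrib_right add.commute)
  also have "\<dots> = (\<Sum>(j,i)\<in>(SIGMA j:{..?L}. {..?L - j}). ?f j i)"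
    by (simp add: sum.Sigma)
  also have "\<dots> = (\<Sum>(m,j)\<in>(SIGMA m:{..?L}. {..m}). ?g m j)"
    by (rule sum.reindex_bij_witness[where i = "\<lambda>(m,j). (j, m - j)" and j = "\<lambda>(j,i). (j + i, j)"])
       (auto simp: drop_take)
  also have "\<dots> = (\<Sum>m\<le>?L. \<Sum>j\<le>m. ?g m j)"
    by (simp add: sum.Sigma)
  also have "\<dots> = (a \<otimes>\<^bsub>cpath_algebra G\<^esub> (b \<otimes>\<^bsub>cpath_algebra G\<^esub> c)) (v, w)"
    by (simp add: cpath_algebra_def sum_distrib_left mult.assoc min.absorb1 cong: sum.cong_simp)
  finally show "((a \<otimes>\<^bsub>cpath_algebra G\<^esub> b) \<otimes>\<^bsub>cpath_algebra G\<^esub> c) (v, w)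
     = (a \<otimes>\<^bsub>cpath_algebra G\<^esub> (b \<otimes>\<^bsub>cpath_algebra G\<^esub> c)) (v, w)" .
qed

lemma cpath_mult_closed:
  assumes "wf_digraph G" "a \<in> carrier (cpath_algebra G)" "b \<in> carrier (cpath_algebra G)"
  shows "a \<otimes>\<^bsub>cpath_algebra G\<^esub> b \<in> carrier (cpath_algebra G)"
proof -
  have "a (path_end G (v, take j w), drop j w) * b (v, take j w) = 0"
    if "(v, w) \<notin> quiver_paths G" for v w j
    using quiver_paths_append[OF assms(1), of v "take j w" "drop j w"] that assms(2,3)
    by (auto simp: cpath_algebra_def)
  then have "(a \<otimes>\<^bsub>cpath_algebra G\<^esub> b) (v, w) = 0" if "(v, w) \<notin> quiver_paths G" for v w
    using that by (simp add: cpath_algebra_def sum.neutral del: mult_eq_0_iff)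
  then show ?thesis
    by (simp add: cpath_algebra_def)
qed

lemma cpath_one_mult:
  assumes "wf_digraph G" "a \<in> carrier (cpath_algebra G)"
  shows "\<one>\<^bsub>cpath_algebra G\<^esub> \<otimes>\<^bsub>cpath_algebra G\<^esub> a = a" "a \<otimes>\<^bsub>cpath_algebra G\<^esub> \<one>\<^bsub>cpath_algebra G\<^esub> = a"
proof -
  have end_in: "path_end G (v, w) \<in> verts G" if "(v, w) \<in> quiver_paths G" for v w
    using quiver_paths_append[OF assms(1), of v w "[]"] that by simp
  have start_in: "v \<in> verts G" if "(v, w) \<in> quiver_paths G" for v w
    using quiver_paths_append[OF assms(1), of v "[]" w] that by simp
  have "(\<one>\<^bsub>cpath_algebra G\<^esub> \<otimes>\<^bsub>cpath_algebra G\<^esub> a) (v, w) = a (v, w)" for v w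
  proof -
    have "(\<one>\<^bsub>cpath_algebra G\<^esub> \<otimes>\<^bsub>cpath_algebra G\<^esub> a) (v, w)
      = (\<Sum>j\<le>length w. if j = length w then
           (if path_end G (v, w) \<in> verts G then a (v, w) else 0) else 0)"
      unfolding cpath_algebra_def ring.simps monoid.simps partial_object.simps prod.case
      by (rule sum.cong) auto
    also have "\<dots> = a (v, w)"
      using end_in[of v w] assms(2) by (auto simp: cpath_algebra_def)
    finally show ?thesis .
  qed
  then show "\<one>\<^bsub>cpath_algebra G\<^esub> \<otimes>\<^bsub>cpath_algebra G\<^esub> a = a" by auto
  have "(a \<otimes>\<^bsub>cpath_algebra G\<^esub> \<one>\<^bsub>cpath_algebra G\<^esub>) (v, w) = a (v, w)" for v w
  proof -
    have "(a \<otimes>\<^bsub>cpath_algebra G\<^esub> \<one>\<^bsub>cpath_algebra G\<^esub>) (v, w)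
      = (\<Sum>j\<le>length w. if j = 0 then (if v \<in> verts G then a (v, w) else 0) else 0)"
      unfolding cpath_algebra_def ring.simps monoid.simps partial_object.simps prod.case
      by (rule sum.cong) auto
    also have "\<dots> = a (v, w)"
      using start_in[of v w] assms(2) by (auto simp: cpath_algebra_def)
    finally show ?thesis .
  qed
  then show "a \<otimes>\<^bsub>cpath_algebra G\<^esub> \<one>\<^bsub>cpath_algebra G\<^esub> = a" by auto
qed

lemma ring_cpath_algebra:
  assumes "wf_digraph G"
  shows "ring (cpath_algebra G)"
proof (rule ringI)
  show "abelian_group (cpath_algebra G)"
  proof (rule abelian_groupI)
    fix a assume "a \<in> carrier (cpath_algebra G)"
    then show "\<exists>b\<in>carrier (cpath_algebra G). b \<oplus>\<^bsub>cpath_algebra G\<^esub> a = \<zero>\<^bsub>cpath_algebra G\<^esub>"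
      by (intro bexI[of _ "\<lambda>p. - a p"]) (auto simp: cpath_algebra_def)
  qed (auto simp: cpath_algebra_def)
  show "Group.monoid (cpath_algebra G)"
  proof (rule monoidI)
    show "\<one>\<^bsub>cpath_algebra G\<^esub> \<in> carrier (cpath_algebra G)"
      by (auto simp: cpath_algebra_def)
  qed (simp_all add: assms cpath_mult_closed cpath_mult_assoc cpath_one_mult)
qed (auto simp: cpath_algebra_def fun_eq_iff algebra_simps sum.distrib)

lemma adic_closure_ideal:
  assumes G: "wf_digraph G" and I: "ideal I (cpath_algebra G)"
  shows "ideal (adic_closure G I) (cpath_algebra G)"
proof -
  interpret I: ideal I "cpath_algebra G" by fact
  let ?R = "cpath_algebra G"
  have minus: "\<ominus>\<^bsub>?R\<^esub> a = (\<lambda>p. - a p)" if "a \<in> carrier ?R" for a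
    using that by (intro I.minus_equality) (auto simp: cpath_algebra_def)
  have add: "a \<oplus>\<^bsub>?R\<^esub> b = (\<lambda>p. a p + b p)" for a b
    by (simp add: cpath_algebra_def)
  have mult: "(a \<otimes>\<^bsub>?R\<^esub> b) (v, w) = (a' \<otimes>\<^bsub>?R\<^esub> b') (v, w)"
    if "\<forall>p. length (snd p) < N \<longrightarrow> a p = a' p" "\<forall>p. length (snd p) < N \<longrightarrow> b p = b' p" "length w < N"
    for a b a' b' N v w
    using that by (auto simp: cpath_algebra_def intro!: sum.cong)
  show ?thesis
  proof (rule idealI)
    show "ring ?R" by (rule I.ring_axioms)
    show "subgroup (adic_closure G I) (add_monoid ?R)"
    proof (rule group.subgroupI)
      show "group (add_monoid ?R)" by (rule I.a_group)
      show "adic_closure G I \<subseteq> carrier (add_monoid ?R)"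
        by (auto simp: adic_closure_def)
      have "\<zero>\<^bsub>?R\<^esub> \<in> adic_closure G I"
        by (auto simp: adic_closure_def)
      then show "adic_closure G I \<noteq> {}" by blast
    next
      fix a assume a: "a \<in> adic_closure G I"
      then have ca: "a \<in> carrier ?R" by (simp add: adic_closure_def)
      have "\<exists>b\<in>I. \<forall>p. length (snd p) < N \<longrightarrow> (\<ominus>\<^bsub>?R\<^esub> a) p = b p" for N
      proof -
        from a obtain b where b: "b \<in> I" "\<forall>p. length (snd p) < N \<longrightarrow> a p = b p"
          unfolding adic_closure_def by blast
        have "\<ominus>\<^bsub>?R\<^esub> b \<in> I"
          using subgroup.m_inv_closed[OF I.a_subgroup, of b] b by (simp add: a_inv_def)
        with b show ?thesis
          by (intro bexI[of _ "\<ominus>\<^bsub>?R\<^esub> b"]) (auto simp: minus ca I.a_Hcarr)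
      qed
      then have "\<ominus>\<^bsub>?R\<^esub> a \<in> adic_closure G I"
        unfolding adic_closure_def using ca by blast
      then show "inv\<^bsub>add_monoid ?R\<^esub> a \<in> adic_closure G I"
        by (simp only: a_inv_def)
    next
      fix a b assume a: "a \<in> adic_closure G I" and b: "b \<in> adic_closure G I"
      have "\<exists>c\<in>I. \<forall>p. length (snd p) < N \<longrightarrow> (a \<oplus>\<^bsub>?R\<^esub> b) p = c p" for N
      proof -
        from a b obtain a' b' where "a' \<in> I" "\<forall>p. length (snd p) < N \<longrightarrow> a p = a' p"
          "b' \<in> I" "\<forall>p. length (snd p) < N \<longrightarrow> b p = b' p"
          unfolding adic_closure_def by blast
        moreover from this have "a' \<oplus>\<^bsub>?R\<^esub> b' \<in> I"
          using subgroup.m_closed[OF I.a_subgroup, of a' b'] by simp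
        ultimately show ?thesis
          by (intro bexI[of _ "a' \<oplus>\<^bsub>?R\<^esub> b'"]) (simp_all add: add)
      qed
      then show "a \<otimes>\<^bsub>add_monoid ?R\<^esub> b \<in> adic_closure G I"
        using a b by (simp add: adic_closure_def)
    qed
  next
    fix a x assume a: "a \<in> adic_closure G I" and x: "x \<in> carrier ?R"
    have "\<exists>c\<in>I. \<forall>p. length (snd p) < N \<longrightarrow> (x \<otimes>\<^bsub>?R\<^esub> a) p = c p"
         "\<exists>c\<in>I. \<forall>p. length (snd p) < N \<longrightarrow> (a \<otimes>\<^bsub>?R\<^esub> x) p = c p" for N
    proof -
      from a obtain b where b: "b \<in> I" "\<forall>p. length (snd p) < N \<longrightarrow> a p = b p"
        unfolding adic_closure_def by blast
      show "\<exists>c\<in>I. \<forall>p. length (snd p) < N \<longrightarrow> (x \<otimes>\<^bsub>?R\<^esub> a) p = c p"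
        using b x mult[of N x x a b]
        by (intro bexI[of _ "x \<otimes>\<^bsub>?R\<^esub> b"]) (auto simp: I.I_l_closed)
      show "\<exists>c\<in>I. \<forall>p. length (snd p) < N \<longrightarrow> (a \<otimes>\<^bsub>?R\<^esub> x) p = c p"
        using b x mult[of N a b x x]
        by (intro bexI[of _ "b \<otimes>\<^bsub>?R\<^esub> x"]) (auto simp: I.I_r_closed)
    qed
    then show "x \<otimes>\<^bsub>?R\<^esub> a \<in> adic_closure G I" "a \<otimes>\<^bsub>?R\<^esub> x \<in> adic_closure G I"
      using a x by (auto simp: adic_closure_def)
  qed
qed


section \<open>Left modules over a ring\<close>

text \<open>
  The library locale \<open>module\<close> is restricted to commutative rings; this is the same notion, on the
  same record type, over an arbitrary ring.
\<close>

locale left_module = R?: ring R + M?: abelian_group M for R (structure) and M (structure) +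
  assumes smult_closed:
      "\<lbrakk>a \<in> carrier R; x \<in> carrier M\<rbrakk> \<Longrightarrow> a \<odot>\<^bsub>M\<^esub> x \<in> carrier M"
    and smult_l_distr:
      "\<lbrakk>a \<in> carrier R; b \<in> carrier R; x \<in> carrier M\<rbrakk> \<Longrightarrow>
        (a \<oplus> b) \<odot>\<^bsub>M\<^esub> x = a \<odot>\<^bsub>M\<^esub> x \<oplus>\<^bsub>M\<^esub> b \<odot>\<^bsub>M\<^esub> x"
    and smult_r_distr:
      "\<lbrakk>a \<in> carrier R; x \<in> carrier M; y \<in> carrier M\<rbrakk> \<Longrightarrow>
        a \<odot>\<^bsub>M\<^esub> (x \<oplus>\<^bsub>M\<^esub> y) = a \<odot>\<^bsub>M\<^esub> x \<oplus>\<^bsub>M\<^esub> a \<odot>\<^bsub>M\<^esub> y"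
    and smult_assoc:
      "\<lbrakk>a \<in> carrier R; b \<in> carrier R; x \<in> carrier M\<rbrakk> \<Longrightarrow>
        (a \<otimes> b) \<odot>\<^bsub>M\<^esub> x = a \<odot>\<^bsub>M\<^esub> (b \<odot>\<^bsub>M\<^esub> x)"
    and smult_one: "x \<in> carrier M \<Longrightarrow> \<one> \<odot>\<^bsub>M\<^esub> x = x"

definition left_module_hom ::
  "('a, 'r) ring_scheme \<Rightarrow> ('a, 'b, 'm) module_scheme \<Rightarrow> ('a, 'c, 'n) module_scheme \<Rightarrow> ('b \<Rightarrow> 'c) set" where
  "left_module_hom R M N = {h \<in> carrier M \<rightarrow> carrier N.
     (\<forall>x\<in>carrier M. \<forall>y\<in>carrier M. h (x \<oplus>\<^bsub>M\<^esub> y) = h x \<oplus>\<^bsub>N\<^esub> h y) \<and>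
     (\<forall>a\<in>carrier R. \<forall>x\<in>carrier M. h (a \<odot>\<^bsub>M\<^esub> x) = a \<odot>\<^bsub>N\<^esub> h x)}"

definition indecomposable_module :: "('a, 'r) ring_scheme \<Rightarrow> ('a, 'b, 'm) module_scheme \<Rightarrow> bool" where
  "indecomposable_module R M \<longleftrightarrow> left_module R M \<and> carrier M \<noteq> {\<zero>\<^bsub>M\<^esub>} \<and>
     (\<forall>U V. submodule U R M \<and> submodule V R M \<and> U \<inter> V = {\<zero>\<^bsub>M\<^esub>} \<and> U <+>\<^bsub>M\<^esub> V = carrier M
        \<longrightarrow> U = {\<zero>\<^bsub>M\<^esub>} \<or> V = {\<zero>\<^bsub>M\<^esub>})"


section \<open>The algebra $B_{k,n}$ and its Cohen--Macaulay modules\<close>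

text \<open>
  The vertices are \<open>{0..<n}\<close>, representing $\mathbb{Z}/n$; the arrows are indexed by \<open>{1..n}\<close>.
\<close>

datatype arrow = ArrX nat | ArrY nat

definition cyclic_quiver :: "nat \<Rightarrow> (nat, arrow) pre_digraph" where
  "cyclic_quiver n =
    \<lparr>verts = {0..<n}, arcs = ArrX ` {1..n} \<union> ArrY ` {1..n},
     tail = (\<lambda>e. case e of ArrX i \<Rightarrow> i - 1 | ArrY i \<Rightarrow> i mod n),
     head = (\<lambda>e. case e of ArrX i \<Rightarrow> i mod n | ArrY i \<Rightarrow> i - 1)\<rparr>"

lemma wf_cyclic_quiver: "wf_digraph (cyclic_quiver n)"
  by unfold_locales (auto simp: cyclic_quiver_def)

type_synonym cpa = "nat \<times> arrow list \<Rightarrow> complex"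

abbreviation CPA :: "nat \<Rightarrow> cpa ring" where
  "CPA n \<equiv> cpath_algebra (cyclic_quiver n)"

definition vertex_idem :: "nat \<Rightarrow> cpa" where
  "vertex_idem i = (\<lambda>p. if p = (i, []) then 1 else 0)"

definition x_elem :: "nat \<Rightarrow> cpa" where
  "x_elem n = (\<lambda>p. if \<exists>i\<in>{1..n}. p = (i - 1, [ArrX i]) then 1 else 0)"

definition y_elem :: "nat \<Rightarrow> cpa" where
  "y_elem n = (\<lambda>p. if \<exists>i\<in>{1..n}. p = (i mod n, [ArrY i]) then 1 else 0)"

text \<open>The relations $xy = yx$ and $x^k = y^{n-k}$, one of each for every vertex.\<close>

definition B_relations :: "nat \<Rightarrow> nat \<Rightarrow> cpa set" where
  "B_relations k n = (\<Union>i\<in>{0..<n}.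
     {vertex_idem i \<otimes>\<^bsub>CPA n\<^esub>
        (x_elem n \<otimes>\<^bsub>CPA n\<^esub> y_elem n \<ominus>\<^bsub>CPA n\<^esub> y_elem n \<otimes>\<^bsub>CPA n\<^esub> x_elem n),
      vertex_idem i \<otimes>\<^bsub>CPA n\<^esub>
        (x_elem n [^]\<^bsub>CPA n\<^esub> k \<ominus>\<^bsub>CPA n\<^esub> y_elem n [^]\<^bsub>CPA n\<^esub> (n - k))})"

text \<open>As usual for completed path algebras, the ideal generated by relations is a closed ideal.\<close>

definition B_ideal :: "nat \<Rightarrow> nat \<Rightarrow> cpa set" where
  "B_ideal k n = adic_closure (cyclic_quiver n) (Idl\<^bsub>CPA n\<^esub> (B_relations k n))"

definition B :: "nat \<Rightarrow> nat \<Rightarrow> cpa set ring" where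
  "B k n = CPA n Quot B_ideal k n"

definition B_class :: "nat \<Rightarrow> nat \<Rightarrow> cpa \<Rightarrow> cpa set" where
  "B_class k n a = B_ideal k n +>\<^bsub>CPA n\<^esub> a"

lemma x_y_vertex_in_CPA:
  "i < n \<Longrightarrow> vertex_idem i \<in> carrier (CPA n)"
  "x_elem n \<in> carrier (CPA n)"
  "y_elem n \<in> carrier (CPA n)"
  by (auto simp: cpath_algebra_def vertex_idem_def x_elem_def y_elem_def quiver_paths_def
      cyclic_quiver_def pre_digraph.awalk_def pre_digraph.cas.simps)

lemma B_ideal_ideal: "ideal (B_ideal k n) (CPA n)"
proof -
  interpret ring "CPA n" by (rule ring_cpath_algebra[OF wf_cyclic_quiver])
  have "B_relations k n \<subseteq> carrier (CPA n)"
    unfolding B_relations_def by (auto intro!: m_closed minus_closed nat_pow_closed x_y_vertex_in_CPA)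
  then show ?thesis
    unfolding B_ideal_def by (intro adic_closure_ideal wf_cyclic_quiver genideal_ideal)
qed

lemma ring_B: "ring (B k n)"
  unfolding B_def by (rule ideal.quotient_is_ring[OF B_ideal_ideal])

text \<open>The central subalgebra $Z = \mathbb{C}[[t]]$ of $B_{k,n}$, with $t = \sum_i x_i y_i = xy$.\<close>

definition Z_elem :: "nat \<Rightarrow> nat \<Rightarrow> complex fps \<Rightarrow> cpa set" where
  "Z_elem k n f = B_class k n (power_series_at (cyclic_quiver n) f (x_elem n \<otimes>\<^bsub>CPA n\<^esub> y_elem n))"

type_synonym 'm B_module = "(cpa set, 'm) module"

definition vertex_space :: "nat \<Rightarrow> nat \<Rightarrow> 'm B_module \<Rightarrow> nat \<Rightarrow> 'm set" where
  "vertex_space k n M i = (\<lambda>m. B_class k n (vertex_idem i) \<odot>\<^bsub>M\<^esub> m) ` carrier M"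

definition free_over_Z :: "nat \<Rightarrow> nat \<Rightarrow> 'm B_module \<Rightarrow> 'm set \<Rightarrow> nat \<Rightarrow> bool" where
  "free_over_Z k n M U r \<longleftrightarrow> (\<exists>b \<in> {..<r} \<rightarrow> U.
     bij_betw (\<lambda>f. \<Oplus>\<^bsub>M\<^esub>j\<in>{..<r}. Z_elem k n (f j) \<odot>\<^bsub>M\<^esub> b j) ({..<r} \<rightarrow>\<^sub>E UNIV) U)"

text \<open>\<open>CM_of_rank k n r M\<close>: the module \<open>M\<close> lies in $\mathrm{CM}(B_{k,n})$ and has rank \<open>r\<close>.\<close>

definition CM_of_rank :: "nat \<Rightarrow> nat \<Rightarrow> nat \<Rightarrow> 'm B_module \<Rightarrow> bool" where
  "CM_of_rank k n r M \<longleftrightarrow> left_module (B k n) M \<and>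
     (\<forall>i<n. free_over_Z k n M (vertex_space k n M i) r)"


section \<open>The modules $L_I$ and filtrations by them\<close>

text \<open>
  A path acts on $L_I$ as multiplication by $t$ to the number of its arrows that act as $t$. The
  coefficient of $t^l$ in the action of an infinite combination of paths involves only the finitely
  many paths for which that number is at most \<open>l\<close>.
\<close>

fun arrow_weight :: "nat set \<Rightarrow> arrow \<Rightarrow> nat" where
  "arrow_weight I (ArrX i) = (if i \<in> I then 0 else 1)"
| "arrow_weight I (ArrY i) = (if i \<in> I then 1 else 0)"

definition path_weight :: "nat set \<Rightarrow> nat \<times> arrow list \<Rightarrow> nat" where
  "path_weight I p = (\<Sum>e\<leftarrow>snd p. arrow_weight I e)"

definition L_action :: "nat \<Rightarrow> nat set \<Rightarrow> cpa \<Rightarrow> (nat \<Rightarrow> complex fps) \<Rightarrow> (nat \<Rightarrow> complex fps)" where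
  "L_action n I a u = (\<lambda>j. Abs_fps (\<lambda>l.
     \<Sum>p\<in>{p \<in> quiver_paths (cyclic_quiver n).
            path_end (cyclic_quiver n) p = j \<and> path_weight I p \<le> l}.
       a p * fps_nth (u (fst p)) (l - path_weight I p)))"

text \<open>
  The ring fields \<open>mult\<close> and \<open>one\<close> of a module record carry no meaning. A class in \<open>B k n\<close> acts as
  any of its representatives.
\<close>

definition L_module :: "nat \<Rightarrow> nat set \<Rightarrow> (nat \<Rightarrow> complex fps) B_module" where
  "L_module n I =
    \<lparr>carrier = {u. \<forall>j\<ge>n. u j = 0}, monoid.mult = undefined, one = undefined,
     zero = (\<lambda>_. 0), add = (\<lambda>u v j. u j + v j),
     smult = (\<lambda>b u. the_elem ((\<lambda>a. L_action n I a u) ` b))\<rparr>"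

text \<open>
  \<open>L_filtration k n M Is\<close>: there is a chain \<open>0 = N 0 \<subseteq> N 1 \<subseteq> \<dots> \<subseteq> M\<close> of submodules whose successive
  quotients are isomorphic to the modules $L_I$, for \<open>I\<close> running through the list \<open>Is\<close> of
  \<open>k\<close>-subsets. An isomorphism from \<open>N (Suc j) / N j\<close> to $L_I$ is given as an epimorphism from
  \<open>N (Suc j)\<close> with kernel \<open>N j\<close>.
\<close>

definition L_filtration :: "nat \<Rightarrow> nat \<Rightarrow> 'm B_module \<Rightarrow> nat set list \<Rightarrow> bool" where
  "L_filtration k n M Is \<longleftrightarrow>
     (\<forall>I\<in>set Is. I \<subseteq> {1..n} \<and> card I = k) \<and>
     (\<exists>N. N 0 = {\<zero>\<^bsub>M\<^esub>} \<and> N (length Is) = carrier M \<and>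
        (\<forall>j\<le>length Is. submodule (N j) (B k n) M) \<and>
        (\<forall>j<length Is. N j \<subseteq> N (Suc j) \<and>
           (\<exists>h \<in> left_module_hom (B k n) (M\<lparr>carrier := N (Suc j)\<rparr>) (L_module n (Is ! j)).
              h ` N (Suc j) = carrier (L_module n (Is ! j)) \<and>
              {m \<in> N (Suc j). h m = \<zero>\<^bsub>L_module n (Is ! j)\<^esub>} = N j)))"

text \<open>The vector $x(M)$ read off from the factors of a filtration, extended by zero outside \<open>{1..n}\<close>.\<close>

definition x_vector :: "nat \<Rightarrow> nat set list \<Rightarrow> nat \<Rightarrow> int" where
  "x_vector n Is = (\<lambda>i. if i \<in> {1..n} then int (card {j. j < length Is \<and> i \<in> Is ! j}) else 0)"


section \<open>Kac--Moody algebras\<close>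

text \<open>
  Lie algebra words in the Chevalley generators $e_i$, $f_i$, $\alpha_i^\vee$.
\<close>

datatype 'i km_term =
    Gen_e 'i | Gen_f 'i | Gen_h 'i
  | LZero | LAdd "'i km_term" "'i km_term" | LScale complex "'i km_term"
  | LBr "'i km_term" "'i km_term"

text \<open>
  Equality in the complex Lie algebra $\tilde{\mathfrak g}'(A)$ presented by the generators with index
  in \<open>V\<close> and the Chevalley relations \<open>ef\<close>, \<open>hh\<close>, \<open>he\<close>, \<open>hf\<close> (no Serre relations): the least
  congruence containing the relations and the axioms of a Lie algebra. Generators with index outside
  \<open>V\<close> are discarded by setting them to zero.
\<close>

inductive km_eq :: "'i set \<Rightarrow> ('i \<Rightarrow> 'i \<Rightarrow> int) \<Rightarrow> 'i km_term \<Rightarrow> 'i km_term \<Rightarrow> bool"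
  for V :: "'i set" and A :: "'i \<Rightarrow> 'i \<Rightarrow> int" where
  refl: "km_eq V A s s"
| sym: "km_eq V A s t \<Longrightarrow> km_eq V A t s"
| trans: "km_eq V A s t \<Longrightarrow> km_eq V A t u \<Longrightarrow> km_eq V A s u"
| cong_add: "km_eq V A s s' \<Longrightarrow> km_eq V A t t' \<Longrightarrow> km_eq V A (LAdd s t) (LAdd s' t')"
| cong_scale: "km_eq V A s s' \<Longrightarrow> km_eq V A (LScale c s) (LScale c s')"
| cong_br: "km_eq V A s s' \<Longrightarrow> km_eq V A t t' \<Longrightarrow> km_eq V A (LBr s t) (LBr s' t')"
| add_assoc: "km_eq V A (LAdd (LAdd s t) u) (LAdd s (LAdd t u))"
| add_commute: "km_eq V A (LAdd s t) (LAdd t s)"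
| add_zero: "km_eq V A (LAdd s LZero) s"
| add_minus: "km_eq V A (LAdd s (LScale (-1) s)) LZero"
| scale_add: "km_eq V A (LScale c (LAdd s t)) (LAdd (LScale c s) (LScale c t))"
| add_scale: "km_eq V A (LScale (c + d) s) (LAdd (LScale c s) (LScale d s))"
| scale_scale: "km_eq V A (LScale c (LScale d s)) (LScale (c * d) s)"
| scale_one: "km_eq V A (LScale 1 s) s"
| br_add_left: "km_eq V A (LBr (LAdd s t) u) (LAdd (LBr s u) (LBr t u))"
| br_add_right: "km_eq V A (LBr u (LAdd s t)) (LAdd (LBr u s) (LBr u t))"
| br_scale_left: "km_eq V A (LBr (LScale c s) u) (LScale c (LBr s u))"
| br_scale_right: "km_eq V A (LBr u (LScale c s)) (LScale c (LBr u s))"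
| br_alternating: "km_eq V A (LBr s s) LZero"
| jacobi: "km_eq V A (LAdd (LBr s (LBr t u)) (LAdd (LBr t (LBr u s)) (LBr u (LBr s t)))) LZero"
| ef: "i \<in> V \<Longrightarrow> j \<in> V \<Longrightarrow> km_eq V A (LBr (Gen_e i) (Gen_f j)) (if i = j then Gen_h i else LZero)"
| hh: "i \<in> V \<Longrightarrow> j \<in> V \<Longrightarrow> km_eq V A (LBr (Gen_h i) (Gen_h j)) LZero"
| he: "i \<in> V \<Longrightarrow> j \<in> V \<Longrightarrow>
    km_eq V A (LBr (Gen_h i) (Gen_e j)) (LScale (of_int (A i j)) (Gen_e j))"
| hf: "i \<in> V \<Longrightarrow> j \<in> V \<Longrightarrow>
    km_eq V A (LBr (Gen_h i) (Gen_f j)) (LScale (of_int (- A i j)) (Gen_f j))"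
| no_e: "i \<notin> V \<Longrightarrow> km_eq V A (Gen_e i) LZero"
| no_f: "i \<notin> V \<Longrightarrow> km_eq V A (Gen_f i) LZero"
| no_h: "i \<notin> V \<Longrightarrow> km_eq V A (Gen_h i) LZero"

text \<open>
  The element \<open>\<Sum>\<^sub>i c i \<alpha>\<^sub>i\<close> of the root lattice is represented by its coefficient function \<open>c\<close>.
\<close>

definition simple_root :: "'i \<Rightarrow> 'i \<Rightarrow> int" where
  "simple_root i = (\<lambda>j. if j = i then 1 else 0)"

text \<open>The grading of $\tilde{\mathfrak g}'(A)$ by the root lattice.\<close>

inductive km_degree :: "'i set \<Rightarrow> ('i \<Rightarrow> 'i \<Rightarrow> int) \<Rightarrow> ('i \<Rightarrow> int) \<Rightarrow> 'i km_term \<Rightarrow> bool"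
  for V :: "'i set" and A :: "'i \<Rightarrow> 'i \<Rightarrow> int" where
  "i \<in> V \<Longrightarrow> km_degree V A (simple_root i) (Gen_e i)"
| "i \<in> V \<Longrightarrow> km_degree V A (\<lambda>j. - simple_root i j) (Gen_f i)"
| "i \<in> V \<Longrightarrow> km_degree V A (\<lambda>j. 0) (Gen_h i)"
| "km_degree V A \<alpha> LZero"
| "km_degree V A \<alpha> s \<Longrightarrow> km_degree V A \<alpha> t \<Longrightarrow> km_degree V A \<alpha> (LAdd s t)"
| "km_degree V A \<alpha> s \<Longrightarrow> km_degree V A \<alpha> (LScale c s)"
| "km_degree V A \<alpha> s \<Longrightarrow> km_degree V A \<gamma> t \<Longrightarrow> km_degree V A (\<lambda>j. \<alpha> j + \<gamma> j) (LBr s t)"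
| "km_degree V A \<alpha> s \<Longrightarrow> km_eq V A s t \<Longrightarrow> km_degree V A \<alpha> t"

text \<open>The span of the $\alpha_i^\vee$.\<close>

inductive_set km_cartan :: "'i set \<Rightarrow> ('i \<Rightarrow> 'i \<Rightarrow> int) \<Rightarrow> 'i km_term set"
  for V :: "'i set" and A :: "'i \<Rightarrow> 'i \<Rightarrow> int" where
  "i \<in> V \<Longrightarrow> Gen_h i \<in> km_cartan V A"
| "LZero \<in> km_cartan V A"
| "s \<in> km_cartan V A \<Longrightarrow> t \<in> km_cartan V A \<Longrightarrow> LAdd s t \<in> km_cartan V A"
| "s \<in> km_cartan V A \<Longrightarrow> LScale c s \<in> km_cartan V A"
| "s \<in> km_cartan V A \<Longrightarrow> km_eq V A s t \<Longrightarrow> t \<in> km_cartan V A"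

definition km_graded_ideal :: "'i set \<Rightarrow> ('i \<Rightarrow> 'i \<Rightarrow> int) \<Rightarrow> 'i km_term set \<Rightarrow> bool" where
  "km_graded_ideal V A J \<longleftrightarrow>
     LZero \<in> J \<and>
     (\<forall>s\<in>J. \<forall>t\<in>J. LAdd s t \<in> J) \<and>
     (\<forall>s\<in>J. \<forall>c. LScale c s \<in> J) \<and>
     (\<forall>s\<in>J. \<forall>t. LBr t s \<in> J) \<and>
     (\<forall>s\<in>J. \<forall>t. km_eq V A s t \<longrightarrow> t \<in> J) \<and>
     (\<forall>s\<in>J. \<exists>ts. (\<forall>t\<in>set ts. t \<in> J \<and> (\<exists>\<alpha>. km_degree V A \<alpha> t)) \<and> km_eq V A s (foldr LAdd ts LZero))"

text \<open>
  The derived Kac--Moody algebra $\mathfrak g'(A) = \tilde{\mathfrak g}'(A) / \mathfrak r$ is the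
  quotient by the largest graded ideal that meets the span of the $\alpha_i^\vee$ trivially (Kac,
  Infinite dimensional Lie algebras, Chapter 1). For a nonzero element of the root lattice its root
  space coincides with that of $\mathfrak g(A)$.
\<close>

definition km_radical :: "'i set \<Rightarrow> ('i \<Rightarrow> 'i \<Rightarrow> int) \<Rightarrow> 'i km_term set" where
  "km_radical V A = \<Union>{J. km_graded_ideal V A J \<and> (\<forall>s\<in>J \<inter> km_cartan V A. km_eq V A s LZero)}"

definition km_root :: "'i set \<Rightarrow> ('i \<Rightarrow> 'i \<Rightarrow> int) \<Rightarrow> ('i \<Rightarrow> int) \<Rightarrow> bool" where
  "km_root V A \<alpha> \<longleftrightarrow> \<alpha> \<noteq> (\<lambda>j. 0) \<and> (\<exists>s. km_degree V A \<alpha> s \<and> s \<notin> km_radical V A)"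

text \<open>The simple reflection $s_i(\alpha) = \alpha - \langle\alpha, \alpha_i^\vee\rangle \alpha_i$.\<close>

definition km_reflection :: "'i set \<Rightarrow> ('i \<Rightarrow> 'i \<Rightarrow> int) \<Rightarrow> 'i \<Rightarrow> ('i \<Rightarrow> int) \<Rightarrow> ('i \<Rightarrow> int)" where
  "km_reflection V A i \<alpha> = (\<lambda>j. \<alpha> j - (\<Sum>l\<in>V. A i l * \<alpha> l) * simple_root i j)"

definition km_real_root :: "'i set \<Rightarrow> ('i \<Rightarrow> 'i \<Rightarrow> int) \<Rightarrow> ('i \<Rightarrow> int) \<Rightarrow> bool" where
  "km_real_root V A \<alpha> \<longleftrightarrow>
     (\<exists>i\<in>V. \<exists>is. set is \<subseteq> V \<and> \<alpha> = foldr (km_reflection V A) is (simple_root i))"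

definition km_imaginary_root :: "'i set \<Rightarrow> ('i \<Rightarrow> 'i \<Rightarrow> int) \<Rightarrow> ('i \<Rightarrow> int) \<Rightarrow> bool" where
  "km_imaginary_root V A \<alpha> \<longleftrightarrow> km_root V A \<alpha> \<and> \<not> km_real_root V A \<alpha>"


section \<open>The root system $J_{k,n}$\<close>

definition J_edge :: "nat \<Rightarrow> nat \<Rightarrow> nat \<Rightarrow> nat \<Rightarrow> bool" where
  "J_edge k n i j \<longleftrightarrow>
     i \<in> {1..<n} \<and> j \<in> {1..<n} \<and> (j = i + 1 \<or> i = j + 1) \<or> {i, j} = {k, n}"

definition J_cartan :: "nat \<Rightarrow> nat \<Rightarrow> nat \<Rightarrow> nat \<Rightarrow> int" where
  "J_cartan k n i j = (if i = j then 2 else if J_edge k n i j then -1 else 0)"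

definition J_real_root :: "nat \<Rightarrow> nat \<Rightarrow> (nat \<Rightarrow> int) \<Rightarrow> bool" where
  "J_real_root k n = km_real_root {1..n} (J_cartan k n)"

definition J_imaginary_root :: "nat \<Rightarrow> nat \<Rightarrow> (nat \<Rightarrow> int) \<Rightarrow> bool" where
  "J_imaginary_root k n = km_imaginary_root {1..n} (J_cartan k n)"

text \<open>
  The identification of the root lattice with $\{x\in\mathbb{Z}^n : k \mid \sum_i x_i\}$, under which
  $\alpha_i = -e_i + e_{i+1}$ for $i < n$ and $\alpha_n = \beta = e_1 + \dots + e_k$.
\<close>

definition simple_root_vector :: "nat \<Rightarrow> nat \<Rightarrow> nat \<Rightarrow> nat \<Rightarrow> int" where
  "simple_root_vector k n j = (\<lambda>i.
     if j = n then (if i \<in> {1..k} then 1 else 0)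
     else if i = j then -1 else if i = j + 1 then 1 else 0)"

definition lattice_vector :: "nat \<Rightarrow> nat \<Rightarrow> (nat \<Rightarrow> int) \<Rightarrow> nat \<Rightarrow> int" where
  "lattice_vector k n c = (\<lambda>i. \<Sum>j\<in>{1..n}. c j * simple_root_vector k n j i)"

definition root_lattice_elem :: "nat \<Rightarrow> nat \<Rightarrow> (nat \<Rightarrow> int) \<Rightarrow> nat \<Rightarrow> int" where
  "root_lattice_elem k n x =
     (THE c. (\<forall>i. i \<notin> {1..n} \<longrightarrow> c i = 0) \<and> lattice_vector k n c = x)"

lemma lattice_vector_eq:
  assumes "0 < k" "k < n"
  shows "lattice_vector k n c i = (if i \<in> {1..k} then c n else 0)
    + (if i \<in> {2..n} then c (i - 1) else 0) - (if i \<in> {1..<n} then c i else 0)"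
proof -
  have "{1..n} = insert n {1..<n}"
    using assms by auto
  then have "lattice_vector k n c i = (if i \<in> {1..k} then c n else 0)
      + (\<Sum>j\<in>{1..<n}. c j * simple_root_vector k n j i)"
    by (simp add: lattice_vector_def simple_root_vector_def)
  also have "(\<Sum>j\<in>{1..<n}. c j * simple_root_vector k n j i)
      = (\<Sum>j\<in>{1..<n}. (if j = i - 1 then (if i \<in> {2..n} then c j else 0) else 0)
          - (if j = i then c j else 0))"
    by (rule sum.cong) (auto simp: simple_root_vector_def)
  also have "\<dots> = (if i \<in> {2..n} then c (i - 1) else 0) - (if i \<in> {1..<n} then c i else 0)"
    using assms by (auto simp: sum_subtractf)
  finally show ?thesis by simp
qed

lemma root_lattice_elem_unique:
  assumes k: "0 < k" "k < n"
    and supp: "\<forall>i. i \<notin> {1..n} \<longrightarrow> x i = 0"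
    and dvd: "int k dvd (\<Sum>i\<in>{1..n}. x i)"
  shows "\<exists>!c. (\<forall>i. i \<notin> {1..n} \<longrightarrow> c i = 0) \<and> lattice_vector k n c = x"
proof -
  obtain d where d: "(\<Sum>i\<in>{1..n}. x i) = int k * d"
    using dvd by blast
  define c where "c = (\<lambda>i. if i \<in> {1..<n} then int (min i k) * d - (\<Sum>l\<in>{1..i}. x l)
     else if i = n then d else 0)"
  show ?thesis
  proof (rule ex1I[of _ c], intro conjI)
    show "\<forall>i. i \<notin> {1..n} \<longrightarrow> c i = 0"
      using k by (auto simp: c_def)
    show "lattice_vector k n c = x"
    proof
      fix i
      consider "i \<notin> {1..n}" | "i = 1" | "i \<in> {2..<n}" | "i = n" "n \<ge> 2"
        using k by force
      then show "lattice_vector k n c i = x i"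
      proof cases
        case 3
        then have "{1..i} = insert i {1..i-1}" by auto
        then have "(\<Sum>l\<in>{1..i}. x l) = x i + (\<Sum>l\<in>{1..i-1}. x l)"
          using 3 by (subst \<open>{1..i} = _\<close>, subst sum.insert) auto
        moreover have "int (min i k) = int (min (i - 1) k) + (if i \<le> k then 1 else 0)"
          using 3 by auto
        ultimately show ?thesis
          using 3 k by (auto simp: lattice_vector_eq c_def algebra_simps)
      next
        case 4
        then have "{1..n} = insert n {1..n-1}" by auto
        then have "(\<Sum>l\<in>{1..n}. x l) = x n + (\<Sum>l\<in>{1..n-1}. x l)"
          using 4 by (subst \<open>{1..n} = _\<close>, subst sum.insert) auto
        moreover have "min (n - 1) k = k" "n - Suc 0 \<ge> 1"
          using 4 k by auto
        ultimately show ?thesis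
          using 4 k d by (auto simp: lattice_vector_eq c_def)
      qed (use k supp in \<open>auto simp: lattice_vector_eq c_def\<close>)
    qed
  next
    fix c' assume c': "(\<forall>i. i \<notin> {1..n} \<longrightarrow> c' i = 0) \<and> lattice_vector k n c' = x"
    then have lv: "lattice_vector k n c' i = x i" for i by simp
    have step: "c' i = int (min i k) * c' n - (\<Sum>l\<in>{1..i}. x l)" if "i \<in> {1..<n}" for i
      using that
    proof (induction i)
      case (Suc i)
      show ?case
      proof (cases "i = 0")
        case True
        then show ?thesis
          using lv[of 1] k by (simp add: lattice_vector_eq)
      next
        case False
        then have "c' i = int (min i k) * c' n - (\<Sum>l\<in>{1..i}. x l)"
          using Suc by simp
        moreover have "int (min (Suc i) k) = int (min i k) + (if Suc i \<le> k then 1 else 0)"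
          by auto
        ultimately show ?thesis
          using lv[of "Suc i"] k False Suc.prems
          by (auto simp: lattice_vector_eq algebra_simps)
      qed
    qed simp
    have "c' n = d"
    proof -
      have "{1..n} = insert n {1..n-1}" using k by auto
      then have "(\<Sum>l\<in>{1..n}. x l) = x n + (\<Sum>l\<in>{1..n-1}. x l)"
        using k by (subst \<open>{1..n} = _\<close>, subst sum.insert) auto
      moreover have "c' (n - 1) = int k * c' n - (\<Sum>l\<in>{1..n-1}. x l)"
        using step[of "n - 1"] k by (simp add: min.absorb2)
      moreover have "c' (n - 1) = x n"
        using lv[of n] k by (simp add: lattice_vector_eq)
      ultimately have "int k * c' n = int k * d"
        using d by linarith
      then show ?thesis using k by simp
    qed
    then show "c' = c"
      using step c' by (auto simp: c_def fun_eq_iff)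
  qed
qed

definition q_form :: "nat \<Rightarrow> nat \<Rightarrow> (nat \<Rightarrow> int) \<Rightarrow> rat" where
  "q_form k n x = of_int (\<Sum>i\<in>{1..n}. (x i)\<^sup>2)
     + (2 - of_nat k) / (of_nat k)\<^sup>2 * (of_int (\<Sum>i\<in>{1..n}. x i))\<^sup>2"

end

theory Submission
  imports Defs "HOL-Analysis.Cartesian_Space" "HOL-Computational_Algebra.Formal_Laurent_Series"
    "HOL-Combinatorics.Permutations"
begin

text \<open>
  A module \<open>M\<close> of rank 3 is a chain \<open>X\<^sub>0 \<supseteq> X\<^sub>1 \<supseteq> \<dots> \<supseteq> X\<^sub>n = t\<^sup>3 X\<^sub>0\<close> of lattices in
  \<open>K\<^sup>3\<close>, \<open>K = \<complex>((t))\<close>, with \<open>t X\<^sub>i \<subseteq> X\<^sub>i\<^sub>+\<^sub>1\<close>: put \<open>X\<^sub>i = y\<^sup>i M\<^sub>i\<close> inside \<open>M\<^sub>0\<close>. It decomposes iff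
  some nontrivial idempotent matrix preserves all \<open>X\<^sub>i\<close>. If \<open>i\<close> lies in none of the sets \<open>I\<^sub>j\<close> of a
  filtration, then \<open>y\<close> is surjective from \<open>M\<^sub>i\<close> to \<open>M\<^sub>i\<^sub>-\<^sub>1\<close>, so \<open>X\<^sub>i = X\<^sub>i\<^sub>-\<^sub>1\<close>. The heart of the
  proof is that a chain with at most seven proper steps always has such an idempotent. Hence the three
  sets \<open>I\<^sub>j\<close> cover at least eight indices, and since their sizes add up to 9 the vector \<open>x(M)\<close>
  consists of nine ones (\<open>q = 0\<close>) or of one two and seven ones (\<open>q = 2\<close>).

  In the second case reflections reduce \<open>x(M)\<close> to \<open>\<beta>\<close>. In the first case one reaches \<open>x(M)\<close> from \<open>\<beta>\<close>
  by adding simple roots \<open>\<alpha>\<^sub>i\<close> to positive roots \<open>\<gamma>\<close> with \<open>\<langle>\<gamma>, \<alpha>\<^sub>i\<^sup>\<or>\<rangle> < 0\<close>, which by the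
  representation theory of \<open>sl\<^sub>2\<close> leads from roots to roots.

  For the seven steps: in the absence of a step that can be merged with its neighbour
  (\<open>t X\<^sub>i\<^sub>-\<^sub>1 \<subseteq> X\<^sub>i\<^sub>+\<^sub>1\<close>) the number of generators of the chain is at most 9 minus its length. So
  seven steps can always be reduced to six, and a chain of six steps without such a step is given by
  an adapted basis. A chain of five steps amounts to a pair of flags, where lattices can be inserted
  in two places.
\<close>

text \<open>The constants come from one count. Over a period the indices of the steps add up to 9,
  the dimension of \<open>X\<^sub>0 / t\<^sup>3 X\<^sub>0\<close>, and a step that cannot be merged
  always contains one unit of index that its neighbours supply. On the other side three generators
  are indispensable, because X/tX has dimension 3. The members removed on the way must be preserved
  as well. All idempotents built for this have rank one, z -> (beta . z) alpha up to scaling by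
  powers of t: such an operator preserves a lattice between tX and X as soon as alpha or beta fits
  modulo t, so everything reduces to lines, planes and comparisons of exponents. Two obstacles lie
  outside the lattices. The radical of the Lie algebra is defined as a union of ideals, so an
  element is shown to be nonzero only by keeping it out of each of them; this starts from a
  representation in which no h_i vanishes. And an infinite combination of paths acts on a module by
  a given ring action, not by a limit; that the kernel of a matrix is stable under it needs a growth
  argument on orders.\<close>

subsection \<open>The Lie algebra without Serre relations\<close>

(* otherwise these rules shadow those of HOL *)
hide_fact (open) km_eq.refl km_eq.sym km_eq.trans

definition wordwt :: "('i \<Rightarrow> 'i \<Rightarrow> int) \<Rightarrow> 'i \<Rightarrow> 'i list \<Rightarrow> complex" where
  "wordwt A i u = (\<Sum>l\<leftarrow>u. of_int (A i l))"

lemma wordwt_simps [simp]: "wordwt A i [] = 0" "wordwt A i (j # u) = of_int (A i j) + wordwt A i u"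
  by (simp_all add: wordwt_def)

text \<open>Applying e_i to f_w v removes one occurrence of i from w at a time; the factor is the
  eigenvalue of h_i on the part of f_w v to the right of that letter. On coefficients this becomes a
  sum over the ways of inserting i into u. It is finite for every \<open>\<phi>\<close>, so the
  completion raises no question of convergence.\<close>

fun word_e :: "('i \<Rightarrow> 'i \<Rightarrow> int) \<Rightarrow> 'i \<Rightarrow> ('i list \<Rightarrow> complex) \<Rightarrow> 'i list \<Rightarrow> complex" where
  "word_e A i \<phi> [] = \<phi> [i]"
| "word_e A i \<phi> (j # u) = (1 - wordwt A i (j # u)) * \<phi> (i # j # u) + word_e A i (\<lambda>w. \<phi> (j # w)) u"

fun word_f :: "'i \<Rightarrow> ('i list \<Rightarrow> complex) \<Rightarrow> 'i list \<Rightarrow> complex" where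
  "word_f i \<phi> [] = 0"
| "word_f i \<phi> (j # u) = (if j = i then \<phi> u else 0)"

text \<open>
  The Verma module of highest weight \<open>1, \<dots>, 1\<close>, completed: its weight vectors are the words
  \<open>f\<^sub>u v\<close>, and \<open>\<phi>\<close> is the formal combination with coefficient \<open>\<phi> u\<close> at \<open>f\<^sub>u v\<close>.
\<close>

fun word_action :: "'i set \<Rightarrow> ('i \<Rightarrow> 'i \<Rightarrow> int) \<Rightarrow> 'i km_term \<Rightarrow> ('i list \<Rightarrow> complex) \<Rightarrow> 'i list \<Rightarrow> complex" where
  "word_action V A (Gen_e i) \<phi> = (if i \<in> V then word_e A i \<phi> else (\<lambda>_. 0))"
| "word_action V A (Gen_f i) \<phi> = (if i \<in> V then word_f i \<phi> else (\<lambda>_. 0))"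
| "word_action V A (Gen_h i) \<phi> = (if i \<in> V then (\<lambda>u. (1 - wordwt A i u) * \<phi> u) else (\<lambda>_. 0))"
| "word_action V A LZero \<phi> = (\<lambda>_. 0)"
| "word_action V A (LAdd s t) \<phi> = (\<lambda>u. word_action V A s \<phi> u + word_action V A t \<phi> u)"
| "word_action V A (LScale c s) \<phi> = (\<lambda>u. c * word_action V A s \<phi> u)"
| "word_action V A (LBr s t) \<phi> =
     (\<lambda>u. word_action V A s (word_action V A t \<phi>) u - word_action V A t (word_action V A s \<phi>) u)"

lemma word_e_linear:
  "word_e A i (\<lambda>u. a * \<phi> u + b * \<psi> u) u = a * word_e A i \<phi> u + b * word_e A i \<psi> u"
  by (induction u arbitrary: \<phi> \<psi>) (simp_all add: algebra_simps)

lemma word_f_linear: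
  "word_f i (\<lambda>u. a * \<phi> u + b * \<psi> u) u = a * word_f i \<phi> u + b * word_f i \<psi> u"
  by (cases u) simp_all

lemma word_action_linear:
  "word_action V A s (\<lambda>u. a * \<phi> u + b * \<psi> u) = (\<lambda>u. a * word_action V A s \<phi> u + b * word_action V A s \<psi> u)"
proof (induction s arbitrary: \<phi> \<psi> a b)
  case (LBr s t)
  show ?case by (simp only: word_action.simps LBr) (simp add: algebra_simps)
qed (auto simp: word_e_linear word_f_linear algebra_simps)

lemma word_e_zero [simp]: "word_e A i (\<lambda>_. 0) u = 0"
  using word_e_linear[of A i 0 "\<lambda>_. 0" 0 "\<lambda>_. 0" u] by simp

lemma word_e_f:
  "word_e A i (word_f j \<phi>) u - word_f j (word_e A i \<phi>) u = (if i = j then (1 - wordwt A i u) * \<phi> u else 0)"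
  by (cases u) (auto simp: if_distrib[of "\<lambda>\<phi>. word_e A i \<phi> _"] fun_eq_iff cong: if_cong)

lemma word_e_weight:
  "word_e A j (\<lambda>w. (c - wordwt A i w) * \<phi> w) u = (c - wordwt A i u - of_int (A i j)) * word_e A j \<phi> u"
proof (induction u arbitrary: c \<phi>)
  case (Cons k u)
  have "(\<lambda>w. (c - wordwt A i (k # w)) * \<phi> (k # w)) = (\<lambda>w. ((c - of_int (A i k)) - wordwt A i w) * \<phi> (k # w))"
    by (simp add: algebra_simps)
  then show ?case using Cons[of "c - of_int (A i k)" "\<lambda>w. \<phi> (k # w)"] by (simp add: algebra_simps)
qed (simp add: algebra_simps)

lemma word_f_weight:
  "word_f j (\<lambda>w. (c - wordwt A i w) * \<phi> w) u = (c - wordwt A i u + of_int (A i j)) * word_f j \<phi> u"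
  by (cases u) auto

lemma km_eq_word_action:
  "km_eq V A s t \<Longrightarrow> word_action V A s = word_action V A t"
proof (induction rule: km_eq.induct)
  case (cong_br s s' t t')
  show ?case by (rule ext)+ (simp only: word_action.simps cong_br)
next
  case (br_add_right u s t)
  show ?case
    using word_action_linear[of V A u 1 _ 1] by (simp add: fun_eq_iff)
next
  case (br_scale_right u c s)
  show ?case
    using word_action_linear[of V A u c _ 0] by (simp add: fun_eq_iff algebra_simps)
next
  case (br_add_left s t u)
  show ?case
    using word_action_linear[of V A u 1 _ 1] by (simp add: fun_eq_iff)
next
  case (br_scale_left c s u)
  show ?case
    using word_action_linear[of V A u c _ 0] by (simp add: fun_eq_iff algebra_simps)
next
  case (jacobi s t u)
  have d: "word_action V A r (\<lambda>u. \<phi> u - \<psi> u) = (\<lambda>u. word_action V A r \<phi> u - word_action V A r \<psi> u)" for r \<phi> \<psi>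
    using word_action_linear[of V A r 1 \<phi> "- 1" \<psi>] by simp
  show ?case by (simp add: fun_eq_iff d)
next
  case (ef i j)
  then show ?case by (auto simp: fun_eq_iff word_e_f)
next
  case (he i j)
  then have "word_action V A (LBr (Gen_h i) (Gen_e j)) \<phi> u
      = (1 - wordwt A i u) * word_e A j \<phi> u - word_e A j (\<lambda>w. (1 - wordwt A i w) * \<phi> w) u" for \<phi> u
    by simp
  then show ?case using he unfolding word_e_weight by (simp add: fun_eq_iff algebra_simps)
next
  case (hf i j)
  then have "word_action V A (LBr (Gen_h i) (Gen_f j)) \<phi> u
      = (1 - wordwt A i u) * word_f j \<phi> u - word_f j (\<lambda>w. (1 - wordwt A i w) * \<phi> w) u" for \<phi> u
    by simp
  then show ?case using hf unfolding word_f_weight by (simp add: fun_eq_iff algebra_simps)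
next
  case (hh i j)
  then show ?case by (simp add: fun_eq_iff algebra_simps)
qed (auto simp: fun_eq_iff algebra_simps)

text \<open>The highest weight takes the value 1 on every coroot, so h_i fixes the highest weight
  vector instead of killing it.\<close>

lemma not_km_eq_Gen_h: "i \<in> V \<Longrightarrow> \<not> km_eq V A (Gen_h i) LZero"
proof
  assume i: "i \<in> V" and "km_eq V A (Gen_h i) LZero"
  from km_eq_word_action[OF this(2)]
  have "word_action V A (Gen_h i) (\<lambda>_. 1) [] = word_action V A LZero (\<lambda>_. 1) []" by simp
  then show False using i by simp
qed

section \<open>The positive part and the action of the f_i on it\<close>

locale km_algebra =
  fixes V :: "'i set" and A :: "'i \<Rightarrow> 'i \<Rightarrow> int"
  assumes finite_V: "finite V" and A_diag: "i \<in> V \<Longrightarrow> A i i = 2"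
begin

abbreviation eqv (infix "\<approx>" 50) where "s \<approx> t \<equiv> km_eq V A s t"

lemmas [trans] = km_eq.trans
lemmas [intro!, simp] = km_eq.refl

lemmas km_cong = km_eq.cong_add km_eq.cong_scale km_eq.cong_br

lemma scale_0: "LScale 0 s \<approx> LZero"
proof -
  have "LScale (1 + - 1) s \<approx> LAdd (LScale 1 s) (LScale (- 1) s)" by (rule km_eq.add_scale)
  also have "\<dots> \<approx> LAdd s (LScale (- 1) s)" by (intro km_cong km_eq.scale_one km_eq.refl)
  also have "\<dots> \<approx> LZero" by (rule km_eq.add_minus)
  finally show ?thesis by simp
qed

lemma scale_LZero: "LScale c LZero \<approx> LZero"
proof -
  have "LScale c LZero \<approx> LScale c (LScale 0 LZero)" by (intro km_cong km_eq.sym[OF scale_0])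
  also have "\<dots> \<approx> LScale (c * 0) LZero" by (rule km_eq.scale_scale)
  also have "\<dots> \<approx> LZero" using scale_0 by simp
  finally show ?thesis .
qed

lemma br_LZero_right: "LBr s LZero \<approx> LZero"
proof -
  have "LBr s LZero \<approx> LBr s (LScale 0 LZero)" by (intro km_cong km_eq.sym[OF scale_0] km_eq.refl)
  also have "\<dots> \<approx> LScale 0 (LBr s LZero)" by (rule km_eq.br_scale_right)
  also have "\<dots> \<approx> LZero" by (rule scale_0)
  finally show ?thesis .
qed

lemma br_LZero_left: "LBr LZero s \<approx> LZero"
proof -
  have "LBr LZero s \<approx> LBr (LScale 0 LZero) s" by (intro km_cong km_eq.sym[OF scale_0] km_eq.refl)
  also have "\<dots> \<approx> LScale 0 (LBr LZero s)" by (rule km_eq.br_scale_left)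
  also have "\<dots> \<approx> LZero" by (rule scale_0)
  finally show ?thesis .
qed

lemma zero_add: "LAdd LZero s \<approx> s"
  by (rule km_eq.trans[OF km_eq.add_commute km_eq.add_zero])

lemma eq_minusI:
  assumes "LAdd a b \<approx> LZero"
  shows "a \<approx> LScale (- 1) b"
proof -
  have "a \<approx> LAdd a LZero" by (rule km_eq.sym[OF km_eq.add_zero])
  also have "\<dots> \<approx> LAdd a (LAdd b (LScale (- 1) b))" by (intro km_cong km_eq.refl km_eq.sym[OF km_eq.add_minus])
  also have "\<dots> \<approx> LAdd (LAdd a b) (LScale (- 1) b)" by (rule km_eq.sym[OF km_eq.add_assoc])
  also have "\<dots> \<approx> LAdd LZero (LScale (- 1) b)" by (intro km_cong km_eq.refl assms)
  also have "\<dots> \<approx> LScale (- 1) b" by (rule zero_add)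
  finally show ?thesis .
qed

lemma br_anti: "LBr s t \<approx> LScale (- 1) (LBr t s)"
proof (rule eq_minusI)
  have "LAdd (LBr s t) (LBr t s) \<approx> LAdd (LAdd (LBr s s) (LBr s t)) (LAdd (LBr t s) (LBr t t))"
    by (intro km_cong(1) km_eq.sym[OF km_eq.trans[OF km_cong(1)[OF km_eq.br_alternating km_eq.refl] zero_add]]
        km_eq.sym[OF km_eq.trans[OF km_cong(1)[OF km_eq.refl km_eq.br_alternating] km_eq.add_zero]])
  also have "\<dots> \<approx> LAdd (LBr s (LAdd s t)) (LBr t (LAdd s t))"
    by (intro km_cong(1) km_eq.sym[OF km_eq.br_add_right])
  also have "\<dots> \<approx> LBr (LAdd s t) (LAdd s t)" by (rule km_eq.sym[OF km_eq.br_add_left])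
  also have "\<dots> \<approx> LZero" by (rule km_eq.br_alternating)
  finally show "LAdd (LBr s t) (LBr t s) \<approx> LZero" .
qed

lemma br_derivation: "LBr s (LBr t u) \<approx> LAdd (LBr (LBr s t) u) (LBr t (LBr s u))"
proof -
  have "LBr s (LBr t u) \<approx> LScale (- 1) (LAdd (LBr t (LBr u s)) (LBr u (LBr s t)))"
    by (rule eq_minusI[OF km_eq.jacobi])
  also have "\<dots> \<approx> LAdd (LScale (- 1) (LBr t (LBr u s))) (LScale (- 1) (LBr u (LBr s t)))"
    by (rule km_eq.scale_add)
  also have "\<dots> \<approx> LAdd (LBr t (LScale (- 1) (LBr u s))) (LBr (LBr s t) u)"
    by (intro km_cong(1) km_eq.sym[OF km_eq.br_scale_right] km_eq.sym[OF br_anti])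
  also have "\<dots> \<approx> LAdd (LBr t (LBr s u)) (LBr (LBr s t) u)"
    by (intro km_cong(1) km_cong(3) km_eq.refl km_eq.sym[OF br_anti])
  also have "\<dots> \<approx> LAdd (LBr (LBr s t) u) (LBr t (LBr s u))" by (rule km_eq.add_commute)
  finally show ?thesis .
qed

lemma add_scaleI: "s \<approx> LScale a u \<Longrightarrow> t \<approx> LScale b u \<Longrightarrow> LAdd s t \<approx> LScale (a + b) u"
  by (rule km_eq.trans[OF km_cong(1) km_eq.sym[OF km_eq.add_scale]])

definition pairing :: "'i \<Rightarrow> ('i \<Rightarrow> int) \<Rightarrow> int" where
  "pairing i c = (\<Sum>l\<in>V. A i l * c l)"

lemma pairing_simple: "j \<in> V \<Longrightarrow> pairing i (\<lambda>l. c l + a * simple_root j l) = pairing i c + a * A i j"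
proof -
  assume j: "j \<in> V"
  have "A i l * (c l + a * simple_root j l) = A i l * c l + (if l = j then a * A i j else 0)" for l
    by (simp add: simple_root_def algebra_simps)
  then show ?thesis using j by (simp add: pairing_def sum.distrib finite_V)
qed

lemma pairing_simple1: "j \<in> V \<Longrightarrow> pairing i (simple_root j) = A i j"
  using pairing_simple[of j i "\<lambda>_. 0" 1] by (simp add: pairing_def)

text \<open>Bracketing only with single generators e_i on the left keeps the degree under control:
  elements arise by adding one simple root at a time, and all later inductions on degrees run along
  this shape.\<close>

inductive positive :: "('i \<Rightarrow> int) \<Rightarrow> 'i km_term \<Rightarrow> bool" where
  gen: "i \<in> V \<Longrightarrow> positive (simple_root i) (Gen_e i)"
| zero: "positive c LZero"
| add: "positive c s \<Longrightarrow> positive c t \<Longrightarrow> positive c (LAdd s t)"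
| scale: "positive c s \<Longrightarrow> positive c (LScale a s)"
| br: "i \<in> V \<Longrightarrow> positive c s \<Longrightarrow> positive (\<lambda>j. c j + simple_root i j) (LBr (Gen_e i) s)"
| eqv: "positive c s \<Longrightarrow> s \<approx> t \<Longrightarrow> positive c t"

lemma positive_degree: "positive c s \<Longrightarrow> km_degree V A c s"
proof (induction rule: positive.induct)
  case (br i c s)
  then have "km_degree V A (\<lambda>j. simple_root i j + c j) (LBr (Gen_e i) s)"
    by (intro km_degree.intros(1,7))
  then show ?case by (simp add: add.commute)
next
  case (eqv c s t)
  then show ?case by (blast intro: km_degree.intros(8))
qed (blast intro: km_degree.intros(1,4,5,6))+

text \<open>Vanishing spreads upwards. If a bad degree contains no generator, and removing the
  outermost e_i leads to another bad degree or to one already known to vanish, then nothing survives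
  in bad degrees. Applied to degrees with a negative coefficient and to the degree zero.\<close>

lemma positive_null_cases:
  fixes Q :: "('i \<Rightarrow> int) \<Rightarrow> bool"
  assumes N: "\<And>i. i \<in> V \<Longrightarrow> Q (simple_root i) \<Longrightarrow> False"
    and step: "\<And>i c. i \<in> V \<Longrightarrow> Q (\<lambda>j. c j + simple_root i j) \<Longrightarrow> Q c \<or> (\<forall>s. positive c s \<longrightarrow> s \<approx> LZero)"
  shows "positive c s \<Longrightarrow> Q c \<Longrightarrow> s \<approx> LZero"
proof (induction rule: positive.induct)
  case (add c s t)
  then show ?case by (metis km_cong(1) km_eq.add_zero km_eq.trans)
next
  case (scale c s a)
  then show ?case by (metis km_cong(2) scale_LZero km_eq.trans)
next
  case (br i c s)
  then have "s \<approx> LZero" using step by blast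
  then show ?case by (metis km_cong(3) km_eq.refl br_LZero_right km_eq.trans)
next
  case (eqv c s t)
  then show ?case by (metis km_eq.sym km_eq.trans)
qed (use N in auto)

lemma positive_negative: "positive c s \<Longrightarrow> c l < 0 \<Longrightarrow> s \<approx> LZero"
  by (rule positive_null_cases[where Q = "\<lambda>c::'i \<Rightarrow> int. c l < 0"])
     (auto simp: simple_root_def split: if_splits)

lemma positive_0: "positive (\<lambda>_. 0) s \<Longrightarrow> s \<approx> LZero"
proof (rule positive_null_cases[where Q = "\<lambda>c::'i \<Rightarrow> int. c = (\<lambda>_. 0)"])
  fix i :: 'i assume "simple_root i = (\<lambda>_. 0::int)"
  from fun_cong[OF this, of i] show False by (simp add: simple_root_def)
next
  fix i and c :: "'i \<Rightarrow> int" assume c: "(\<lambda>j. c j + simple_root i j) = (\<lambda>_. 0)"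
  from fun_cong[OF this, of i] have "c i < 0" by (simp add: simple_root_def)
  then show "c = (\<lambda>_. 0) \<or> (\<forall>s. positive c s \<longrightarrow> s \<approx> LZero)" using positive_negative by blast
qed auto

lemma positive_simple: "positive c s \<Longrightarrow> c = simple_root i \<Longrightarrow> \<exists>a. s \<approx> LScale a (Gen_e i)"
proof (induction rule: positive.induct)
  case (gen j)
  from fun_cong[OF this(2), of j] have "j = i" by (simp add: simple_root_def split: if_splits)
  then show ?case using km_eq.sym[OF km_eq.scale_one] by blast
next
  case (zero c)
  then show ?case using km_eq.sym[OF scale_0] by blast
next
  case (add c s t)
  then show ?case by (metis add_scaleI)
next
  case (scale c s a)
  then show ?case by (metis km_cong(2) km_eq.scale_scale km_eq.trans)
next
  case (br j c s)
  have "s \<approx> LZero"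
  proof (cases "j = i")
    case True
    have "c = (\<lambda>_. 0)"
    proof
      fix l show "c l = 0" using fun_cong[OF br(4), of l] True by simp
    qed
    then show ?thesis using br(2) positive_0 by blast
  next
    case False
    then have "c j < 0" using fun_cong[OF br(4), of j] by (simp add: simple_root_def split: if_splits)
    then show ?thesis by (rule positive_negative[OF br(2)])
  qed
  then have "LBr (Gen_e j) s \<approx> LZero" by (metis km_cong(3) km_eq.refl br_LZero_right km_eq.trans)
  then show ?case by (metis km_eq.sym scale_0 km_eq.trans)
next
  case (eqv c s t)
  then show ?case by (metis km_eq.sym km_eq.trans)
qed

lemma h_positive: "positive c s \<Longrightarrow> i \<in> V \<Longrightarrow> LBr (Gen_h i) s \<approx> LScale (of_int (pairing i c)) s"
proof (induction rule: positive.induct)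
  case (gen j)
  then show ?case using km_eq.he[of i V j A] by (simp add: pairing_simple1)
next
  case (zero c)
  then show ?case by (metis br_LZero_right scale_LZero km_eq.sym km_eq.trans)
next
  case (add c s t)
  then have "LBr (Gen_h i) (LAdd s t) \<approx> LAdd (LScale (of_int (pairing i c)) s) (LScale (of_int (pairing i c)) t)"
    by (metis km_eq.br_add_right km_cong(1) km_eq.trans)
  then show ?case by (metis km_eq.scale_add km_eq.sym km_eq.trans)
next
  case (scale c s a)
  have "LBr (Gen_h i) (LScale a s) \<approx> LScale a (LBr (Gen_h i) s)" by (rule km_eq.br_scale_right)
  also have "\<dots> \<approx> LScale a (LScale (of_int (pairing i c)) s)" by (rule km_cong(2)[OF scale.IH[OF scale.prems]])
  also have "\<dots> \<approx> LScale (a * of_int (pairing i c)) s" by (rule km_eq.scale_scale)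
  also have "\<dots> \<approx> LScale (of_int (pairing i c)) (LScale a s)"
    by (subst mult.commute) (rule km_eq.sym[OF km_eq.scale_scale])
  finally show ?case .
next
  case (br j c s)
  have p: "pairing i (\<lambda>l. c l + simple_root j l) = A i j + pairing i c"
    using pairing_simple[OF br(1), of i c 1] by simp
  have "LBr (Gen_h i) (LBr (Gen_e j) s) \<approx> LAdd (LBr (LBr (Gen_h i) (Gen_e j)) s) (LBr (Gen_e j) (LBr (Gen_h i) s))"
    by (rule br_derivation)
  also have "\<dots> \<approx> LScale (of_int (A i j) + of_int (pairing i c)) (LBr (Gen_e j) s)"
  proof (rule add_scaleI)
    show "LBr (LBr (Gen_h i) (Gen_e j)) s \<approx> LScale (of_int (A i j)) (LBr (Gen_e j) s)"
      by (rule km_eq.trans[OF km_cong(3)[OF km_eq.he km_eq.refl] km_eq.br_scale_left]) (use br in auto)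
    show "LBr (Gen_e j) (LBr (Gen_h i) s) \<approx> LScale (of_int (pairing i c)) (LBr (Gen_e j) s)"
      by (rule km_eq.trans[OF km_cong(3)[OF km_eq.refl br.IH] km_eq.br_scale_right]) (use br in auto)
  qed
  finally show ?case unfolding p by simp
next
  case (eqv c s t)
  then show ?case by (meson km_eq.sym km_cong(2) km_cong(3) km_eq.refl km_eq.trans)
qed

lemma br_f_e: "i \<in> V \<Longrightarrow> j \<in> V \<Longrightarrow> LBr (Gen_f i) (Gen_e j) \<approx> (if i = j then LScale (- 1) (Gen_h i) else LZero)"
  using km_eq.trans[OF br_anti[of "Gen_f i" "Gen_e j"] km_cong(2)[OF km_eq.ef[of j V i A], of "- 1"]]
    km_eq.trans[OF _ scale_LZero[of "- 1"]]
  by (cases "i = j") simp_all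

lemma br_e_h: "i \<in> V \<Longrightarrow> j \<in> V \<Longrightarrow> LBr (Gen_e j) (Gen_h i) \<approx> LScale (- of_int (A i j)) (Gen_e j)"
  using km_eq.trans[OF km_eq.trans[OF br_anti[of "Gen_e j" "Gen_h i"] km_cong(2)[OF km_eq.he[of i V j A]]] km_eq.scale_scale]
  by simp

text \<open>By the derivation rule f_i either meets the outermost e_j, which leaves a multiple of s
  through h_i, or passes to the inner element. Only in the degree of e_i itself does the result
  leave the positive part.\<close>

lemma f_positive:
  "positive c s \<Longrightarrow> i \<in> V \<Longrightarrow> c \<noteq> simple_root i \<Longrightarrow> positive (\<lambda>l. c l - simple_root i l) (LBr (Gen_f i) s)"
proof (induction rule: positive.induct)
  case (gen j)
  then have "i \<noteq> j" by blast
  then have "LBr (Gen_f i) (Gen_e j) \<approx> LZero" using br_f_e[of i j] gen by simp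
  then show ?case using positive.zero positive.eqv km_eq.sym by blast
next
  case (zero c)
  show ?case by (rule positive.eqv[OF positive.zero km_eq.sym[OF br_LZero_right]])
next
  case (add c s t)
  then show ?case by (blast intro: positive.eqv[OF positive.add km_eq.sym[OF km_eq.br_add_right]])
next
  case (scale c s a)
  then show ?case by (blast intro: positive.eqv[OF positive.scale km_eq.sym[OF km_eq.br_scale_right]])
next
  case (eqv c s t)
  then show ?case by (blast intro: positive.eqv km_cong(3) km_eq.refl)
next
  case (br j c s)
  let ?c = "\<lambda>l. c l + simple_root j l - simple_root i l"
  have 1: "positive ?c (LBr (LBr (Gen_f i) (Gen_e j)) s)"
  proof (cases "i = j")
    case True
    have "LBr (LBr (Gen_f i) (Gen_e j)) s \<approx> LBr (LScale (- 1) (Gen_h i)) s"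
      using br_f_e[of i j] br True by (intro km_cong) auto
    also have "\<dots> \<approx> LScale (- 1) (LBr (Gen_h i) s)" by (rule km_eq.br_scale_left)
    also have "\<dots> \<approx> LScale (- 1) (LScale (of_int (pairing i c)) s)"
      by (intro km_cong h_positive br)
    finally have "LBr (LBr (Gen_f i) (Gen_e j)) s \<approx> LScale (- 1) (LScale (of_int (pairing i c)) s)" .
    moreover have "?c = c" using True by simp
    ultimately show ?thesis using br(2) by (metis positive.scale positive.eqv km_eq.sym)
  next
    case False
    then have "LBr (LBr (Gen_f i) (Gen_e j)) s \<approx> LBr LZero s"
      using br_f_e[of i j] br by (intro km_cong) auto
    also have "\<dots> \<approx> LZero" by (rule br_LZero_left)
    finally show ?thesis by (metis positive.zero positive.eqv km_eq.sym)
  qed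
  have 2: "positive ?c (LBr (Gen_e j) (LBr (Gen_f i) s))"
  proof (cases "c = simple_root i")
    case False
    from positive.br[OF br(1) br.IH[OF br.prems(1) False]]
    show ?thesis by (simp add: algebra_simps)
  next
    \<comment> \<open>In the degree of alpha_i the bracket of f_i with s is a multiple of h_i and no
      longer positive; the outer e_j brings it back as a multiple of e_j.\<close>
    case True
    obtain a where "s \<approx> LScale a (Gen_e i)" using positive_simple[OF br(2) True] by blast
    then have "LBr (Gen_f i) s \<approx> LBr (Gen_f i) (LScale a (Gen_e i))" by (intro km_cong) auto
    also have "\<dots> \<approx> LScale a (LBr (Gen_f i) (Gen_e i))" by (rule km_eq.br_scale_right)
    also have "\<dots> \<approx> LScale a (LScale (- 1) (Gen_h i))" using br_f_e[of i i] br by (intro km_cong) auto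
    also have "\<dots> \<approx> LScale (a * - 1) (Gen_h i)" by (rule km_eq.scale_scale)
    finally have "LBr (Gen_e j) (LBr (Gen_f i) s) \<approx> LBr (Gen_e j) (LScale (a * - 1) (Gen_h i))"
      by (intro km_cong) auto
    also have "\<dots> \<approx> LScale (a * - 1) (LBr (Gen_e j) (Gen_h i))" by (rule km_eq.br_scale_right)
    also have "\<dots> \<approx> LScale (a * - 1) (LScale (- of_int (A i j)) (Gen_e j))" using br_e_h[of i j] br by (intro km_cong) auto
    finally have "LBr (Gen_e j) (LBr (Gen_f i) s) \<approx> LScale (a * - 1) (LScale (- of_int (A i j)) (Gen_e j))" .
    moreover have "?c = simple_root j" using True by simp
    ultimately show ?thesis using positive.gen[OF br(1)] by (metis positive.scale positive.eqv km_eq.sym)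
  qed
  show ?case by (rule positive.eqv[OF positive.add[OF 1 2] km_eq.sym[OF br_derivation]])
qed

definition admissible :: "'i km_term set \<Rightarrow> bool" where
  "admissible J \<longleftrightarrow> km_graded_ideal V A J \<and> (\<forall>s\<in>J \<inter> km_cartan V A. s \<approx> LZero)"

lemma admissibleD:
  assumes "admissible J"
  shows "LZero \<in> J" "s \<in> J \<Longrightarrow> t \<in> J \<Longrightarrow> LAdd s t \<in> J" "s \<in> J \<Longrightarrow> LScale a s \<in> J"
    "s \<in> J \<Longrightarrow> LBr t s \<in> J" "s \<in> J \<Longrightarrow> s \<approx> t \<Longrightarrow> t \<in> J"
  using assms unfolding admissible_def km_graded_ideal_def by blast+

text \<open>
  A nonzero vector of weight \<open>m < 0\<close> that is killed by \<open>e\<^sub>i\<close> generates an infinite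
  string under \<open>f\<^sub>i\<close>, which cannot happen inside the positive part.
\<close>

lemma e_not_in_admissible:
  assumes J: "admissible J" and s: "positive c s" "s \<notin> J" and i: "i \<in> V"
    and neg: "pairing i c < 0" and l: "l \<noteq> i" "c l > 0"
  shows "LBr (Gen_e i) s \<notin> J"
proof
  assume e: "LBr (Gen_e i) s \<in> J"
  let ?m = "pairing i c"
  define F where "F k = ((LBr (Gen_f i)) ^^ k) s" for k
  have F: "F 0 = s" "F (Suc k) = LBr (Gen_f i) (F k)" for k by (simp_all add: F_def)
  have pos: "positive (\<lambda>l. c l + (- int k) * simple_root i l) (F k)" for k
  proof (induction k)
    case (Suc k)
    \<comment> \<open>Lowering along i does not touch the coefficient at l, so the string never
      passes through alpha_i, the one degree where \<open>f_positive\<close> fails.\<close>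
    have "c l + (- int k) * simple_root i l \<noteq> simple_root i l" using l by (simp add: simple_root_def)
    then have "(\<lambda>l. c l + (- int k) * simple_root i l) \<noteq> simple_root i" by metis
    from f_positive[OF Suc i this] show ?case unfolding F(2) by (simp add: algebra_simps)
  qed (simp add: F s)
  \<comment> \<open>The sl_2 factor in e f^(k+1) s = (k+1)(m-k) f^k s, valid modulo J because e s
    lies in J. As m is negative it never vanishes, so membership of f^(k+1) s in J would pass down
    to f^k s.\<close>
  let ?a = "\<lambda>k. of_int ((int k + 1) * (?m - int k)) :: complex"
  have step: "\<exists>u\<in>J. LBr (Gen_e i) (F (Suc k)) \<approx> LAdd (LScale (?a k) (F k)) u" for k
  proof -
    have e_f: "LBr (Gen_e i) (F (Suc k)) \<approx> LAdd (LScale (of_int (?m - 2 * int k)) (F k)) (LBr (Gen_f i) (LBr (Gen_e i) (F k)))" for k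
    proof -
      have "pairing i (\<lambda>l. c l + (- int k) * simple_root i l) = ?m - 2 * int k"
        using pairing_simple[OF i, of i c "- int k"] A_diag[OF i] by simp
      then have h: "LBr (Gen_h i) (F k) \<approx> LScale (of_int (?m - 2 * int k)) (F k)"
        using h_positive[OF pos i, of k] by simp
      have ef: "LBr (Gen_e i) (Gen_f i) \<approx> Gen_h i" using km_eq.ef[OF i i, of A] by simp
      have "LBr (Gen_e i) (F (Suc k)) \<approx> LAdd (LBr (LBr (Gen_e i) (Gen_f i)) (F k)) (LBr (Gen_f i) (LBr (Gen_e i) (F k)))"
        unfolding F(2) by (rule br_derivation)
      also have "\<dots> \<approx> LAdd (LScale (of_int (?m - 2 * int k)) (F k)) (LBr (Gen_f i) (LBr (Gen_e i) (F k)))"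
        using km_eq.trans[OF km_cong(3)[OF ef km_eq.refl] h] by (intro km_cong(1)) auto
      finally show ?thesis .
    qed
    show ?thesis
    proof (induction k)
      case 0
      show ?case using e_f[of 0] admissibleD(4)[OF J e] by (auto simp: F)
    next
      case (Suc k)
      then obtain u where u: "u \<in> J" "LBr (Gen_e i) (F (Suc k)) \<approx> LAdd (LScale (?a k) (F k)) u" by blast
      have "LBr (Gen_f i) (LBr (Gen_e i) (F (Suc k))) \<approx> LBr (Gen_f i) (LAdd (LScale (?a k) (F k)) u)"
        using u by (intro km_cong) auto
      also have "\<dots> \<approx> LAdd (LBr (Gen_f i) (LScale (?a k) (F k))) (LBr (Gen_f i) u)" by (rule km_eq.br_add_right)
      also have "\<dots> \<approx> LAdd (LScale (?a k) (F (Suc k))) (LBr (Gen_f i) u)"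
        unfolding F(2) by (intro km_cong km_eq.refl km_eq.br_scale_right)
      finally have "LBr (Gen_e i) (F (Suc (Suc k))) \<approx> LAdd (LScale (of_int (?m - 2 * int (Suc k))) (F (Suc k)))
          (LAdd (LScale (?a k) (F (Suc k))) (LBr (Gen_f i) u))"
        using km_eq.trans[OF e_f[of "Suc k"] km_cong(1)] by blast
      also have "\<dots> \<approx> LAdd (LAdd (LScale (of_int (?m - 2 * int (Suc k))) (F (Suc k)))
          (LScale (?a k) (F (Suc k)))) (LBr (Gen_f i) u)" by (rule km_eq.sym[OF km_eq.add_assoc])
      also have "\<dots> \<approx> LAdd (LScale (of_int (?m - 2 * int (Suc k)) + ?a k) (F (Suc k))) (LBr (Gen_f i) u)"
        by (intro km_cong km_eq.refl add_scaleI)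
      also have "of_int (?m - 2 * int (Suc k)) + ?a k = ?a (Suc k)"
        by (simp add: algebra_simps)
      finally show ?case using admissibleD(4)[OF J u(1)] by blast
    qed
  qed
  have "F k \<notin> J" for k
  proof (induction k)
    case (Suc k)
    show ?case
    proof
      assume "F (Suc k) \<in> J"
      then have 1: "LBr (Gen_e i) (F (Suc k)) \<in> J" by (rule admissibleD(4)[OF J])
      obtain u where u: "u \<in> J" "LBr (Gen_e i) (F (Suc k)) \<approx> LAdd (LScale (?a k) (F k)) u" using step by blast
      have "LAdd (LScale (?a k) (F k)) u \<in> J" by (rule admissibleD(5)[OF J 1 u(2)])
      then have "LAdd (LAdd (LScale (?a k) (F k)) u) (LScale (- 1) u) \<in> J"
        using admissibleD(2)[OF J _ admissibleD(3)[OF J u(1)]] by blast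
      moreover have "LAdd (LAdd (LScale (?a k) (F k)) u) (LScale (- 1) u) \<approx> LScale (?a k) (F k)"
        by (metis km_eq.add_assoc km_eq.add_minus km_cong(1) km_eq.refl km_eq.add_zero km_eq.trans)
      ultimately have "LScale (?a k) (F k) \<in> J" by (rule admissibleD(5)[OF J])
      then have "LScale (inverse (?a k)) (LScale (?a k) (F k)) \<in> J" by (rule admissibleD(3)[OF J])
      moreover have "LScale (inverse (?a k)) (LScale (?a k) (F k)) \<approx> F k"
      proof -
        have nz: "?a k \<noteq> 0" using neg unfolding of_int_eq_0_iff mult_eq_0_iff by linarith
        have "LScale (inverse (?a k)) (LScale (?a k) (F k)) \<approx> LScale (inverse (?a k) * ?a k) (F k)"
          by (rule km_eq.scale_scale)
        also have "inverse (?a k) * ?a k = 1" using nz by (rule left_inverse)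
        also have "LScale 1 (F k) \<approx> F k" by (rule km_eq.scale_one)
        finally show ?thesis .
      qed
      ultimately show False using admissibleD(5)[OF J] Suc by blast
    qed
  qed (simp add: F s)
  \<comment> \<open>One step beyond c i the coefficient at i is negative, so the string ends in
    zero, which does lie in J.\<close>
  moreover have "F (nat (c i) + 1) \<approx> LZero"
    by (rule positive_negative[OF pos[of "nat (c i) + 1"], of i]) (simp add: simple_root_def)
  ultimately show False using admissibleD(1)[OF J] admissibleD(5)[OF J] km_eq.sym by blast
qed

text \<open>Bracketing with f_i would put h_i into J; as a member of the Cartan part it would have
  to vanish.\<close>

lemma Gen_e_not_in_admissible:
  assumes J: "admissible J" and i: "i \<in> V"
  shows "Gen_e i \<notin> J"
proof
  assume "Gen_e i \<in> J"
  then have "LScale (- 1) (LBr (Gen_f i) (Gen_e i)) \<in> J" by (intro admissibleD(3,4)[OF J])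
  moreover have "LScale (- 1) (LBr (Gen_f i) (Gen_e i)) \<approx> Gen_h i"
    using km_eq.trans[OF km_eq.sym[OF br_anti] km_eq.ef[OF i i]] by simp
  ultimately have "Gen_h i \<in> J" by (rule admissibleD(5)[OF J])
  moreover have "Gen_h i \<in> km_cartan V A" using i by (rule km_cartan.intros)
  ultimately have "Gen_h i \<approx> LZero" using J unfolding admissible_def by blast
  then show False using not_km_eq_Gen_h[OF i] by blast
qed

text \<open>The radical is a union of ideals, so a single element has to avoid all of them. Keeping
  it positive allows the next e_i to be applied to it.\<close>

definition root_witness :: "('i \<Rightarrow> int) \<Rightarrow> bool" where
  "root_witness c \<longleftrightarrow> (\<exists>s. positive c s \<and> (\<forall>J. admissible J \<longrightarrow> s \<notin> J))"

lemma root_witness_simple: "i \<in> V \<Longrightarrow> root_witness (simple_root i)"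
  unfolding root_witness_def using positive.gen Gen_e_not_in_admissible by blast

lemma root_witness_step:
  assumes "root_witness c" "i \<in> V" "pairing i c < 0" "l \<noteq> i" "c l > 0"
  shows "root_witness (\<lambda>j. c j + simple_root i j)"
proof -
  obtain s where "positive c s" "\<forall>J. admissible J \<longrightarrow> s \<notin> J" using assms(1) unfolding root_witness_def by blast
  then show ?thesis
    unfolding root_witness_def
    by (intro exI[of _ "LBr (Gen_e i) s"]) (use assms positive.br e_not_in_admissible in blast)
qed

lemma root_witness_root: "root_witness c \<Longrightarrow> c \<noteq> (\<lambda>_. 0) \<Longrightarrow> km_root V A c"
  unfolding root_witness_def km_root_def km_radical_def admissible_def
  using positive_degree by blast

end

subsection \<open>The root lattice\<close>

lemma sum_J_cartan:
  assumes n: "3 < n" and i: "i \<in> {1..n}"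
  shows "(\<Sum>l\<in>{1..n}. J_cartan 3 n i l * c l) =
    (if i = n then 2 * c n - c 3
     else 2 * c i - (if 2 \<le> i then c (i - 1) else 0) - (if i + 1 < n then c (i + 1) else 0)
       - (if i = 3 then c n else 0))"
proof (cases "i = n")
  case True
  have "J_cartan 3 n i l * c l = (if l = n then 2 * c n else 0) - (if l = 3 then c 3 else 0)"
    if "l \<in> {1..n}" for l
    using that n unfolding True J_cartan_def J_edge_def by (auto simp: doubleton_eq_iff)
  then have "(\<Sum>l\<in>{1..n}. J_cartan 3 n i l * c l)
      = (\<Sum>l\<in>{1..n}. (if l = n then 2 * c n else 0) - (if l = 3 then c 3 else 0))"
    by (rule sum.cong[OF HOL.refl])
  then show ?thesis using n True by (simp add: sum_subtractf)
next
  case False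
  have "J_cartan 3 n i l * c l = (if l = i then 2 * c i else 0)
      - (if l = i - 1 then (if 2 \<le> i then c (i - 1) else 0) else 0)
      - (if l = i + 1 then (if i + 1 < n then c (i + 1) else 0) else 0)
      - (if l = n then (if i = 3 then c n else 0) else 0)"
    if "l \<in> {1..n}" for l
  proof -
    have e: "J_edge 3 n i l \<longleftrightarrow> l < n \<and> (l = i + 1 \<or> i = l + 1) \<or> i = 3 \<and> l = n"
      using that n i False unfolding J_edge_def doubleton_eq_iff by auto
    obtain m where m: "i = Suc m" using i by (cases i) auto
    have l: "1 \<le> l" "l \<le> n" and i: "i \<noteq> n" "m + 1 < n" using that i False m by auto
    consider "l = i" | "l = m" | "l = i + 1" "l < n" | "l = n" | "l \<noteq> i" "l \<noteq> m" "l \<noteq> i + 1" "l \<noteq> n"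
      using l(2) by fastforce
    then show ?thesis
    proof cases
      case 1
      then show ?thesis using i m by (simp add: J_cartan_def)
    next
      case 2
      then show ?thesis using i l m unfolding J_cartan_def e by simp
    next
      case 3
      then show ?thesis using i m unfolding J_cartan_def e by simp
    next
      case 4
      then show ?thesis using i m unfolding J_cartan_def e by simp
    next
      case 5
      then show ?thesis using i m unfolding J_cartan_def e by simp
    qed
  qed
  then have "(\<Sum>l\<in>{1..n}. J_cartan 3 n i l * c l) = (\<Sum>l\<in>{1..n}. (if l = i then 2 * c i else 0)
      - (if l = i - 1 then (if 2 \<le> i then c (i - 1) else 0) else 0)
      - (if l = i + 1 then (if i + 1 < n then c (i + 1) else 0) else 0)
      - (if l = n then (if i = 3 then c n else 0) else 0))"
    by (rule sum.cong[OF HOL.refl])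
  then show ?thesis using n i False by (simp add: sum_subtractf) auto
qed

text \<open>In coordinates the pairing with alpha_i is a difference of neighbouring entries, so its
  reflection swaps them. The pairing with beta is x_1 + x_2 + x_3 minus c n, where c n is a third of
  the coordinate sum.\<close>

lemma sum_J_cartan_lattice_vector:
  assumes n: "3 < n" and i: "i \<in> {1..n}"
  shows "(\<Sum>l\<in>{1..n}. J_cartan 3 n i l * c l) =
    (if i = n then lattice_vector 3 n c 1 + lattice_vector 3 n c 2 + lattice_vector 3 n c 3 - c n
     else lattice_vector 3 n c (i + 1) - lattice_vector 3 n c i)"
  using n i unfolding sum_J_cartan[OF n i] by (auto simp: lattice_vector_eq)

lemma lattice_vector_add_simple:
  assumes "j \<in> {1..n}"
  shows "lattice_vector k n (\<lambda>l. c l + a * simple_root j l) i = lattice_vector k n c i + a * simple_root_vector k n j i"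
proof -
  have "(c l + a * simple_root j l) * simple_root_vector k n l i
      = c l * simple_root_vector k n l i + (if l = j then a * simple_root_vector k n j i else 0)" for l
    by (simp add: simple_root_def algebra_simps)
  then show ?thesis using assms by (simp add: lattice_vector_def sum.distrib)
qed

lemma sum_lattice_vector:
  assumes "0 < k" "k < n"
  shows "(\<Sum>i\<in>{1..n}. lattice_vector k n c i) = int k * c n"
proof -
  have "(\<Sum>i\<in>{1..n}. if i \<in> {1..k} then c n else 0) = (\<Sum>i\<in>{1..k}. c n)"
    using assms by (intro sum.mono_neutral_cong_right) auto
  moreover have "(\<Sum>i\<in>{1..n}. if i \<in> {2..n} then c (i - 1) else 0) = (\<Sum>i\<in>{1..<n}. c i)"
  proof -
    have "(\<Sum>i\<in>{1..n}. if i \<in> {2..n} then c (i - 1) else 0) = (\<Sum>i\<in>{2..n}. c (i - 1))"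
      by (intro sum.mono_neutral_cong_right) auto
    also have "\<dots> = (\<Sum>i\<in>{1..<n}. c i)"
      by (rule sum.reindex_bij_witness[of _ Suc "\<lambda>i. i - 1"]) auto
    finally show ?thesis .
  qed
  moreover have "(\<Sum>i\<in>{1..n}. if i \<in> {1..<n} then c i else 0) = (\<Sum>i\<in>{1..<n}. c i)"
    by (intro sum.mono_neutral_cong_right) auto
  ultimately show ?thesis using assms by (simp add: lattice_vector_eq sum.distrib sum_subtractf)
qed

text \<open>Transports a property of coefficient functions to vectors. A preimage with the property
  is enough to compute with, so the description by \<open>THE\<close> enters only at the
  end.\<close>

definition represents :: "nat \<Rightarrow> ((nat \<Rightarrow> int) \<Rightarrow> bool) \<Rightarrow> (nat \<Rightarrow> int) \<Rightarrow> bool" where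
  "represents n Q x \<longleftrightarrow> (\<exists>c. (\<forall>i. i \<notin> {1..n} \<longrightarrow> c i = 0) \<and> lattice_vector 3 n c = x \<and> Q c)"

lemma represents_root_lattice_elem:
  assumes n: "3 < n" and x: "represents n Q x"
  shows "Q (root_lattice_elem 3 n x)"
proof -
  obtain c where c: "\<forall>i. i \<notin> {1..n} \<longrightarrow> c i = 0" "lattice_vector 3 n c = x" "Q c"
    using x unfolding represents_def by blast
  have "\<exists>!c. (\<forall>i. i \<notin> {1..n} \<longrightarrow> c i = 0) \<and> lattice_vector 3 n c = x"
  proof (rule root_lattice_elem_unique)
    show "\<forall>i. i \<notin> {1..n} \<longrightarrow> x i = 0" using n unfolding c(2)[symmetric] by (auto simp: lattice_vector_eq)
    show "int 3 dvd (\<Sum>i\<in>{1..n}. x i)" unfolding c(2)[symmetric] using sum_lattice_vector[of 3 n c] n by simp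
  qed (use n in auto)
  then have "root_lattice_elem 3 n x = c"
    unfolding root_lattice_elem_def using c(1,2) by (intro the1_equality) auto
  then show ?thesis using c(3) by simp
qed

definition indic :: "nat set \<Rightarrow> nat \<Rightarrow> int" where
  "indic T = (\<lambda>i. if i \<in> T then 1 else 0)"

lemma lattice_vector_beta: "3 < n \<Longrightarrow> lattice_vector 3 n (simple_root n) = indic {1..3}"
  by (auto simp: fun_eq_iff lattice_vector_eq simple_root_def indic_def)

lemma represents_beta:
  assumes "3 < n" "Q (simple_root n)"
  shows "represents n Q (indic {1..3})"
  unfolding represents_def using lattice_vector_beta[OF assms(1)] assms
  by (intro exI[of _ "simple_root n"]) (simp add: simple_root_def)

lemma represents_sum:
  assumes "3 < n" "represents n Q x"
  shows "\<exists>c. (\<forall>i. i \<notin> {1..n} \<longrightarrow> c i = 0) \<and> lattice_vector 3 n c = x \<and> Q c \<and> (\<Sum>i\<in>{1..n}. x i) = 3 * c n"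
proof -
  obtain c where c: "\<forall>i. i \<notin> {1..n} \<longrightarrow> c i = 0" "lattice_vector 3 n c = x" "Q c"
    using assms unfolding represents_def by blast
  moreover have "(\<Sum>i\<in>{1..n}. x i) = 3 * c n"
    using sum_lattice_vector[of 3 n c] assms(1) unfolding c(2) by simp
  ultimately show ?thesis by blast
qed

subsection \<open>Roots with coordinates 0 and 1\<close>

locale J3 =
  fixes n :: nat
  assumes n: "3 < n"
begin

sublocale km_algebra "{1..n}" "J_cartan 3 n"
  by unfold_locales (auto simp: J_cartan_def)

lemma pairing_lattice_vector:
  "i \<in> {1..n} \<Longrightarrow> pairing i c =
    (if i = n then lattice_vector 3 n c 1 + lattice_vector 3 n c 2 + lattice_vector 3 n c 3 - c n
     else lattice_vector 3 n c (i + 1) - lattice_vector 3 n c i)"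
  unfolding pairing_def by (rule sum_J_cartan_lattice_vector[OF n])

text \<open>The factors 3 express c n through the coordinate sum. The hypothesis \<open>pos\<close>
  provides the second positive coefficient that \<open>root_witness_step\<close> asks for: it is c 1
  = c n - x 1 when beta is added, and c n otherwise.\<close>

lemma represents_add_simple:
  assumes x: "represents n root_witness x" and i: "i \<in> {1..n}"
    and neg: "(if i = n then 3 * (x 1 + x 2 + x 3) < (\<Sum>i\<in>{1..n}. x i) else x (i + 1) < x i)"
    and pos: "(if i = n then 3 * x 1 < (\<Sum>i\<in>{1..n}. x i) else 0 < (\<Sum>i\<in>{1..n}. x i))"
  shows "represents n root_witness (\<lambda>l. x l + simple_root_vector 3 n i l)"
proof -
  obtain c where c: "\<forall>i. i \<notin> {1..n} \<longrightarrow> c i = 0" "lattice_vector 3 n c = x" "root_witness c"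
    and s: "(\<Sum>i\<in>{1..n}. x i) = 3 * c n"
    using represents_sum[OF n x] by blast
  have "pairing i c < 0"
    using neg s pairing_lattice_vector[OF i, of c] unfolding c(2) by (auto split: if_splits)
  moreover have "\<exists>l. l \<noteq> i \<and> c l > 0"
  proof (cases "i = n")
    case True
    have "x 1 = c n - c 1" using n unfolding c(2)[symmetric] by (simp add: lattice_vector_eq)
    then have "c 1 > 0" using pos s True by simp
    then show ?thesis using True n by (intro exI[of _ 1]) simp
  next
    case False
    then show ?thesis using pos s by (intro exI[of _ n]) simp
  qed
  ultimately have "root_witness (\<lambda>l. c l + simple_root i l)"
    using root_witness_step[OF c(3) i] by blast
  moreover have "lattice_vector 3 n (\<lambda>l. c l + simple_root i l) = (\<lambda>l. x l + simple_root_vector 3 n i l)"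
    using lattice_vector_add_simple[OF i, of 3 c 1] c(2) by (simp add: fun_eq_iff)
  ultimately show ?thesis
    unfolding represents_def using c(1) i by (intro exI[of _ "\<lambda>l. c l + simple_root i l"]) (auto simp: simple_root_def)
qed

lemma sum_indic: "T \<subseteq> {1..n} \<Longrightarrow> (\<Sum>i\<in>{1..n}. indic T i) = int (card T)"
proof -
  assume "T \<subseteq> {1..n}"
  then have "(\<Sum>i\<in>{1..n}. indic T i) = (\<Sum>i\<in>T. 1)"
    by (intro sum.mono_neutral_cong_right) (auto simp: indic_def)
  then show ?thesis by simp
qed

lemma represents_right_shift:
  assumes T: "represents n root_witness (indic T)" "T \<subseteq> {1..n}" and i: "i \<in> T" "i + 1 \<notin> T" "i < n"
  shows "represents n root_witness (indic (insert (i + 1) (T - {i})))"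
proof -
  have card: "card T > 0" using T(2) i(1) finite_subset[of T "{1..n}"] by (auto simp: card_gt_0_iff)
  have "represents n root_witness (\<lambda>l. indic T l + simple_root_vector 3 n i l)"
  proof (intro represents_add_simple[OF T(1)])
    show "if i = n then 3 * indic T 1 < (\<Sum>i\<in>{1..n}. indic T i) else 0 < (\<Sum>i\<in>{1..n}. indic T i)"
      using i card sum_indic[OF T(2)] by simp
  qed (use i T(2) in \<open>auto simp: indic_def\<close>)
  moreover have "(\<lambda>l. indic T l + simple_root_vector 3 n i l) = indic (insert (i + 1) (T - {i}))"
    using i by (auto simp: fun_eq_iff indic_def simple_root_vector_def)
  ultimately show ?thesis by simp
qed

text \<open>Adding alpha_i moves an element of the set from i to i + 1, so every m-set can be
  reached from the initial one. The induction goes backwards: pushing an element to the left lowers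
  the sum of the set.\<close>

lemma represents_indic_subset:
  assumes m: "represents n root_witness (indic {1..m})" and T: "T \<subseteq> {1..n}" "card T = m"
  shows "represents n root_witness (indic T)"
  using T
proof (induction "\<Sum>T" arbitrary: T rule: less_induct)
  case less
  have fin: "finite T" using less.prems finite_subset by blast
  show ?case
  proof (cases "\<exists>i\<in>T. i \<ge> 2 \<and> i - 1 \<notin> T")
    case False
    have down: "j \<in> T" if "1 \<le> j" "j \<le> i" "i \<in> T" for i j
      using that
    proof (induction "i - j" arbitrary: j)
      case (Suc k)
      then have "Suc j \<in> T" by simp
      moreover have "Suc j \<ge> 2" using Suc by simp
      ultimately show ?case using False by force
    qed simp
    have "T = {1..Max (insert 0 T)}"
    proof
      show "T \<subseteq> {1..Max (insert 0 T)}" using fin less.prems(1) by auto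
      show "{1..Max (insert 0 T)} \<subseteq> T"
      proof
        fix j assume j: "j \<in> {1..Max (insert 0 T)}"
        have "Max (insert 0 T) \<in> insert 0 T" using fin by (intro Max_in) auto
        then show "j \<in> T" using j down[of j "Max (insert 0 T)"] by auto
      qed
    qed
    then have "T = {1..m}" using less.prems(2) by (metis card_atLeastAtMost diff_Suc_1)
    then show ?thesis using m by simp
  next
    case True
    then obtain i where i: "i \<in> T" "i \<ge> 2" "i - 1 \<notin> T" by blast
    let ?T = "insert (i - 1) (T - {i})"
    have T': "?T \<subseteq> {1..n}" using less.prems(1) i by auto
    have s: "\<Sum>T = i + \<Sum>(T - {i})" using sum.remove[OF fin i(1), of "\<lambda>x. x"] by simp
    have "\<Sum>?T = (i - 1) + \<Sum>(T - {i})" using fin i by (subst sum.insert) auto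
    then have "\<Sum>?T < \<Sum>T" using s i by linarith
    moreover have "card ?T = m"
      using fin i less.prems(2) card_Suc_Diff1[OF fin i(1)] by (subst card_insert_disjoint) auto
    ultimately have "represents n root_witness (indic ?T)" using T' by (intro less.hyps)
    from represents_right_shift[OF this T', of "i - 1"]
    have "represents n root_witness (indic (insert (i - 1 + 1) (?T - {i - 1})))"
      using i less.prems(1) by fastforce
    moreover have "insert (i - 1 + 1) (?T - {i - 1}) = T" using i by auto
    ultimately show ?thesis by simp
  qed
qed

text \<open>The 3m ones are first moved off the coordinates 1, 2, 3. There the pairing with beta is
  - m, so beta can be added.\<close>

lemma represents_indic_add_beta:
  assumes T: "represents n root_witness (indic {1..3 * m})" and m: "1 \<le> m" "3 * m + 3 \<le> n"
  shows "represents n root_witness (indic {1..3 * m + 3})"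
proof -
  have sub: "{4..3 * m + 3} \<subseteq> {1..n}" using m by auto
  have "represents n root_witness (indic {4..3 * m + 3})"
    by (rule represents_indic_subset[OF T sub]) simp
  then have "represents n root_witness (\<lambda>l. indic {4..3 * m + 3} l + simple_root_vector 3 n n l)"
  proof (rule represents_add_simple)
    have s: "(\<Sum>i\<in>{1..n}. indic {4..3 * m + 3} i) = 3 * int m" using sum_indic[OF sub] by simp
    show "(if n = n then 3 * (indic {4..3 * m + 3} 1 + indic {4..3 * m + 3} 2 + indic {4..3 * m + 3} 3)
        < (\<Sum>i\<in>{1..n}. indic {4..3 * m + 3} i)
      else indic {4..3 * m + 3} (n + 1) < indic {4..3 * m + 3} n)"
      unfolding s using m by (simp add: indic_def)
    show "(if n = n then 3 * indic {4..3 * m + 3} 1 < (\<Sum>i\<in>{1..n}. indic {4..3 * m + 3} i)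
      else 0 < (\<Sum>i\<in>{1..n}. indic {4..3 * m + 3} i))"
      unfolding s using m by (simp add: indic_def)
  qed (use n in auto)
  moreover have "(\<lambda>l. indic {4..3 * m + 3} l + simple_root_vector 3 n n l) = indic {1..3 * m + 3}"
    using m by (auto simp: fun_eq_iff indic_def simple_root_vector_def)
  ultimately show ?thesis by simp
qed

lemma root_nine_ones:
  assumes T: "T \<subseteq> {1..n}" "card T = 9"
  shows "km_root {1..n} (J_cartan 3 n) (root_lattice_elem 3 n (indic T))"
proof -
  have n9: "9 \<le> n" using card_mono[OF _ T(1)] T(2) by simp
  have "represents n root_witness (indic {1..3})"
    using n by (intro represents_beta root_witness_simple) auto
  then have "represents n root_witness (indic {1..6})"
    using represents_indic_add_beta[of 1] n9 by simp
  then have "represents n root_witness (indic {1..9})"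
    using represents_indic_add_beta[of 2] n9 by simp
  from represents_indic_subset[OF this T]
  have x: "represents n root_witness (indic T)" .
  have "represents n (km_root {1..n} (J_cartan 3 n)) (indic T)"
  proof -
    obtain c where c: "\<forall>i. i \<notin> {1..n} \<longrightarrow> c i = 0" "lattice_vector 3 n c = indic T" "root_witness c"
      and "(\<Sum>i\<in>{1..n}. indic T i) = 3 * c n"
      using represents_sum[OF n x] by blast
    then have "c n = 3" using sum_indic[OF T(1)] T(2) by simp
    then have "km_root {1..n} (J_cartan 3 n) c" by (intro root_witness_root[OF c(3)]) auto
    then show ?thesis unfolding represents_def using c by blast
  qed
  then show ?thesis by (rule represents_root_lattice_elem[OF n])
qed

subsection \<open>Real roots and permutations of the coordinates\<close>

abbreviation "real_vec \<equiv> represents n (km_real_root {1..n} (J_cartan 3 n))"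

lemma real_vec_reflection:
  assumes x: "real_vec x" and i: "i \<in> {1..n}"
    and m: "(if i = n then 3 * m = (\<Sum>i\<in>{1..n}. x i) - 3 * (x 1 + x 2 + x 3) else m = x i - x (i + 1))"
  shows "real_vec (\<lambda>l. x l + m * simple_root_vector 3 n i l)"
proof -
  obtain c where c: "\<forall>i. i \<notin> {1..n} \<longrightarrow> c i = 0" "lattice_vector 3 n c = x"
      "km_real_root {1..n} (J_cartan 3 n) c"
    and s: "(\<Sum>i\<in>{1..n}. x i) = 3 * c n"
    using represents_sum[OF n x] by blast
  have p: "pairing i c = - m"
    using m s pairing_lattice_vector[OF i, of c] unfolding c(2) by (auto split: if_splits)
  have r: "km_reflection {1..n} (J_cartan 3 n) i c = (\<lambda>l. c l + m * simple_root i l)"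
    using p[unfolded pairing_def] by (simp add: km_reflection_def)
  obtain j js where j: "j \<in> {1..n}" "set js \<subseteq> {1..n}"
    "c = foldr (km_reflection {1..n} (J_cartan 3 n)) js (simple_root j)"
    using c(3) unfolding km_real_root_def by blast
  have "km_real_root {1..n} (J_cartan 3 n) (\<lambda>l. c l + m * simple_root i l)"
    unfolding km_real_root_def
  proof (intro bexI[OF _ j(1)] exI conjI)
    show "set (i # js) \<subseteq> {1..n}" using j i by simp
    show "(\<lambda>l. c l + m * simple_root i l) = foldr (km_reflection {1..n} (J_cartan 3 n)) (i # js) (simple_root j)"
      unfolding foldr_Cons comp_apply j(3)[symmetric] r ..
  qed
  moreover have "lattice_vector 3 n (\<lambda>l. c l + m * simple_root i l) = (\<lambda>l. x l + m * simple_root_vector 3 n i l)"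
    using lattice_vector_add_simple[OF i, of 3 c m] c(2) by (simp add: fun_eq_iff)
  ultimately show ?thesis
    unfolding represents_def using c(1) i
    by (intro exI[of _ "\<lambda>l. c l + m * simple_root i l"]) (auto simp: simple_root_def)
qed

lemma real_vec_adjacent:
  assumes "real_vec x" "1 \<le> i" "i < n"
  shows "real_vec (x \<circ> Transposition.transpose i (Suc i))"
proof -
  have "real_vec (\<lambda>l. x l + (x i - x (i + 1)) * simple_root_vector 3 n i l)"
    using assms by (intro real_vec_reflection) auto
  moreover have "(\<lambda>l. x l + (x i - x (i + 1)) * simple_root_vector 3 n i l) = x \<circ> Transposition.transpose i (Suc i)"
    using assms by (auto simp: fun_eq_iff simple_root_vector_def Transposition.transpose_def)
  ultimately show ?thesis by simp
qed

text \<open>Conjugating a transposition by an adjacent one at its upper end makes it longer by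
  one.\<close>

lemma real_vec_transpose:
  "real_vec x \<Longrightarrow> 1 \<le> i \<Longrightarrow> i + d < n \<Longrightarrow> real_vec (x \<circ> Transposition.transpose i (i + Suc d))"
proof (induction d arbitrary: x)
  case 0
  then show ?case using real_vec_adjacent[of x i] by (simp only: add_Suc_right add_0_right)
next
  case (Suc d)
  let ?s = "Transposition.transpose (i + Suc d) (Suc (i + Suc d))" and ?t = "Transposition.transpose i (i + Suc d)"
  have 1: "real_vec (x \<circ> ?s)" by (rule real_vec_adjacent[OF Suc.prems(1)]) (use Suc.prems in auto)
  have 2: "real_vec (x \<circ> ?s \<circ> ?t)" by (rule Suc.IH[OF 1]) (use Suc.prems in auto)
  have "real_vec (x \<circ> ?s \<circ> ?t \<circ> ?s)" by (rule real_vec_adjacent[OF 2]) (use Suc.prems in auto)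
  moreover have "x \<circ> ?s \<circ> ?t \<circ> ?s = x \<circ> Transposition.transpose i (i + Suc (Suc d))"
    by (auto simp: fun_eq_iff Transposition.transpose_def)
  ultimately show ?case by (simp only:)
qed

lemma real_vec_permutes:
  assumes "p permutes {1..n}" "real_vec x"
  shows "real_vec (x \<circ> p)"
proof -
  have "\<forall>x. real_vec x \<longrightarrow> real_vec (x \<circ> p)"
    using assms(1) finite_atLeastAtMost[of 1 n]
  proof (induction rule: permutes_induct)
    case id
    then show ?case by simp
  next
    case (swap a b p)
    have "real_vec (x \<circ> Transposition.transpose a b)" if x: "real_vec x" for x
    proof (cases a b rule: linorder_cases)
      case less
      then show ?thesis using real_vec_transpose[OF x, of a "b - a - 1"] swap by simp
    next
      case equal
      then show ?thesis using x by simp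
    next
      case greater
      then show ?thesis using real_vec_transpose[OF x, of b "a - b - 1"] swap
        by (simp add: Transposition.transpose_commute)
    qed
    then have "real_vec (x \<circ> Transposition.transpose a b \<circ> p)" if "real_vec x" for x using swap that by blast
    then show ?case by (simp only: comp_assoc) blast
  qed
  then show ?thesis using assms(2) by blast
qed

text \<open>The reflections in the alpha_i with i < n generate all permutations of the coordinates,
  so only the multiset of entries matters.\<close>

lemma real_vec_rearrange:
  assumes x: "real_vec x" and y: "\<forall>i. i \<notin> {1..n} \<longrightarrow> y i = 0"
    and eq: "\<And>v. card {i\<in>{1..n}. y i = v} = card {i\<in>{1..n}. x i = v}"
  shows "real_vec y"
proof -
  have "count (image_mset f (mset_set {1..n})) v = card {i\<in>{1..n}. f i = v}" for f :: "nat \<Rightarrow> int" and v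
    by (simp add: count_image_mset_eq_card_vimage)
  then have "image_mset y (mset_set {1..n}) = image_mset x (mset_set {1..n})"
    using eq by (intro multiset_eqI) simp
  then obtain p where p: "p permutes {1..n}" "\<forall>i\<in>{1..n}. y i = x (p i)"
    using image_mset_eq_implies_permutes[of "{1..n}" y x] by auto
  have "y = x \<circ> p"
  proof
    fix i
    have "x i = 0" if "i \<notin> {1..n}"
      using x that n unfolding represents_def by (auto simp: lattice_vector_eq)
    then show "y i = (x \<circ> p) i"
      using p y permutes_not_in[OF p(1), of i] by (cases "i \<in> {1..n}") auto
  qed
  then show ?thesis using real_vec_permutes[OF p(1) x] by simp
qed

lemma real_vec_indic:
  assumes "real_vec (indic S)" "S \<subseteq> {1..n}" "T \<subseteq> {1..n}" "card S = card T"
  shows "real_vec (indic T)"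
proof (rule real_vec_rearrange[OF assms(1)])
  fix v
  have c: "card {i \<in> {1..n}. indic U i = v} = (if v = 1 then card U else if v = 0 then n - card U else 0)"
    if U: "U \<subseteq> {1..n}" for U
  proof -
    have "{i \<in> {1..n}. indic U i = 1} = U" "{i \<in> {1..n}. indic U i = 0} = {1..n} - U"
      using U by (auto simp: indic_def)
    moreover have "{i \<in> {1..n}. indic U i = v} = {}" if "v \<noteq> 0" "v \<noteq> 1" using that by (auto simp: indic_def)
    ultimately show ?thesis using U by (auto simp: card_Diff_subset finite_subset)
  qed
  show "card {i \<in> {1..n}. indic T i = v} = card {i \<in> {1..n}. indic S i = v}"
    using c[OF assms(2)] c[OF assms(3)] assms(4) by simp
qed (use assms in \<open>auto simp: indic_def\<close>)

text \<open>Three ones outside the first three places reflect under beta to six ones. Six ones of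
  which exactly one sits in the first three places reflect to one two and seven ones. Permutations
  do the rest.\<close>

lemma real_vec_two_seven:
  assumes n8: "8 \<le> n" and a: "a \<in> {1..n}" and T: "T \<subseteq> {1..n} - {a}" "card T = 7"
  shows "real_vec (\<lambda>i. indic T i + 2 * indic {a} i)"
proof -
  have "real_vec (indic {1..3})"
    unfolding represents_def[of n "km_real_root {1..n} (J_cartan 3 n)"]
  proof (intro exI conjI)
    show "km_real_root {1..n} (J_cartan 3 n) (simple_root n)"
      unfolding km_real_root_def using n by (intro bexI[of _ n] exI[of _ "[]"]) auto
    show "lattice_vector 3 n (simple_root n) = indic {1..3}" by (rule lattice_vector_beta[OF n])
  qed (use n in \<open>auto simp: simple_root_def\<close>)
  then have "real_vec (indic {4..6})" by (rule real_vec_indic) (use n8 in auto)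
  then have "real_vec (\<lambda>l. indic {4..6} l + 1 * simple_root_vector 3 n n l)"
  proof (rule real_vec_reflection)
    show "if n = n then 3 * 1 = (\<Sum>i\<in>{1..n}. indic {4..6} i) - 3 * (indic {4..6} 1 + indic {4..6} 2 + indic {4..6} 3)
      else 1 = indic {4..6} n - indic {4..6} (n + 1)"
      using n8 sum_indic[of "{4..6}"] by (simp add: indic_def)
  qed (use n in auto)
  moreover have "(\<lambda>l. indic {4..6} l + 1 * simple_root_vector 3 n n l) = indic {1..6}"
    by (auto simp: fun_eq_iff indic_def simple_root_vector_def)
  ultimately have "real_vec (indic {1..6})" by simp
  then have "real_vec (indic (insert 1 {4..8}))" by (rule real_vec_indic) (use n8 in auto)
  then have "real_vec (\<lambda>l. indic (insert 1 {4..8}) l + 1 * simple_root_vector 3 n n l)"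
  proof (rule real_vec_reflection)
    show "if n = n then 3 * 1 = (\<Sum>i\<in>{1..n}. indic (insert 1 {4..8}) i)
        - 3 * (indic (insert 1 {4..8}) 1 + indic (insert 1 {4..8}) 2 + indic (insert 1 {4..8}) 3)
      else 1 = indic (insert 1 {4..8}) n - indic (insert 1 {4..8}) (n + 1)"
      using n8 sum_indic[of "insert 1 {4..8}"] by (simp add: indic_def)
  qed (use n in auto)
  moreover have "(\<lambda>l. indic (insert 1 {4..8}) l + 1 * simple_root_vector 3 n n l)
      = (\<lambda>i. indic {2..8} i + 2 * indic {1} i)"
    by (auto simp: fun_eq_iff indic_def simple_root_vector_def)
  ultimately have x: "real_vec (\<lambda>i. indic {2..8} i + 2 * indic {1} i)" by simp
  have c: "card {i \<in> {1..n}. indic U i + 2 * indic {b} i = v}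
      = (if v = 2 then 1 else if v = 1 then 7 else if v = 0 then n - 8 else 0)"
    if U: "b \<in> {1..n}" "U \<subseteq> {1..n} - {b}" "card U = 7" for U b v
  proof -
    have e: "{i \<in> {1..n}. indic U i + 2 * indic {b} i = 2} = {b}"
      "{i \<in> {1..n}. indic U i + 2 * indic {b} i = 1} = U"
      "{i \<in> {1..n}. indic U i + 2 * indic {b} i = 0} = {1..n} - insert b U"
      using U by (auto simp: indic_def)
    have "{i \<in> {1..n}. indic U i + 2 * indic {b} i = v} = {}" if "v \<noteq> 0" "v \<noteq> 1" "v \<noteq> 2"
      using that U by (auto simp: indic_def)
    moreover have "finite U" using U finite_subset by blast
    moreover have "card (insert b U) = 8" using U \<open>finite U\<close> by (subst card_insert_disjoint) auto
    moreover have "card ({1..n} - insert b U) = n - 8"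
      using U \<open>finite U\<close> \<open>card (insert b U) = 8\<close> by (subst card_Diff_subset) auto
    ultimately show ?thesis using e U by auto
  qed
  show ?thesis
  proof (rule real_vec_rearrange[OF x])
    show "\<forall>i. i \<notin> {1..n} \<longrightarrow> indic T i + 2 * indic {a} i = 0" using T a by (auto simp: indic_def)
    have 1: "1 \<in> {1..n}" "{2..8} \<subseteq> {1..n} - {1}" "card {2..8::nat} = 7" using n8 by auto
    show "card {i \<in> {1..n}. indic T i + 2 * indic {a} i = v} = card {i \<in> {1..n}. indic {2..8} i + 2 * indic {1} i = v}" for v
      unfolding c[OF a T] c[OF 1] ..
  qed
qed

end

text \<open>Over the support the numbers x_i - 1 add up to 9 minus its size, hence to at most 1. So
  at most one entry exceeds 1, and it is then 2. The correction term of \<open>q_form\<close> equals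
  - 9.\<close>

lemma root_of_large_support:
  fixes x :: "nat \<Rightarrow> int"
  assumes n: "3 < n" and x: "\<And>i. 0 \<le> x i" "\<And>i. i \<notin> {1..n} \<Longrightarrow> x i = 0"
    and s: "(\<Sum>i\<in>{1..n}. x i) = 9" and supp: "8 \<le> card {i\<in>{1..n}. x i \<noteq> 0}"
  shows "q_form 3 n x \<in> {0, 2} \<and> (J_real_root 3 n (root_lattice_elem 3 n x) \<or> J_imaginary_root 3 n (root_lattice_elem 3 n x))"
proof -
  interpret J3 n by unfold_locales (rule n)
  let ?S = "{i\<in>{1..n}. x i \<noteq> 0}"
  have q: "q_form 3 n x = of_int ((\<Sum>i\<in>{1..n}. (x i)\<^sup>2) - 9)"
    unfolding q_form_def s by simp
  have ge1: "1 \<le> x i" if "i \<in> ?S" for i using x(1)[of i] that by auto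
  have sS: "(\<Sum>i\<in>?S. x i) = 9" unfolding s[symmetric] by (rule sum.mono_neutral_left) auto
  have sq: "(\<Sum>i\<in>{1..n}. (x i)\<^sup>2) = (\<Sum>i\<in>?S. (x i)\<^sup>2)" by (rule sum.mono_neutral_right) auto
  have exc: "(\<Sum>i\<in>?S. x i - 1) = 9 - int (card ?S)" using sS by (simp add: sum_subtractf)
  have exc0: "0 \<le> x i - 1" if "i \<in> ?S" for i using ge1[OF that] by simp
  show ?thesis
  proof (cases "\<forall>i\<in>?S. x i = 1")
    case True
    then have "(\<Sum>i\<in>?S. x i - 1) = 0" by (intro sum.neutral) auto
    then have 9: "card ?S = 9" using exc by simp
    have "x = indic ?S" using True x(2) by (auto simp: fun_eq_iff indic_def)
    moreover have "?S \<subseteq> {1..n}" by blast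
    ultimately have "km_root {1..n} (J_cartan 3 n) (root_lattice_elem 3 n x)" using root_nine_ones[of ?S, OF _ 9] by simp
    moreover have "(\<Sum>i\<in>?S. (x i)\<^sup>2) = (\<Sum>i\<in>?S. 1)" using True by (intro sum.cong) auto
    then have "(\<Sum>i\<in>?S. (x i)\<^sup>2) = 9" using 9 by (simp only: sum_constant)
    \<comment> \<open>Whether this root is real is left open: a root that is not real is imaginary
      by definition.\<close>
    ultimately show ?thesis
      unfolding q sq J_real_root_def J_imaginary_root_def km_imaginary_root_def by auto
  next
    case False
    then obtain a where a: "a \<in> ?S" "x a \<noteq> 1" by blast
    have r: "(\<Sum>i\<in>?S. x i - 1) = (x a - 1) + (\<Sum>i\<in>?S - {a}. x i - 1)"
      by (rule sum.remove) (use a in auto)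
    have r0: "0 \<le> (\<Sum>i\<in>?S - {a}. x i - 1)" by (rule sum_nonneg) (use exc0 in auto)
    have "x a \<ge> 2" using ge1[OF a(1)] a(2) by simp
    then have a2: "x a = 2" "card ?S = 8" "(\<Sum>i\<in>?S - {a}. x i - 1) = 0" using r r0 exc supp by linarith+
    have one: "x i = 1" if "i \<in> ?S - {a}" for i
    proof -
      have "(\<Sum>i\<in>?S - {a}. x i - 1) = 0 \<longleftrightarrow> (\<forall>i\<in>?S - {a}. x i - 1 = 0)"
        by (rule sum_nonneg_eq_0_iff) (use exc0 in auto)
      then have "x i - 1 = 0" using a2(3) that by blast
      then show ?thesis by simp
    qed
    have 7: "card (?S - {a}) = 7" using a2(2) a(1) by simp
    have "card ?S \<le> card {1..n}" by (rule card_mono) auto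
    then have n8: "8 \<le> n" using supp by simp
    have "x = (\<lambda>i. indic (?S - {a}) i + 2 * indic {a} i)"
      using one x(2) a2(1) by (auto simp: fun_eq_iff indic_def)
    moreover have "real_vec (\<lambda>i. indic (?S - {a}) i + 2 * indic {a} i)"
      by (rule real_vec_two_seven[OF n8 _ _ 7]) (use a in auto)
    ultimately have "real_vec x" by (rule ssubst[where P = real_vec])
    then have "J_real_root 3 n (root_lattice_elem 3 n x)"
      unfolding J_real_root_def by (rule represents_root_lattice_elem[OF n])
    moreover have "(\<Sum>i\<in>?S. (x i)\<^sup>2) = 4 + (\<Sum>i\<in>?S - {a}. (x i)\<^sup>2)"
      using sum.remove[of ?S a "\<lambda>i. (x i)\<^sup>2"] a(1) a2(1) by simp
    moreover have "(\<Sum>i\<in>?S - {a}. (x i)\<^sup>2) = (\<Sum>i\<in>?S - {a}. 1)"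
    proof (rule sum.cong)
      fix i assume "i \<in> ?S - {a}"
      then show "(x i)\<^sup>2 = 1" by (simp only: one power_one)
    qed (rule HOL.refl)
    then have "(\<Sum>i\<in>?S - {a}. (x i)\<^sup>2) = 7" using 7 by (simp only: sum_constant)
    ultimately show ?thesis unfolding q sq by simp
  qed
qed

subsection \<open>The completed path algebra of the cyclic quiver\<close>

lemma cpa_simps:
  "(a \<otimes>\<^bsub>cpath_algebra G\<^esub> b) (v, w) = (\<Sum>j\<le>length w. a (path_end G (v, take j w), drop j w) * b (v, take j w))"
  "\<one>\<^bsub>cpath_algebra G\<^esub> (v, w) = (if v \<in> verts G \<and> w = [] then 1 else 0)"
  "\<zero>\<^bsub>cpath_algebra G\<^esub> = (\<lambda>_. 0)"
  "(a \<oplus>\<^bsub>cpath_algebra G\<^esub> b) p = a p + b p"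
  by (simp_all add: cpath_algebra_def)

lemma cpa_carrier: "a \<in> carrier (cpath_algebra G) \<longleftrightarrow> (\<forall>p. p \<notin> quiver_paths G \<longrightarrow> a p = 0)"
  by (simp add: cpath_algebra_def)

lemma cpa_minus:
  assumes "wf_digraph G" "a \<in> carrier (cpath_algebra G)" "b \<in> carrier (cpath_algebra G)"
  shows "(a \<ominus>\<^bsub>cpath_algebra G\<^esub> b) p = a p - b p"
proof -
  interpret ring "cpath_algebra G" by (rule ring_cpath_algebra[OF assms(1)])
  have "\<ominus>\<^bsub>cpath_algebra G\<^esub> b = (\<lambda>p. - b p)"
    using assms by (intro minus_equality) (auto simp: cpa_carrier cpa_simps fun_eq_iff)
  then show ?thesis by (simp add: a_minus_def cpa_simps)
qed

lemma cpa_mult_lengthD: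
  assumes "\<And>v w. w \<noteq> [] \<Longrightarrow> d (v, w) = 0"
  shows "(d \<otimes>\<^bsub>cpath_algebra G\<^esub> b) (v, w) = d (path_end G (v, w), []) * b (v, w)"
    "(b \<otimes>\<^bsub>cpath_algebra G\<^esub> d) (v, w) = b (v, w) * d (v, [])"
proof -
  have "(d \<otimes>\<^bsub>cpath_algebra G\<^esub> b) (v, w) = (\<Sum>j\<le>length w. if j = length w then d (path_end G (v, w), []) * b (v, w) else 0)"
    unfolding cpa_simps by (rule sum.cong) (auto simp: assms)
  then show "(d \<otimes>\<^bsub>cpath_algebra G\<^esub> b) (v, w) = d (path_end G (v, w), []) * b (v, w)" by simp
  have "(b \<otimes>\<^bsub>cpath_algebra G\<^esub> d) (v, w) = (\<Sum>j\<le>length w. if j = 0 then b (v, w) * d (v, []) else 0)"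
    unfolding cpa_simps
  proof (rule sum.cong)
    fix j assume "j \<in> {..length w}"
    then have "take j w \<noteq> []" if "j \<noteq> 0" using that by auto
    then show "b (path_end G (v, take j w), drop j w) * d (v, take j w) = (if j = 0 then b (v, w) * d (v, []) else 0)"
      using assms by simp
  qed simp
  then show "(b \<otimes>\<^bsub>cpath_algebra G\<^esub> d) (v, w) = b (v, w) * d (v, [])" by simp
qed

lemma cpa_mult_arrows:
  assumes "\<And>v w. length w \<noteq> 1 \<Longrightarrow> a (v, w) = 0"
  shows "(a \<otimes>\<^bsub>cpath_algebra G\<^esub> b) (v, []) = 0" "(b \<otimes>\<^bsub>cpath_algebra G\<^esub> a) (v, []) = 0"
    "(a \<otimes>\<^bsub>cpath_algebra G\<^esub> b) (v, w @ [e]) = a (path_end G (v, w), [e]) * b (v, w)"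
proof -
  show "(a \<otimes>\<^bsub>cpath_algebra G\<^esub> b) (v, []) = 0" "(b \<otimes>\<^bsub>cpath_algebra G\<^esub> a) (v, []) = 0"
    using assms by (simp_all add: cpa_simps)
  have "(a \<otimes>\<^bsub>cpath_algebra G\<^esub> b) (v, w @ [e])
      = (\<Sum>j\<le>length (w @ [e]). if j = length w then a (path_end G (v, w), [e]) * b (v, w) else 0)"
    unfolding cpa_simps by (rule sum.cong) (auto simp: assms)
  then show "(a \<otimes>\<^bsub>cpath_algebra G\<^esub> b) (v, w @ [e]) = a (path_end G (v, w), [e]) * b (v, w)" by simp
qed

lemma cpa_pow_short:
  assumes "\<And>v. a (v, []) = 0" "length w < j"
  shows "(a [^]\<^bsub>cpath_algebra G\<^esub> j) (v, w) = 0"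
  using assms(2)
proof (induction j arbitrary: v w)
  case (Suc j)
  have "(a [^]\<^bsub>cpath_algebra G\<^esub> j) (path_end G (v, take i w), drop i w) * a (v, take i w) = 0" for i
  proof (cases "i = 0")
    case True
    then show ?thesis using assms(1) by simp
  next
    case False
    show ?thesis
    proof (cases "w = []")
      case True
      then show ?thesis using assms(1) by simp
    next
      case nonempty: False
      then have "length (drop i w) < j" using Suc.prems False by (cases w) auto
      then show ?thesis using Suc.IH by simp
    qed
  qed
  then show ?case unfolding nat_pow_Suc cpa_simps(1) by (intro sum.neutral ballI)
qed simp

section \<open>Power series in an element of the path algebra\<close>

lemma power_series_at_add:
  "power_series_at G (f + g) a = power_series_at G f a \<oplus>\<^bsub>cpath_algebra G\<^esub> power_series_at G g a"
  by (auto simp: power_series_at_def cpa_simps fun_eq_iff algebra_simps sum.distrib)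

lemma power_series_at_const:
  "power_series_at G (fps_const c) a p = c * \<one>\<^bsub>cpath_algebra G\<^esub> p"
proof -
  have "power_series_at G (fps_const c) a p = (\<Sum>j\<le>length (snd p). if j = 0 then c * \<one>\<^bsub>cpath_algebra G\<^esub> p else 0)"
    unfolding power_series_at_def by (rule sum.cong) auto
  then show ?thesis by simp
qed

lemma power_series_at_const_mult:
  assumes "wf_digraph G" "power_series_at G g a \<in> carrier (cpath_algebra G)"
  shows "power_series_at G (fps_const c * g) a = power_series_at G (fps_const c) a \<otimes>\<^bsub>cpath_algebra G\<^esub> power_series_at G g a"
proof (rule ext, clarify)
  fix v w
  have "(power_series_at G (fps_const c) a \<otimes>\<^bsub>cpath_algebra G\<^esub> power_series_at G g a) (v, w)
      = c * (\<one>\<^bsub>cpath_algebra G\<^esub> \<otimes>\<^bsub>cpath_algebra G\<^esub> power_series_at G g a) (v, w)"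
    unfolding cpa_simps(1) power_series_at_const by (simp add: sum_distrib_left mult.assoc)
  also have "\<dots> = c * power_series_at G g a (v, w)" unfolding cpath_one_mult(1)[OF assms] ..
  also have "\<dots> = power_series_at G (fps_const c * g) a (v, w)"
    by (simp add: power_series_at_def sum_distrib_left mult.assoc)
  finally show "power_series_at G (fps_const c * g) a (v, w)
      = (power_series_at G (fps_const c) a \<otimes>\<^bsub>cpath_algebra G\<^esub> power_series_at G g a) (v, w)" ..
qed

lemma power_series_at_closed:
  assumes "wf_digraph G" "a \<in> carrier (cpath_algebra G)"
  shows "power_series_at G f a \<in> carrier (cpath_algebra G)"
proof -
  interpret ring "cpath_algebra G" by (rule ring_cpath_algebra[OF assms(1)])
  show ?thesis
    using nat_pow_closed[OF assms(2)] by (auto simp: power_series_at_def cpa_carrier)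
qed

lemma power_series_at_X_mult:
  fixes G :: "('v, 'e) pre_digraph"
  assumes G: "wf_digraph G" and a: "a \<in> carrier (cpath_algebra G)" "\<And>v. a (v, []) = 0"
  shows "power_series_at G (fps_X * f) a = a \<otimes>\<^bsub>cpath_algebra G\<^esub> power_series_at G f a"
proof (rule ext, clarify)
  fix v :: 'v and w :: "'e list"
  interpret ring "cpath_algebra G" by (rule ring_cpath_algebra[OF G])
  let ?L = "length w" and ?p = "\<lambda>j. a [^]\<^bsub>cpath_algebra G\<^esub> (j::nat)"
  have "(a \<otimes>\<^bsub>cpath_algebra G\<^esub> power_series_at G f a) (v, w)
      = (\<Sum>i\<le>?L. \<Sum>j\<le>?L. a (path_end G (v, take i w), drop i w) * (fps_nth f j * ?p j (v, take i w)))"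
  proof -
    \<comment> \<open>The cut-off is raised from the length of the initial segment to that of the
      whole path. This is harmless, as higher powers of a vanish on short paths, and it makes the
      two sums interchangeable.\<close>
    have "power_series_at G f a (v, take i w) = (\<Sum>j\<le>?L. fps_nth f j * ?p j (v, take i w))" if "i \<le> ?L" for i
      unfolding power_series_at_def using that
      by (intro sum.mono_neutral_cong_left) (auto intro!: cpa_pow_short a)
    then show ?thesis by (simp add: cpa_simps sum_distrib_left)
  qed
  also have "\<dots> = (\<Sum>j\<le>?L. fps_nth f j * (\<Sum>i\<le>?L. a (path_end G (v, take i w), drop i w) * ?p j (v, take i w)))"
    by (subst sum.swap) (simp add: sum_distrib_left mult.left_commute)
  also have "\<dots> = (\<Sum>j\<le>?L. fps_nth f j * ?p (Suc j) (v, w))"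
    using nat_pow_Suc2[OF a(1)] by (simp add: cpa_simps del: nat_pow_Suc)
  also have "\<dots> = (\<Sum>j\<le>Suc ?L. fps_nth (fps_X * f) j * ?p j (v, w))"
    by (simp add: sum.atMost_Suc_shift del: nat_pow_Suc sum.atMost_Suc)
  also have "\<dots> = power_series_at G (fps_X * f) a (v, w)"
  proof -
    have "?p (Suc ?L) (v, w) = 0" by (rule cpa_pow_short) (simp_all add: a(2))
    then show ?thesis unfolding power_series_at_def sum.atMost_Suc by simp
  qed
  finally show "power_series_at G (fps_X * f) a (v, w) = (a \<otimes>\<^bsub>cpath_algebra G\<^esub> power_series_at G f a) (v, w)" ..
qed

section \<open>Paths and distinguished elements of the cyclic quiver\<close>

lemma cyclic_path_end_snoc [simp]:
  "path_end (cyclic_quiver n) (v, w @ [ArrX i]) = i mod n"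
  "path_end (cyclic_quiver n) (v, w @ [ArrY i]) = i - 1"
  by (simp_all only: path_end_append)
     (simp_all add: path_end_def pre_digraph.awalk_verts.simps cyclic_quiver_def)

lemma cyclic_path_end_single [simp]:
  "path_end (cyclic_quiver n) (v, [ArrX i]) = i mod n"
  "path_end (cyclic_quiver n) (v, [ArrY i]) = i - 1"
  using cyclic_path_end_snoc[of n v "[]" i] by simp_all

lemma cyclic_path_single:
  "(v, [e]) \<in> quiver_paths (cyclic_quiver n) \<longleftrightarrow>
     (\<exists>i\<in>{1..n}. e = ArrX i \<and> v = i - 1 \<or> e = ArrY i \<and> v = i mod n)"
  by (auto simp: quiver_paths_def cyclic_quiver_def pre_digraph.awalk_def pre_digraph.cas.simps)

lemma cyclic_path_snoc:
  "(v, w @ [e]) \<in> quiver_paths (cyclic_quiver n) \<longleftrightarrow> (v, w) \<in> quiver_paths (cyclic_quiver n) \<and>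
     (\<exists>i\<in>{1..n}. e = ArrX i \<and> path_end (cyclic_quiver n) (v, w) = i - 1
       \<or> e = ArrY i \<and> path_end (cyclic_quiver n) (v, w) = i mod n)"
  unfolding quiver_paths_append[OF wf_cyclic_quiver] cyclic_path_single ..

lemma cyclic_path_end_less: "p \<in> quiver_paths (cyclic_quiver n) \<Longrightarrow> path_end (cyclic_quiver n) p < n"
  using quiver_paths_append[OF wf_cyclic_quiver, of "fst p" "snd p" "[]" n] by (simp add: cyclic_quiver_def)

lemma x_y_elem_length:
  "length w \<noteq> 1 \<Longrightarrow> x_elem n (v, w) = 0" "length w \<noteq> 1 \<Longrightarrow> y_elem n (v, w) = 0"
  by (auto simp: x_elem_def y_elem_def)

definition diag_elem :: "nat \<Rightarrow> (nat \<Rightarrow> complex) \<Rightarrow> cpa" where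
  "diag_elem n d = (\<lambda>(v, w). if v < n \<and> w = [] then d v else 0)"

lemma diag_elem_closed: "diag_elem n d \<in> carrier (CPA n)"
  by (auto simp: diag_elem_def cpa_carrier cyclic_quiver_def)

lemma diag_elem_Nil: "w \<noteq> [] \<Longrightarrow> diag_elem n d (v, w) = 0"
  by (simp add: diag_elem_def)

lemma diag_mult:
  "(diag_elem n d \<otimes>\<^bsub>CPA n\<^esub> b) (v, w) = diag_elem n d (path_end (cyclic_quiver n) (v, w), []) * b (v, w)"
  "(b \<otimes>\<^bsub>CPA n\<^esub> diag_elem n d) (v, w) = b (v, w) * diag_elem n d (v, [])"
  by (rule cpa_mult_lengthD; simp add: diag_elem_Nil)+

lemma vertex_idem_eq: "i < n \<Longrightarrow> vertex_idem i = diag_elem n (\<lambda>v. if v = i then 1 else 0)"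
  by (auto simp: vertex_idem_def diag_elem_def fun_eq_iff)

lemma diag_mult_diag: "diag_elem n d \<otimes>\<^bsub>CPA n\<^esub> diag_elem n d' = diag_elem n (\<lambda>i. d i * d' i)"
  by (rule ext, clarify, unfold diag_mult) (simp add: diag_elem_def)

lemma one_eq_diag: "\<one>\<^bsub>CPA n\<^esub> = diag_elem n (\<lambda>_. 1)"
  by (auto simp: cpa_simps(2) diag_elem_def fun_eq_iff cyclic_quiver_def)

lemma power_series_at_const_diag: "power_series_at (cyclic_quiver n) (fps_const c) a = diag_elem n (\<lambda>_. c)"
  unfolding one_eq_diag by (auto simp: power_series_at_const diag_elem_def one_eq_diag fun_eq_iff)

lemma diag_x: "diag_elem n d \<otimes>\<^bsub>CPA n\<^esub> x_elem n = x_elem n \<otimes>\<^bsub>CPA n\<^esub> diag_elem n (\<lambda>i. d (Suc i mod n))"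
  by (rule ext, clarify, unfold diag_mult) (auto simp: x_elem_def diag_elem_def)

lemma diag_y: "diag_elem n (\<lambda>i. d (Suc i mod n)) \<otimes>\<^bsub>CPA n\<^esub> y_elem n = y_elem n \<otimes>\<^bsub>CPA n\<^esub> diag_elem n d"
  by (rule ext, clarify, unfold diag_mult) (auto simp: y_elem_def diag_elem_def)

lemma x_y_mult:
  "(x_elem n \<otimes>\<^bsub>CPA n\<^esub> b) (v, []) = 0" "(y_elem n \<otimes>\<^bsub>CPA n\<^esub> b) (v, []) = 0"
  "(x_elem n \<otimes>\<^bsub>CPA n\<^esub> b) (v, w @ [e]) = x_elem n (path_end (cyclic_quiver n) (v, w), [e]) * b (v, w)"
  "(y_elem n \<otimes>\<^bsub>CPA n\<^esub> b) (v, w @ [e]) = y_elem n (path_end (cyclic_quiver n) (v, w), [e]) * b (v, w)"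
  by (rule cpa_mult_arrows; simp add: x_y_elem_length)+

text \<open>Splitting off the last arrow of each path.\<close>

lemma cpa_decompose:
  assumes a: "a \<in> carrier (CPA n)"
  obtains b c where "b \<in> carrier (CPA n)" "c \<in> carrier (CPA n)"
    "a = diag_elem n (\<lambda>v. a (v, [])) \<oplus>\<^bsub>CPA n\<^esub> (x_elem n \<otimes>\<^bsub>CPA n\<^esub> b \<oplus>\<^bsub>CPA n\<^esub> y_elem n \<otimes>\<^bsub>CPA n\<^esub> c)"
proof -
  let ?e = "path_end (cyclic_quiver n)"
  define b :: cpa where "b = (\<lambda>(v, w). a (v, w @ [ArrX (?e (v, w) + 1)]))"
  \<comment> \<open>The arrow y out of a vertex v is \<open>ArrY v\<close>, except at vertex 0,
    where it is \<open>ArrY n\<close>; the arrow x out of v is always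
    \<open>ArrX (v + 1)\<close>.\<close>
  define c :: cpa where "c = (\<lambda>(v, w). a (v, w @ [ArrY (if ?e (v, w) = 0 then n else ?e (v, w))]))"
  have a0: "a p = 0" if "p \<notin> quiver_paths (cyclic_quiver n)" for p using a that unfolding cpa_carrier by blast
  have cbc: "b \<in> carrier (CPA n)" "c \<in> carrier (CPA n)"
    using a0 by (auto simp: cpa_carrier b_def c_def cyclic_path_snoc)
  have dec: "a (v, w) = (diag_elem n (\<lambda>v. a (v, [])) \<oplus>\<^bsub>CPA n\<^esub> (x_elem n \<otimes>\<^bsub>CPA n\<^esub> b \<oplus>\<^bsub>CPA n\<^esub> y_elem n \<otimes>\<^bsub>CPA n\<^esub> c)) (v, w)" for v w
  proof (cases w rule: rev_cases)
    case Nil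
    have "a (v, []) = diag_elem n (\<lambda>v. a (v, [])) (v, [])"
      using a0[of "(v, [])"] by (auto simp: diag_elem_def cyclic_quiver_def)
    then show ?thesis
      unfolding Nil cpa_simps(4) x_y_mult by simp
  next
    case (snoc w' e)
    have s: "(diag_elem n (\<lambda>v. a (v, [])) \<oplus>\<^bsub>CPA n\<^esub> (x_elem n \<otimes>\<^bsub>CPA n\<^esub> b \<oplus>\<^bsub>CPA n\<^esub> y_elem n \<otimes>\<^bsub>CPA n\<^esub> c)) (v, w' @ [e])
        = x_elem n (?e (v, w'), [e]) * b (v, w') + y_elem n (?e (v, w'), [e]) * c (v, w')"
      unfolding cpa_simps(4) x_y_mult
      by (simp add: diag_elem_Nil)
    show ?thesis
    proof (cases "(v, w' @ [e]) \<in> quiver_paths (cyclic_quiver n)")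
      case False
      have "x_elem n (?e (v, w'), [e]) * b (v, w') = 0"
      proof (cases "x_elem n (?e (v, w'), [e]) = 0")
        case nz: False
        then obtain i where "i \<in> {1..n}" "?e (v, w') = i - 1" "e = ArrX i" by (auto simp: x_elem_def split: if_splits)
        then have "a (v, w' @ [ArrX (?e (v, w') + 1)]) = 0" using a0[OF False] by simp
        then show ?thesis by (simp add: b_def)
      qed simp
      moreover have "y_elem n (?e (v, w'), [e]) * c (v, w') = 0"
      proof (cases "y_elem n (?e (v, w'), [e]) = 0")
        case nz: False
        then obtain i where i: "i \<in> {1..n}" "?e (v, w') = i mod n" "e = ArrY i" by (auto simp: y_elem_def split: if_splits)
        then have "(if ?e (v, w') = 0 then n else ?e (v, w')) = i" by (cases "i = n") auto
        then show ?thesis using a0[OF False] i(3) by (simp add: c_def)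
      qed simp
      ultimately show ?thesis unfolding snoc s a0[OF False] by (simp only: add_0_right)
    next
      case True
      then obtain i where i: "i \<in> {1..n}" "e = ArrX i \<and> ?e (v, w') = i - 1 \<or> e = ArrY i \<and> ?e (v, w') = i mod n"
        unfolding cyclic_path_snoc by blast
      have "x_elem n (?e (v, w'), [e]) * b (v, w') + y_elem n (?e (v, w'), [e]) * c (v, w') = a (v, w' @ [e])"
        using i(2)
      proof (elim disjE conjE)
        assume "e = ArrX i" "?e (v, w') = i - 1"
        then show ?thesis using i(1) by (simp add: x_elem_def y_elem_def b_def)
      next
        assume e: "e = ArrY i" "?e (v, w') = i mod n"
        then have "(if ?e (v, w') = 0 then n else ?e (v, w')) = i" using i(1) by (cases "i = n") auto
        then show ?thesis using i(1) e by (simp add: x_elem_def y_elem_def c_def)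
      qed
      then show ?thesis unfolding snoc s by simp
    qed
  qed
  have "a = diag_elem n (\<lambda>v. a (v, [])) \<oplus>\<^bsub>CPA n\<^esub> (x_elem n \<otimes>\<^bsub>CPA n\<^esub> b \<oplus>\<^bsub>CPA n\<^esub> y_elem n \<otimes>\<^bsub>CPA n\<^esub> c)"
  proof (rule ext)
    fix p :: "nat \<times> arrow list"
    obtain v w where p: "p = (v, w)" by (cases p)
    show "a p = (diag_elem n (\<lambda>v. a (v, [])) \<oplus>\<^bsub>CPA n\<^esub> (x_elem n \<otimes>\<^bsub>CPA n\<^esub> b \<oplus>\<^bsub>CPA n\<^esub> y_elem n \<otimes>\<^bsub>CPA n\<^esub> c)) p"
      unfolding p by (rule dec)
  qed
  with that show ?thesis using cbc by blast
qed

subsection \<open>The action of the path algebra on a module\<close>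

abbreviation "xy n \<equiv> x_elem n \<otimes>\<^bsub>CPA n\<^esub> y_elem n"

lemma xy_closed: "xy n \<in> carrier (CPA n)"
  by (intro cpath_mult_closed wf_cyclic_quiver x_y_vertex_in_CPA)

lemma fps_split: "f = fps_const (fps_nth f 0) + fps_X * fps_shift 1 (f :: complex fps)"
  by (auto simp: fps_eq_iff)

locale B_mod = left_module "B k n" M for k n and M :: "'m B_module" (structure) +
  assumes k: "0 < k" "k < n"
begin

definition act :: "cpa \<Rightarrow> 'm \<Rightarrow> 'm" where
  "act a m = B_class k n a \<odot>\<^bsub>M\<^esub> m"

abbreviation "C \<equiv> carrier M"
abbreviation madd (infixl "\<boxplus>" 65) where "x \<boxplus> y \<equiv> x \<oplus>\<^bsub>M\<^esub> y"
abbreviation "X \<equiv> act (x_elem n)"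
abbreviation "Y \<equiv> act (y_elem n)"
abbreviation "E i \<equiv> act (vertex_idem i)"
abbreviation "D d \<equiv> act (diag_elem n d)"
abbreviation "T \<equiv> act (xy n)"
abbreviation "Z f \<equiv> act (power_series_at (cyclic_quiver n) f (xy n))"

lemma class_hom: "B_class k n \<in> ring_hom (CPA n) (B k n)"
  unfolding B_def B_class_def by (rule ideal.rcos_ring_hom[OF B_ideal_ideal])

lemma ring_CPA: "ring (CPA n)"
  by (rule ring_cpath_algebra[OF wf_cyclic_quiver])

lemma act_closed [simp]: "a \<in> carrier (CPA n) \<Longrightarrow> m \<in> C \<Longrightarrow> act a m \<in> C"
  unfolding act_def by (intro smult_closed ring_hom_closed[OF class_hom])

lemma act_add: "a \<in> carrier (CPA n) \<Longrightarrow> b \<in> carrier (CPA n) \<Longrightarrow> m \<in> C \<Longrightarrow>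
    act (a \<oplus>\<^bsub>CPA n\<^esub> b) m = act a m \<boxplus> act b m"
  unfolding act_def ring_hom_add[OF class_hom] by (intro smult_l_distr ring_hom_closed[OF class_hom])

lemma act_add_right: "a \<in> carrier (CPA n) \<Longrightarrow> m \<in> C \<Longrightarrow> m' \<in> C \<Longrightarrow> act a (m \<boxplus> m') = act a m \<boxplus> act a m'"
  unfolding act_def by (intro smult_r_distr ring_hom_closed[OF class_hom])

lemma act_mult: "a \<in> carrier (CPA n) \<Longrightarrow> b \<in> carrier (CPA n) \<Longrightarrow> m \<in> C \<Longrightarrow>
    act (a \<otimes>\<^bsub>CPA n\<^esub> b) m = act a (act b m)"
  unfolding act_def ring_hom_mult[OF class_hom] by (intro smult_assoc ring_hom_closed[OF class_hom])

lemma act_one: "m \<in> C \<Longrightarrow> act \<one>\<^bsub>CPA n\<^esub> m = m"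
  unfolding act_def ring_hom_one[OF class_hom] by (rule smult_one)

lemma act_zero_right [simp]: "a \<in> carrier (CPA n) \<Longrightarrow> act a \<zero>\<^bsub>M\<^esub> = \<zero>\<^bsub>M\<^esub>"
proof -
  assume a: "a \<in> carrier (CPA n)"
  have "act a \<zero>\<^bsub>M\<^esub> \<boxplus> act a \<zero>\<^bsub>M\<^esub> = act a \<zero>\<^bsub>M\<^esub>"
    using act_add_right[OF a, of "\<zero>\<^bsub>M\<^esub>" "\<zero>\<^bsub>M\<^esub>"] by simp
  then show ?thesis using a M.add.l_cancel_one[of "act a \<zero>\<^bsub>M\<^esub>" "act a \<zero>\<^bsub>M\<^esub>"] by simp
qed

lemma act_ideal: "a \<in> B_ideal k n \<Longrightarrow> m \<in> C \<Longrightarrow> act a m = \<zero>\<^bsub>M\<^esub>"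
proof -
  assume a: "a \<in> B_ideal k n" and m: "m \<in> C"
  interpret I: ideal "B_ideal k n" "CPA n" by (rule B_ideal_ideal)
  have ca: "a \<in> carrier (CPA n)" using a by (rule I.a_Hcarr)
  have "B_class k n a = B_class k n \<zero>\<^bsub>CPA n\<^esub>"
    unfolding B_class_def by (metis I.a_coset_join2 I.zero_closed a additive_subgroup.zero_closed I.additive_subgroup_axioms ca I.a_subgroup)
  then have "act a m = act \<zero>\<^bsub>CPA n\<^esub> m" unfolding act_def by simp
  moreover have "act \<zero>\<^bsub>CPA n\<^esub> m \<boxplus> act \<zero>\<^bsub>CPA n\<^esub> m = act \<zero>\<^bsub>CPA n\<^esub> m"
    using act_add[of "\<zero>\<^bsub>CPA n\<^esub>" "\<zero>\<^bsub>CPA n\<^esub>" m] m by simp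
  then have "act \<zero>\<^bsub>CPA n\<^esub> m = \<zero>\<^bsub>M\<^esub>"
    using m M.add.l_cancel_one[of "act \<zero>\<^bsub>CPA n\<^esub> m" "act \<zero>\<^bsub>CPA n\<^esub> m"] by simp
  ultimately show ?thesis by simp
qed

lemma D_zero: "m \<in> C \<Longrightarrow> D (\<lambda>_. 0) m = \<zero>\<^bsub>M\<^esub>"
proof -
  have "diag_elem n (\<lambda>i. 0) = \<zero>\<^bsub>CPA n\<^esub>"
    by (simp add: diag_elem_def cpa_simps(3) fun_eq_iff)
  then have "diag_elem n (\<lambda>i. 0) \<in> B_ideal k n"
    using additive_subgroup.zero_closed[OF ideal.axioms(1)[OF B_ideal_ideal]] by simp
  then show "m \<in> C \<Longrightarrow> ?thesis" by (rule act_ideal)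
qed

lemmas closed [simp] = x_y_vertex_in_CPA(2,3) diag_elem_closed xy_closed
  power_series_at_closed[OF wf_cyclic_quiver xy_closed]

lemma vertex_closed [simp]: "i < n \<Longrightarrow> vertex_idem i \<in> carrier (CPA n)"
  by (rule x_y_vertex_in_CPA)

text \<open>The vertex idempotents add up to 1; their partial sums are diagonal elements.\<close>

lemma eq_zero_of_E:
  assumes m: "m \<in> C" and E: "\<And>i. i < n \<Longrightarrow> E i m = \<zero>\<^bsub>M\<^esub>"
  shows "m = \<zero>\<^bsub>M\<^esub>"
proof -
  have "D (\<lambda>i. if i < j then 1 else 0) m = \<zero>\<^bsub>M\<^esub>" if "j \<le> n" for j
    using that
  proof (induction j)
    case 0
    show ?case using D_zero[OF m] by simp
  next
    case (Suc j)
    have "diag_elem n (\<lambda>i. if i < Suc j then 1 else 0) = diag_elem n (\<lambda>i. if i < j then 1 else 0) \<oplus>\<^bsub>CPA n\<^esub> vertex_idem j"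
      using Suc by (auto simp: diag_elem_def vertex_idem_def cpa_simps fun_eq_iff)
    then show ?case using Suc m E[of j] by (simp add: act_add)
  qed
  from this[of n] have "D (\<lambda>_. 1) m = \<zero>\<^bsub>M\<^esub>"
    by (simp add: diag_elem_def cong: conj_cong if_cong)
  then show ?thesis using act_one[OF m] by (simp add: one_eq_diag)
qed

text \<open>The relations come one per vertex, each cut down by an idempotent. Jointly over all
  vertices they make the two actions equal.\<close>

lemma act_relation:
  assumes r: "\<And>i. i < n \<Longrightarrow> vertex_idem i \<otimes>\<^bsub>CPA n\<^esub> (a \<ominus>\<^bsub>CPA n\<^esub> b) \<in> B_relations k n"
    and a: "a \<in> carrier (CPA n)" "b \<in> carrier (CPA n)" and m: "m \<in> C"
  shows "act a m = act b m"
proof -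
  interpret R: ring "CPA n" by (rule ring_CPA)
  have "B_relations k n \<subseteq> carrier (CPA n)"
    unfolding B_relations_def by (auto intro!: R.m_closed R.minus_closed R.nat_pow_closed x_y_vertex_in_CPA)
  then have sub: "B_relations k n \<subseteq> B_ideal k n"
    using R.genideal_self[of "B_relations k n"] unfolding B_ideal_def adic_closure_def by blast
  have c: "a \<ominus>\<^bsub>CPA n\<^esub> b \<in> carrier (CPA n)" using a by simp
  have "act (a \<ominus>\<^bsub>CPA n\<^esub> b) m = \<zero>\<^bsub>M\<^esub>"
  proof (rule eq_zero_of_E)
    fix i assume i: "i < n"
    have "act (vertex_idem i \<otimes>\<^bsub>CPA n\<^esub> (a \<ominus>\<^bsub>CPA n\<^esub> b)) m = \<zero>\<^bsub>M\<^esub>"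
      using act_ideal r[OF i] sub m by blast
    then show "E i (act (a \<ominus>\<^bsub>CPA n\<^esub> b) m) = \<zero>\<^bsub>M\<^esub>" using act_mult[OF _ c m] i by simp
  qed (use c m in simp)
  moreover have "(a \<ominus>\<^bsub>CPA n\<^esub> b) \<oplus>\<^bsub>CPA n\<^esub> b = a"
    by (auto simp: cpa_simps cpa_minus[OF wf_cyclic_quiver a] fun_eq_iff)
  ultimately show ?thesis using act_add[OF c a(2) m] a m by simp
qed

lemma X_Y: "m \<in> C \<Longrightarrow> X (Y m) = T m" "m \<in> C \<Longrightarrow> Y (X m) = T m"
proof -
  assume m: "m \<in> C"
  have yx: "y_elem n \<otimes>\<^bsub>CPA n\<^esub> x_elem n \<in> carrier (CPA n)"
    by (intro cpath_mult_closed wf_cyclic_quiver x_y_vertex_in_CPA)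
  have "T m = act (y_elem n \<otimes>\<^bsub>CPA n\<^esub> x_elem n) m"
    by (rule act_relation[OF _ xy_closed yx m]) (auto simp: B_relations_def)
  then show "X (Y m) = T m" "Y (X m) = T m" using m by (simp_all add: act_mult)
qed

lemma act_pow: "a \<in> carrier (CPA n) \<Longrightarrow> m \<in> C \<Longrightarrow> act (a [^]\<^bsub>CPA n\<^esub> (j::nat)) m = (act a ^^ j) m"
proof (induction j arbitrary: m)
  case 0
  then show ?case by (simp add: act_one)
next
  case (Suc j)
  interpret R: ring "CPA n" by (rule ring_CPA)
  have "act (a [^]\<^bsub>CPA n\<^esub> Suc j) m = act (a [^]\<^bsub>CPA n\<^esub> j) (act a m)"
    using Suc.prems by (simp add: act_mult)
  then show ?case using Suc by (simp add: funpow_swap1)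
qed

lemma X_pow_eq_Y_pow: "m \<in> C \<Longrightarrow> (X ^^ k) m = (Y ^^ (n - k)) m"
proof -
  assume m: "m \<in> C"
  interpret R: ring "CPA n" by (rule ring_CPA)
  have "act (x_elem n [^]\<^bsub>CPA n\<^esub> k) m = act (y_elem n [^]\<^bsub>CPA n\<^esub> (n - k)) m"
    by (rule act_relation[OF _ _ _ m]) (auto simp: B_relations_def)
  then show ?thesis using m by (simp add: act_pow)
qed

lemma pow_closed [simp]: "a \<in> carrier (CPA n) \<Longrightarrow> m \<in> C \<Longrightarrow> (act a ^^ j) m \<in> C"
  by (induction j) auto

definition additive :: "('m \<Rightarrow> 'm) \<Rightarrow> bool" where
  "additive h \<longleftrightarrow> (\<forall>m\<in>C. h m \<in> C) \<and> (\<forall>m\<in>C. \<forall>m'\<in>C. h (m \<boxplus> m') = h m \<boxplus> h m')"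

lemma additive_act: "a \<in> carrier (CPA n) \<Longrightarrow> additive (act a)"
  by (simp add: additive_def act_add_right)

lemma pow_commute:
  assumes "additive g" "\<And>m. m \<in> C \<Longrightarrow> h (g m) = g (h m)" "m \<in> C"
  shows "h ((g ^^ j) m) = (g ^^ j) (h m)"
proof -
  have "(g ^^ j) m \<in> C \<and> h ((g ^^ j) m) = (g ^^ j) (h m)"
    using assms by (induction j) (auto simp: additive_def)
  then show ?thesis by blast
qed

text \<open>y^n = y^k y^(n-k) = y^k x^k = t^k. This is the source of the factor t^3 in the period of
  the chain, and also of the injectivity of y.\<close>

lemma Y_pow_n: "m \<in> C \<Longrightarrow> (Y ^^ n) m = (T ^^ k) m"
proof -
  have "m \<in> C \<Longrightarrow> (Y ^^ j) ((X ^^ j) m) = (T ^^ j) m" for j m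
  proof (induction j)
    case (Suc j)
    have "(Y ^^ Suc j) ((X ^^ Suc j) m) = Y ((Y ^^ j) (X ((X ^^ j) m)))" by simp
    also have "\<dots> = Y (X ((Y ^^ j) ((X ^^ j) m)))"
      using Suc.prems by (subst pow_commute[of Y X, OF additive_act]) (simp_all add: X_Y)
    finally show ?case using Suc by (simp add: X_Y)
  qed simp
  note YX = this
  assume m: "m \<in> C"
  have "(Y ^^ n) m = (Y ^^ k) ((Y ^^ (n - k)) m)"
    using k by (simp flip: comp_apply[of "Y ^^ k"] funpow_add)
  also have "\<dots> = (T ^^ k) m" unfolding X_pow_eq_Y_pow[OF m, symmetric] by (rule YX[OF m])
  finally show ?thesis .
qed

lemma T_commute:
  "m \<in> C \<Longrightarrow> T (X m) = X (T m)" "m \<in> C \<Longrightarrow> T (Y m) = Y (T m)"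
  by (simp_all add: X_Y(2) flip: X_Y(1))

lemma D_X: "m \<in> C \<Longrightarrow> D d (X m) = X (D (\<lambda>i. d (Suc i mod n)) m)"
  using arg_cong[OF diag_x[of n d], of "\<lambda>a. act a m"] by (simp add: act_mult)

lemma D_Y: "m \<in> C \<Longrightarrow> D (\<lambda>i. d (Suc i mod n)) (Y m) = Y (D d m)"
  using arg_cong[OF diag_y[of n d], of "\<lambda>a. act a m"] by (simp add: act_mult)

lemma D_T: "m \<in> C \<Longrightarrow> D d (T m) = T (D d m)"
proof -
  assume m: "m \<in> C"
  \<comment> \<open>Shifting by n - 1 inverts the successor modulo n. So d becomes a function of the
    successor, which is the form that \<open>D_X\<close> and \<open>D_Y\<close> ask for.\<close>
  have "diag_elem n (\<lambda>i. d ((Suc i + (n - 1)) mod n)) = diag_elem n d"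
    using k by (auto simp: diag_elem_def fun_eq_iff)
  moreover have "(\<lambda>i. d ((Suc i + (n - 1)) mod n)) = (\<lambda>i. (\<lambda>i. d ((i + (n - 1)) mod n)) (Suc i mod n))"
    by (simp add: mod_simps)
  ultimately have "D d = D (\<lambda>i. (\<lambda>i. d ((i + (n - 1)) mod n)) (Suc i mod n))" by simp
  note d = this
  have "D d (T m) = D d (Y (X m))" using m by (simp only: X_Y)
  also have "\<dots> = Y (D (\<lambda>i. d ((i + (n - 1)) mod n)) (X m))"
    unfolding d by (rule D_Y) (simp add: m)
  also have "D (\<lambda>i. d ((i + (n - 1)) mod n)) (X m) = X (D d m)"
    unfolding d by (rule D_X[OF m])
  finally show ?thesis using m by (simp add: X_Y)
qed

lemma E_eq_D: "i < n \<Longrightarrow> E i = D (\<lambda>v. if v = i then 1 else 0)"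
  by (simp add: vertex_idem_eq)

lemma D_cong: "(\<And>i. i < n \<Longrightarrow> d i = d' i) \<Longrightarrow> D d = D d'"
  by (rule arg_cong[of _ _ act]) (auto simp: diag_elem_def fun_eq_iff)

lemma Suc_mod_inj: "i < n \<Longrightarrow> j < n \<Longrightarrow> Suc i mod n = Suc j mod n \<longleftrightarrow> i = j"
  by (cases "Suc i = n"; cases "Suc j = n") auto

lemma E_Y: "i < n \<Longrightarrow> m \<in> C \<Longrightarrow> E i (Y m) = Y (E (Suc i mod n) m)"
  using D_Y[of m "\<lambda>v. if v = Suc i mod n then 1 else 0"]
    D_cong[of "\<lambda>j. if Suc j mod n = Suc i mod n then 1 else 0" "\<lambda>v. if v = i then 1 else 0"]
  by (simp add: E_eq_D Suc_mod_inj)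

lemma E_T: "i < n \<Longrightarrow> m \<in> C \<Longrightarrow> E i (T m) = T (E i m)"
  by (simp add: E_eq_D D_T)

lemma D_D: "m \<in> C \<Longrightarrow> D d (D d' m) = D (\<lambda>i. d i * d' i) m"
  by (simp add: diag_mult_diag flip: act_mult)

lemma E_D: "i < n \<Longrightarrow> m \<in> C \<Longrightarrow> E i (D d m) = D (\<lambda>_. d i) (E i m)"
  by (simp add: E_eq_D D_D) (intro fun_cong[OF D_cong], simp)

lemma E_E: "i < n \<Longrightarrow> j < n \<Longrightarrow> m \<in> C \<Longrightarrow> E i (E j m) = (if i = j then E i m else \<zero>\<^bsub>M\<^esub>)"
proof -
  assume a: "i < n" "j < n" "m \<in> C"
  have "E i (E j m) = D (\<lambda>v. (if v = i then 1 else 0) * (if v = j then 1 else 0)) m"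
    using a by (simp add: E_eq_D D_D)
  also have "\<dots> = (if i = j then D (\<lambda>v. if v = i then 1 else 0) m else D (\<lambda>_. 0) m)"
    by (auto intro!: fun_cong[OF D_cong])
  finally show ?thesis using a by (simp add: E_eq_D D_zero)
qed

lemma Z_const: "Z (fps_const c) = D (\<lambda>_. c)"
  by (simp add: power_series_at_const_diag)

lemma Z_add: "m \<in> C \<Longrightarrow> Z (f + g) m = Z f m \<boxplus> Z g m"
  by (simp add: power_series_at_add act_add)

lemma Z_const_mult: "m \<in> C \<Longrightarrow> Z (fps_const c * f) m = D (\<lambda>_. c) (Z f m)"
  by (simp add: power_series_at_const_mult[OF wf_cyclic_quiver] act_mult power_series_at_const_diag)

lemma Z_X_mult: "m \<in> C \<Longrightarrow> Z (fps_X * f) m = T (Z f m)"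
proof -
  have "xy n (v, []) = 0" for v by (rule x_y_mult)
  then show "m \<in> C \<Longrightarrow> ?thesis"
    by (simp add: power_series_at_X_mult[OF wf_cyclic_quiver xy_closed] act_mult)
qed

text \<open>Nothing is known about continuity of the action. Splitting off the constant term is the
  only access to the action of a power series, and it determines that action wherever coefficients
  can be compared.\<close>

lemma Z_split: "m \<in> C \<Longrightarrow> Z f m = D (\<lambda>_. fps_nth f 0) m \<boxplus> T (Z (fps_shift 1 f) m)"
  using Z_add[of m "fps_const (fps_nth f 0)" "fps_X * fps_shift 1 f"] fps_split[of f]
  by (simp add: Z_const Z_X_mult)

end

subsection \<open>Modules of rank one\<close>

locale L_mod =
  fixes k n :: nat and I :: "nat set"
  assumes k: "0 < k" "k < n" and I: "I \<subseteq> {1..n}" "card I = k"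
begin

abbreviation "\<L> \<equiv> L_action n I"
abbreviation "pend \<equiv> path_end (cyclic_quiver n)"
abbreviation "wt \<equiv> path_weight I"
abbreviation "paths \<equiv> quiver_paths (cyclic_quiver n)"

lemma path_weight_append: "wt (v, w @ w') = wt (v, w) + wt (v', w')"
  by (simp add: path_weight_def)

text \<open>The term k v balances the k elements of I, so the values at 0 and at n agree and the
  potential is a function on the cycle.\<close>

definition pot :: "nat \<Rightarrow> int" where
  "pot v = int n * int (card (I \<inter> {1..v})) - int k * int v"

lemma pot_step: "i \<in> {1..n} \<Longrightarrow> pot (i mod n) = pot (i - 1) + (if i \<in> I then int n else 0) - int k"
proof -
  assume i: "i \<in> {1..n}"
  have "pot n = pot 0" using I by (simp add: pot_def Int_absorb2)
  then have 1: "pot (i mod n) = pot i" using i by (cases "i = n") auto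
  have "{1..i} = insert i {1..i - 1}" using i by auto
  then have "I \<inter> {1..i} = (if i \<in> I then insert i (I \<inter> {1..i - 1}) else I \<inter> {1..i - 1})"
    by (simp only: Int_insert_right)
  moreover have "i \<notin> I \<inter> {1..i - 1}" using i by auto
  ultimately have c: "card (I \<inter> {1..i}) = (if i \<in> I then Suc (card (I \<inter> {1..i - 1})) else card (I \<inter> {1..i - 1}))"
    by simp
  obtain m where m: "i = Suc m" using i by (cases i) auto
  show ?thesis unfolding 1 unfolding pot_def c unfolding m by (simp add: algebra_simps)
qed

text \<open>
  Along an arrow the potential drops by \<open>n\<close> times the weight minus \<open>n - k\<close> or \<open>k\<close>, so a path of bounded
  weight has bounded length.
\<close>

lemma path_length_le:
  "(v, w) \<in> paths \<Longrightarrow> int (length w) \<le> int n * int (wt (v, w)) + pot (pend (v, w)) - pot v"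
proof (induction w rule: rev_induct)
  case Nil
  then show ?case by (simp add: path_weight_def)
next
  case (snoc e w)
  then obtain i where i: "i \<in> {1..n}" "e = ArrX i \<and> pend (v, w) = i - 1 \<or> e = ArrY i \<and> pend (v, w) = i mod n"
    unfolding cyclic_path_snoc by blast
  have IH: "int (length w) \<le> int n * int (wt (v, w)) + pot (pend (v, w)) - pot v"
    using snoc unfolding cyclic_path_snoc by blast
  have "1 \<le> int n * int (wt (v, [e])) + pot (pend (v, w @ [e])) - pot (pend (v, w))"
    using i(2) pot_step[OF i(1)] k by (auto simp: path_weight_def)
  then show ?case using IH by (simp add: path_weight_append[of v w "[e]" v] algebra_simps)
qed

lemma pot_bounds: "v \<le> n \<Longrightarrow> \<bar>pot v\<bar> \<le> int (n * n)"
proof -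
  assume v: "v \<le> n"
  have "card (I \<inter> {1..v}) \<le> n" using card_mono[of "{1..v}" "I \<inter> {1..v}"] v by simp
  then have "n * card (I \<inter> {1..v}) \<le> n * n" "k * v \<le> n * n" using v k by (simp_all add: mult_le_mono)
  then have "int (n * card (I \<inter> {1..v})) \<le> int (n * n)" "int (k * v) \<le> int (n * n)" by (simp_all only: of_nat_le_iff)
  moreover have "0 \<le> int (n * card (I \<inter> {1..v}))" "0 \<le> int (k * v)" by simp_all
  ultimately show ?thesis unfolding pot_def of_nat_mult abs_le_iff by linarith
qed

definition S :: "nat \<Rightarrow> nat \<Rightarrow> (nat \<times> arrow list) set" where
  "S j l = {p \<in> paths. pend p = j \<and> wt p \<le> l}"

lemma path_facts:
  assumes "(v, w) \<in> paths"
  shows "v < n" "pend (v, w) < n" "set w \<subseteq> ArrX ` {1..n} \<union> ArrY ` {1..n}"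
proof -
  show "pend (v, w) < n" by (rule cyclic_path_end_less[OF assms])
  have "(v, [] @ w) \<in> paths" using assms by simp
  then show "v < n" unfolding quiver_paths_append[OF wf_cyclic_quiver] by (simp add: cyclic_quiver_def)
  show "set w \<subseteq> ArrX ` {1..n} \<union> ArrY ` {1..n}"
    using assms by (auto simp: quiver_paths_def pre_digraph.awalk_def cyclic_quiver_def)
qed

lemma S_length: "p \<in> S j l \<Longrightarrow> length (snd p) \<le> n * l + 2 * (n * n)"
proof -
  assume p: "p \<in> S j l"
  obtain v w where vw: "p = (v, w)" by (cases p)
  have path: "(v, w) \<in> paths" and wl: "wt (v, w) \<le> l" using p by (auto simp: S_def vw)
  have "n * wt (v, w) \<le> n * l" using wl by simp
  then have "int (n * wt (v, w)) \<le> int (n * l)" by (simp only: of_nat_le_iff)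
  then have "int (length w) \<le> int (n * l + 2 * (n * n))"
  proof -
    have "\<bar>pot v\<bar> \<le> int (n * n)" "\<bar>pot (pend (v, w))\<bar> \<le> int (n * n)"
      using path_facts[OF path] by (simp_all only: pot_bounds less_imp_le)
    then show ?thesis
      using path_length_le[OF path] \<open>int (n * wt (v, w)) \<le> int (n * l)\<close>
      unfolding of_nat_mult of_nat_add by linarith
  qed
  then show ?thesis by (simp only: vw snd_conv of_nat_le_iff)
qed

lemma finite_S: "finite (S j l)"
proof (rule finite_subset)
  let ?A = "ArrX ` {1..n} \<union> ArrY ` {1..n}"
  show "S j l \<subseteq> {..<n} \<times> {w. set w \<subseteq> ?A \<and> length w \<le> n * l + 2 * (n * n)}"
    using S_length path_facts by (fastforce simp: S_def)
  show "finite ({..<n} \<times> {w. set w \<subseteq> ?A \<and> length w \<le> n * l + 2 * (n * n)})"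
    by (intro finite_cartesian_product finite_lists_length_le) auto
qed

lemma L_action_nth: "fps_nth (\<L> a u j) l = (\<Sum>p\<in>S j l. a p * fps_nth (u (fst p)) (l - wt p))"
  by (simp add: L_action_def S_def)

lemma L_add: "\<L> (a \<oplus>\<^bsub>CPA n\<^esub> b) u j = \<L> a u j + \<L> b u j"
  by (simp add: fps_eq_iff L_action_nth cpa_simps algebra_simps sum.distrib)

lemma L_minus: "a \<in> carrier (CPA n) \<Longrightarrow> b \<in> carrier (CPA n) \<Longrightarrow> \<L> (a \<ominus>\<^bsub>CPA n\<^esub> b) u j = \<L> a u j - \<L> b u j"
  by (simp add: fps_eq_iff L_action_nth cpa_minus[OF wf_cyclic_quiver] algebra_simps sum_subtractf)

lemma L_zero: "\<L> a (\<lambda>_. 0) = (\<lambda>_. 0)"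
  by (simp add: fun_eq_iff fps_eq_iff L_action_nth)

lemma L_outside: "n \<le> j \<Longrightarrow> \<L> a u j = 0"
proof -
  assume "n \<le> j"
  then have "S j l = {}" for l using cyclic_path_end_less unfolding S_def by fastforce
  then show ?thesis by (simp add: fps_eq_iff L_action_nth)
qed

text \<open>Both sides are sums over a path with a cutting point: cutting is a bijection onto pairs
  of composable paths, and weights are additive.\<close>

lemma L_mult: "\<L> (a \<otimes>\<^bsub>CPA n\<^esub> b) u = \<L> a (\<L> b u)"
proof (rule ext, rule fps_ext)
  fix j l
  let ?F = "\<lambda>q p. a q * (b p * fps_nth (u (fst p)) (l - wt q - wt p))"
  have "fps_nth (\<L> (a \<otimes>\<^bsub>CPA n\<^esub> b) u j) l
      = (\<Sum>p\<in>S j l. \<Sum>i\<le>length (snd p). a (pend (fst p, take i (snd p)), drop i (snd p)) * b (fst p, take i (snd p))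
          * fps_nth (u (fst p)) (l - wt p))"
    unfolding L_action_nth by (rule sum.cong) (auto simp: cpa_simps sum_distrib_right)
  also have "\<dots> = (\<Sum>(p, i)\<in>(SIGMA p:S j l. {..length (snd p)}).
      a (pend (fst p, take i (snd p)), drop i (snd p)) * b (fst p, take i (snd p)) * fps_nth (u (fst p)) (l - wt p))"
    by (rule sum.Sigma) (auto simp: finite_S)
  also have "\<dots> = (\<Sum>(q, p)\<in>(SIGMA q:S j l. S (fst q) (l - wt q)). ?F q p)"
  proof (rule sum.reindex_bij_witness[where i = "\<lambda>(q, p). ((fst p, snd p @ snd q), length (snd p))"
        and j = "\<lambda>(p, i). ((pend (fst p, take i (snd p)), drop i (snd p)), (fst p, take i (snd p)))"])
    fix z assume z: "z \<in> (SIGMA p:S j l. {..length (snd p)})"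
    obtain v w i where vw: "z = ((v, w), i)" by (metis surj_pair)
    let ?e = "pend (v, take i w)"
    have i: "i \<le> length w" and p: "(v, take i w @ drop i w) \<in> paths" "pend (v, take i w @ drop i w) = j"
      "wt (v, take i w @ drop i w) \<le> l" using z by (auto simp: vw S_def)
    have q: "(v, take i w) \<in> paths" "(?e, drop i w) \<in> paths" using p(1) unfolding quiver_paths_append[OF wf_cyclic_quiver] by auto
    have e: "pend (?e, drop i w) = j" using p(2) unfolding path_end_append .
    have wt: "wt (v, w) = wt (v, take i w) + wt (?e, drop i w)" using path_weight_append[of v "take i w" "drop i w" ?e] by simp
    show "(\<lambda>(q, p). ((fst p, snd p @ snd q), length (snd p))) ((\<lambda>(p, i). ((pend (fst p, take i (snd p)), drop i (snd p)), (fst p, take i (snd p)))) z) = z"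
      using i by (simp add: vw)
    show "(\<lambda>(p, i). ((pend (fst p, take i (snd p)), drop i (snd p)), (fst p, take i (snd p)))) z \<in> (SIGMA q:S j l. S (fst q) (l - wt q))"
      using q e wt p(3) by (simp add: vw S_def)
    show "(case (\<lambda>(p, i). ((pend (fst p, take i (snd p)), drop i (snd p)), (fst p, take i (snd p)))) z of (q, p) \<Rightarrow> ?F q p)
        = (case z of (p, i) \<Rightarrow> a (pend (fst p, take i (snd p)), drop i (snd p)) * b (fst p, take i (snd p)) * fps_nth (u (fst p)) (l - wt p))"
      by (simp add: vw wt diff_diff_add add.commute)
  next
    fix z assume z: "z \<in> (SIGMA q:S j l. S (fst q) (l - wt q))"
    obtain v w v' w' where vw: "z = ((v', w'), (v, w))" by (metis surj_pair)
    have p: "(v', w') \<in> paths" "pend (v', w') = j" "wt (v', w') \<le> l" "(v, w) \<in> paths" "pend (v, w) = v'"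
      "wt (v, w) \<le> l - wt (v', w')" using z by (auto simp: vw S_def)
    show "(\<lambda>(p, i). ((pend (fst p, take i (snd p)), drop i (snd p)), (fst p, take i (snd p)))) ((\<lambda>(q, p). ((fst p, snd p @ snd q), length (snd p))) z) = z"
      using p by (simp add: vw)
    have "(v, w @ w') \<in> paths" "pend (v, w @ w') = j" "wt (v, w @ w') \<le> l"
      using p by (simp_all add: quiver_paths_append[OF wf_cyclic_quiver] path_end_append path_weight_append[of v w w' v'])
    then show "(\<lambda>(q, p). ((fst p, snd p @ snd q), length (snd p))) z \<in> (SIGMA p:S j l. {..length (snd p)})"
      by (simp add: vw S_def)
  qed
  also have "\<dots> = (\<Sum>q\<in>S j l. \<Sum>p\<in>S (fst q) (l - wt q). ?F q p)"
    by (rule sum.Sigma[symmetric]) (auto simp: finite_S)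
  also have "\<dots> = fps_nth (\<L> a (\<L> b u) j) l"
    unfolding L_action_nth by (simp add: sum_distrib_left)
  finally show "fps_nth (\<L> (a \<otimes>\<^bsub>CPA n\<^esub> b) u j) l = fps_nth (\<L> a (\<L> b u) j) l" .
qed

lemma L_single:
  assumes p0: "p0 \<in> paths" "pend p0 = j" and z: "\<And>p. p \<in> paths \<Longrightarrow> pend p = j \<Longrightarrow> p \<noteq> p0 \<Longrightarrow> a p = 0"
  shows "\<L> a u j = fps_const (a p0) * (fps_X ^ wt p0 * u (fst p0))"
proof (rule fps_ext)
  fix l
  have "fps_nth (\<L> a u j) l = (\<Sum>p\<in>S j l. if p = p0 then a p0 * fps_nth (u (fst p0)) (l - wt p0) else 0)"
    unfolding L_action_nth using z by (intro sum.cong) (auto simp: S_def)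
  also have "\<dots> = (if wt p0 \<le> l then a p0 * fps_nth (u (fst p0)) (l - wt p0) else 0)"
    using p0 finite_S[of j l] by (simp add: S_def)
  also have "\<dots> = fps_nth (fps_const (a p0) * (fps_X ^ wt p0 * u (fst p0))) l"
    by (simp add: fps_X_power_mult_nth)
  finally show "fps_nth (\<L> a u j) l = fps_nth (fps_const (a p0) * (fps_X ^ wt p0 * u (fst p0))) l" .
qed

lemma L_x: "i \<in> {1..n} \<Longrightarrow> \<L> (x_elem n) u (i mod n) = (if i \<in> I then 1 else fps_X) * u (i - 1)"
proof -
  assume i: "i \<in> {1..n}"
  have "\<L> (x_elem n) u (i mod n) = fps_const (x_elem n (i - 1, [ArrX i])) * (fps_X ^ wt (i - 1, [ArrX i]) * u (fst (i - 1, [ArrX i])))"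
  proof (rule L_single)
    show "(i - 1, [ArrX i]) \<in> paths" using i by (auto simp: cyclic_path_single)
    fix p assume p: "pend p = i mod n" "p \<noteq> (i - 1, [ArrX i])"
    show "x_elem n p = 0"
    proof (rule ccontr)
      assume "x_elem n p \<noteq> 0"
      then obtain i' where i': "i' \<in> {1..n}" "p = (i' - 1, [ArrX i'])" by (auto simp: x_elem_def split: if_splits)
      then have "i' mod n = i mod n" using p by simp
      then have "i' = i" using i i'(1) by (cases "i = n"; cases "i' = n") auto
      then show False using p i' by simp
    qed
  qed simp
  then show ?thesis using i by (auto simp: path_weight_def x_elem_def)
qed

lemma L_y: "i \<in> {1..n} \<Longrightarrow> \<L> (y_elem n) u (i - 1) = (if i \<in> I then fps_X else 1) * u (i mod n)"
proof -
  assume i: "i \<in> {1..n}"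
  have "\<L> (y_elem n) u (i - 1) = fps_const (y_elem n (i mod n, [ArrY i])) * (fps_X ^ wt (i mod n, [ArrY i]) * u (fst (i mod n, [ArrY i])))"
  proof (rule L_single)
    show "(i mod n, [ArrY i]) \<in> paths" using i by (auto simp: cyclic_path_single)
    fix p assume p: "pend p = i - 1" "p \<noteq> (i mod n, [ArrY i])"
    show "y_elem n p = 0"
    proof (rule ccontr)
      assume "y_elem n p \<noteq> 0"
      then obtain i' where i': "i' \<in> {1..n}" "p = (i' mod n, [ArrY i'])" by (auto simp: y_elem_def split: if_splits)
      then have "i' = i" using p i by auto
      then show False using p i' by simp
    qed
  qed simp
  then show ?thesis using i by (auto simp: path_weight_def y_elem_def)
qed

lemma L_diag: "j < n \<Longrightarrow> \<L> (diag_elem n d) u j = fps_const (d j) * u j"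
proof -
  assume j: "j < n"
  have "\<L> (diag_elem n d) u j = fps_const (diag_elem n d (j, [])) * (fps_X ^ wt (j, []) * u (fst (j, [] :: arrow list)))"
  proof (rule L_single[of "(j, [])" j "diag_elem n d" u])
    show "(j, []) \<in> paths" using j by (simp add: cyclic_quiver_def)
    show "diag_elem n d p = 0" if "pend p = j" "p \<noteq> (j, [])" for p
      using that by (auto simp: diag_elem_def split: prod.splits)
  qed simp
  then show ?thesis using j by (simp add: diag_elem_def path_weight_def)
qed

lemma vertex_cases: "j < n \<Longrightarrow> \<exists>i\<in>{1..n}. j = i mod n" "j < n \<Longrightarrow> \<exists>i\<in>{1..n}. j = i - 1"
  by (cases "j = 0", rule bexI[of _ n], simp, use k in simp, rule bexI[of _ j], simp, simp)
     (rule bexI[of _ "Suc j"]; simp)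

lemma L_xy: "\<L> (x_elem n) (\<L> (y_elem n) u) j = (if j < n then fps_X * u j else 0)"
  "\<L> (y_elem n) (\<L> (x_elem n) u) j = (if j < n then fps_X * u j else 0)"
proof -
  show "\<L> (x_elem n) (\<L> (y_elem n) u) j = (if j < n then fps_X * u j else 0)"
  proof (cases "j < n")
    case True
    then obtain i where i: "i \<in> {1..n}" "j = i mod n" using vertex_cases by blast
    then show ?thesis using True L_x[OF i(1), of "\<L> (y_elem n) u"] L_y[OF i(1), of u] by auto
  qed (simp add: L_outside)
  show "\<L> (y_elem n) (\<L> (x_elem n) u) j = (if j < n then fps_X * u j else 0)"
  proof (cases "j < n")
    case True
    then obtain i where i: "i \<in> {1..n}" "j = i - 1" using vertex_cases by blast
    then show ?thesis using True L_y[OF i(1), of "\<L> (x_elem n) u"] L_x[OF i(1), of u] by auto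
  qed (simp add: L_outside)
qed

abbreviation "LX \<equiv> \<L> (x_elem n)"
abbreviation "LY \<equiv> \<L> (y_elem n)"

lemma L_smult: "\<L> a (\<lambda>j. fps_X * u j) = (\<lambda>j. fps_X * \<L> a u j)"
proof (rule ext, rule fps_ext)
  fix j l
  show "fps_nth (\<L> a (\<lambda>j. fps_X * u j) j) l = fps_nth (fps_X * \<L> a u j) l"
  proof (cases l)
    case 0
    then show ?thesis by (simp add: L_action_nth S_def)
  next
    case (Suc m)
    have "(\<Sum>p\<in>S j l. a p * fps_nth (fps_X * u (fst p)) (l - wt p))
        = (\<Sum>p\<in>S j m. a p * fps_nth (u (fst p)) (m - wt p))"
    proof (rule sum.mono_neutral_cong_right)
      show "S j m \<subseteq> S j l" by (auto simp: S_def Suc)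
      show "\<forall>p\<in>S j l - S j m. a p * fps_nth (fps_X * u (fst p)) (l - wt p) = 0"
        by (auto simp: S_def Suc)
      show "a p * fps_nth (fps_X * u (fst p)) (l - wt p) = a p * fps_nth (u (fst p)) (m - wt p)" if "p \<in> S j m" for p
        using that by (simp add: S_def Suc Suc_diff_le)
    qed (rule finite_S)
    then show ?thesis by (simp add: L_action_nth Suc)
  qed
qed

lemma LX_pow: "v + m \<le> n \<Longrightarrow> v < n \<Longrightarrow> (LX ^^ m) u ((v + m) mod n) = (\<Prod>i\<in>{v + 1..v + m}. if i \<in> I then 1 else fps_X) * u v"
proof (induction m)
  case (Suc m)
  have "(LX ^^ Suc m) u ((v + Suc m) mod n) = (if v + Suc m \<in> I then 1 else fps_X) * (LX ^^ m) u (v + m)"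
    using L_x[of "v + Suc m" "(LX ^^ m) u"] Suc by simp
  moreover have "(v + m) mod n = v + m" using Suc by simp
  ultimately show ?case using Suc by (simp add: mult.assoc atLeastAtMostSuc_conv)
qed simp

text \<open>Once around the cycle, x multiplies by t for each of the n - k indices outside I. A
  start at v is transported to vertex 0, and the nonzero factor of the transport is
  cancelled.\<close>

lemma LX_pow_n: "v < n \<Longrightarrow> (LX ^^ n) u v = fps_X ^ (n - k) * u v"
proof -
  have 0: "(LX ^^ n) u 0 = fps_X ^ (n - k) * u 0" for u
  proof -
    have "(\<Prod>i\<in>{1..n}. if i \<in> I then 1 else fps_X :: complex fps) = (\<Prod>i\<in>{1..n} - I. fps_X)"
      by (rule prod.mono_neutral_cong_right) auto
    also have "\<dots> = fps_X ^ (n - k)" using I by (simp add: card_Diff_subset finite_subset[of I "{1..n}"])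
    finally show ?thesis using LX_pow[of 0 n u] k by simp
  qed
  assume v: "v < n"
  let ?c = "\<Prod>i\<in>{v + 1..n}. if i \<in> I then 1 else fps_X :: complex fps"
  have c: "(LX ^^ (n - v)) w 0 = ?c * w v" for w using LX_pow[of v "n - v" w] v by simp
  have "?c * (LX ^^ n) u v = (LX ^^ n) ((LX ^^ (n - v)) u) 0"
    unfolding c[symmetric] by (simp flip: comp_apply[of "LX ^^ _" "LX ^^ _"] funpow_add add: add.commute)
  also have "\<dots> = ?c * (fps_X ^ (n - k) * u v)" unfolding 0 c by (simp add: mult.left_commute)
  finally show ?thesis by (auto simp: prod_zero_iff split: if_splits)
qed

abbreviation "CL \<equiv> carrier (L_module n I)"

lemma CL: "u \<in> CL \<longleftrightarrow> (\<forall>j\<ge>n. u j = 0)"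
  by (simp add: L_module_def)

lemma L_closed [simp]: "\<L> a u \<in> CL"
  by (simp add: CL L_outside)

lemma LX_LY: "u \<in> CL \<Longrightarrow> LX (LY u) = (\<lambda>j. fps_X * u j)" "u \<in> CL \<Longrightarrow> LY (LX u) = (\<lambda>j. fps_X * u j)"
  by (auto simp: fun_eq_iff L_xy CL)

lemma pow_CL: "u \<in> CL \<Longrightarrow> (\<L> a ^^ j) u \<in> CL"
  by (cases j) simp_all

lemma L_pow_smult: "(\<L> a ^^ j) (\<lambda>i. fps_X * u i) = (\<lambda>i. fps_X * (\<L> a ^^ j) u i)"
  by (induction j) (simp_all add: L_smult)

lemma LX_pow_LY_pow: "u \<in> CL \<Longrightarrow> (LX ^^ j) ((LY ^^ j) u) = (\<lambda>i. fps_X ^ j * u i)"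
proof (induction j)
  case (Suc j)
  have "(LX ^^ Suc j) ((LY ^^ Suc j) u) = (LX ^^ j) (LX (LY ((LY ^^ j) u)))"
    by (simp add: funpow_swap1)
  also have "\<dots> = (\<lambda>i. fps_X * (LX ^^ j) ((LY ^^ j) u) i)"
    using Suc.prems by (simp only: LX_LY pow_CL L_pow_smult)
  finally show ?case using Suc by (simp add: mult.assoc)
qed simp

lemma LX_pow_inj: "u \<in> CL \<Longrightarrow> w \<in> CL \<Longrightarrow> (LX ^^ j) u = (LX ^^ j) w \<Longrightarrow> u = w"
proof (induction j)
  case (Suc j)
  have "LY (LX ((LX ^^ j) u)) = LY (LX ((LX ^^ j) w))" using Suc.prems by simp
  then have "(\<lambda>i. fps_X * (LX ^^ j) u i) = (\<lambda>i. fps_X * (LX ^^ j) w i)"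
    using Suc.prems by (simp only: LX_LY pow_CL)
  then have "(LX ^^ j) u = (LX ^^ j) w" by (simp add: fun_eq_iff)
  then show ?case using Suc by blast
qed simp

text \<open>The injective map x^(n-k) turns both sides into multiplication by t^(n-k).\<close>

lemma LX_pow_k: "u \<in> CL \<Longrightarrow> (LX ^^ k) u = (LY ^^ (n - k)) u"
proof (rule LX_pow_inj[of _ _ "n - k"])
  assume u: "u \<in> CL"
  have "(LX ^^ (n - k)) ((LX ^^ k) u) = (LX ^^ n) u"
    using k by (simp flip: comp_apply[of "LX ^^ (n - k)"] funpow_add)
  also have "\<dots> = (\<lambda>i. fps_X ^ (n - k) * u i)"
  proof
    fix v show "(LX ^^ n) u v = fps_X ^ (n - k) * u v"
      using LX_pow_n[of v u] pow_CL[OF u, where a = "x_elem n" and j = n] u by (cases "v < n") (simp_all add: CL)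
  qed
  finally show "(LX ^^ (n - k)) ((LX ^^ k) u) = (LX ^^ (n - k)) ((LY ^^ (n - k)) u)"
    by (simp only: LX_pow_LY_pow[OF u])
qed (simp_all add: pow_CL)

lemma L_one: "u \<in> CL \<Longrightarrow> \<L> \<one>\<^bsub>CPA n\<^esub> u = u"
proof
  fix j assume "u \<in> CL"
  then show "\<L> \<one>\<^bsub>CPA n\<^esub> u j = u j"
    by (cases "j < n") (simp_all add: one_eq_diag L_diag L_outside CL)
qed

lemma L_pow: "u \<in> CL \<Longrightarrow> \<L> (a [^]\<^bsub>CPA n\<^esub> (j::nat)) u = (\<L> a ^^ j) u"
proof (induction j arbitrary: u)
  case (Suc j)
  then show ?case by (simp add: nat_pow_Suc L_mult funpow_swap1)
qed (simp add: L_one)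

text \<open>In \<open>L_module\<close> a class acts through \<open>the_elem\<close> of the actions
  of its representatives. These agree once the closed ideal of relations is known to annihilate the
  module.\<close>

definition annihilator :: "cpa set" where
  "annihilator = {a \<in> carrier (CPA n). \<forall>u\<in>CL. \<L> a u = (\<lambda>_. 0)}"

lemma ideal_annihilator: "ideal annihilator (CPA n)"
proof -
  interpret R: ring "CPA n" by (rule ring_cpath_algebra[OF wf_cyclic_quiver])
  show ?thesis
  proof (rule idealI)
    show "ring (CPA n)" by (rule R.ring_axioms)
    show "subgroup annihilator (add_monoid (CPA n))"
    proof (rule R.add.subgroupI)
      show "annihilator \<subseteq> carrier (CPA n)" by (auto simp: annihilator_def)
      have "\<zero>\<^bsub>CPA n\<^esub> \<in> annihilator"
        by (simp add: annihilator_def fun_eq_iff fps_eq_iff L_action_nth) (simp add: cpa_simps(3))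
      then show "annihilator \<noteq> {}" by blast
      show "a \<oplus>\<^bsub>CPA n\<^esub> b \<in> annihilator" if "a \<in> annihilator" "b \<in> annihilator" for a b
        using that by (simp add: annihilator_def fun_eq_iff L_add)
      show "\<ominus>\<^bsub>CPA n\<^esub> a \<in> annihilator" if a: "a \<in> annihilator" for a
      proof -
        have ca: "a \<in> carrier (CPA n)" using a by (simp add: annihilator_def)
        have "\<ominus>\<^bsub>CPA n\<^esub> a = \<zero>\<^bsub>CPA n\<^esub> \<ominus>\<^bsub>CPA n\<^esub> a" using ca by (simp add: a_minus_def)
        moreover have "\<L> (\<zero>\<^bsub>CPA n\<^esub> \<ominus>\<^bsub>CPA n\<^esub> a) u j = \<L> \<zero>\<^bsub>CPA n\<^esub> u j - \<L> a u j" for u j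
          by (rule L_minus) (use ca in auto)
        then have "\<L> (\<zero>\<^bsub>CPA n\<^esub> \<ominus>\<^bsub>CPA n\<^esub> a) u = (\<lambda>_. 0)" if "u \<in> CL" for u
          using that a \<open>\<zero>\<^bsub>CPA n\<^esub> \<in> annihilator\<close> by (auto simp: annihilator_def fun_eq_iff)
        then have "\<zero>\<^bsub>CPA n\<^esub> \<ominus>\<^bsub>CPA n\<^esub> a \<in> annihilator" using ca by (simp add: annihilator_def)
        ultimately show ?thesis by (simp only:)
      qed
    qed
  next
    fix a x assume a: "a \<in> annihilator" and x: "x \<in> carrier (CPA n)"
    then show "x \<otimes>\<^bsub>CPA n\<^esub> a \<in> annihilator" "a \<otimes>\<^bsub>CPA n\<^esub> x \<in> annihilator"
      by (simp_all add: annihilator_def L_mult L_zero)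
  qed
qed

lemma relations_annihilate: "B_relations k n \<subseteq> annihilator"
proof
  interpret R: ring "CPA n" by (rule ring_cpath_algebra[OF wf_cyclic_quiver])
  note closed = R.m_closed R.nat_pow_closed x_y_vertex_in_CPA R.minus_closed
  have ann: "vertex_idem i \<otimes>\<^bsub>CPA n\<^esub> (a \<ominus>\<^bsub>CPA n\<^esub> b) \<in> annihilator"
    if ab: "a \<in> carrier (CPA n)" "b \<in> carrier (CPA n)" "\<And>u. u \<in> CL \<Longrightarrow> \<L> a u = \<L> b u" and i: "i < n" for a b i
  proof -
    have "\<L> (a \<ominus>\<^bsub>CPA n\<^esub> b) u = (\<lambda>_. 0)" if "u \<in> CL" for u
      using ab that by (simp add: fun_eq_iff L_minus)
    then show ?thesis using ab i by (simp add: annihilator_def L_mult L_zero closed)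
  qed
  fix r assume "r \<in> B_relations k n"
  then obtain i where i: "i < n"
    and r: "r = vertex_idem i \<otimes>\<^bsub>CPA n\<^esub> (x_elem n \<otimes>\<^bsub>CPA n\<^esub> y_elem n \<ominus>\<^bsub>CPA n\<^esub> y_elem n \<otimes>\<^bsub>CPA n\<^esub> x_elem n)
      \<or> r = vertex_idem i \<otimes>\<^bsub>CPA n\<^esub> (x_elem n [^]\<^bsub>CPA n\<^esub> k \<ominus>\<^bsub>CPA n\<^esub> y_elem n [^]\<^bsub>CPA n\<^esub> (n - k))"
    unfolding B_relations_def by auto
  from r show "r \<in> annihilator"
  proof
    assume r: "r = vertex_idem i \<otimes>\<^bsub>CPA n\<^esub> (x_elem n \<otimes>\<^bsub>CPA n\<^esub> y_elem n \<ominus>\<^bsub>CPA n\<^esub> y_elem n \<otimes>\<^bsub>CPA n\<^esub> x_elem n)"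
    show ?thesis unfolding r by (rule ann) (simp_all add: closed i L_mult LX_LY)
  next
    assume r: "r = vertex_idem i \<otimes>\<^bsub>CPA n\<^esub> (x_elem n [^]\<^bsub>CPA n\<^esub> k \<ominus>\<^bsub>CPA n\<^esub> y_elem n [^]\<^bsub>CPA n\<^esub> (n - k))"
    show ?thesis unfolding r by (rule ann) (simp_all add: closed i L_pow LX_pow_k)
  qed
qed

text \<open>A coefficient of t^l involves only paths of bounded length, by \<open>S_length\<close>.
  So it cannot tell an element of the closure from a sufficiently close element of the ideal
  itself.\<close>

lemma B_ideal_annihilates:
  assumes a: "a \<in> B_ideal k n" and u: "u \<in> CL"
  shows "\<L> a u = (\<lambda>_. 0)"
proof -
  interpret R: ring "CPA n" by (rule ring_cpath_algebra[OF wf_cyclic_quiver])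
  have sub: "Idl\<^bsub>CPA n\<^esub> (B_relations k n) \<subseteq> annihilator"
    by (rule R.genideal_minimal[OF ideal_annihilator relations_annihilate])
  have "fps_nth (\<L> a u j) l = 0" for j l
  proof -
    obtain b where b: "b \<in> Idl\<^bsub>CPA n\<^esub> (B_relations k n)"
      "\<forall>p. length (snd p) < Suc (n * l + 2 * (n * n)) \<longrightarrow> a p = b p"
      using a unfolding B_ideal_def adic_closure_def by blast
    have "fps_nth (\<L> a u j) l = fps_nth (\<L> b u j) l"
      unfolding L_action_nth
    proof (rule sum.cong)
      fix p assume "p \<in> S j l"
      then have "a p = b p" using b(2)[rule_format, of p] S_length[of p j l] by (simp add: less_Suc_eq_le)
      then show "a p * fps_nth (u (fst p)) (l - wt p) = b p * fps_nth (u (fst p)) (l - wt p)" by simp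
    qed simp
    also have "\<dots> = 0" using b(1) sub u by (auto simp: annihilator_def)
    finally show ?thesis .
  qed
  then show ?thesis by (simp add: fun_eq_iff fps_eq_iff)
qed

lemma L_module_smult:
  assumes a: "a \<in> carrier (CPA n)" and u: "u \<in> CL"
  shows "B_class k n a \<odot>\<^bsub>L_module n I\<^esub> u = \<L> a u"
proof -
  interpret Id: ideal "B_ideal k n" "CPA n" by (rule B_ideal_ideal)
  have "\<L> b u = \<L> a u" if b: "b \<in> B_class k n a" for b
  proof -
    obtain i where i: "i \<in> B_ideal k n" and b: "b = i \<oplus>\<^bsub>CPA n\<^esub> a"
      using b unfolding B_class_def a_r_coset_def' by auto
    show ?thesis unfolding b by (rule ext) (simp add: L_add B_ideal_annihilates[OF i u])
  qed
  moreover have "a \<in> B_class k n a" unfolding B_class_def by (rule Id.a_rcos_self[OF a])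
  ultimately have "(\<lambda>b. \<L> b u) ` B_class k n a = {\<L> a u}" by blast
  then show ?thesis by (simp add: L_module_def)
qed

end

subsection \<open>Lattices in three-dimensional space over the Laurent series\<close>

no_notation fps_nth (infixl "$" 75)
notation fls_nth (infixl "$$" 75)

definition tp :: "int \<Rightarrow> complex fls" where
  "tp k = fls_X_intpow k"

definition ordge :: "int \<Rightarrow> complex fls \<Rightarrow> bool" where
  "ordge k c \<longleftrightarrow> (\<forall>m<k. c $$ m = 0)"

lemma tp_0 [simp]: "tp 0 = 1"
  by (simp add: tp_def)

lemma tp_add: "tp (a + b) = tp a * tp b"
  by (simp add: tp_def fls_X_intpow_times_fls_X_intpow)

lemma tp_mult_tp: "tp a * tp b = tp (a + b)"
  by (simp add: tp_add)

lemma tp_nth: "(tp k * c) $$ m = c $$ (m - k)"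
  by (simp add: tp_def fls_X_intpow_times_conv_shift)

lemma tp_nonzero [simp]: "tp k \<noteq> 0"
  by (simp add: tp_def)

lemma ordge_0 [simp]: "ordge k 0"
  by (simp add: ordge_def)

lemma ordge_add: "ordge k c \<Longrightarrow> ordge k d \<Longrightarrow> ordge k (c + d)"
  by (simp add: ordge_def)

lemma ordge_diff: "ordge k c \<Longrightarrow> ordge k d \<Longrightarrow> ordge k (c - d)"
  by (simp add: ordge_def)

lemma ordge_mono: "ordge k c \<Longrightarrow> l \<le> k \<Longrightarrow> ordge l c"
  by (simp add: ordge_def)

lemma ordge_iff: "ordge k c \<longleftrightarrow> c = 0 \<or> k \<le> fls_subdegree c"
  by (metis fls_eq0_below_subdegree fls_subdegree_geI ordge_def ordge_0 order_less_le_trans)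

lemma ordge_mult: "ordge k c \<Longrightarrow> ordge l d \<Longrightarrow> ordge (k + l) (c * d)"
  by (cases "c = 0 \<or> d = 0") (auto simp: ordge_iff fls_subdegree_mult simp del: mult_eq_0_iff)

lemma ordge_mult0: "ordge 0 c \<Longrightarrow> ordge l d \<Longrightarrow> ordge l (c * d)"
  using ordge_mult[of 0 c l d] by simp

lemma ordge_tp [simp]: "ordge k (tp j * c) \<longleftrightarrow> ordge (k - j) c"
  by (auto simp: ordge_def tp_nth) (metis add_diff_cancel_right' add_less_cancel_right diff_add_cancel)

lemma ordge_const [simp]: "k \<le> 0 \<Longrightarrow> ordge k (fls_const a)"
  by (auto simp: ordge_def fls_const_nth)

lemma ordge_1 [simp]: "k \<le> 0 \<Longrightarrow> ordge k 1"
  by (auto simp: ordge_def)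

lemma ordge_tp' [simp]: "ordge k (tp j) \<longleftrightarrow> k \<le> j"
  using fls_subdegree_fls_X_intpow[of j, where ?'a = complex] tp_nonzero[of j]
  by (simp add: ordge_iff tp_def)

lemma mult_nth0:
  assumes "ordge 0 c" "ordge 0 d"
  shows "(c * d) $$ 0 = c $$ 0 * d $$ 0"
proof (cases "c \<noteq> 0 \<and> d \<noteq> 0 \<and> fls_subdegree c = 0 \<and> fls_subdegree d = 0")
  case True
  then show ?thesis using fls_times_base[of c d] by simp
next
  case False
  then show ?thesis using assms
    by (auto simp: ordge_iff fls_times_nth_eq0 order_le_less)
qed

lemma ordge_1_iff: "ordge 1 c \<longleftrightarrow> ordge 0 c \<and> c $$ 0 = 0"
  unfolding ordge_def by (metis int_one_le_iff_zero_less linorder_not_less order_le_less zero_less_one order_less_trans)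

type_synonym V = "complex fls ^ 3"

definition Omod :: "V set \<Rightarrow> bool" where
  "Omod X \<longleftrightarrow> 0 \<in> X \<and> (\<forall>x\<in>X. \<forall>y\<in>X. x + y \<in> X) \<and> (\<forall>c. ordge 0 c \<longrightarrow> (\<forall>x\<in>X. c *s x \<in> X))"

text \<open>The lattice t^k X, written as a preimage so that membership needs no witness.\<close>

definition tim :: "int \<Rightarrow> V set \<Rightarrow> V set" where
  "tim k X = {z. tp (- k) *s z \<in> X}"

definition std :: "int \<Rightarrow> V set" where
  "std k = {z. \<forall>s. ordge k (z $ s)}"

definition lattice :: "V set \<Rightarrow> bool" where
  "lattice X \<longleftrightarrow> Omod X \<and> (\<exists>N. std N \<subseteq> X \<and> X \<subseteq> std (- N))"

definition splits :: "V set set \<Rightarrow> bool" where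
  "splits \<X> \<longleftrightarrow> (\<exists>A :: complex fls ^ 3 ^ 3. A ** A = A \<and> A \<noteq> 0 \<and> A \<noteq> mat 1 \<and>
     (\<forall>X\<in>\<X>. \<forall>z\<in>X. A *v z \<in> X))"

lemma splits_subset: "splits \<Y> \<Longrightarrow> \<X> \<subseteq> \<Y> \<Longrightarrow> splits \<X>"
  unfolding splits_def by blast

lemma tim_0 [simp]: "tim 0 X = X"
  by (simp add: tim_def)

lemma tim_tim [simp]: "tim k (tim l X) = tim (k + l) X"
  by (simp add: tim_def vector_smult_assoc tp_mult_tp add.commute)

lemma tim_mono: "X \<subseteq> Y \<Longrightarrow> tim k X \<subseteq> tim k Y"
  by (auto simp: tim_def)

lemma tim_subset_iff: "tim k X \<subseteq> tim k Y \<longleftrightarrow> X \<subseteq> Y"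
  using tim_mono[of X Y k] tim_mono[of "tim k X" "tim k Y" "- k"] by auto

lemma tim_eq_iff: "tim k X = tim k Y \<longleftrightarrow> X = Y"
  by (simp add: set_eq_subset tim_subset_iff)

lemma tp_smult_in_tim [simp]: "tp j *s z \<in> tim k X \<longleftrightarrow> tp (j - k) *s z \<in> X"
  by (simp add: tim_def vector_smult_assoc tp_mult_tp)

lemma matrix_vector_smult: "A *v (c *s z) = c *s (A *v z)" for A :: "complex fls ^ 3 ^ 3"
  by (simp add: vec.scale)

text \<open>Matrices commute with scalars, so a lattice and its multiples by powers of t are
  preserved together. Hence one period of a chain suffices.\<close>

lemma splits_tim:
  assumes "splits \<Y>" "\<And>X. X \<in> \<X> \<Longrightarrow> \<exists>Y\<in>\<Y>. \<exists>k. X = tim k Y"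
  shows "splits \<X>"
proof -
  obtain A :: "complex fls ^ 3 ^ 3" where A: "A ** A = A" "A \<noteq> 0" "A \<noteq> mat 1"
    "\<forall>X\<in>\<Y>. \<forall>z\<in>X. A *v z \<in> X"
    using assms(1) unfolding splits_def by blast
  have "A *v z \<in> X" if X: "X \<in> \<X>" and z: "z \<in> X" for X z
  proof -
    obtain Y k where Y: "Y \<in> \<Y>" "X = tim k Y" using assms(2)[OF X] by blast
    then have "A *v (tp (- k) *s z) \<in> Y" using A z by (auto simp: tim_def)
    then show ?thesis using Y by (simp add: tim_def matrix_vector_smult)
  qed
  with A show ?thesis unfolding splits_def by blast
qed

lemma splits_conj:
  fixes g h :: "complex fls ^ 3 ^ 3"
  assumes gh: "g ** h = mat 1" "h ** g = mat 1"
    and s: "splits ((\<lambda>X. (*v) g ` X) ` \<X>)"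
  shows "splits \<X>"
proof -
  obtain A :: "complex fls ^ 3 ^ 3" where A: "A ** A = A" "A \<noteq> 0" "A \<noteq> mat 1"
    and pres: "\<forall>X\<in>\<X>. \<forall>z\<in>X. A *v (g *v z) \<in> (*v) g ` X"
    using s unfolding splits_def by auto
  let ?B = "h ** A ** g"
  have gB: "g ** ?B = A ** g"
    by (simp add: matrix_mul_assoc gh)
  then have "g ** ?B ** h = A ** (g ** h)"
    by (simp only: matrix_mul_assoc)
  then have bk: "g ** ?B ** h = A"
    unfolding gh(1) matrix_mul_rid .
  have "?B ** ?B = h ** A ** (g ** ?B)"
    by (simp only: matrix_mul_assoc)
  also have "\<dots> = h ** (A ** A) ** g"
    unfolding gB by (simp only: matrix_mul_assoc)
  also have "\<dots> = ?B"
    by (simp only: A)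
  finally have n1: "?B ** ?B = ?B" .
  have n2: "?B \<noteq> 0"
  proof
    assume B0: "?B = 0"
    have "A = g ** 0 ** h" using bk unfolding B0 by (rule sym)
    also have "\<dots> = 0" by (simp add: matrix_matrix_mult_def vec_eq_iff)
    finally show False using A(2) by simp
  qed
  have n3: "?B \<noteq> mat 1"
  proof
    assume B1: "?B = mat 1"
    have "A = g ** mat 1 ** h" using bk unfolding B1 by (rule sym)
    then show False using A(3) gh(1) by (simp only: matrix_mul_rid)
  qed
  have n4: "?B *v z \<in> X" if X: "X \<in> \<X>" and z: "z \<in> X" for X z
  proof -
    have "A *v (g *v z) \<in> (*v) g ` X" using pres X z by simp
    then obtain w where w: "w \<in> X" "A *v (g *v z) = g *v w" by (elim imageE)
    have "?B *v z = h *v (A *v (g *v z))" by (simp only: matrix_vector_mul_assoc matrix_mul_assoc)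
    also have "\<dots> = h *v (g *v w)" by (simp only: w(2))
    also have "\<dots> = w" by (simp only: matrix_vector_mul_assoc gh matrix_vector_mul_lid)
    finally show ?thesis using w(1) by (simp only:)
  qed
  show ?thesis unfolding splits_def
    by (rule exI[of _ ?B]) (intro conjI ballI n1 n2 n3 n4)
qed

text \<open>The operator is \<open>t\<^sup>b\<close> alpha (beta . \<open>t\<^sup>-\<^sup>b\<close>
  z), of rank one. It is idempotent because alpha and beta pair to 1, and its effect on a lattice
  can be read off entry by entry.\<close>

lemma splits_rank1:
  fixes \<alpha> \<beta> :: "3 \<Rightarrow> complex" and b :: "3 \<Rightarrow> int"
  assumes one: "(\<Sum>s\<in>UNIV. \<alpha> s * \<beta> s) = 1"
    and pres: "\<And>X z. X \<in> \<X> \<Longrightarrow> z \<in> X \<Longrightarrow>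
       (\<chi> s. tp (b s) * (fls_const (\<alpha> s) * (\<Sum>r\<in>UNIV. fls_const (\<beta> r) * (tp (- b r) * z $ r)))) \<in> X"
  shows "splits \<X>"
proof -
  define A :: "complex fls ^ 3 ^ 3" where "A = (\<chi> s r. tp (b s - b r) * fls_const (\<alpha> s * \<beta> r))"
  have tpd: "tp (b s - b r) = tp (b s) * tp (- b r)" for s r
    by (simp add: tp_mult_tp)
  have Av: "A *v z = (\<chi> s. tp (b s) * (fls_const (\<alpha> s) * (\<Sum>r\<in>UNIV. fls_const (\<beta> r) * (tp (- b r) * z $ r))))" for z
    by (simp add: A_def matrix_vector_mult_def vec_eq_iff sum_distrib_left tpd mult_ac
        flip: fls_const_mult_const)
  have "A ** A = A"
  proof -
    have "(\<Sum>k\<in>UNIV. tp (b s - b k) * fls_const (\<alpha> s * \<beta> k) * (tp (b k - b r) * fls_const (\<alpha> k * \<beta> r)))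
      = tp (b s - b r) * fls_const (\<alpha> s * \<beta> r)" for s r
    proof -
      have "tp (b s - b k) * fls_const (\<alpha> s * \<beta> k) * (tp (b k - b r) * fls_const (\<alpha> k * \<beta> r))
        = tp (b s - b r) * (fls_const (\<alpha> s * \<beta> r) * fls_const (\<alpha> k * \<beta> k))" for k
      proof -
        have "tp (b s - b k) * fls_const (\<alpha> s * \<beta> k) * (tp (b k - b r) * fls_const (\<alpha> k * \<beta> r))
          = (tp (b s - b k) * tp (b k - b r)) * (fls_const (\<alpha> s * \<beta> k) * fls_const (\<alpha> k * \<beta> r))"
          by (simp only: mult_ac)
        then show ?thesis by (simp add: tp_mult_tp mult_ac)
      qed
      moreover have "(\<Sum>k\<in>UNIV. fls_const (\<alpha> k * \<beta> k)) = 1"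
        using one by (simp add: sum_3 fls_plus_const)
      ultimately show ?thesis by (simp only: sum_distrib_left[symmetric] mult_1_right)
    qed
    then show ?thesis by (simp add: A_def matrix_matrix_mult_def vec_eq_iff)
  qed
  moreover have "A \<noteq> 0"
  proof
    assume A0: "A = 0"
    have "\<alpha> s * \<beta> s = 0" for s
      using arg_cong[OF A0, of "\<lambda>A. A $ s $ s"] by (simp add: A_def)
    then have "(\<Sum>s\<in>UNIV. \<alpha> s * \<beta> s) = 0"
      by (meson sum.neutral)
    then show False using one by simp
  qed
  moreover have "A \<noteq> mat 1"
  proof
    assume eq: "A = mat 1"
    have c: "tp (b s - b r) * fls_const (\<alpha> s * \<beta> r) = (if s = r then 1 else 0)" for s r
      using arg_cong[OF eq, of "\<lambda>A. A $ s $ r"] by (simp add: A_def mat_def)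
    \<comment> \<open>For the identity matrix all products of alpha s with beta s would be nonzero,
      yet the entry in position (1, 2) would vanish.\<close>
    have "\<alpha> 1 * \<beta> 2 = 0" using c[of 1 2] by simp
    moreover have "\<alpha> s * \<beta> s \<noteq> 0" for s
      using c[of s s] by auto
    then have "\<alpha> 1 \<noteq> 0" "\<beta> 2 \<noteq> 0" by (metis mult_zero_left, metis mult_zero_right)
    ultimately show False by simp
  qed
  ultimately show ?thesis
    using pres unfolding splits_def by (intro exI[of _ A]) (auto simp: Av)
qed

subsection \<open>Pivots\<close>

definition ix :: "int \<Rightarrow> 3" where
  "ix m = (if m mod 3 = 0 then 1 else if m mod 3 = 1 then 2 else 3)"

text \<open>The three coordinates are interleaved into one sequence of complex numbers indexed by
  the integers, on which t acts as a shift by 3. The leading position of a vector is then a single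
  integer.\<close>

definition cf :: "V \<Rightarrow> int \<Rightarrow> complex" where
  "cf z m = (z $ ix m) $$ (m div 3)"

text \<open>As in Gaussian elimination, the leading positions that occur measure a complex subspace:
  for lattices Y inside X, the difference of the pivot sets has as many elements as the dimension of
  X/Y. This avoids quotient spaces.\<close>

definition piv :: "V set \<Rightarrow> int set" where
  "piv X = {m. \<exists>z\<in>X. cf z m \<noteq> 0 \<and> (\<forall>m'<m. cf z m' = 0)}"

definition csub :: "V set \<Rightarrow> bool" where
  "csub X \<longleftrightarrow> 0 \<in> X \<and> (\<forall>x\<in>X. \<forall>y\<in>X. x + y \<in> X) \<and> (\<forall>c. \<forall>x\<in>X. fls_const c *s x \<in> X)"

definition adj :: "V \<Rightarrow> V set \<Rightarrow> V set" where
  "adj q Y = {y + fls_const c *s q | y c. y \<in> Y}"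

lemma cf_linear [simp]:
  "cf (x + y) m = cf x m + cf y m" "cf (x - y) m = cf x m - cf y m"
  "cf (fls_const c *s x) m = c * cf x m" "cf 0 m = 0" "cf (- x) m = - cf x m"
  by (auto simp: cf_def)

lemma cf_tp: "cf (tp k *s z) m = cf z (m - 3 * k)"
proof -
  have "(m - 3 * k) mod 3 = m mod 3" "(m - 3 * k) div 3 = m div 3 - k"
    by presburger+
  then show ?thesis by (simp add: cf_def ix_def tp_nth)
qed

lemma ix_cover: "\<exists>m. ix m = s \<and> m div 3 = j \<and> 3 * j \<le> m \<and> m < 3 * j + 3"
proof -
  have "s = 1 \<or> s = 2 \<or> s = 3" by (rule exhaust_3)
  moreover have "ix (3 * j) = 1" "ix (3 * j + 1) = 2" "ix (3 * j + 2) = 3"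
    by (auto simp: ix_def)
  moreover have "(3 * j + 1) div 3 = j" "(3 * j + 2) div 3 = j" by presburger+
  ultimately show ?thesis
    by (elim disjE) (intro exI[of _ "3 * j"] exI[of _ "3 * j + 1"] exI[of _ "3 * j + 2"]; simp)+
qed

lemma std_iff: "z \<in> std N \<longleftrightarrow> (\<forall>m<3 * N. cf z m = 0)"
proof
  assume "z \<in> std N"
  then show "\<forall>m<3 * N. cf z m = 0"
    by (auto simp: std_def cf_def ordge_def)
next
  assume r: "\<forall>m<3 * N. cf z m = 0"
  have "(z $ s) $$ j = 0" if "j < N" for s j
  proof -
    obtain m where "ix m = s" "m div 3 = j" "m < 3 * j + 3" using ix_cover by blast
    then show ?thesis using r that by (auto simp: cf_def)
  qed
  then show "z \<in> std N" by (simp add: std_def ordge_def)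
qed

lemma csub_adj: "csub Y \<Longrightarrow> csub (adj q Y)"
  unfolding csub_def
proof (intro conjI ballI allI; elim conjE)
  assume Y: "0 \<in> Y" "\<forall>x\<in>Y. \<forall>y\<in>Y. x + y \<in> Y" "\<forall>c. \<forall>x\<in>Y. fls_const c *s x \<in> Y"
  show "0 \<in> adj q Y" using Y(1) by (force simp: adj_def intro: exI[of _ 0])
  fix x y c assume x: "x \<in> adj q Y"
  then obtain x' a where x': "x' \<in> Y" "x = x' + fls_const a *s q" by (auto simp: adj_def)
  show "fls_const c *s x \<in> adj q Y"
    unfolding adj_def using x' Y(3)
    by (auto simp: vector_add_ldistrib vector_smult_assoc fls_const_mult_const intro!: exI)
  assume "y \<in> adj q Y"
  then obtain y' b where y': "y' \<in> Y" "y = y' + fls_const b *s q" by (auto simp: adj_def)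
  have "x + y = (x' + y') + fls_const (a + b) *s q"
    by (simp add: x' y' vector_sadd_rdistrib flip: fls_plus_const)
  then show "x + y \<in> adj q Y" using x' y' Y(2) unfolding adj_def by blast
qed

lemma adj_superset: "Y \<subseteq> adj q Y"
  by (force simp: adj_def intro: exI[of _ 0])

lemma adj_in: "0 \<in> Y \<Longrightarrow> q \<in> adj q Y"
  by (force simp: adj_def intro: exI[of _ 1])

lemma adj_least: "csub X \<Longrightarrow> Y \<subseteq> X \<Longrightarrow> q \<in> X \<Longrightarrow> adj q Y \<subseteq> X"
  by (auto simp: adj_def csub_def)

lemma piv_mono: "X \<subseteq> Y \<Longrightarrow> piv X \<subseteq> piv Y"
  by (auto simp: piv_def)

text \<open>Elements with two different new pivots both involve q. The combination that eliminates q
  lies in Y and still has the smaller of the two pivots.\<close>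

lemma piv_adj_unique:
  assumes Y: "csub Y" and m: "m \<in> piv (adj q Y) - piv Y" and m': "m' \<in> piv (adj q Y) - piv Y"
  shows "m = m'"
proof (rule ccontr)
  assume ne: "m \<noteq> m'"
  have wlog: False if mm: "m < m'" and m: "m \<in> piv (adj q Y) - piv Y" and m': "m' \<in> piv (adj q Y) - piv Y"
    for m m'
  proof -
    from m m' obtain z z' where z: "z \<in> adj q Y" "cf z m \<noteq> 0" "\<forall>k<m. cf z k = 0"
      and z': "z' \<in> adj q Y" "cf z' m' \<noteq> 0" "\<forall>k<m'. cf z' k = 0"
      by (auto simp: piv_def)
    obtain y c where y: "y \<in> Y" "z = y + fls_const c *s q" using z(1) by (auto simp: adj_def)
    obtain y' c' where y': "y' \<in> Y" "z' = y' + fls_const c' *s q" using z'(1) by (auto simp: adj_def)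
    have "z' \<notin> Y" using m' z' by (auto simp: piv_def)
    then have c': "c' \<noteq> 0" using y' by auto
    let ?w = "fls_const c' *s z + fls_const (- c) *s z'"
    have "?w = fls_const c' *s y + fls_const (- c) *s y'"
      by (simp add: y y' vec_eq_iff algebra_simps)
    then have "?w \<in> Y" using Y y y' unfolding csub_def by metis
    moreover have "cf ?w m \<noteq> 0" "\<forall>k<m. cf ?w k = 0"
      using z z' mm c' by auto
    ultimately have "m \<in> piv Y" unfolding piv_def by blast
    then show False using m by blast
  qed
  show False using wlog[of m m'] wlog[of m' m] m m' ne by linarith
qed

lemma piv_adj_card:
  assumes "csub Y" shows "finite (piv (adj q Y) - piv Y)" "card (piv (adj q Y) - piv Y) \<le> 1"
proof -
  obtain m where "piv (adj q Y) - piv Y \<subseteq> {m}"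
    using piv_adj_unique[OF assms] by blast
  then show "finite (piv (adj q Y) - piv Y)" "card (piv (adj q Y) - piv Y) \<le> 1"
    using finite_subset[of "piv (adj q Y) - piv Y" "{m}"] card_mono[of "{m}" "piv (adj q Y) - piv Y"]
    by auto
qed

lemma csub_adjs: "csub Y \<Longrightarrow> csub (foldr adj qs Y)"
  by (induction qs) (auto intro: csub_adj)

lemma adjs_superset: "Y \<subseteq> foldr adj qs Y"
  by (induction qs) (use adj_superset in auto)

lemma piv_adjs_card:
  assumes "csub Y"
  shows "finite (piv (foldr adj qs Y) - piv Y) \<and> card (piv (foldr adj qs Y) - piv Y) \<le> length qs"
proof (induction qs)
  case (Cons q qs)
  let ?Z = "foldr adj qs Y"
  have sub: "piv (adj q ?Z) - piv Y \<subseteq> (piv (adj q ?Z) - piv ?Z) \<union> (piv ?Z - piv Y)" by blast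
  note f = piv_adj_card[OF csub_adjs[OF assms], of q qs]
  have "card (piv (adj q ?Z) - piv Y) \<le> card ((piv (adj q ?Z) - piv ?Z) \<union> (piv ?Z - piv Y))"
    using sub f Cons by (intro card_mono) auto
  also have "\<dots> \<le> card (piv (adj q ?Z) - piv ?Z) + card (piv ?Z - piv Y)"
    by (rule card_Un_le)
  finally show ?case using f Cons finite_subset[OF sub] by auto
qed simp

text \<open>Elements of Y cancel the leading terms of x one position after another. After finitely
  many positions the remainder lies in \<open>std N\<close>, which is part of Y, so no limit is
  taken.\<close>

lemma piv_eq_imp_eq:
  assumes X: "csub X" and Y: "csub Y" and YX: "Y \<subseteq> X" and N: "std N \<subseteq> Y" and M: "X \<subseteq> std M"
    and eq: "piv X \<subseteq> piv Y"
  shows "X = Y"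
proof -
  have approx: "\<exists>y\<in>Y. \<forall>m<3 * M + int k. cf (x - y) m = 0" if "x \<in> X" for x k
  proof (induction k)
    case 0
    show ?case using that M Y by (intro bexI[of _ 0]) (auto simp: std_iff csub_def)
  next
    case (Suc k)
    then obtain y where y: "y \<in> Y" "\<forall>m<3 * M + int k. cf (x - y) m = 0" by blast
    let ?m = "3 * M + int k"
    show ?case
    proof (cases "cf (x - y) ?m = 0")
      case True
      have "m = ?m \<or> m < ?m" if "m < 3 * M + int (Suc k)" for m
        using that by auto
      then have "\<forall>m<3 * M + int (Suc k). cf (x - y) m = 0" using y True by blast
      then show ?thesis using y by blast
    next
      case False
      have "x - y = x + fls_const (-1) *s y"
        by (simp add: vec_eq_iff)
      then have "x - y \<in> X" using that y YX X unfolding csub_def by (metis subsetD)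
      then have "?m \<in> piv Y" using False y eq unfolding piv_def by blast
      then obtain w where w: "w \<in> Y" "cf w ?m \<noteq> 0" "\<forall>m<?m. cf w m = 0" by (auto simp: piv_def)
      let ?y = "y + fls_const (cf (x - y) ?m / cf w ?m) *s w"
      have "?y \<in> Y" using y w Y unfolding csub_def by blast
      moreover have "cf (x - ?y) m = 0" if "m < 3 * M + int (Suc k)" for m
      proof (cases "m = ?m")
        case True
        then show ?thesis using w by simp
      next
        case False
        then have "m < ?m" using that by simp
        then show ?thesis using y w by (simp add: diff_diff_eq[symmetric] del: cf_linear(1))
      qed
      ultimately show ?thesis by blast
    qed
  qed
  then have "x \<in> Y" if "x \<in> X" for x
  proof -
    obtain y where y: "y \<in> Y" "\<forall>m<3 * M + int (nat (3 * N - 3 * M)). cf (x - y) m = 0"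
      using approx[OF \<open>x \<in> X\<close>] by blast
    then have "x - y \<in> std N" by (auto simp: std_iff)
    then have "x - y \<in> Y" using N by blast
    then have "(x - y) + y \<in> Y" using Y y unfolding csub_def by blast
    then show ?thesis by simp
  qed
  with YX show ?thesis by blast
qed

text \<open>Adjoining an element with a missing pivot makes the finite difference of pivot sets
  smaller.\<close>

lemma adjs_exist:
  assumes X: "csub X" and Y: "csub Y" and YX: "Y \<subseteq> X" and N: "std N \<subseteq> Y" and M: "X \<subseteq> std M"
    and fin: "finite (piv X - piv Y)"
  shows "\<exists>qs. set qs \<subseteq> X \<and> length qs \<le> card (piv X - piv Y) \<and> foldr adj qs Y = X"
  using Y YX N fin
proof (induction "card (piv X - piv Y)" arbitrary: Y rule: less_induct)
  case less
  show ?case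
  proof (cases "piv X \<subseteq> piv Y")
    case True
    then have "X = Y" using piv_eq_imp_eq[OF X less.prems(1,2,3) M] by blast
    then show ?thesis by (intro exI[of _ "[]"]) auto
  next
    case False
    then obtain m where m: "m \<notin> piv Y" "m \<in> piv X" by blast
    then obtain q where "q \<in> X" "cf q m \<noteq> 0" "\<forall>k<m. cf q k = 0"
      unfolding piv_def by blast
    note q = m this
    let ?Y = "adj q Y"
    have "q \<in> ?Y" using less.prems(1) adj_in by (auto simp: csub_def)
    then have "m \<in> piv ?Y" using q by (auto simp: piv_def)
    then have sub: "piv X - piv ?Y \<subset> piv X - piv Y"
      using q piv_mono[OF adj_superset[of Y q]] by blast
    then have lt: "card (piv X - piv ?Y) < card (piv X - piv Y)"
      using less.prems(4) psubset_card_mono by blast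
    obtain qs where qs: "set qs \<subseteq> X" "length qs \<le> card (piv X - piv ?Y)" "foldr adj qs ?Y = X"
      using less.hyps[OF lt csub_adj[OF less.prems(1)] adj_least[OF X less.prems(2) q(3)]]
        sub less.prems adj_superset[of Y q] by (meson finite_subset order_trans psubset_imp_subset)
    show ?thesis
      using qs lt q by (intro exI[of _ "qs @ [q]"]) auto
  qed
qed

subsection \<open>Adapted bases of two flags\<close>

text \<open>A common adapted basis of two flags, as in the Bruhat decomposition. The vector e lies
  in H, outside the first F that does not contain H, and as deep in G as this permits. A hyperplane
  H' of H that avoids e and contains H cut with this F then contains, for each flag, every member
  not containing e, cut with H.\<close>

lemma two_flags:
  fixes F G :: "nat \<Rightarrow> ('a::field ^ 'n) set"
  assumes F: "\<And>i. vec.subspace (F i)" "F 0 = UNIV" "F m = {0}" "\<And>i. F (Suc i) \<subseteq> F i"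
    and G: "\<And>i. vec.subspace (G i)" "G 0 = UNIV" "G m = {0}" "\<And>i. G (Suc i) \<subseteq> G i"
    and H: "vec.subspace H"
  shows "\<exists>B\<subseteq>H. vec.independent B \<and> vec.span B = H \<and>
    (\<forall>i. vec.span (B \<inter> F i) = H \<inter> F i) \<and> (\<forall>i. vec.span (B \<inter> G i) = H \<inter> G i)"
  using H
proof (induction "vec.dim H" arbitrary: H rule: less_induct)
  case (less H)
  note H = less.prems
  show ?case
  proof (cases "H = {0}")
    case True
    then have "vec.span {} = H" by simp
    moreover have "H \<inter> F i = {0}" "H \<inter> G i = {0}" for i
      using True vec.subspace_0[OF F(1)] vec.subspace_0[OF G(1)] by auto
    ultimately show ?thesis
      by (intro exI[of _ "{}"]) (auto simp: vec.independent_empty)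
  next
    case False
    have Fa: "F j \<subseteq> F i" if "i \<le> j" for i j
      using that by (rule lift_Suc_antimono_le[of F, rotated]) (use F(4) in auto)
    have Ga: "G j \<subseteq> G i" if "i \<le> j" for i j
      using that by (rule lift_Suc_antimono_le[of G, rotated]) (use G(4) in auto)
    have "\<not> H \<subseteq> F m" using False F(3) vec.subspace_0[OF H] by auto
    then obtain a where a: "H \<subseteq> F a" "\<not> H \<subseteq> F (Suc a)"
      using ex_least_nat_less[of "\<lambda>i. \<not> H \<subseteq> F i" m] F(2) by auto
    have "G m \<inter> H \<subseteq> F (Suc a)" using G(3) vec.subspace_0[OF F(1)] by auto
    moreover have "\<not> G 0 \<inter> H \<subseteq> F (Suc a)" using G(2) a by auto
    ultimately obtain b where b: "\<not> G b \<inter> H \<subseteq> F (Suc a)" "G (Suc b) \<inter> H \<subseteq> F (Suc a)"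
      using ex_least_nat_less[of "\<lambda>i. G i \<inter> H \<subseteq> F (Suc a)" m] by blast
    then obtain e where e: "e \<in> G b" "e \<in> H" "e \<notin> F (Suc a)" by blast
    let ?F = "H \<inter> F (Suc a)"
    have sF: "vec.subspace ?F" using H F(1) by (rule vec.subspace_inter)
    obtain B1 where B1: "B1 \<subseteq> ?F" "vec.independent B1" "?F \<subseteq> vec.span B1"
      using vec.maximal_independent_subset[of ?F] by blast
    have sB1: "vec.span B1 = ?F" using B1 sF by (metis vec.span_minimal subset_antisym)
    then have "vec.independent (insert e B1)"
      using e B1 by (intro vec.independent_insertI) auto
    then obtain B2 where B2: "insert e B1 \<subseteq> B2" "B2 \<subseteq> H" "vec.independent B2" "H \<subseteq> vec.span B2"
      using vec.maximal_independent_subset_extend[of "insert e B1" H] B1 e by blast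
    have eB1: "e \<notin> B1" using B1 e by blast
    let ?H' = "vec.span (B2 - {e})"
    have B1': "B1 \<subseteq> B2 - {e}" using B2 eB1 by blast
    have FH': "?F \<subseteq> ?H'" using vec.span_mono[OF B1'] sB1 by simp
    have eH': "e \<notin> ?H'" using B2 vec.dependent_def by blast
    have H'H: "?H' \<subseteq> H" using B2 H by (intro vec.span_minimal) auto
    have "vec.span ?H' \<subset> vec.span H" using H'H eH' e H
      by (metis vec.span_eq_iff vec.subspace_span psubsetI)
    then have "vec.dim ?H' < vec.dim H" by (rule vec.dim_psubset)
    from less.hyps[OF this vec.subspace_span] obtain B' where B': "B' \<subseteq> ?H'" "vec.independent B'" "vec.span B' = ?H'"
      "\<And>i. vec.span (B' \<inter> F i) = ?H' \<inter> F i" "\<And>i. vec.span (B' \<inter> G i) = ?H' \<inter> G i" by auto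
    let ?B = "insert e B'"
    have dec: "\<exists>k. x - k *s e \<in> ?H'" if "x \<in> H" for x
    proof -
      have "x \<in> vec.span (insert e (B2 - {e}))"
        using that B2 by (metis insert_Diff insert_subset subsetD)
      then show ?thesis using vec.span_breakdown_eq[of x e "B2 - {e}"] by blast
    qed
    \<comment> \<open>A subspace S inherits its basis from H' in two situations: it contains e, or
      it meets H only inside H'.\<close>
    have key: "vec.span (?B \<inter> S) = H \<inter> S"
      if S: "vec.subspace S" "vec.span (B' \<inter> S) = ?H' \<inter> S" "e \<in> S \<or> S \<inter> H \<subseteq> ?H'" for S
    proof (cases "e \<in> S")
      case True
      show ?thesis
      proof
        show "vec.span (?B \<inter> S) \<subseteq> H \<inter> S"
          using B' H'H e H S by (intro vec.span_minimal vec.subspace_inter) auto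
        show "H \<inter> S \<subseteq> vec.span (?B \<inter> S)"
        proof
          fix x assume x: "x \<in> H \<inter> S"
          then obtain k where k: "x - k *s e \<in> ?H'" using dec by blast
          then have "x - k *s e \<in> ?H' \<inter> S"
            using x True S(1) by (auto intro: vec.subspace_diff vec.subspace_scale)
          then have "x \<in> vec.span (insert e (B' \<inter> S))"
            unfolding S(2)[symmetric] by (auto simp: vec.span_breakdown_eq)
          then show "x \<in> vec.span (?B \<inter> S)" using True by simp
        qed
      qed
    next
      case False
      then have "?B \<inter> S = B' \<inter> S" by auto
      then show ?thesis using S False H'H by auto
    qed
    have "e \<in> F i \<or> F i \<inter> H \<subseteq> ?H'" for i
    proof (cases "i \<le> a")
      case True then show ?thesis using a e Fa[of i a] by blast
    next
      case False then show ?thesis using Fa[of "Suc a" i] FH' by auto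
    qed
    moreover have "e \<in> G i \<or> G i \<inter> H \<subseteq> ?H'" for i
    proof (cases "i \<le> b")
      case True then show ?thesis using e Ga[of i b] by blast
    next
      case False then show ?thesis using Ga[of "Suc b" i] b FH' by auto
    qed
    moreover have "vec.independent ?B" using B' eH' by (intro vec.independent_insertI) auto
    moreover have "vec.span ?B = H"
      using key[of UNIV] B' by (simp add: vec.subspace_UNIV)
    moreover have "?B \<subseteq> H" using B' H'H e by auto
    ultimately show ?thesis
      using key F(1) G(1) B'(4,5) by (intro exI[of _ ?B]) auto
  qed
qed

subsection \<open>Lattices\<close>

lemma Omod_csub: "Omod X \<Longrightarrow> csub X"
  by (auto simp: Omod_def csub_def)

lemma OmodD:
  assumes "Omod X"
  shows "0 \<in> X" "x \<in> X \<Longrightarrow> y \<in> X \<Longrightarrow> x + y \<in> X" "ordge 0 c \<Longrightarrow> x \<in> X \<Longrightarrow> c *s x \<in> X"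
    "x \<in> X \<Longrightarrow> - x \<in> X" "x \<in> X \<Longrightarrow> y \<in> X \<Longrightarrow> x - y \<in> X" "x \<in> X \<Longrightarrow> fls_const a *s x \<in> X"
proof -
  note A = assms[unfolded Omod_def]
  show "0 \<in> X" "x \<in> X \<Longrightarrow> y \<in> X \<Longrightarrow> x + y \<in> X" "ordge 0 c \<Longrightarrow> x \<in> X \<Longrightarrow> c *s x \<in> X"
    using A by auto
  show "x \<in> X \<Longrightarrow> fls_const a *s x \<in> X" using A by auto
  have neg: "- x = fls_const (-1) *s x" for x :: V
    by (simp add: vec_eq_iff)
  show *: "- x \<in> X" if "x \<in> X" for x
  proof -
    have "fls_const (-1) *s x \<in> X" using that A ordge_const[of 0 "-1"] by blast
    then show ?thesis by (simp only: neg)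
  qed
  show "x \<in> X \<Longrightarrow> y \<in> X \<Longrightarrow> x - y \<in> X"
    using A *[of y] by (metis diff_conv_add_uminus)
qed

lemma Omod_sum: "Omod X \<Longrightarrow> (\<And>s. s \<in> S \<Longrightarrow> f s \<in> X) \<Longrightarrow> sum f S \<in> X"
  by (induction S rule: infinite_finite_induct) (auto simp: OmodD)

lemma Omod_tim: "Omod X \<Longrightarrow> Omod (tim k X)"
  by (auto simp: Omod_def tim_def vector_add_ldistrib vector_smult_assoc mult.commute)
     (metis vector_smult_assoc)

lemma Omod_std [simp]: "Omod (std k)"
  by (auto simp: Omod_def std_def ordge_add ordge_mult0)

lemma tim_std [simp]: "tim k (std l) = std (k + l)"
  by (auto simp: tim_def std_def add.commute)

lemma std_mono: "k \<le> l \<Longrightarrow> std l \<subseteq> std k"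
  by (auto simp: std_def intro: ordge_mono)

lemma Omod_image: "Omod X \<Longrightarrow> Omod ((*v) (h :: complex fls ^ 3 ^ 3) ` X)"
  unfolding Omod_def
  by (auto simp flip: matrix_vector_smult vec.add intro!: imageI)
     (metis image_eqI vec.zero)

lemma tim_image: "tim k ((*v) (h :: complex fls ^ 3 ^ 3) ` X) = (*v) h ` tim k X"
proof -
  have "z \<in> (*v) h ` tim k X" if "tp (- k) *s z = h *v x" "x \<in> X" for z x
  proof -
    have "z = tp k *s (tp (- k) *s z)" by (simp add: vector_smult_assoc tp_mult_tp)
    also have "\<dots> = h *v (tp k *s x)" by (simp add: that matrix_vector_smult)
    finally show ?thesis using that by auto
  qed
  then show ?thesis by (auto simp: tim_def simp flip: matrix_vector_smult)
qed

lemma latticeD: "lattice X \<Longrightarrow> Omod X"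
  by (simp add: lattice_def)

lemma lattice_tim:
  assumes "lattice X" shows "lattice (tim k X)"
proof -
  obtain N where N: "std N \<subseteq> X" "X \<subseteq> std (- N)" using assms by (auto simp: lattice_def)
  have "std (N + \<bar>k\<bar>) \<subseteq> std (k + N)" "std (k + (- N)) \<subseteq> std (- (N + \<bar>k\<bar>))"
    by (rule std_mono; linarith)+
  moreover have "std (k + N) \<subseteq> tim k X" "tim k X \<subseteq> std (k + (- N))"
    using tim_mono[OF N(1), of k] tim_mono[OF N(2), of k] by simp_all
  ultimately show ?thesis
    using assms Omod_tim unfolding lattice_def by (meson order_trans)
qed

lemma lattice_between:
  assumes "lattice X" "lattice Y" "X \<subseteq> Z" "Z \<subseteq> Y" "Omod Z" shows "lattice Z"
proof -
  obtain N where N: "std N \<subseteq> X" using assms by (auto simp: lattice_def)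
  obtain M where M: "Y \<subseteq> std (- M)" using assms by (auto simp: lattice_def)
  have "std (max N M) \<subseteq> std N" "std (- M) \<subseteq> std (- max N M)"
    by (rule std_mono; simp)+
  then show ?thesis using assms N M unfolding lattice_def by (meson order_trans)
qed

section \<open>Pivots of a lattice and the index of a sublattice\<close>

lemma piv_tim: "piv (tim k X) = (\<lambda>m. m + 3 * k) ` piv X"
proof -
  have sub: "(\<lambda>m. m + 3 * k) ` piv X \<subseteq> piv (tim k X)" for k X
  proof
    fix m assume "m \<in> (\<lambda>m. m + 3 * k) ` piv X"
    then obtain m' z where "m = m' + 3 * k" "z \<in> X" "cf z m' \<noteq> 0" "\<forall>j<m'. cf z j = 0"
      by (auto simp: piv_def)
    then show "m \<in> piv (tim k X)"
      by (auto simp: piv_def cf_tp intro!: bexI[of _ "tp k *s z"])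
  qed
  have "(\<lambda>m. m + 3 * (- k)) ` piv (tim k X) \<subseteq> piv X"
    using sub[of "- k" "tim k X"] by simp
  then have "piv (tim k X) \<subseteq> (\<lambda>m. m + 3 * k) ` piv X"
    by (force simp: image_subset_iff)
  with sub show ?thesis by blast
qed

text \<open>Each residue class modulo 3 meets S in a ray, and only the least element of the ray is
  not a shift of another one.\<close>

lemma card_shift3:
  fixes S :: "int set"
  assumes up: "\<And>m. m \<in> S \<Longrightarrow> m + 3 \<in> S" and lo: "\<And>m. m \<in> S \<Longrightarrow> a \<le> m" and hi: "\<And>m. b \<le> m \<Longrightarrow> m \<in> S"
  shows "finite (S - (\<lambda>m. m + 3) ` S) \<and> card (S - (\<lambda>m. m + 3) ` S) = 3"
proof -
  let ?D = "S - (\<lambda>m. m + 3) ` S"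
  have up': "m + 3 * int k \<in> S" if "m \<in> S" for m k
    by (induction k) (use that up in \<open>auto simp: algebra_simps\<close>, metis add.assoc add.commute up)
  have "inj_on (\<lambda>m. m mod 3) ?D"
  proof (rule linorder_inj_onI')
    show "m mod 3 \<noteq> m' mod 3" if "m \<in> ?D" "m' \<in> ?D" "m < m'" for m m'
    proof
      assume "m mod 3 = m' mod 3"
      note that = that(1,2) this that(3)
      have "(m' - m) mod 3 = 0" using that(3) by presburger
      then obtain j where "m' - m = 3 * j" by (auto elim: dvdE)
      then have "m' = (m + 3 * int (nat (j - 1))) + 3" using that(4) by simp
      then have "m' \<in> (\<lambda>m. m + 3) ` S" using up'[of m] that(1) by blast
      then show False using that(2) by blast
    qed
  qed
  moreover have "(\<lambda>m. m mod 3) ` ?D = {0, 1, 2}"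
  proof
    show "(\<lambda>m. m mod 3) ` ?D \<subseteq> {0, 1, 2}" by auto
    show "{0, 1, 2} \<subseteq> (\<lambda>m. m mod 3) ` ?D"
    proof
      fix r :: int assume r: "r \<in> {0, 1, 2}"
      let ?P = "\<lambda>k::nat. a + int k \<in> S \<and> (a + int k) mod 3 = r"
      obtain m where m: "b \<le> m" "a \<le> m" "m mod 3 = r"
      proof -
        let ?m = "max a b + (r - max a b) mod 3"
        have "?m mod 3 = (max a b + (r - max a b)) mod 3" by (rule mod_add_right_eq)
        then have "?m mod 3 = r" using r by auto
        moreover have "b \<le> ?m" "a \<le> ?m" by (auto simp: add_increasing2)
        ultimately show ?thesis using that by blast
      qed
      then have "?P (nat (m - a))" using hi by simp
      then have L: "?P (LEAST k. ?P k)" by (rule LeastI)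
      let ?m = "a + int (LEAST k. ?P k)"
      have "?m \<notin> (\<lambda>m. m + 3) ` S"
      proof
        assume "?m \<in> (\<lambda>m. m + 3) ` S"
        then have s: "?m - 3 \<in> S" by auto
        then have ge: "a \<le> ?m - 3" using lo by blast
        have "(x - 3) mod 3 = r" if "x mod 3 = r" for x :: int using that by presburger
        then have "(?m - 3) mod 3 = r" using L by blast
        moreover have "a + int (nat (?m - 3 - a)) = ?m - 3" using ge by simp
        ultimately have "?P (nat (?m - 3 - a))" using s by presburger
        then have "(LEAST k. ?P k) \<le> nat (?m - 3 - a)" by (rule Least_le)
        then show False using ge by linarith
      qed
      then show "r \<in> (\<lambda>m. m mod 3) ` ?D" using L by (intro image_eqI[of _ _ ?m]) auto
    qed
  qed
  ultimately have "bij_betw (\<lambda>m. m mod 3) ?D {0, 1, 2}" by (simp add: bij_betw_def)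
  then show ?thesis
    using bij_betw_finite[of _ ?D] bij_betw_same_card[of _ ?D] by force
qed

lemma piv_lattice_bounds:
  assumes "lattice X"
  shows "\<exists>a b. (\<forall>m\<in>piv X. a \<le> m) \<and> (\<forall>m\<ge>b. m \<in> piv X)"
proof -
  obtain N where N: "std N \<subseteq> X" "X \<subseteq> std (- N)" using assms by (auto simp: lattice_def)
  have "3 * (- N) \<le> m" if "m \<in> piv X" for m
    using that N(2) by (force simp: piv_def std_iff subset_eq not_le[symmetric])
  moreover have "m \<in> piv X" if "3 * N \<le> m" for m
  proof -
    let ?z = "axis (ix m) (tp (m div 3)) :: V"
    have z: "cf ?z k = (if k = m then 1 else 0)" for k
    proof (cases "ix k = ix m")
      case True
      then have "k mod 3 = m mod 3"
        by (auto simp: ix_def split: if_splits)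
      then have "k div 3 = m div 3 \<longleftrightarrow> k = m" by presburger
      then show ?thesis using True tp_nth[of "m div 3" 1 "k div 3"] by (auto simp: cf_def)
    next
      case False
      then show ?thesis by (auto simp: cf_def axis_def)
    qed
    then have "?z \<in> X" using N(1) that by (auto simp: std_iff)
    then show ?thesis using z unfolding piv_def by (intro CollectI bexI[of _ ?z]) auto
  qed
  ultimately show ?thesis by blast
qed

text \<open>For lattices Y inside X this is the complex dimension of X/Y.\<close>

definition lidx :: "V set \<Rightarrow> V set \<Rightarrow> nat" where
  "lidx X Y = card (piv X - piv Y)"

lemma lattice_tim1_subset: "lattice X \<Longrightarrow> k \<ge> 0 \<Longrightarrow> tim k X \<subseteq> X"
proof
  fix z assume X: "lattice X" and k: "k \<ge> 0" and "z \<in> tim k X"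
  then have "tp (- k) *s z \<in> X" by (simp add: tim_def)
  moreover have "ordge 0 (tp k)" using k by simp
  ultimately have "tp k *s (tp (- k) *s z) \<in> X"
    using OmodD(3)[OF latticeD[OF X]] by blast
  then show "z \<in> X" by (simp add: vector_smult_assoc tp_mult_tp)
qed

lemma lidx_tim1: "lattice X \<Longrightarrow> finite (piv X - piv (tim 1 X)) \<and> lidx X (tim 1 X) = 3"
proof -
  assume X: "lattice X"
  obtain a b where ab: "\<forall>m\<in>piv X. a \<le> m" "\<forall>m\<ge>b. m \<in> piv X"
    using piv_lattice_bounds[OF X] by blast
  have "m + 3 \<in> piv X" if "m \<in> piv X" for m
    using that piv_mono[OF lattice_tim1_subset[OF X, of 1]] piv_tim[of 1 X] by auto
  from card_shift3[OF this, of a b] ab show ?thesis by (simp add: lidx_def piv_tim)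
qed

lemma finite_piv_diff:
  assumes "lattice X" "lattice Y" shows "finite (piv X - piv Y)"
proof -
  obtain a where "\<forall>m\<in>piv X. a \<le> m" using piv_lattice_bounds[OF assms(1)] by blast
  moreover obtain b where "\<forall>m\<ge>b. m \<in> piv Y" using piv_lattice_bounds[OF assms(2)] by blast
  ultimately have "piv X - piv Y \<subseteq> {a..b}"
    by (metis Diff_iff atLeastAtMost_iff linear subsetI)
  then show ?thesis by (rule finite_subset) simp
qed

lemma lidx_add:
  assumes "lattice X" "lattice Y" "lattice Z" "Y \<subseteq> X" "Z \<subseteq> Y"
  shows "lidx X Z = lidx X Y + lidx Y Z"
proof -
  have "piv X - piv Z = (piv X - piv Y) \<union> (piv Y - piv Z)"
    using piv_mono[OF assms(4)] piv_mono[OF assms(5)] by blast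
  then show ?thesis unfolding lidx_def
    by (simp add: card_Un_disjoint finite_piv_diff assms Int_Diff Diff_Int_distrib2)
       (subst card_Un_disjoint, auto simp: finite_piv_diff assms)
qed

lemma lidx_tim: "lidx (tim k X) (tim k Y) = lidx X Y"
proof -
  have "piv (tim k X) - piv (tim k Y) = (\<lambda>m. m + 3 * k) ` (piv X - piv Y)"
    unfolding piv_tim by (auto simp: image_def)
  then show ?thesis unfolding lidx_def by (simp add: card_image)
qed

lemma lidx_pos:
  assumes "lattice X" "lattice Y" "Y \<subset> X" shows "0 < lidx X Y"
proof -
  obtain N where N: "std N \<subseteq> Y" using assms by (auto simp: lattice_def)
  obtain M where M: "X \<subseteq> std (- M)" using assms by (auto simp: lattice_def)
  have "\<not> piv X \<subseteq> piv Y"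
    using piv_eq_imp_eq[OF Omod_csub Omod_csub _ N M] assms latticeD by blast
  then show ?thesis unfolding lidx_def using finite_piv_diff assms by (auto simp: card_gt_0_iff)
qed

lemma lidx_generators:
  assumes "lattice X" "lattice Y" "Y \<subseteq> X"
  shows "\<exists>qs. set qs \<subseteq> X \<and> length qs \<le> lidx X Y \<and> foldr adj qs Y = X"
proof -
  obtain N where N: "std N \<subseteq> Y" using assms by (auto simp: lattice_def)
  obtain M where M: "X \<subseteq> std (- M)" using assms by (auto simp: lattice_def)
  show ?thesis
    using adjs_exist[OF Omod_csub Omod_csub _ N M finite_piv_diff] assms latticeD
    unfolding lidx_def by blast
qed

lemma lidx_le_length:
  assumes "lattice X" "lattice Y" "X \<subseteq> foldr adj qs Y" shows "lidx X Y \<le> length qs"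
proof -
  have "piv X - piv Y \<subseteq> piv (foldr adj qs Y) - piv Y" using piv_mono[OF assms(3)] by blast
  then show ?thesis
    using piv_adjs_card[OF Omod_csub[OF latticeD[OF assms(2)]], of qs] card_mono
    unfolding lidx_def by (metis order_trans)
qed

section \<open>Bases of a lattice from vectors that span it modulo t\<close>

definition vlin :: "(3 \<Rightarrow> complex fls) \<Rightarrow> (3 \<Rightarrow> V) \<Rightarrow> V" where
  "vlin c v = (\<Sum>s\<in>UNIV. c s *s v s)"

lemma std_lead:
  assumes "z \<noteq> 0" shows "\<exists>k s. z \<in> std k \<and> (z $ s) $$ k \<noteq> 0"
proof -
  let ?S = "{s. z $ s \<noteq> 0}"
  have ne: "?S \<noteq> {}" using assms by (auto simp: vec_eq_iff)
  let ?k = "Min ((\<lambda>s. fls_subdegree (z $ s)) ` ?S)"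
  have "?k \<in> (\<lambda>s. fls_subdegree (z $ s)) ` ?S" using ne by (intro Min_in) auto
  then obtain s where s: "z $ s \<noteq> 0" "?k = fls_subdegree (z $ s)" by blast
  have "ordge ?k (z $ r)" for r
    by (cases "z $ r = 0") (auto simp: ordge_iff intro!: Min_le)
  then have "z \<in> std ?k" by (auto simp: std_def)
  moreover have "(z $ s) $$ ?k \<noteq> 0" using s by simp
  ultimately show ?thesis by blast
qed

lemma three_others:
  fixes s :: 3
  obtains a b where "UNIV = {s, a, b}" "s \<noteq> a" "s \<noteq> b" "a \<noteq> b"
proof -
  have U: "UNIV = {1, 2, 3 :: 3}" by (rule UNIV_3)
  have d: "(1::3) \<noteq> 2" "(1::3) \<noteq> 3" "(2::3) \<noteq> 3" by simp_all
  have U': "UNIV = {2, 1, 3 :: 3}" "UNIV = {3, 1, 2 :: 3}" using U by blast+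
  consider "s = 1" | "s = 2" | "s = 3" using exhaust_3[of s] by blast
  then show ?thesis
    using that[of 2 3] that[of 1 3] that[of 1 2] U U' d by cases metis+
qed

locale adapted_vectors =
  fixes X :: "V set" and v :: "3 \<Rightarrow> V"
  assumes X: "lattice X" and v: "\<And>s. v s \<in> X"
    and spanning: "\<And>z. z \<in> X \<Longrightarrow> \<exists>\<alpha>. z - vlin (\<lambda>s. fls_const (\<alpha> s)) v \<in> tim 1 X"
begin

lemmas OX = latticeD[OF X]
lemmas OtX = Omod_tim[OF OX, of 1]

definition g :: "complex fls ^ 3 ^ 3" where
  "g = (\<chi> i j. v j $ i)"

lemma g_mult: "g *v c = vlin (\<lambda>s. c $ s) v"
  by (simp add: g_def vlin_def matrix_vector_mult_def vec_eq_iff sum_component mult.commute)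

lemma vlin_in: "(\<And>s. ordge 0 (c s)) \<Longrightarrow> vlin c v \<in> X"
  unfolding vlin_def by (intro Omod_sum OX OmodD(3)[OF OX] v)

lemma indep_mod:
  assumes "vlin (\<lambda>s. fls_const (\<alpha> s)) v \<in> tim 1 X" shows "\<alpha> s = 0"
proof (rule ccontr)
  assume nz: "\<alpha> s \<noteq> 0"
  obtain a b where ab: "UNIV = {s, a, b}" "s \<noteq> a" "s \<noteq> b" "a \<noteq> b"
    by (rule three_others)
  have sum: "vlin c v = c s *s v s + (c a *s v a + c b *s v b)" for c
    unfolding vlin_def by (subst ab(1)) (use ab(2-4) in simp)
  have "X \<subseteq> foldr adj [v a, v b] (tim 1 X)"
  proof
    fix z assume "z \<in> X"
    then obtain \<gamma> where \<gamma>: "z - vlin (\<lambda>s. fls_const (\<gamma> s)) v \<in> tim 1 X" using spanning by blast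
    let ?l = "\<gamma> s / \<alpha> s"
    let ?t = "(z - vlin (\<lambda>s. fls_const (\<gamma> s)) v) + fls_const ?l *s vlin (\<lambda>s. fls_const (\<alpha> s)) v"
    have t: "?t \<in> tim 1 X" by (rule OmodD(2)[OF OtX \<gamma> OmodD(6)[OF OtX assms]])
    have alg: "z = (z - (Gs *s v s + (Ga *s v a + Gb *s v b))) + L *s (As *s v s + (Aa *s v a + Ab *s v b))
        + (Gb - L * Ab) *s v b + (Ga - L * Aa) *s v a" if "Gs = L * As" for Gs Ga Gb L As Aa Ab
      unfolding that vec_eq_iff vector_add_component vector_minus_component vector_smult_component
      by (intro allI) Groebner_Basis.algebra
    have cc: "fls_const (x - ?l * y) = fls_const x - fls_const ?l * fls_const y" for x y
      by (simp add: fls_minus_const)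
    have "fls_const (\<gamma> s) = fls_const ?l * fls_const (\<alpha> s)" using nz by simp
    from alg[OF this] have "z = ?t + fls_const (\<gamma> b - ?l * \<alpha> b) *s v b + fls_const (\<gamma> a - ?l * \<alpha> a) *s v a"
      unfolding sum cc .
    moreover have "?t + fls_const (\<gamma> b - ?l * \<alpha> b) *s v b \<in> adj (v b) (tim 1 X)"
      using t unfolding adj_def by blast
    ultimately have "z \<in> adj (v a) (adj (v b) (tim 1 X))"
      unfolding adj_def[of "v a"] by blast
    then show "z \<in> foldr adj [v a, v b] (tim 1 X)" by simp
  qed
  then have "lidx X (tim 1 X) \<le> 2"
    using lidx_le_length[OF X lattice_tim[OF X]] by fastforce
  then show False using lidx_tim1[OF X] by simp
qed

lemma indep_mod':
  assumes c: "\<And>s. ordge 0 (c s)" and "vlin c v \<in> tim 1 X" shows "c s $$ 0 = 0"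
proof -
  let ?d = "\<lambda>s. c s - fls_const (c s $$ 0)"
  have "ordge 1 (?d s)" for s
    using ordge_diff[OF c ordge_const] by (auto simp: ordge_1_iff)
  then have "vlin (\<lambda>s. tp (- 1) * ?d s) v \<in> X" by (intro vlin_in) simp
  then have "tp 1 *s vlin (\<lambda>s. tp (- 1) * ?d s) v \<in> tim 1 X" by simp
  moreover have "tp 1 *s vlin (\<lambda>s. tp (- 1) * ?d s) v = vlin ?d v"
    by (simp add: vlin_def vec.scale_sum_right mult.assoc[symmetric] tp_mult_tp)
  ultimately have "vlin c v - vlin ?d v \<in> tim 1 X"
    using assms OmodD(5)[OF OtX] by simp
  moreover have "vlin c v - vlin ?d v = vlin (\<lambda>s. fls_const (c s $$ 0)) v"
    by (simp add: vlin_def vec.scale_left_diff_distrib flip: sum_subtractf)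
  ultimately show ?thesis using indep_mod[of "\<lambda>s. c s $$ 0"] by simp
qed

text \<open>Scaling a nonintegral c to order exactly 0 moves its image into tX while one residue
  stays nonzero, against independence modulo t.\<close>

lemma coords_integral:
  assumes "g *v c \<in> X" shows "c \<in> std 0"
proof (rule ccontr)
  assume n: "c \<notin> std 0"
  then have "c \<noteq> 0" by (auto simp: std_def)
  then obtain k s where k: "c \<in> std k" "(c $ s) $$ k \<noteq> 0" using std_lead by blast
  have "k < 0" using n k std_mono[of 0 k] by force
  let ?c = "tp (- k) *s c"
  have "g *v ?c \<in> tim 1 X"
  proof -
    have "g *v ?c \<in> tim (- k) X" using assms by (simp add: matrix_vector_smult)
    moreover have "tim (- k) X \<subseteq> tim 1 X"
      using lattice_tim1_subset[OF lattice_tim[OF X, of 1], of "- k - 1"] \<open>k < 0\<close> by simp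
    ultimately show ?thesis by blast
  qed
  then have "?c $ s $$ 0 = 0"
    unfolding g_mult using k by (intro indep_mod') (auto simp: std_def simp del: vector_smult_component, simp)
  then show False using k by (simp add: tp_nth)
qed

lemma g_ker: assumes "g *v c = 0" shows "c = 0"
proof (rule ccontr)
  assume "c \<noteq> 0"
  then obtain k s where k: "c \<in> std k" "(c $ s) $$ k \<noteq> 0" using std_lead by blast
  \<comment> \<open>Scaled to order - 1 the vector is not integral, although its image 0 lies in
    X.\<close>
  let ?c = "tp (- k - 1) *s c"
  have "g *v ?c = 0" using assms by (simp add: matrix_vector_smult)
  then have "?c \<in> std 0" using OX by (intro coords_integral) (simp add: OmodD)
  then have "ordge 0 (tp (- k - 1) * c $ s)" by (simp add: std_def)
  then have "ordge (k + 1) (c $ s)" by (simp add: add.commute)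
  then show False using k by (simp add: ordge_def)
qed

lemma inverse: "\<exists>h. g ** h = mat 1 \<and> h ** g = mat 1"
  using matrix_left_invertible_ker[of g] g_ker matrix_left_right_inverse[of _ g] by blast

definition h :: "complex fls ^ 3 ^ 3" where
  "h = (SOME h. g ** h = mat 1 \<and> h ** g = mat 1)"

lemma gh: "g ** h = mat 1" "h ** g = mat 1"
  using someI_ex[OF inverse] by (auto simp: h_def)

lemma gh_cancel [simp]: "g *v (h *v z) = z" "h *v (g *v z) = z"
  by (simp_all only: matrix_vector_mul_assoc gh matrix_vector_mul_lid)

lemma mem_iff: "z \<in> X \<longleftrightarrow> h *v z \<in> std 0"
proof
  assume "z \<in> X"
  then show "h *v z \<in> std 0" by (intro coords_integral) simp
next
  assume "h *v z \<in> std 0"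
  then have "g *v (h *v z) \<in> X" unfolding g_mult by (intro vlin_in) (simp add: std_def)
  then show "z \<in> X" by simp
qed

lemma image_h: "(*v) h ` X = std 0"
  using mem_iff by (auto simp: image_iff intro!: bexI[of _ "g *v _"])

end

lemma ex_fun_3: "\<exists>f :: 3 \<Rightarrow> 'a. f 1 = a \<and> f 2 = b \<and> f 3 = c"
  by (rule exI[of _ "\<lambda>s. if s = 1 then a else if s = 2 then b else c"]) simp

lemma lattice_vectors:
  assumes X: "lattice X"
  shows "\<exists>v. adapted_vectors X v"
proof -
  have tX: "lattice (tim 1 X)" "tim 1 X \<subseteq> X"
    using lattice_tim X lattice_tim1_subset by auto
  obtain qs where qs: "set qs \<subseteq> X" "length qs \<le> 3" "foldr adj qs (tim 1 X) = X"
    using lidx_generators[OF X tX] lidx_tim1[OF X] by auto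
  \<comment> \<open>Fewer than three generators are filled up with zeros, which adjoin
    nothing.\<close>
  let ?q = "\<lambda>i. if i < length qs then qs ! i else 0"
  have step: "adj 0 Y = Y" for Y :: "V set" by (auto simp: adj_def)
  have "X = foldr adj [?q 0, ?q 1, ?q 2] (tim 1 X)"
  proof -
    consider "qs = []" | a where "qs = [a]" | a b where "qs = [a, b]" | a b c where "qs = [a, b, c]"
      using qs(2) by (cases qs; cases "tl qs"; cases "tl (tl qs)") auto
    then show ?thesis using qs(3) by cases (auto simp: step)
  qed
  moreover have gen3: "\<exists>t\<in>T. \<exists>a b c. z = t + fls_const c *s q2 + fls_const b *s q1 + fls_const a *s q0"
    if "z \<in> foldr adj [q0, q1, q2] T" for z q0 q1 q2 T
    using that by (auto simp: adj_def)
  ultimately have gen: "\<exists>t\<in>tim 1 X. \<exists>a b c. z = t + fls_const c *s ?q 2 + fls_const b *s ?q 1 + fls_const a *s ?q 0"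
    if "z \<in> X" for z
    using that by blast
  obtain v :: "3 \<Rightarrow> V" where v: "v 1 = ?q 0" "v 2 = ?q 1" "v 3 = ?q 2"
    using ex_fun_3[of "?q 0" "?q 1" "?q 2"] by blast
  have "adapted_vectors X v"
  proof
    show "lattice X" by fact
    have "?q i \<in> X" for i
      using qs(1) OmodD(1)[OF latticeD[OF X]] by (auto simp: subset_eq)
    then have "\<forall>s. v s \<in> X" unfolding forall_3 v by blast
    then show "v s \<in> X" for s by blast
    fix z assume "z \<in> X"
    then obtain t a b c where t: "t \<in> tim 1 X"
      "z = t + fls_const c *s ?q 2 + fls_const b *s ?q 1 + fls_const a *s ?q 0" using gen by blast
    obtain \<alpha> :: "3 \<Rightarrow> complex" where \<alpha>: "\<alpha> 1 = a" "\<alpha> 2 = b" "\<alpha> 3 = c"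
      using ex_fun_3[of a b c] by blast
    have "vlin (\<lambda>s. fls_const (\<alpha> s)) v = fls_const a *s ?q 0 + fls_const b *s ?q 1 + fls_const c *s ?q 2"
      unfolding vlin_def sum_3 v \<alpha> ..
    then have "z - vlin (\<lambda>s. fls_const (\<alpha> s)) v = t"
      unfolding t(2) by (simp only: add.assoc add.commute add.left_commute add_diff_cancel_right' add_diff_cancel_left')
    then show "\<exists>\<alpha>. z - vlin (\<lambda>s. fls_const (\<alpha> s)) v \<in> tim 1 X" using t(1) by metis
  qed
  then show ?thesis by blast
qed

lemma std_lattice [simp]: "lattice (std k)"
  unfolding lattice_def by (intro conjI exI[of _ "\<bar>k\<bar>"] std_mono Omod_std) auto

subsection \<open>Chains with two flags\<close>

text \<open>The exponent of the label s in the i-th member of a chain from \<open>std 0\<close> to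
  \<open>std 2\<close>: it rises by one in step p s and again in step q s, steps being counted from
  0.\<close>

definition two_step :: "(3 \<Rightarrow> nat) \<Rightarrow> (3 \<Rightarrow> nat) \<Rightarrow> nat \<Rightarrow> 3 \<Rightarrow> int" where
  "two_step p q i s = (if p s < i then 1 else 0) + (if q s < i then 1 else 0)"

definition ev :: "V \<Rightarrow> complex ^ 3" where
  "ev z = (\<chi> s. (z $ s) $$ 0)"

lemma ev_linear: "ev (x + y) = ev x + ev y" "ev (x - y) = ev x - ev y" "ev 0 = 0" "ev (fls_const a *s x) = a *s ev x"
  by (auto simp: ev_def vec_eq_iff)

lemma ev_scale: "ordge 0 c \<Longrightarrow> x \<in> std 0 \<Longrightarrow> ev (c *s x) = (c $$ 0) *s ev x"
  by (auto simp: ev_def vec_eq_iff std_def mult_nth0)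

lemma ev_sum: "ev (sum f S) = (\<Sum>s\<in>S. ev (f s))"
  by (induction S rule: infinite_finite_induct) (auto simp: ev_linear)

lemma ev_0_iff: "z \<in> std 0 \<Longrightarrow> ev z = 0 \<longleftrightarrow> z \<in> std 1"
  by (auto simp: std_def ev_def vec_eq_iff ordge_1_iff)

lemma ev_surj: "\<exists>z\<in>std 0. ev z = e"
  by (rule bexI[of _ "\<chi> s. fls_const (e $ s)"]) (auto simp: ev_def std_def vec_eq_iff)

lemma ev_subspace: "Omod X \<Longrightarrow> vec.subspace (ev ` X)"
  unfolding vec.subspace_def
  by (auto simp flip: ev_linear simp: OmodD intro!: imageI)

text \<open>Residues modulo t turn the chain into two flags, one from Z i itself and one from the
  part of \<open>tim (- 1) (Z i)\<close> inside \<open>std 0\<close>. A common basis of both is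
  lifted to vectors v s in Z (p s), where p s and q s are the last members of the two flags that
  contain e s. The inclusion of t Z i in Z (i + 1) forces p s < q s.\<close>

lemma two_step_normal_form:
  assumes Z0: "Z 0 = std 0" and Zm: "Z m = std 2"
    and Om: "\<And>i. i \<le> m \<Longrightarrow> Omod (Z i)"
    and dec: "\<And>i. i < m \<Longrightarrow> Z (Suc i) \<subseteq> Z i" and t: "\<And>i. i < m \<Longrightarrow> tim 1 (Z i) \<subseteq> Z (Suc i)"
  shows "\<exists>g h p q. g ** h = mat 1 \<and> h ** g = mat 1 \<and> (\<forall>s. p s < q s \<and> q s < m) \<and>
    (\<forall>i\<le>m. (*v) h ` Z i = {c. \<forall>s. ordge (two_step p q i s) (c $ s)})"
proof -
  \<comment> \<open>Continued constantly beyond m, since \<open>two_flags\<close> speaks of families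
    over all natural numbers.\<close>
  define W where "W i = Z (min i m)" for i
  have OW: "Omod (W i)" for i using Om by (simp add: W_def)
  have decW: "W (Suc i) \<subseteq> W i" for i
    using dec[of i] by (cases "i < m") (auto simp: W_def min_def)
  have antiW: "W j \<subseteq> W i" if "i \<le> j" for i j
    using that by (rule lift_Suc_antimono_le[of W, rotated]) (use decW in auto)
  have tW: "tim 1 (W i) \<subseteq> W (Suc i)" if "i < m" for i
    using t[of i] that by (simp add: W_def min_def)
  have W0: "W 0 = std 0" and Wm: "W i = std 2" if "m \<le> i" for i
    using Z0 Zm that by (auto simp: W_def)
  have W0: "W 0 = std 0" using Z0 by (simp add: W_def)
  have Wsub: "W i \<subseteq> std 0" for i using antiW[of 0 i] W0 by simp
  have m0: "0 < m"
  proof (rule ccontr)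
    assume "\<not> 0 < m"
    then have "std 0 = std 2" using Z0 Zm by simp
    moreover have "vec 1 \<in> std 0" "vec 1 \<notin> std 2" by (auto simp: std_def ordge_def)
    ultimately show False by blast
  qed
  let ?F = "\<lambda>i. ev ` W i" and ?G = "\<lambda>i. ev ` (tim (- 1) (W i) \<inter> std 0)"
  have OG: "Omod (tim (- 1) (W i) \<inter> std 0)" for i
    using Omod_tim[OF OW[of i], of "- 1"] Omod_std[of 0] unfolding Omod_def by auto
  have full: "ev ` std 0 = UNIV" using ev_surj by (metis UNIV_eq_I image_eqI)
  have zero: "ev ` std k = {0}" if "1 \<le> k" for k
  proof -
    have "std k \<subseteq> std 1" using that by (rule std_mono)
    then show ?thesis using ev_0_iff std_mono[of 0 1] OmodD(1)[OF Omod_std[of k]] ev_linear(3)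
      by (auto simp: image_iff subset_eq)
  qed
  obtain Bs where Bs: "vec.independent Bs" "vec.span Bs = UNIV"
    "\<And>i. vec.span (Bs \<inter> ?F i) = ?F i" "\<And>i. vec.span (Bs \<inter> ?G i) = ?G i"
  proof -
    have "\<exists>B\<subseteq>UNIV. vec.independent B \<and> vec.span B = UNIV \<and>
      (\<forall>i. vec.span (B \<inter> ?F i) = UNIV \<inter> ?F i) \<and> (\<forall>i. vec.span (B \<inter> ?G i) = UNIV \<inter> ?G i)"
    proof (rule two_flags[where m = m])
      show "vec.subspace (?F i)" "vec.subspace (?G i)" for i
        using ev_subspace OW OG by auto
      show "?F 0 = UNIV" using full W0 by simp
      show "?F m = {0}" using zero[of 2] Wm[of m] by simp
      show "?F (Suc i) \<subseteq> ?F i" "?G (Suc i) \<subseteq> ?G i" for i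
        using decW[of i] tim_mono[OF decW[of i], of "- 1"] by auto
      have "std 0 \<subseteq> std (- 1)" by (rule std_mono) simp
      then show "?G 0 = UNIV" using W0 full by (simp add: Int_absorb1)
      have "std 1 \<subseteq> std 0" by (rule std_mono) simp
      then show "?G m = {0}" using Wm[of m] zero[of 1] by (simp add: Int_absorb2)
    qed (simp add: vec.subspace_UNIV)
    then show ?thesis using that by auto
  qed
  have cardB: "card Bs = 3"
    using vec.dim_eq_card[of Bs UNIV] Bs vec.dim_UNIV card_cart_basis[where 'a = complex and 'i = 3]
    by (simp add: vec.span_UNIV)
  then have "finite Bs" by (metis card.infinite zero_neq_numeral)
  then obtain e :: "3 \<Rightarrow> complex ^ 3" where e: "bij_betw e UNIV Bs"
    using finite_same_card_bij[of "UNIV :: 3 set" Bs] cardB by auto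
  have e_in: "e s \<in> Bs" for s using e by (auto simp: bij_betw_def)
  have e_inj: "e s = e r \<longleftrightarrow> s = r" for s r using e by (auto simp: bij_betw_def inj_on_def)
  have e_nz: "e s \<noteq> 0" for s using e_in[of s] Bs(1) vec.dependent_zero by metis
  have span_e: "\<exists>\<alpha>. x = (\<Sum>s\<in>UNIV. \<alpha> s *s e s) \<and> (\<forall>s. e s \<notin> S \<longrightarrow> \<alpha> s = 0)"
    if "x \<in> vec.span (Bs \<inter> S)" for x S
  proof -
    have "x \<in> range (\<lambda>u. \<Sum>v\<in>Bs \<inter> S. u v *s v)"
      using that vec.span_finite[of "Bs \<inter> S"] \<open>finite Bs\<close> by simp
    then obtain u where u: "x = (\<Sum>v\<in>Bs \<inter> S. u v *s v)" by blast
    also have "\<dots> = (\<Sum>v\<in>Bs. (if v \<in> S then u v else 0) *s v)"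
      by (rule sum.mono_neutral_cong_left) (use \<open>finite Bs\<close> in auto)
    also have "\<dots> = (\<Sum>s\<in>UNIV. (if e s \<in> S then u (e s) else 0) *s e s)"
      by (rule sum.reindex_bij_betw[OF e, symmetric])
    finally show ?thesis by (intro exI[of _ "\<lambda>s. if e s \<in> S then u (e s) else 0"]) auto
  qed
  have e_indep: "\<alpha> s = 0" if "(\<Sum>s\<in>UNIV. \<alpha> s *s e s) = 0" for \<alpha> s
  proof -
    have "(\<Sum>v\<in>Bs. \<alpha> (the_inv_into UNIV e v) *s v) = (\<Sum>s\<in>UNIV. \<alpha> s *s e s)"
      using sum.reindex_bij_betw[OF e, of "\<lambda>v. \<alpha> (the_inv_into UNIV e v) *s v"]
        e by (simp add: bij_betw_def the_inv_into_f_f)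
    then have "\<alpha> (the_inv_into UNIV e (e s)) = 0"
      using vec.independentD[OF Bs(1) \<open>finite Bs\<close> order_refl _ e_in, of "\<lambda>v. \<alpha> (the_inv_into UNIV e v)"] that by simp
    then show ?thesis using e by (simp add: bij_betw_def the_inv_into_f_f)
  qed
  have thresh: "\<exists>p<m. \<forall>i. x \<in> S i \<longleftrightarrow> i \<le> p"
    if t1: "x \<in> S 0" "x \<notin> S m" and "\<And>i. S (Suc i) \<subseteq> S i" for x :: "complex ^ 3" and S :: "nat \<Rightarrow> (complex ^ 3) set"
  proof -
    have anti: "S j \<subseteq> S i" if "i \<le> j" for i j
      using that by (rule lift_Suc_antimono_le[of S, rotated]) (use \<open>\<And>i. S (Suc i) \<subseteq> S i\<close> in auto)
    obtain p where p: "p < m" "\<forall>i\<le>p. x \<in> S i" "x \<notin> S (Suc p)"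
      using ex_least_nat_less[of "\<lambda>i. x \<notin> S i" m] t1 by blast
    have "x \<in> S i \<longleftrightarrow> i \<le> p" for i
      using p anti[of "Suc p" i] by (meson not_less_eq_eq subsetD)
    then show ?thesis using p(1) by blast
  qed
  have "std 0 \<subseteq> std (- 1)" by (rule std_mono) simp
  then have G0: "?G 0 = UNIV" using W0 full by (simp add: Int_absorb1)
  have "std 1 \<subseteq> std 0" by (rule std_mono) simp
  then have Gm: "?G m = {0}" using Wm[of m] zero[of 1] by (simp add: Int_absorb2)
  have "\<exists>p<m. \<forall>i. e s \<in> ?F i \<longleftrightarrow> i \<le> p" for s
  proof (rule thresh)
    show "e s \<in> ?F 0" using full W0 by simp
    show "e s \<notin> ?F m" using zero[of 2] Wm[of m] e_nz by simp
    show "?F (Suc i) \<subseteq> ?F i" for i using decW[of i] by auto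
  qed
  then obtain p where p: "\<And>s. p s < m" "\<And>s i. e s \<in> ?F i \<longleftrightarrow> i \<le> p s" by metis
  have "\<exists>q<m. \<forall>i. e s \<in> ?G i \<longleftrightarrow> i \<le> q" for s
  proof (rule thresh)
    show "e s \<in> ?G 0" using G0 by simp
    show "e s \<notin> ?G m" using Gm e_nz by simp
    show "?G (Suc i) \<subseteq> ?G i" for i using tim_mono[OF decW[of i], of "- 1"] by auto
  qed
  then obtain q where q: "\<And>s. q s < m" "\<And>s i. e s \<in> ?G i \<longleftrightarrow> i \<le> q s" by metis
  have "\<forall>s. \<exists>z\<in>W (p s). ev z = e s" using p(2) by (metis imageE order_refl)
  then obtain v where v: "\<And>s. v s \<in> W (p s)" "\<And>s. ev (v s) = e s" by metis
  have v0: "v s \<in> std 0" for s using v Wsub by blast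
  have pq: "p s < q s" for s
  proof -
    have "tp 1 *s v s \<in> W (Suc (p s))" using tW[OF p(1)[of s]] v(1)[of s] by auto
    then have "v s \<in> tim (- 1) (W (Suc (p s))) \<inter> std 0" using v0 by (simp add: tim_def)
    then have "e s \<in> ?G (Suc (p s))" using v(2)[of s] by (metis imageI)
    then show ?thesis using q(2) by auto
  qed
  have ev_vlin: "ev (vlin c v) = (\<Sum>s\<in>UNIV. (c s $$ 0) *s e s)" if "\<And>s. ordge 0 (c s)" for c
    unfolding vlin_def ev_sum by (rule sum.cong) (simp_all add: ev_scale that v0 v(2))
  interpret A: adapted_vectors "std 0" v
  proof
    fix z assume z: "z \<in> std 0"
    obtain \<alpha> where \<alpha>: "ev z = (\<Sum>s\<in>UNIV. \<alpha> s *s e s)" using span_e[of "ev z" UNIV] Bs(2) by auto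
    have "vlin (\<lambda>s. fls_const (\<alpha> s)) v \<in> std 0"
      unfolding vlin_def by (intro Omod_sum OmodD(6)) (simp_all add: v0)
    then have "z - vlin (\<lambda>s. fls_const (\<alpha> s)) v \<in> std 0" using z by (intro OmodD(5)) auto
    moreover have "ev (z - vlin (\<lambda>s. fls_const (\<alpha> s)) v) = 0"
      unfolding ev_linear by (simp add: ev_vlin \<alpha>)
    ultimately show "\<exists>\<alpha>. z - vlin (\<lambda>s. fls_const (\<alpha> s)) v \<in> tim 1 (std 0)"
      using ev_0_iff by auto
  qed (auto simp: v0)
  have std2: "std 2 \<subseteq> W i" for i using antiW[of i "max i m"] Wm[of "max i m"] by simp
  have key: "tp (two_step p q i s) *s v s \<in> W i" for i s
  proof -
    consider "i \<le> p s" | "p s < i" "i \<le> q s" | "q s < i" by linarith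
    then show ?thesis
    proof cases
      case 1
      then show ?thesis using pq[of s] v(1)[of s] antiW[OF 1] by (auto simp: two_step_def)
    next
      case 2
      have "e s \<in> ?G (q s)" using q(2) by blast
      then obtain z where z: "tp 1 *s z \<in> W (q s)" "z \<in> std 0" "ev z = e s" by (auto simp: tim_def)
      \<comment> \<open>The second flag supplies another lift z of e s. The two lifts agree modulo
        t, so t times their difference lies in \<open>std 2\<close>, which every W i
        contains.\<close>
      have "v s - z \<in> std 0" using v0 z by (intro OmodD(5)) auto
      then have "v s - z \<in> std 1" using ev_0_iff[of "v s - z"] by (simp add: ev_linear v(2) z)
      then have "tp 1 *s (v s - z) \<in> std 2" by (simp add: std_def)
      then have "tp 1 *s z + tp 1 *s (v s - z) \<in> W (q s)"
        using z std2 by (intro OmodD(2)[OF OW]) auto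
      then have "tp 1 *s v s \<in> W (q s)" by (simp add: vec.scale_right_diff_distrib)
      then show ?thesis using 2 antiW[OF 2(2)] by (auto simp: two_step_def)
    next
      case 3
      have "tp 2 *s v s \<in> std 2" using v0[of s] by (simp add: std_def)
      then show ?thesis using 3 pq[of s] std2[of i] by (auto simp: two_step_def)
    qed
  qed
  have mem: "z \<in> W i \<longleftrightarrow> (\<forall>s. ordge (two_step p q i s) ((A.h *v z) $ s))" for z i
  proof
    assume r: "\<forall>s. ordge (two_step p q i s) ((A.h *v z) $ s)"
    have "vlin (\<lambda>s. (A.h *v z) $ s) v \<in> W i"
      unfolding vlin_def
    proof (rule Omod_sum[OF OW])
      fix s
      let ?k = "two_step p q i s" and ?c = "(A.h *v z) $ s"
      have m1: "(tp (- ?k) * ?c) *s (tp ?k *s v s) \<in> W i"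
        using r by (intro OmodD(3)[OF OW] key) simp
      have "tp (- ?k) * ?c * tp ?k = ?c"
        by (simp add: mult.commute[of _ ?c] mult.assoc tp_mult_tp)
      then have eq: "(tp (- ?k) * ?c) *s (tp ?k *s v s) = ?c *s v s"
        by (simp only: vector_smult_assoc)
      show "?c *s v s \<in> W i" using m1 unfolding eq .
    qed
    then show "z \<in> W i" by (simp flip: A.g_mult)
  next
    assume z: "z \<in> W i"
    define c where "c s = (A.h *v z) $ s" for s
    have zc: "z = vlin c v" unfolding c_def by (simp flip: A.g_mult)
    have c0: "ordge 0 (c s)" for s using z Wsub[of i] A.mem_iff[of z] by (auto simp: c_def std_def)
    have coef: "d s $$ 0 = 0" if d: "\<And>s. ordge 0 (d s)" and e: "ev (vlin d v) \<in> vec.span (Bs \<inter> S)" "e s \<notin> S" for d S s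
    proof -
      obtain \<alpha> where \<alpha>: "ev (vlin d v) = (\<Sum>s\<in>UNIV. \<alpha> s *s e s)" "\<forall>s. e s \<notin> S \<longrightarrow> \<alpha> s = 0"
        using span_e[OF e(1)] by blast
      have "(\<Sum>s\<in>UNIV. (d s $$ 0 - \<alpha> s) *s e s) = 0"
        using \<alpha>(1) by (simp add: ev_vlin d vec.scale_left_diff_distrib sum_subtractf)
      then show ?thesis using e_indep[of "\<lambda>s. d s $$ 0 - \<alpha> s"] \<alpha>(2) e(2) by auto
    qed
    have c1: "c s $$ 0 = 0" if "p s < i" for s
      by (rule coef[of c "?F i"]) (use c0 z that in \<open>auto simp: Bs(3) zc[symmetric] p(2)\<close>)
    \<comment> \<open>The summands left out have v s in W i, so what is kept still lies in W i. It
      is divisible by t, and its quotient by t has its residue in the second flag.\<close>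
    define d where "d s = (if p s < i then c s else 0)" for s
    have d1: "ordge 1 (d s)" for s using c0 c1 by (auto simp: d_def ordge_1_iff)
    have "vlin (\<lambda>s. c s - d s) v \<in> W i"
      unfolding vlin_def
    proof (rule Omod_sum[OF OW])
      fix s
      show "(c s - d s) *s v s \<in> W i"
      proof (cases "p s < i")
        case True
        then show ?thesis using OmodD(1)[OF OW] by (simp add: d_def)
      next
        case False
        then have "v s \<in> W i" using v(1)[of s] antiW[of i "p s"] by auto
        then show ?thesis using c0 False by (auto simp: d_def intro: OmodD(3)[OF OW])
      qed
    qed
    then have "z - vlin (\<lambda>s. c s - d s) v \<in> W i" using z by (intro OmodD(5)[OF OW])
    moreover have "z - vlin (\<lambda>s. c s - d s) v = vlin d v"
      unfolding zc by (simp add: vlin_def vec.scale_left_diff_distrib flip: sum_subtractf)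
    moreover have "vlin d v = tp 1 *s vlin (\<lambda>s. tp (- 1) * d s) v"
      by (simp add: vlin_def vec.scale_sum_right mult.assoc[symmetric] tp_mult_tp)
    ultimately have "vlin (\<lambda>s. tp (- 1) * d s) v \<in> tim (- 1) (W i)" by (simp add: tim_def)
    moreover have "vlin (\<lambda>s. tp (- 1) * d s) v \<in> std 0"
      using d1 by (intro A.vlin_in) simp
    ultimately have "ev (vlin (\<lambda>s. tp (- 1) * d s) v) \<in> ?G i" by blast
    then have dz: "(tp (- 1) * d s) $$ 0 = 0" if "q s < i" for s
      by (intro coef[of _ "?G i"]) (use d1 that in \<open>auto simp: Bs(4) q(2)\<close>)
    have c2: "c s $$ 1 = 0" if "q s < i" for s
    proof -
      have "p s < i" using that pq[of s] by linarith
      then show ?thesis using dz[OF that] by (simp add: tp_nth d_def)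
    qed
    have "ordge 2 (c s)" if "q s < i" for s
    proof -
      have "m < 2 \<Longrightarrow> m < 0 \<or> m = 0 \<or> m = 1" for m :: int by linarith
      then show ?thesis using c0[of s] c1[of s] c2[of s] that pq[of s] unfolding ordge_def
        by (metis order_less_trans)
    qed
    moreover have "p s < i" if "q s < i" for s using pq[of s] that by linarith
    ultimately show "\<forall>s. ordge (two_step p q i s) ((A.h *v z) $ s)"
      using c0 c1 unfolding c_def[symmetric] two_step_def
      by (auto simp: ordge_1_iff)
  qed
  have "(*v) A.h ` Z i = {c. \<forall>s. ordge (two_step p q i s) (c $ s)}" if "i \<le> m" for i
  proof -
    have "W i = Z i" using that by (simp add: W_def min_def)
    then have "z \<in> Z i \<longleftrightarrow> (\<forall>s. ordge (two_step p q i s) ((A.h *v z) $ s))" for z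
      using mem[of z i] by argo
    then show ?thesis by (auto simp: image_iff intro!: bexI[of _ "A.g *v _"])
  qed
  then show ?thesis using A.gh pq q(1)
    by (intro exI[of _ A.g] exI[of _ A.h] exI[of _ p] exI[of _ q]) auto
qed

section \<open>Diagonal lattices and operators of rank one\<close>

definition dset :: "(3 \<Rightarrow> int) \<Rightarrow> V set" where
  "dset a = {z. \<forall>s. ordge (a s) (z $ s)}"

lemma Omod_dset [simp]: "Omod (dset a)"
  by (auto simp: Omod_def dset_def ordge_add ordge_mult0)

lemma tim_dset: "tim k (dset a) = dset (\<lambda>s. a s + k)"
  by (auto simp: tim_def dset_def)

lemma std_dset: "std k = dset (\<lambda>_. k)"
  by (simp add: std_def dset_def)

lemma dset_mono: "(\<And>s. b s \<le> a s) \<Longrightarrow> dset a \<subseteq> dset b"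
  by (auto simp: dset_def intro: ordge_mono)

lemma ordge_sum: "(\<And>s. s \<in> S \<Longrightarrow> ordge k (f s)) \<Longrightarrow> ordge k (sum f S)"
  by (induction S rule: infinite_finite_induct) (auto intro: ordge_add)

lemma ordge_const_mult: "ordge k c \<Longrightarrow> ordge k (fls_const x * c)"
  by (rule ordge_mult0) auto

lemma sum_labels:
  fixes f :: "3 \<Rightarrow> 'a::comm_monoid_add"
  assumes "UNIV = {r, s, u}" "r \<noteq> s" "r \<noteq> u" "s \<noteq> u"
  shows "(\<Sum>i\<in>UNIV. f i) = f r + (f s + f u)"
  by (subst assms(1)) (use assms(2-4) in simp)

lemma third_label:
  fixes r s :: 3
  assumes "r \<noteq> s"
  obtains u where "UNIV = {r, s, u}" "r \<noteq> u" "s \<noteq> u"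
proof -
  obtain a b where ab: "UNIV = {r, a, b}" "r \<noteq> a" "r \<noteq> b" "a \<noteq> b" by (rule three_others)
  have "s = a \<or> s = b" using ab(1) assms(1) by (metis UNIV_I insertE singletonD)
  then show ?thesis using ab that[of a] that[of b] by auto
qed

lemma ex_max_3: "\<exists>u. \<forall>r. f r \<le> f u" for f :: "3 \<Rightarrow> nat"
proof -
  have "Max (range f) \<in> range f" by (rule Max_in) auto
  then obtain u where u: "Max (range f) = f u" by blast
  have "f r \<le> f u" for r unfolding u[symmetric] by (rule Max_ge) auto
  then show ?thesis by blast
qed

lemma ex_min_3: "\<exists>u. \<forall>r. f u \<le> f r" for f :: "3 \<Rightarrow> nat"
proof -
  have "Min (range f) \<in> range f" by (rule Min_in) auto
  then obtain u where u: "Min (range f) = f u" by blast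
  have "f u \<le> f r" for r unfolding u[symmetric] by (rule Min_le) auto
  then show ?thesis by blast
qed

definition rk1 :: "(3 \<Rightarrow> int) \<Rightarrow> (3 \<Rightarrow> complex) \<Rightarrow> (3 \<Rightarrow> complex) \<Rightarrow> V \<Rightarrow> V" where
  "rk1 b \<alpha> \<beta> z = (\<chi> s. tp (b s) * (fls_const (\<alpha> s) * (\<Sum>r\<in>UNIV. fls_const (\<beta> r) * (tp (- b r) * z $ r))))"

lemma splits_rk1:
  assumes "(\<Sum>s\<in>UNIV. \<alpha> s * \<beta> s) = 1" "\<And>X z. X \<in> \<X> \<Longrightarrow> z \<in> X \<Longrightarrow> rk1 b \<alpha> \<beta> z \<in> X"
  shows "splits \<X>"
  using splits_rank1[OF assms(1), of \<X> b] assms(2) unfolding rk1_def by blast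

lemma rk1_dset:
  assumes "z \<in> dset a" "\<And>r s. \<alpha> s \<noteq> 0 \<Longrightarrow> \<beta> r \<noteq> 0 \<Longrightarrow> a' s - b s \<le> a r - b r"
  shows "rk1 b \<alpha> \<beta> z \<in> dset a'"
proof -
  have "ordge (a' s) (rk1 b \<alpha> \<beta> z $ s)" for s
  proof (cases "\<alpha> s = 0")
    case False
    have "ordge (a' s - b s) (fls_const (\<beta> r) * (tp (- b r) * z $ r))" for r
    proof (cases "\<beta> r = 0")
      case False
      have "ordge (a r - b r) (tp (- b r) * z $ r)" using assms(1) by (auto simp: dset_def)
      then show ?thesis using assms(2)[OF \<open>\<alpha> s \<noteq> 0\<close> False] by (meson ordge_const_mult ordge_mono)
    qed simp
    then show ?thesis by (simp add: rk1_def ordge_const_mult ordge_sum)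
  qed (simp add: rk1_def)
  then show ?thesis by (simp add: dset_def)
qed

text \<open>This is the projection onto coordinate s. If the two bounds meet at s, the image of Y
  lies in the inner lattice; if they meet at all other labels, the image under the complementary
  projection does.\<close>

lemma splits_projection:
  assumes "\<And>Y. Y \<in> \<X> \<Longrightarrow> Omod Y \<and> (\<exists>a b. Y \<subseteq> dset a \<and> dset b \<subseteq> Y \<and> (b s \<le> a s \<or> (\<forall>r. r \<noteq> s \<longrightarrow> b r \<le> a r)))"
  shows "splits \<X>"
proof (rule splits_rk1[where b = "\<lambda>_. 0" and \<alpha> = "\<lambda>r. if r = s then 1 else 0" and \<beta> = "\<lambda>r. if r = s then 1 else 0"])
  have "(\<Sum>r\<in>UNIV. (if r = s then 1 else 0) * (if r = s then 1 else 0)) = (\<Sum>r\<in>UNIV. if r = s then 1 else 0 :: complex)"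
    by (rule sum.cong) auto
  then show "(\<Sum>r\<in>UNIV. (if r = s then 1 else 0) * (if r = s then 1 else 0)) = (1 :: complex)" by simp
  fix Y z assume Y: "Y \<in> \<X>" and z: "z \<in> Y"
  let ?p = "rk1 (\<lambda>_. 0) (\<lambda>r. if r = s then 1 else 0) (\<lambda>r. if r = s then 1 else 0) z"
  have p: "?p $ r = (if r = s then z $ s else 0)" for r
  proof -
    have "(\<Sum>i\<in>UNIV. fls_const (if i = s then 1 else 0) * z $ i) = (\<Sum>i\<in>UNIV. if i = s then z $ i else 0)"
      by (rule sum.cong) auto
    then show ?thesis by (simp add: rk1_def)
  qed
  obtain a b where ab: "Y \<subseteq> dset a" "dset b \<subseteq> Y" "b s \<le> a s \<or> (\<forall>r. r \<noteq> s \<longrightarrow> b r \<le> a r)"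
    using assms[OF Y] by blast
  have za: "ordge (a r) (z $ r)" for r using ab(1) z by (auto simp: dset_def)
  show "?p \<in> Y"
  proof (cases "b s \<le> a s")
    case True
    then have "?p \<in> dset b" using za[of s] by (auto simp: dset_def p intro: ordge_mono)
    then show ?thesis using ab by blast
  next
    case False
    then have le: "\<forall>r. r \<noteq> s \<longrightarrow> b r \<le> a r" using ab by blast
    have "(z - ?p) $ r = (if r = s then 0 else z $ r)" for r by (simp add: p)
    then have "z - ?p \<in> dset b" using za le unfolding dset_def by (auto intro: ordge_mono)
    then have "z - ?p \<in> Y" using ab(2) by blast
    moreover have "Omod Y" using assms[OF Y] by blast
    ultimately have "z - (z - ?p) \<in> Y" using z OmodD(5) by blast
    then show ?thesis by simp
  qed
qed

text \<open>Between \<open>std 1\<close> and \<open>std 0\<close> only residues count: if alpha is a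
  residue of Y the image lies in Y, and if beta kills all residues of Y the image lies in
  \<open>std 1\<close>.\<close>

lemma rk1_between:
  assumes O: "Omod Y" and A: "std 1 \<subseteq> Y" "Y \<subseteq> std 0" and z: "z \<in> Y"
    and c: "(\<exists>w\<in>Y. \<forall>s. (w $ s) $$ 0 = \<alpha> s) \<or> (\<forall>w\<in>Y. (\<Sum>r\<in>UNIV. \<beta> r * (w $ r) $$ 0) = 0)"
  shows "rk1 (\<lambda>_. 0) \<alpha> \<beta> z \<in> Y"
proof -
  let ?f = "\<Sum>r\<in>UNIV. fls_const (\<beta> r) * z $ r"
  let ?a = "(\<chi> s. fls_const (\<alpha> s)) :: V"
  have z0: "ordge 0 (z $ s)" for s using A z by (auto simp: std_def)
  have f0: "ordge 0 ?f" using z0 by (intro ordge_sum ordge_const_mult)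
  have rk: "rk1 (\<lambda>_. 0) \<alpha> \<beta> z = ?f *s ?a" by (simp add: rk1_def vec_eq_iff mult.commute)
  have fn: "?f $$ 0 = (\<Sum>r\<in>UNIV. \<beta> r * (z $ r) $$ 0)" by (simp add: sum_3)
  from c show ?thesis
  proof
    assume "\<exists>w\<in>Y. \<forall>s. (w $ s) $$ 0 = \<alpha> s"
    then obtain w where w: "w \<in> Y" "\<And>s. (w $ s) $$ 0 = \<alpha> s" by blast
    have "ordge 0 (w $ s)" for s using A w by (auto simp: std_def)
    then have "?a - w \<in> std 1"
      by (auto simp: std_def ordge_1_iff w intro!: ordge_diff)
    then have "(?a - w) + w \<in> Y" using A w O by (intro OmodD(2)) auto
    then have "?a \<in> Y" by simp
    then show ?thesis unfolding rk using O f0 by (intro OmodD(3))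
  next
    assume "\<forall>w\<in>Y. (\<Sum>r\<in>UNIV. \<beta> r * (w $ r) $$ 0) = 0"
    then have "?f $$ 0 = 0" using z fn by simp
    then have "ordge 1 ?f" using f0 by (simp add: ordge_1_iff)
    then have "?f *s ?a \<in> std 1"
      using ordge_mult[of 1 ?f 0] by (auto simp: std_def)
    then show ?thesis unfolding rk using A by blast
  qed
qed

lemma smult_dset: "ordge k f \<Longrightarrow> w \<in> dset b \<Longrightarrow> f *s w \<in> dset (\<lambda>s. b s + k)"
  unfolding dset_def
proof (intro CollectI allI)
  fix s assume "ordge k f" "w \<in> {z. \<forall>s. ordge (b s) (z $ s)}"
  then show "ordge (b s + k) ((f *s w) $ s)"
    using ordge_mult[of k f "b s" "w $ s"] by (simp add: add.commute)
qed

subsection \<open>Subspaces of a three-dimensional space\<close>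

definition dot :: "(3 \<Rightarrow> complex) \<Rightarrow> (3 \<Rightarrow> complex) \<Rightarrow> complex" where
  "dot a b = (\<Sum>s\<in>UNIV. a s * b s)"

definition fsub :: "(3 \<Rightarrow> complex) set \<Rightarrow> bool" where
  "fsub q \<longleftrightarrow> (\<lambda>_. 0) \<in> q \<and> (\<forall>x\<in>q. \<forall>y\<in>q. \<forall>a b. (\<lambda>s. a * x s + b * y s) \<in> q)"

text \<open>Two independent vectors of q have a cross product l, and the plane orthogonal to l is
  their span. Without such vectors q lies on a line.\<close>

lemma fsub_dichotomy:
  assumes q: "fsub q"
  shows "(\<exists>x. x \<noteq> (\<lambda>_. 0) \<and> q \<subseteq> {\<lambda>s. c * x s | c. True}) \<or> (\<exists>l. l \<noteq> (\<lambda>_. 0) \<and> {z. dot l z = 0} \<subseteq> q)"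
proof (cases "\<exists>x\<in>q. \<exists>y\<in>q. \<exists>i j. x i * y j \<noteq> x j * y i")
  case True
  then obtain x y i j where xy: "x \<in> q" "y \<in> q" "x i * y j \<noteq> x j * y i" by blast
  then have "i \<noteq> j" by auto
  obtain k where k: "UNIV = {i, j, k}" "i \<noteq> k" "j \<noteq> k"
    using third_label[OF \<open>i \<noteq> j\<close>] by blast
  define l where "l = (\<lambda>s. if s = i then x j * y k - x k * y j else if s = j then x k * y i - x i * y k
      else x i * y j - x j * y i)"
  have lv: "l i = x j * y k - x k * y j" "l j = x k * y i - x i * y k" "l k = x i * y j - x j * y i"
    using k \<open>i \<noteq> j\<close> by (auto simp: l_def)
  have "{z. dot l z = 0} \<subseteq> q"
  proof
    fix z assume "z \<in> {z. dot l z = 0}"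
    then have d: "l i * z i + (l j * z j + l k * z k) = 0"
      by (simp add: dot_def sum_labels[OF k(1) \<open>i \<noteq> j\<close> k(2,3)])
    define D where "D = x i * y j - x j * y i"
    have D: "D \<noteq> 0" using xy(3) by (simp add: D_def)
    let ?a = "(z i * y j - z j * y i) / D" and ?b = "(x i * z j - x j * z i) / D"
    \<comment> \<open>Cramer's rule for z in the span of x and y, with D the entry of the cross
      product at k. Only the coordinate k uses that z is orthogonal to l.\<close>
    have eq: "D * z s = (z i * y j - z j * y i) * x s + (x i * z j - x j * z i) * y s" for s
    proof -
      have "s = i \<or> s = j \<or> s = k" using k(1) by (metis UNIV_I insertE singletonD)
      then show ?thesis
      proof (elim disjE)
        assume sk: "s = k"
        show ?thesis using d unfolding lv D_def sk by Groebner_Basis.algebra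
      qed (auto simp: D_def algebra_simps)
    qed
    have "z = (\<lambda>s. ?a * x s + ?b * y s)"
    proof
      fix s
      have "z s = (D * z s) / D" using D by simp
      also have "\<dots> = ?a * x s + ?b * y s" unfolding eq by (simp add: add_divide_distrib)
      finally show "z s = ?a * x s + ?b * y s" .
    qed
    then show "z \<in> q" using q xy unfolding fsub_def by metis
  qed
  moreover have "l \<noteq> (\<lambda>_. 0)" using lv(3) xy(3) by (auto simp: fun_eq_iff intro!: exI[of _ k])
  ultimately show ?thesis by blast
next
  case False
  show ?thesis
  proof (cases "\<exists>x\<in>q. x \<noteq> (\<lambda>_. 0)")
    case True
    then obtain x i where x: "x \<in> q" "x i \<noteq> 0" by (auto simp: fun_eq_iff)
    have "y = (\<lambda>s. (y i / x i) * x s)" if "y \<in> q" for y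
    proof
      fix s
      have "x i * y s = x s * y i" using False x(1) that by blast
      then show "y s = (y i / x i) * x s" using x(2) by (simp add: field_simps)
    qed
    then have "q \<subseteq> {\<lambda>s. c * x s | c. True}" by blast
    then show ?thesis using x(2) by (intro disjI1 exI[of _ x]) auto
  next
    case False
    have "q \<subseteq> {\<lambda>s. c * 1 | c. True}" using False by force
    then show ?thesis by (intro disjI1 exI[of _ "\<lambda>_. 1"]) (auto simp: fun_eq_iff)
  qed
qed


lemma dot_labels:
  assumes "UNIV = {r, s, u}" "r \<noteq> s" "r \<noteq> u" "s \<noteq> u"
  shows "dot a b = a r * b r + (a s * b s + a u * b u)"
  unfolding dot_def by (rule sum_labels[OF assms])

text \<open>The support condition says that the matrix unit from label r to label s preserves every
  \<open>dset (two_step p q i)\<close>: the exponent of s rises no earlier than that of r.\<close>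

definition allowed :: "(3 \<Rightarrow> nat) \<Rightarrow> (3 \<Rightarrow> nat) \<Rightarrow> (3 \<Rightarrow> complex) \<Rightarrow> (3 \<Rightarrow> complex) \<Rightarrow> bool" where
  "allowed p q \<alpha> \<beta> \<longleftrightarrow> dot \<alpha> \<beta> = 1 \<and> (\<forall>r s. \<alpha> s \<noteq> 0 \<longrightarrow> \<beta> r \<noteq> 0 \<longrightarrow> p r \<le> p s \<and> q r \<le> q s)"

text \<open>The ways in which z -> (beta . z) alpha can preserve a subspace: the image lies in it,
  or it lies in the kernel.\<close>

definition fixes_sub :: "(3 \<Rightarrow> complex) \<Rightarrow> (3 \<Rightarrow> complex) \<Rightarrow> (3 \<Rightarrow> complex) set \<Rightarrow> bool" where
  "fixes_sub \<alpha> \<beta> A \<longleftrightarrow> \<alpha> \<in> A \<or> (\<forall>w\<in>A. dot \<beta> w = 0)"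

lemma kill_line:
  assumes "r \<noteq> s" "p r \<le> p s" "q r \<le> q s"
  shows "\<exists>\<alpha> \<beta>. allowed p q \<alpha> \<beta> \<and> dot \<beta> x = 0"
proof -
  obtain u where u: "UNIV = {r, s, u}" "r \<noteq> u" "s \<noteq> u"
    using third_label[OF assms(1)] by blast
  note L = dot_labels[OF u(1) assms(1) u(2,3)]
  show ?thesis
  proof (cases "x r = 0")
    case True
    let ?e = "\<lambda>i. if i = r then 1 else 0 :: complex"
    show ?thesis
      by (rule exI[of _ ?e], rule exI[of _ ?e]) (use u assms True in \<open>auto simp: allowed_def L split: if_splits\<close>)
  next
    case False
    let ?a = "\<lambda>i. if i = s then 1 else 0 :: complex"
    let ?b = "\<lambda>i. if i = s then 1 else if i = r then - (x s / x r) else 0 :: complex"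
    show ?thesis
      by (rule exI[of _ ?a], rule exI[of _ ?b]) (use u assms False in \<open>auto simp: allowed_def L split: if_splits\<close>)
  qed
qed

text \<open>The transposed form of \<open>kill_line\<close>: now alpha is corrected at s so as to
  fall into the plane.\<close>

lemma in_plane:
  assumes "r \<noteq> s" "p r \<le> p s" "q r \<le> q s"
  shows "\<exists>\<alpha> \<beta>. allowed p q \<alpha> \<beta> \<and> dot l \<alpha> = 0"
proof -
  obtain u where u: "UNIV = {r, s, u}" "r \<noteq> u" "s \<noteq> u"
    using third_label[OF assms(1)] by blast
  note L = dot_labels[OF u(1) assms(1) u(2,3)]
  show ?thesis
  proof (cases "l s = 0")
    case True
    let ?e = "\<lambda>i. if i = s then 1 else 0 :: complex"
    show ?thesis
      by (rule exI[of _ ?e], rule exI[of _ ?e]) (use u assms True in \<open>auto simp: allowed_def L split: if_splits\<close>)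
  next
    case False
    let ?a = "\<lambda>i. if i = r then 1 else if i = s then - (l r / l s) else 0 :: complex"
    let ?b = "\<lambda>i. if i = r then 1 else 0 :: complex"
    show ?thesis
      by (rule exI[of _ ?a], rule exI[of _ ?b]) (use u assms False in \<open>auto simp: allowed_def L split: if_splits\<close>)
  qed
qed

lemma dot_scale: "dot \<beta> (\<lambda>s. c * x s) = c * dot \<beta> x" "dot (\<lambda>s. c * x s) \<beta> = c * dot x \<beta>"
  by (simp_all add: dot_def sum_distrib_left mult_ac)

lemma dot_commute: "dot a b = dot b a"
  by (simp add: dot_def mult.commute)

lemma fix_one:
  assumes "fsub A" "r \<noteq> s" "p r \<le> p s" "q r \<le> q s"
  shows "\<exists>\<alpha> \<beta>. allowed p q \<alpha> \<beta> \<and> fixes_sub \<alpha> \<beta> A"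
  using fsub_dichotomy[OF assms(1)]
proof (elim disjE exE conjE)
  fix x assume x: "A \<subseteq> {\<lambda>s. c * x s | c. True}"
  obtain \<alpha> \<beta> where "allowed p q \<alpha> \<beta>" "dot \<beta> x = 0" using kill_line[OF assms(2-4)] by blast
  then show ?thesis using x by (force simp: fixes_sub_def dot_scale)
next
  fix l assume l: "{z. dot l z = 0} \<subseteq> A"
  obtain \<alpha> \<beta> where "allowed p q \<alpha> \<beta>" "dot l \<alpha> = 0" using in_plane[OF assms(2-4)] by blast
  then show ?thesis using l by (force simp: fixes_sub_def)
qed

lemma dot_unit: "dot (\<lambda>i. if i = u then c else 0) x = c * x u" "dot x (\<lambda>i. if i = u then c else 0) = x u * c"
proof -
  have "(\<Sum>i\<in>UNIV. (if i = u then c else 0) * x i) = (\<Sum>i\<in>UNIV. if i = u then c * x i else 0)"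
    by (rule sum.cong) auto
  then show "dot (\<lambda>i. if i = u then c else 0) x = c * x u" by (simp add: dot_def)
  then show "dot x (\<lambda>i. if i = u then c else 0) = x u * c" by (simp add: dot_commute[of x] mult.commute)
qed

text \<open>The line of x lies in the plane of l. A greatest label u permits alpha = e_u with any
  beta normalised at u, a least label permits beta = e_u with any alpha normalised at u, and two
  equal labels give a full block of 2 by 2 matrices. Each freedom suffices to handle line and plane
  together.\<close>

lemma fix_line_in_plane:
  assumes lx: "dot l x = 0" and x: "x \<noteq> (\<lambda>_. 0)" and l: "l \<noteq> (\<lambda>_. 0)"
    and comb: "(\<exists>u. \<forall>r. p r \<le> p u \<and> q r \<le> q u) \<or> (\<exists>u. \<forall>r. p u \<le> p r \<and> q u \<le> q r) \<or>
      (\<exists>r u. r \<noteq> u \<and> p r = p u \<and> q r = q u)"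
  shows "\<exists>\<alpha> \<beta>. allowed p q \<alpha> \<beta> \<and> (dot l \<alpha> = 0 \<and> dot \<beta> x = 0 \<or> (\<exists>c. \<alpha> = (\<lambda>s. c * x s)) \<or> (\<exists>c. \<beta> = (\<lambda>s. c * l s)))"
  using comb
proof (elim disjE exE conjE)
  fix u assume top: "\<forall>r. p r \<le> p u \<and> q r \<le> q u"
  let ?e = "\<lambda>i. if i = u then 1 else 0 :: complex"
  have ok: "allowed p q ?e \<beta>" if "\<beta> u = 1" for \<beta>
    using that top by (auto simp: allowed_def dot_unit)
  show ?thesis
  proof (cases "l u = 0")
    case False
    then show ?thesis
      by (intro exI[of _ ?e] exI[of _ "\<lambda>s. (1 / l u) * l s"] conjI disjI2 ok) (auto intro!: exI[of _ "1 / l u"])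
  next
    case True
    show ?thesis
    proof (cases "\<exists>r. r \<noteq> u \<and> x r \<noteq> 0")
      case False
      then have "x u \<noteq> 0" using x by (metis ext)
      then have "?e = (\<lambda>s. (1 / x u) * x s)" using False by (auto simp: fun_eq_iff)
      then have "\<exists>c. ?e = (\<lambda>s. c * x s)" by blast
      moreover have "allowed p q ?e ?e" by (rule ok) simp
      ultimately show ?thesis by blast
    next
      case 2: True
      then obtain r where r: "r \<noteq> u" "x r \<noteq> 0" by blast
      let ?b = "\<lambda>i. ?e i + (if i = r then - (x u / x r) else 0)"
      have "dot ?b x = dot ?e x + dot (\<lambda>i. if i = r then - (x u / x r) else 0) x"
        by (simp add: dot_def ring_distribs sum.distrib)
      then have "dot ?b x = 0" using r by (simp add: dot_unit)
      moreover have "dot l ?e = 0" using True by (simp add: dot_unit)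
      ultimately show ?thesis using ok[of ?b] r by (intro exI[of _ ?e] exI[of _ ?b]) auto
    qed
  qed
next
  fix u assume bot: "\<forall>r. p u \<le> p r \<and> q u \<le> q r"
  let ?e = "\<lambda>i. if i = u then 1 else 0 :: complex"
  have ok: "allowed p q \<alpha> ?e" if "\<alpha> u = 1" for \<alpha>
    using that bot by (auto simp: allowed_def dot_unit)
  show ?thesis
  proof (cases "x u = 0")
    case False
    have "allowed p q (\<lambda>s. (1 / x u) * x s) ?e" by (rule ok) (use False in simp)
    then show ?thesis by blast
  next
    case True
    show ?thesis
    proof (cases "\<exists>r. r \<noteq> u \<and> l r \<noteq> 0")
      case False
      then have "l u \<noteq> 0" using l by (metis ext)
      then have "?e = (\<lambda>s. (1 / l u) * l s)" using False by (auto simp: fun_eq_iff)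
      then have "\<exists>c. ?e = (\<lambda>s. c * l s)" by blast
      moreover have "allowed p q ?e ?e" by (rule ok) simp
      ultimately show ?thesis by blast
    next
      case 2: True
      then obtain r where r: "r \<noteq> u" "l r \<noteq> 0" by blast
      let ?b = "\<lambda>i. ?e i + (if i = r then - (l u / l r) else 0)"
      have "dot l ?b = dot l ?e + dot l (\<lambda>i. if i = r then - (l u / l r) else 0)"
        by (simp add: dot_def ring_distribs sum.distrib)
      then have "dot l ?b = 0" using r by (simp add: dot_unit)
      moreover have "dot ?e x = 0" using True by (simp add: dot_unit)
      ultimately show ?thesis using ok[of ?b] r by (intro exI[of _ ?b] exI[of _ ?e]) auto
    qed
  qed
next
  fix r u assume ru: "r \<noteq> u" "p r = p u" "q r = q u"
  obtain w where w: "UNIV = {r, u, w}" "r \<noteq> w" "u \<noteq> w"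
    using third_label[OF ru(1)] by blast
  note L = dot_labels[OF w(1) ru(1) w(2,3)]
  have ok: "allowed p q \<alpha> \<beta>" if "\<alpha> w = 0" "\<beta> w = 0" "\<alpha> r * \<beta> r + \<alpha> u * \<beta> u = 1" for \<alpha> \<beta>
  proof -
    have "i = r \<or> i = u" if "\<alpha> i \<noteq> 0 \<or> \<beta> i \<noteq> 0" for i
      using w(1) that \<open>\<alpha> w = 0\<close> \<open>\<beta> w = 0\<close> by (metis UNIV_I insertE singletonD)
    then have "p i = p j \<and> q i = q j" if "\<alpha> i \<noteq> 0" "\<beta> j \<noteq> 0" for i j
      using that ru by metis
    then show ?thesis using that unfolding allowed_def L by auto
  qed
  let ?v = "\<lambda>a b i. if i = r then a else if i = u then b else 0 :: complex"
  have V: "?v a b r = a" "?v a b u = b" "?v a b w = 0" for a b using ru w by auto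
  have A: "allowed p q (?v a b) (?v c d)" if "a * c + b * d = 1" for a b c d
    by (rule ok) (use V that in auto)
  have D: "dot l (?v a b) = l r * a + l u * b" "dot (?v a b) x = a * x r + b * x u" for a b
    unfolding L V by auto
  have lx': "l r * x r + (l u * x u + l w * x w) = 0" using lx unfolding L .
  have key: ?thesis if ex: "\<exists>a b c d. a * c + b * d = 1 \<and> l r * a + l u * b = 0 \<and> c * x r + d * x u = 0"
  proof -
    obtain a b c d where abcd: "a * c + b * d = 1" "l r * a + l u * b = 0" "c * x r + d * x u = 0"
      using ex by blast
    have "dot l (?v a b) = 0 \<and> dot (?v c d) x = 0" unfolding D abcd by simp
    then show ?thesis using A[OF abcd(1)] by blast
  qed
  \<comment> \<open>In case 3 the vectors of the block orthogonal to l and to x pair to a nonzero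
    number and serve as alpha and beta. In case 4 the product of l w and x w is zero, so x or l
    lives in the block and is itself taken as alpha or beta.\<close>
  consider "x r = 0 \<and> x u = 0" | "l r = 0 \<and> l u = 0" | "l r * x r + l u * x u \<noteq> 0"
    | "l r * x r + l u * x u = 0" "x r \<noteq> 0 \<or> x u \<noteq> 0" "l r \<noteq> 0 \<or> l u \<noteq> 0" by blast
  then show ?thesis
  proof cases
    case 1
    show ?thesis
    proof (cases "l u = 0")
      case True
      show ?thesis by (rule key, rule exI[of _ 0], rule exI[of _ 1], rule exI[of _ 0], rule exI[of _ 1]) (use 1 True in auto)
    next
      case False
      show ?thesis by (rule key, rule exI[of _ 1], rule exI[of _ "- l r / l u"], rule exI[of _ 1], rule exI[of _ 0]) (use 1 False in auto)
    qed
  next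
    case 2
    show ?thesis
    proof (cases "x u = 0")
      case True
      show ?thesis by (rule key, rule exI[of _ 0], rule exI[of _ 1], rule exI[of _ 0], rule exI[of _ 1]) (use 2 True in auto)
    next
      case False
      show ?thesis by (rule key, rule exI[of _ 1], rule exI[of _ 0], rule exI[of _ 1], rule exI[of _ "- x r / x u"]) (use 2 False in auto)
    qed
  next
    case 3
    let ?s = "l r * x r + l u * x u"
    show ?thesis
      by (rule key, rule exI[of _ "- l u / ?s"], rule exI[of _ "l r / ?s"], rule exI[of _ "- x u"], rule exI[of _ "x r"])
         (use 3 in \<open>auto simp: algebra_simps add_divide_distrib[symmetric]\<close>)
  next
    case 4
    have "(l r * x r + l u * x u) + l w * x w = 0" using lx' by (simp only: add.assoc)
    then have "l w * x w = 0" by (simp only: 4(1) add_0)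
    then show ?thesis
    proof (cases "x w = 0")
      case True
      obtain c d where cd: "x r * c + x u * d = 1"
        using 4(2) that[of "1 / x r" 0] that[of 0 "1 / x u"] by fastforce
      have "?v (x r) (x u) = (\<lambda>s. 1 * x s)"
      proof
        fix i have "i = r \<or> i = u \<or> i = w" using w(1) by (metis UNIV_I insertE singletonD)
        then show "?v (x r) (x u) i = 1 * x i" using V True by auto
      qed
      then show ?thesis using A[OF cd] by blast
    next
      case False
      then have lw: "l w = 0" using \<open>l w * x w = 0\<close> by simp
      obtain c d where cd: "c * l r + d * l u = 1"
        using 4(3) that[of "1 / l r" 0] that[of 0 "1 / l u"] by fastforce
      have "?v (l r) (l u) = (\<lambda>s. 1 * l s)"
      proof
        fix i have "i = r \<or> i = u \<or> i = w" using w(1) by (metis UNIV_I insertE singletonD)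
        then show "?v (l r) (l u) i = 1 * l i" using V lw by auto
      qed
      then show ?thesis using A[OF cd] by blast
    qed
  qed
qed

text \<open>Apart from a line inside a plane, either one subspace is trivial or one choice serves
  both: a beta that kills a line containing A kills C, and an alpha in C lies in A.\<close>

lemma fix_two:
  assumes A: "fsub A" "fsub C" "C \<subseteq> A" and rs: "r \<noteq> s" "p r \<le> p s" "q r \<le> q s"
    and comb: "(\<exists>u. \<forall>r. p r \<le> p u \<and> q r \<le> q u) \<or> (\<exists>u. \<forall>r. p u \<le> p r \<and> q u \<le> q r) \<or>
      (\<exists>r u. r \<noteq> u \<and> p r = p u \<and> q r = q u)"
  shows "\<exists>\<alpha> \<beta>. allowed p q \<alpha> \<beta> \<and> fixes_sub \<alpha> \<beta> A \<and> fixes_sub \<alpha> \<beta> C"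
proof (cases "A = UNIV")
  case True
  then show ?thesis using fix_one[OF A(2) rs] by (auto simp: fixes_sub_def)
next
  case nA: False
  show ?thesis
  proof (cases "C \<subseteq> {\<lambda>_. 0}")
    case True
    then have "\<forall>w\<in>C. dot \<beta> w = 0" for \<beta> by (auto simp: dot_def)
    then show ?thesis using fix_one[OF A(1) rs] by (auto simp: fixes_sub_def)
  next
    case False
    show ?thesis
      using fsub_dichotomy[OF A(1)]
    proof (elim disjE exE conjE)
      fix x assume x: "A \<subseteq> {\<lambda>s. c * x s | c. True}"
      obtain \<alpha> \<beta> where "allowed p q \<alpha> \<beta>" "dot \<beta> x = 0" using kill_line[OF rs] by blast
      then show ?thesis using x A(3) by (force simp: fixes_sub_def dot_scale)
    next
      fix l assume l: "l \<noteq> (\<lambda>_. 0)" "{z. dot l z = 0} \<subseteq> A"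
      have Al: "dot l z = 0" if "z \<in> A" for z
      proof (rule ccontr)
        assume n: "dot l z \<noteq> 0"
        have "y \<in> A" for y
        proof -
          let ?c = "dot l y / dot l z"
          let ?w = "\<lambda>s. 1 * y s + (- ?c) * z s"
          have "dot l ?w = dot l y + (- ?c) * dot l z"
            by (simp only: dot_def sum_3) Groebner_Basis.algebra
          then have "?w \<in> A" using n l(2) by auto
          moreover have "(\<lambda>s. a * x s + b * y s) \<in> A" if "x \<in> A" "y \<in> A" for x y a b
            using A(1) that unfolding fsub_def by blast
          ultimately have "(\<lambda>s. 1 * ?w s + ?c * z s) \<in> A" using that by blast
          then show ?thesis by simp
        qed
        then show False using nA by blast
      qed
      show ?thesis
        using fsub_dichotomy[OF A(2)]
      proof (elim disjE exE conjE)
        fix l' assume l': "{z. dot l' z = 0} \<subseteq> C"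
        obtain \<alpha> \<beta> where "allowed p q \<alpha> \<beta>" "dot l' \<alpha> = 0" using in_plane[OF rs] by blast
        then show ?thesis using l' A(3) by (force simp: fixes_sub_def)
      next
        fix x' assume x': "C \<subseteq> {\<lambda>s. c * x' s | c. True}"
        obtain x where x: "x \<in> C" "x \<noteq> (\<lambda>_. 0)" using False by blast
        obtain c0 where c0: "x = (\<lambda>s. c0 * x' s)" using x(1) x' by blast
        then have "c0 \<noteq> 0" using x(2) by auto
        have Bx: "\<exists>c. y = (\<lambda>s. c * x s)" if "y \<in> C" for y
        proof -
          obtain c where "y = (\<lambda>s. c * x' s)" using \<open>y \<in> C\<close> x' by blast
          then have "y = (\<lambda>s. (c / c0) * x s)" using c0 \<open>c0 \<noteq> 0\<close> by auto
          then show ?thesis by blast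
        qed
        have xB: "(\<lambda>s. c * x s) \<in> C" for c
        proof -
          have "(\<lambda>s. c * x s + 0 * x s) \<in> C" using A(2) x(1) unfolding fsub_def by blast
          then show ?thesis by simp
        qed
        have "dot l x = 0" using Al x(1) A(3) by blast
        from fix_line_in_plane[OF this x(2) l(1) comb]
        obtain \<alpha> \<beta> where ab: "allowed p q \<alpha> \<beta>"
          "dot l \<alpha> = 0 \<and> dot \<beta> x = 0 \<or> (\<exists>c. \<alpha> = (\<lambda>s. c * x s)) \<or> (\<exists>c. \<beta> = (\<lambda>s. c * l s))" by blast
        from ab(2) have "fixes_sub \<alpha> \<beta> A \<and> fixes_sub \<alpha> \<beta> C"
        proof (elim disjE exE conjE)
          assume "dot l \<alpha> = 0" "dot \<beta> x = 0"
          then have "\<alpha> \<in> A" using l(2) by blast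
          moreover have "dot \<beta> y = 0" if "y \<in> C" for y
            using Bx[OF that] \<open>dot \<beta> x = 0\<close> by (auto simp: dot_scale)
          ultimately show ?thesis unfolding fixes_sub_def by blast
        next
          fix c assume "\<alpha> = (\<lambda>s. c * x s)"
          then show ?thesis using xB A(3) unfolding fixes_sub_def by blast
        next
          fix c assume "\<beta> = (\<lambda>s. c * l s)"
          then show ?thesis using Al A(3) unfolding fixes_sub_def by (auto simp: dot_scale)
        qed
        then show ?thesis using ab(1) by blast
      qed
    qed
  qed
qed


subsection \<open>Chains of two flags with extra lattices\<close>

lemma lattice_std_form:
  assumes "lattice X"
  shows "\<exists>g h. g ** h = mat 1 \<and> h ** g = mat 1 \<and> (*v) h ` X = std 0"
proof -
  obtain v where "adapted_vectors X v" using lattice_vectors[OF assms] by blast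
  then interpret adapted_vectors X v .
  show ?thesis using gh image_h by blast
qed

lemma two_flag_coordinates:
  assumes Z0: "lattice (Z 0)" and Zm: "Z m = tim 2 (Z 0)"
    and Om: "\<And>i. i \<le> m \<Longrightarrow> Omod (Z i)"
    and dec: "\<And>i. i < m \<Longrightarrow> Z (Suc i) \<subseteq> Z i" and t: "\<And>i. i < m \<Longrightarrow> tim 1 (Z i) \<subseteq> Z (Suc i)"
  shows "\<exists>g h p q. g ** h = mat 1 \<and> h ** g = mat 1 \<and> (\<forall>s. p s < q s \<and> q s < m) \<and>
    (\<forall>i\<le>m. (*v) h ` Z i = dset (two_step p q i))"
proof -
  obtain g0 h0 :: "complex fls ^ 3 ^ 3" where 0: "g0 ** h0 = mat 1" "h0 ** g0 = mat 1" "(*v) h0 ` Z 0 = std 0"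
    using lattice_std_form[OF Z0] by blast
  let ?Z = "\<lambda>i. (*v) h0 ` Z i"
  have "\<exists>g h p q. g ** h = mat 1 \<and> h ** g = mat 1 \<and> (\<forall>s. p s < q s \<and> q s < m) \<and>
    (\<forall>i\<le>m. (*v) h ` ?Z i = {c. \<forall>s. ordge (two_step p q i s) (c $ s)})"
  proof (rule two_step_normal_form)
    show "?Z m = std 2" using 0(3) by (simp add: Zm flip: tim_image)
    show "Omod (?Z i)" if "i \<le> m" for i using Om[OF that] by (rule Omod_image)
    show "?Z (Suc i) \<subseteq> ?Z i" if "i < m" for i using dec[OF that] by (rule image_mono)
    show "tim 1 (?Z i) \<subseteq> ?Z (Suc i)" if "i < m" for i
      unfolding tim_image using t[OF that] by (rule image_mono)
  qed (rule 0(3))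
  then obtain g h p q where 1: "g ** h = mat 1" "h ** g = mat 1" "\<forall>s. p s < q s \<and> q s < m"
    "\<forall>i\<le>m. (*v) h ` ?Z i = dset (two_step p q i)" unfolding dset_def by blast
  have "g0 ** g ** (h ** h0) = mat 1" "h ** h0 ** (g0 ** g) = mat 1"
  proof -
    have "g0 ** g ** (h ** h0) = g0 ** (g ** h) ** h0" by (simp only: matrix_mul_assoc)
    then show "g0 ** g ** (h ** h0) = mat 1" by (simp only: 1 0 matrix_mul_rid)
    have "h ** h0 ** (g0 ** g) = h ** (h0 ** g0) ** g" by (simp only: matrix_mul_assoc)
    then show "h ** h0 ** (g0 ** g) = mat 1" by (simp only: 1 0 matrix_mul_rid)
  qed
  moreover have "(*v) (h ** h0) ` Z i = (*v) h ` ?Z i" for i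
    by (simp only: image_image matrix_vector_mul_assoc)
  ultimately show ?thesis using 1(3,4)
    by (intro exI[of _ "g0 ** g"] exI[of _ "h ** h0"] exI[of _ p] exI[of _ q] conjI) simp_all
qed

lemma rk1_two_step:
  assumes "allowed p q \<alpha> \<beta>" "z \<in> dset (two_step p q i)"
  shows "rk1 (\<lambda>_. 0) \<alpha> \<beta> z \<in> dset (two_step p q i)"
proof (rule rk1_dset[OF assms(2)])
  fix r s assume "\<alpha> s \<noteq> 0" "\<beta> r \<noteq> 0"
  then have "p r \<le> p s" "q r \<le> q s" using assms(1) by (auto simp: allowed_def)
  then show "two_step p q i s - 0 \<le> two_step p q i r - 0" by (auto simp: two_step_def)
qed

definition residue :: "V set \<Rightarrow> (3 \<Rightarrow> complex) set" where
  "residue Y = {\<lambda>s. (z $ s) $$ 0 | z. z \<in> Y}"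

lemma fsub_residue: "Omod Y \<Longrightarrow> fsub (residue Y)"
  unfolding fsub_def
proof (intro conjI ballI allI)
  assume Y: "Omod Y"
  show "(\<lambda>_. 0) \<in> residue Y" using OmodD(1)[OF Y] by (force simp: residue_def)
  fix x y a b assume "x \<in> residue Y" "y \<in> residue Y"
  then obtain z w where z: "z \<in> Y" "x = (\<lambda>s. (z $ s) $$ 0)" "w \<in> Y" "y = (\<lambda>s. (w $ s) $$ 0)"
    by (auto simp: residue_def)
  have "fls_const a *s z + fls_const b *s w \<in> Y" using Y z by (intro OmodD)
  then have "(\<lambda>s. ((fls_const a *s z + fls_const b *s w) $ s) $$ 0) \<in> residue Y"
    unfolding residue_def by blast
  then show "(\<lambda>s. a * x s + b * y s) \<in> residue Y" by (simp add: z)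
qed

lemma rk1_fixes:
  assumes "Omod Y" "std 1 \<subseteq> Y" "Y \<subseteq> std 0" "z \<in> Y" "fixes_sub \<alpha> \<beta> (residue Y)"
  shows "rk1 (\<lambda>_. 0) \<alpha> \<beta> z \<in> Y"
proof (rule rk1_between[OF assms(1-4)])
  show "(\<exists>w\<in>Y. \<forall>s. (w $ s) $$ 0 = \<alpha> s) \<or> (\<forall>w\<in>Y. (\<Sum>r\<in>UNIV. \<beta> r * (w $ r) $$ 0) = 0)"
    using assms(5) unfolding fixes_sub_def residue_def dot_def by fastforce
qed

text \<open>Pairwise incomparable pairs are strictly nested intervals, and three of them would need
  six different numbers below 5.\<close>

lemma comparable_five:
  fixes p q :: "3 \<Rightarrow> nat"
  assumes "\<And>s. p s < q s \<and> q s < 5"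
  shows "\<exists>r s. r \<noteq> s \<and> p r \<le> p s \<and> q r \<le> q s"
proof (rule ccontr)
  assume "\<not> ?thesis"
  then have n: "\<And>r s. r \<noteq> s \<Longrightarrow> p r \<le> p s \<Longrightarrow> q s < q r" by force
  show False using n[of 1 2] n[of 2 1] n[of 1 3] n[of 3 1] n[of 2 3] n[of 3 2]
      assms[of 1] assms[of 2] assms[of 3] by simp linarith
qed

text \<open>Below 4 the only incomparable pairs are (0,3) and (1,2), with equal sums. So p + q
  detects comparability; without a greatest or a least label all three sums agree, and then some
  pair is repeated.\<close>

lemma comparable_four:
  fixes p q :: "3 \<Rightarrow> nat"
  assumes pq: "\<And>s. p s < q s \<and> q s < 4"
  shows "(\<exists>u. \<forall>r. p r \<le> p u \<and> q r \<le> q u) \<or> (\<exists>u. \<forall>r. p u \<le> p r \<and> q u \<le> q r) \<or>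
      (\<exists>r u. r \<noteq> u \<and> p r = p u \<and> q r = q u)"
proof (rule ccontr)
  assume n: "\<not> ?thesis"
  have lev: "p r \<le> p s \<and> q r \<le> q s" if "p r + q r < p s + q s" for r s
    using pq[of r] pq[of s] that by linarith
  have top: "\<exists>r. r \<noteq> u \<and> p u + q u \<le> p r + q r" for u
  proof (rule ccontr)
    assume a: "\<not> ?thesis"
    have "p r \<le> p u \<and> q r \<le> q u" for r
      using a lev[of r u] by (cases "r = u") (auto simp: not_le)
    then show False using n by blast
  qed
  have bot: "\<exists>r. r \<noteq> u \<and> p r + q r \<le> p u + q u" for u
  proof (rule ccontr)
    assume a: "\<not> ?thesis"
    have "p u \<le> p r \<and> q u \<le> q r" for r
      using a lev[of u r] by (cases "r = u") (auto simp: not_le)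
    then show False using n by blast
  qed
  obtain u where u: "\<And>r. p r + q r \<le> p u + q u"
    using ex_max_3[of "\<lambda>s. p s + q s"] by blast
  obtain r where r: "r \<noteq> u" "p u + q u \<le> p r + q r" using top by blast
  obtain w where w: "\<And>r. p w + q w \<le> p r + q r"
    using ex_min_3[of "\<lambda>s. p s + q s"] by blast
  obtain x where x: "x \<noteq> w" "p x + q x \<le> p w + q w" using bot by blast
  have all: "p s + q s = p u + q u" for s
  proof -
    have ru: "p r + q r = p u + q u" using r u[of r] by linarith
    have xw: "p x + q x = p w + q w" using x w[of x] by linarith
    obtain y where y: "UNIV = {r, u, y}"
      using third_label[OF r(1)] by blast
    have "x \<in> {r, u} \<or> w \<in> {r, u}" using y x(1) by (metis UNIV_I insertE insertI1 insertI2 singletonD)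
    then have "p u + q u = p w + q w" using ru xw by auto
    then show ?thesis using u[of s] w[of s] by linarith
  qed
  have ne: "p a \<noteq> p b" if "a \<noteq> b" for a b
  proof
    assume "p a = p b"
    then have "q a = q b" using all[of a] all[of b] by linarith
    then show False using n that \<open>p a = p b\<close> by blast
  qed
  show False
    using ne[of 1 2] ne[of 1 3] ne[of 2 3] all[of 1] all[of 2] all[of 3] pq[of 1] pq[of 2] pq[of 3]
    by simp
qed

section \<open>Periodic chains of lattices\<close>

definition chain :: "int \<Rightarrow> (int \<Rightarrow> V set) \<Rightarrow> bool" where
  "chain n X \<longleftrightarrow> (\<forall>i. lattice (X i) \<and> X (i + 1) \<subseteq> X i \<and> tim 1 (X i) \<subseteq> X (i + 1) \<and> X (i + n) = tim 3 (X i))"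

lemma chainD:
  assumes "chain n X"
  shows "lattice (X i)" "Omod (X i)" "X (i + 1) \<subseteq> X i" "tim 1 (X i) \<subseteq> X (i + 1)" "X (i + n) = tim 3 (X i)"
  using assms latticeD unfolding chain_def by blast+

lemma chain_anti:
  assumes "chain n X" "i \<le> j" shows "X j \<subseteq> X i"
proof -
  have "X (i + int k) \<subseteq> X i" for k
  proof (induction k)
    case (Suc k)
    then show ?case using chainD(3)[OF assms(1), of "i + int k"] by (auto simp: algebra_simps)
  qed simp
  from this[of "nat (j - i)"] show ?thesis using assms(2) by simp
qed

lemma chain_tim:
  assumes "chain n X" "0 \<le> k" shows "tim k (X i) \<subseteq> X (i + k)"
proof -
  have "tim (int m) (X i) \<subseteq> X (i + int m)" for m
  proof (induction m)
    case (Suc m)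
    have "tim (int (Suc m)) (X i) = tim 1 (tim (int m) (X i))" by simp
    also have "\<dots> \<subseteq> tim 1 (X (i + int m))" using Suc by (rule tim_mono)
    also have "\<dots> \<subseteq> X (i + int m + 1)" by (rule chainD(4)[OF assms(1)])
    finally show ?case by (simp add: algebra_simps)
  qed simp
  from this[of "nat k"] show ?thesis using assms(2) by simp
qed

lemma chain_period:
  assumes "chain n X" shows "X (i + n * k) = tim (3 * k) (X i)"
proof -
  have 1: "X (i + n * int m) = tim (3 * int m) (X i)" for m i
  proof (induction m)
    case (Suc m)
    have "X (i + n * int (Suc m)) = X ((i + n * int m) + n)" by (simp add: algebra_simps)
    also have "\<dots> = tim 3 (tim (3 * int m) (X i))" by (simp only: chainD(5)[OF assms] Suc)
    finally show ?case by (simp add: algebra_simps)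
  qed simp
  show ?thesis
  proof (cases "0 \<le> k")
    case True then show ?thesis using 1[of i "nat k"] by simp
  next
    case False
    then have "X i = tim (3 * (- k)) (X (i + n * k))" using 1[of "i + n * k" "nat (- k)"] by simp
    then show ?thesis by simp
  qed
qed

lemma chain_rotate: "chain n X \<Longrightarrow> chain n (\<lambda>i. X (i + a))"
  unfolding chain_def
proof
  fix i
  assume "\<forall>i. lattice (X i) \<and> X (i + 1) \<subseteq> X i \<and> tim 1 (X i) \<subseteq> X (i + 1) \<and> X (i + n) = tim 3 (X i)"
  moreover have "i + a + 1 = i + 1 + a" "i + a + n = i + n + a" by simp_all
  ultimately show "lattice (X (i + a)) \<and> X (i + 1 + a) \<subseteq> X (i + a) \<and>
    tim 1 (X (i + a)) \<subseteq> X (i + 1 + a) \<and> X (i + n + a) = tim 3 (X (i + a))" by metis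
qed

lemma chain_splits:
  assumes X: "chain n X" and n: "0 < n" and s: "splits (X ` {a..<a + n} \<union> \<Y>)"
    and Z: "\<And>Z. Z \<in> \<Z> \<Longrightarrow> \<exists>Y\<in>\<Y>. \<exists>k. Z = tim k Y"
  shows "splits (range X \<union> \<Z>)"
proof (rule splits_tim[OF s])
  fix W assume "W \<in> range X \<union> \<Z>"
  then consider i where "W = X i" | "W \<in> \<Z>" by blast
  then show "\<exists>Y\<in>X ` {a..<a + n} \<union> \<Y>. \<exists>k. W = tim k Y"
  proof cases
    case 1
    let ?r = "a + (i - a) mod n" and ?k = "(i - a) div n"
    have "i = ?r + n * ?k" by (simp add: mult_div_mod_eq[symmetric] algebra_simps)
    then have "W = tim (3 * ?k) (X ?r)" using 1 chain_period[OF X, of ?r ?k] by metis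
    moreover have "?r \<in> {a..<a + n}" using n by simp
    ultimately show ?thesis by blast
  next
    case 2
    then show ?thesis using Z by blast
  qed
qed

definition per :: "nat \<Rightarrow> (nat \<Rightarrow> V set) \<Rightarrow> int \<Rightarrow> V set" where
  "per n f i = tim (3 * (i div int n)) (f (nat (i mod int n)))"

lemma per_nat: "i < n \<Longrightarrow> per n f (int i) = f i"
  by (simp add: per_def flip: of_nat_mod of_nat_div)

lemma chain_per:
  assumes n: "0 < n" and lat: "\<And>i. i < n \<Longrightarrow> lattice (f i)"
    and dec: "\<And>i. i < n \<Longrightarrow> f (Suc i) \<subseteq> f i" and t: "\<And>i. i < n \<Longrightarrow> tim 1 (f i) \<subseteq> f (Suc i)"
    and fn: "f n = tim 3 (f 0)"
  shows "chain (int n) (per n f)" "per n f (int n) = f n"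
proof -
  have "lattice (per n f i) \<and> per n f (i + 1) \<subseteq> per n f i \<and> tim 1 (per n f i) \<subseteq> per n f (i + 1)
    \<and> per n f (i + int n) = tim 3 (per n f i)" for i
  proof -
    let ?r = "nat (i mod int n)" and ?k = "i div int n"
    have r: "?r < n" using n by (simp add: nat_less_iff)
    have i: "i = int n * ?k + int ?r" using n by simp
    have nxt: "per n f (i + 1) = tim (3 * ?k) (f (Suc ?r))"
    proof (cases "Suc ?r < n")
      case True
      have "i + 1 = int n * ?k + int (Suc ?r)" using i by linarith
      then have "(i + 1) mod int n = int (Suc ?r)" "(i + 1) div int n = ?k"
        using True by (simp_all del: of_nat_Suc)
      then show ?thesis unfolding per_def by (simp only: nat_int)
    next
      case False
      then have e: "Suc ?r = n" using r by linarith
      have "int ?r + 1 = int n" using e by linarith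
      then have "i + 1 = int n * ?k + int n" using i by linarith
      then have "i + 1 = int n * (?k + 1)" by (simp only: ring_distribs mult_1_right)
      then have "(i + 1) mod int n = 0" "(i + 1) div int n = ?k + 1" using n by simp_all
      then show ?thesis unfolding per_def e fn by (simp add: algebra_simps)
    qed
    have "per n f i = tim (3 * ?k) (f ?r)" by (simp add: per_def)
    moreover have "tim 1 (tim (3 * ?k) (f ?r)) \<subseteq> tim (3 * ?k) (f (Suc ?r))"
      using tim_mono[OF t[OF r], of "3 * ?k"] by (simp add: add.commute)
    moreover have "per n f (i + int n) = tim 3 (tim (3 * ?k) (f ?r))"
      using n by (simp add: per_def algebra_simps)
    ultimately show ?thesis
      using nxt lattice_tim[OF lat[OF r]] tim_mono[OF dec[OF r]] by auto
  qed
  then show "chain (int n) (per n f)" unfolding chain_def by blast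
  show "per n f (int n) = f n" using n fn by (simp add: per_def)
qed

lemma residue_mono: "X \<subseteq> Y \<Longrightarrow> residue X \<subseteq> residue Y"
  unfolding residue_def by blast

text \<open>A chain through a homothetic pair \<open>X (a + b) = t X a\<close> consists, after removing the lattices in
  between, of two flags.\<close>

lemma splits_homothetic:
  assumes X: "chain 7 X" and b: "b \<in> {1, 2, 3}" and h: "X (a + b) = tim 1 (X a)"
  shows "splits (range X)"
proof -
  define m where "m = nat (7 - b)"
  have mb: "int m = 7 - b" using b by (auto simp: m_def)
  \<comment> \<open>Divided by t, the part from X (a + b) on starts at X a and arrives after 7 - b
    steps at t^2 X a, as \<open>two_flag_coordinates\<close> requires.\<close>
  define Z where "Z i = tim (- 1) (X (a + b + int i))" for i :: nat
  have Z0: "Z 0 = X a" by (simp add: Z_def h)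
  have Zm: "Z m = tim 2 (Z 0)"
    using chainD(5)[OF X, of a] unfolding Z0 by (simp add: Z_def mb)
  obtain g h :: "complex fls ^ 3 ^ 3" and p q where gh: "g ** h = mat 1" "h ** g = mat 1"
    and pq: "\<forall>s. p s < q s \<and> q s < m" and D: "\<forall>i\<le>m. (*v) h ` Z i = dset (two_step p q i)"
  proof -
    have "\<exists>g h p q. g ** h = mat 1 \<and> h ** g = mat 1 \<and> (\<forall>s. p s < q s \<and> q s < m) \<and>
      (\<forall>i\<le>m. (*v) h ` Z i = dset (two_step p q i))"
    proof (rule two_flag_coordinates[of Z m])
      show "lattice (Z 0)" using Z0 chainD(1)[OF X] by simp
      show "Z m = tim 2 (Z 0)" by fact
      show "Omod (Z i)" for i unfolding Z_def by (intro Omod_tim chainD(2)[OF X])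
      show "Z (Suc i) \<subseteq> Z i" for i
        unfolding Z_def by (intro tim_mono chain_anti[OF X]) simp
      show "tim 1 (Z i) \<subseteq> Z (Suc i)" for i
        using tim_mono[OF chainD(4)[OF X, of "a + b + int i"], of "- 1"] by (simp add: Z_def algebra_simps)
    qed
    then show ?thesis using that by blast
  qed
  have Da: "(*v) h ` X a = std 0"
  proof -
    have "two_step p q 0 = (\<lambda>_. 0)" by (auto simp: two_step_def)
    then show ?thesis using D[rule_format, of 0] by (simp add: Z0 std_dset)
  qed
  define A where "A k = (*v) h ` X (a + k)" for k
  have A: "Omod (A k)" "std 1 \<subseteq> A k" "A k \<subseteq> std 0" if "0 \<le> k" "k \<le> b" for k
  proof -
    show "Omod (A k)" unfolding A_def by (intro Omod_image chainD(2)[OF X])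
    have "X (a + b) \<subseteq> X (a + k)" using that by (intro chain_anti[OF X]) simp
    then have "(*v) h ` tim 1 (X a) \<subseteq> A k" unfolding A_def h[symmetric] by (rule image_mono)
    then show "std 1 \<subseteq> A k" using Da by (simp flip: tim_image)
    have "X (a + k) \<subseteq> X a" using that by (intro chain_anti[OF X]) simp
    then show "A k \<subseteq> std 0" unfolding A_def Da[symmetric] by (rule image_mono)
  qed
  have AA: "residue (A k) \<subseteq> residue (A l)" if "l \<le> k" for k l
    unfolding A_def by (intro residue_mono image_mono chain_anti[OF X]) (use that in simp)
  \<comment> \<open>Strictly inside the homothetic pair there are b - 1 positions, filled by nested
    subspaces modulo t. The more of them, the shorter the two flags: m = 6, 5, 4 leave just enough
    comparable labels to deal with 0, 1, 2 subspaces.\<close>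
  have "\<exists>\<alpha> \<beta>. allowed p q \<alpha> \<beta> \<and> (\<forall>k. 0 < k \<longrightarrow> k < b \<longrightarrow> fixes_sub \<alpha> \<beta> (residue (A k)))"
  proof -
    consider "b = 1" | "b = 2" | "b = 3" using b by blast
    then show ?thesis
    proof cases
      case 1
      let ?e = "\<lambda>i. if i = 1 then 1 else 0 :: complex"
      have "allowed p q ?e ?e" by (auto simp: allowed_def dot_unit)
      then show ?thesis using 1 by force
    next
      case 2
      then have "m = 5" using mb by simp
      then obtain r s where rs: "r \<noteq> s" "p r \<le> p s" "q r \<le> q s" using comparable_five[of p q] pq by blast
      obtain \<alpha> \<beta> where ab: "allowed p q \<alpha> \<beta>" "fixes_sub \<alpha> \<beta> (residue (A 1))"
        using fix_one[OF fsub_residue[OF A(1)[of 1]] rs] 2 by auto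
      have "k = 1" if "0 < k" "k < b" for k using that 2 by linarith
      then show ?thesis using ab by blast
    next
      case 3
      then have m4: "m = 4" using mb by simp
      then have pq5: "p s < q s \<and> q s < 5" and pq4: "p s < q s \<and> q s < 4" for s using pq[rule_format, of s] by auto
      obtain r s where rs: "r \<noteq> s" "p r \<le> p s" "q r \<le> q s" using comparable_five[of p q] pq5 by blast
      have "\<exists>\<alpha> \<beta>. allowed p q \<alpha> \<beta> \<and> fixes_sub \<alpha> \<beta> (residue (A 1)) \<and> fixes_sub \<alpha> \<beta> (residue (A 2))"
        by (rule fix_two[OF fsub_residue[OF A(1)[of 1]] fsub_residue[OF A(1)[of 2]] AA rs comparable_four[OF pq4]])
           (use 3 in auto)
      then obtain \<alpha> \<beta> where ab: "allowed p q \<alpha> \<beta>" "fixes_sub \<alpha> \<beta> (residue (A 1))" "fixes_sub \<alpha> \<beta> (residue (A 2))" by blast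
      have "k = 1 \<or> k = 2" if "0 < k" "k < b" for k using that 3 by linarith
      then show ?thesis using ab by blast
    qed
  qed
  then obtain \<alpha> \<beta> where ab: "allowed p q \<alpha> \<beta>" "\<And>k. 0 < k \<Longrightarrow> k < b \<Longrightarrow> fixes_sub \<alpha> \<beta> (residue (A k))" by blast
  have "splits ((\<lambda>X. (*v) h ` X) ` (Z ` {..m} \<union> (\<lambda>k. X (a + k)) ` {0<..<b}))"
  proof (rule splits_rk1[where b = "\<lambda>_. 0" and \<alpha> = \<alpha> and \<beta> = \<beta>])
    show "(\<Sum>s\<in>UNIV. \<alpha> s * \<beta> s) = 1" using ab(1) by (simp add: allowed_def dot_def)
    fix Y z assume Y: "Y \<in> (\<lambda>X. (*v) h ` X) ` (Z ` {..m} \<union> (\<lambda>k. X (a + k)) ` {0<..<b})" and z: "z \<in> Y"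
    then consider i where "i \<le> m" "Y = (*v) h ` Z i" | k where "0 < k" "k < b" "Y = A k"
      by (auto simp: A_def)
    then show "rk1 (\<lambda>_. 0) \<alpha> \<beta> z \<in> Y"
    proof cases
      case 1
      then show ?thesis using z D rk1_two_step[OF ab(1)] by auto
    next
      case 2
      then show ?thesis using z A[of k] ab(2)[of k] by (intro rk1_fixes) auto
    qed
  qed
  then have s: "splits (Z ` {..m} \<union> (\<lambda>k. X (a + k)) ` {0<..<b})" by (rule splits_conj[OF gh(2,1)])
  have "splits (X ` {a..<a + 7} \<union> {})"
  proof (rule splits_tim[OF s])
    fix W assume "W \<in> X ` {a..<a + 7} \<union> {}"
    then obtain i where i: "a \<le> i" "i < a + 7" "W = X i" by auto
    consider "i = a" | "a < i" "i < a + b" | "a + b \<le> i" using i by linarith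
    then show "\<exists>Y\<in>Z ` {..m} \<union> (\<lambda>k. X (a + k)) ` {0<..<b}. \<exists>k. W = tim k Y"
    proof cases
      case 1
      then have "W = tim 0 (Z 0)" using i Z0 by simp
      then show ?thesis by blast
    next
      case 2
      then have "i - a \<in> {0<..<b}" "W = tim 0 (X (a + (i - a)))" using i by auto
      then show ?thesis by blast
    next
      case 3
      let ?j = "nat (i - a - b)"
      have "?j \<in> {..m}" using 3 i mb by auto
      moreover have "W = tim 1 (Z ?j)" using 3 i by (simp add: Z_def)
      ultimately show ?thesis by blast
    qed
  qed
  from chain_splits[OF X _ this, of "{}"] show ?thesis by simp
qed

text \<open>The two flags glued along an extra lattice \<open>y\<close> at step \<open>j\<close>, while the labels not involved in
  the second extra lattice \<open>y'\<close> drop at step \<open>j'\<close>.\<close>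

lemma splits_glued:
  fixes p q :: "3 \<Rightarrow> nat"
  defines "a \<equiv> two_step p q"
  assumes lab: "UNIV = {s1, s2, s3}" "s1 \<noteq> s2" "s1 \<noteq> s3" "s2 \<noteq> s3"
    and y: "Omod y" "y \<subseteq> dset (a (Suc j))" "tim 1 (dset (a j)) \<subseteq> y"
    and y': "y' \<subseteq> dset (a (Suc j'))" "tim 1 (dset (a j')) \<subseteq> y'"
    and j: "j < 5" "j' < 5"
    and d3: "a (Suc j) s3 = a j s3 + 1" and d2: "a (Suc j') s2 = a j' s2 + 1"
    and cmp: "(\<forall>i\<le>5. a i s1 - a (Suc j) s1 \<le> a i s2 - a (Suc j) s2) \<or>
      (\<forall>i\<le>5. a i s2 - a (Suc j) s2 \<le> a i s1 - a (Suc j) s1)"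
  shows "splits ((\<lambda>i. dset (a i)) ` {..5} \<union> {y, y'})"
proof -
  define b where "b = a (Suc j)"
  have SD: "(\<Sum>i\<in>UNIV. f i) = f s1 + (f s2 + f s3)" for f :: "3 \<Rightarrow> complex"
    by (rule sum_labels[OF lab])
  have SF: "(\<Sum>i\<in>UNIV. f i) = f s1 + (f s2 + f s3)" for f :: "3 \<Rightarrow> complex fls"
    by (rule sum_labels[OF lab])
  have cases3: "i = s1 \<or> i = s2 \<or> i = s3" for i using lab(1) by (metis UNIV_I insertE singletonD)
  let ?z = "\<lambda>z s. (tp (- b s) * z $ s) $$ 0"
  have zO: "ordge 0 (tp (- b s) * z $ s)" if "z \<in> y" for z s
    using that y(2) by (auto simp: dset_def b_def)
  have base: "dset (\<lambda>s. b s + 1) \<subseteq> y"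
  proof -
    have "a j s \<le> b s" for s by (simp add: a_def b_def two_step_def)
    then have "dset (\<lambda>s. b s + 1) \<subseteq> dset (\<lambda>s. a j s + 1)" by (intro dset_mono) simp
    then show ?thesis using y(3) by (simp add: tim_dset)
  qed
  \<comment> \<open>The label s3 rises in step j, so y contains the whole s3-axis of
    \<open>dset b\<close>. Modulo t, y is therefore a matter of the plane of the labels s1 and
    s2.\<close>
  have e3: "z \<in> y" if "\<And>s. s \<noteq> s3 \<Longrightarrow> z $ s = 0" "ordge (b s3) (z $ s3)" for z
  proof -
    have "z \<in> dset (\<lambda>s. a j s + 1)" using that d3
      unfolding dset_def b_def mem_Collect_eq by (metis ordge_0)
    then show ?thesis using y(3) by (auto simp: tim_dset)
  qed
  have res: "w \<in> y" if w: "w \<in> dset b" and z: "z \<in> y" and eq: "?z w s1 = ?z z s1" "?z w s2 = ?z z s2" for w z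
  proof -
    let ?e = "axis s3 ((w - z) $ s3) :: V"
    have wz: "ordge (b s) ((w - z) $ s)" for s
      using w z y(2) by (auto simp: dset_def b_def intro: ordge_diff)
    have "?e \<in> y" by (rule e3) (use wz in \<open>auto simp: axis_def\<close>)
    moreover have "(w - z) - ?e \<in> dset (\<lambda>s. b s + 1)"
      unfolding dset_def
    proof (intro CollectI allI)
      fix s
      have "ordge 1 (tp (- b s) * ((w - z) $ s))" if "s = s1 \<or> s = s2"
      proof -
        have "ordge 0 (tp (- b s) * ((w - z) $ s))" using wz[of s] by simp
        moreover have "(tp (- b s) * ((w - z) $ s)) $$ 0 = 0"
          using that eq by (auto simp: tp_nth)
        ultimately show ?thesis by (simp only: ordge_1_iff)
      qed
      then have "ordge (b s + 1) ((w - z) $ s)" if "s = s1 \<or> s = s2" using that by (simp add: add.commute)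
      then show "ordge (b s + 1) (((w - z) - ?e) $ s)"
        using cases3[of s] lab by (cases "s = s3") (auto simp: axis_def)
    qed
    ultimately have "((w - z) - ?e) + ?e + z \<in> y" using base z y(1) by (intro OmodD(2)) auto
    then show ?thesis by simp
  qed
  show ?thesis
    using cmp
  proof
    assume c: "\<forall>i\<le>5. a i s1 - a (Suc j) s1 \<le> a i s2 - a (Suc j) s2"
    \<comment> \<open>Here s2 may be moved to s1, so alpha can be corrected. With the slope of a
      residue of y that is nonzero at s2, alpha becomes a residue of y itself; if there is none,
      beta kills the residues of y.\<close>
    obtain \<kappa> where \<kappa>: "(\<forall>z\<in>y. ?z z s2 = 0) \<or> (\<exists>z\<in>y. ?z z s2 \<noteq> 0 \<and> \<kappa> = ?z z s1 / ?z z s2)" by blast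
    let ?\<alpha> = "\<lambda>s. if s = s2 then 1 else if s = s1 then \<kappa> else 0" and ?\<beta> = "\<lambda>s. if s = s2 then 1 else 0 :: complex"
    have \<alpha>nz: "s = s2 \<or> s = s1" if "?\<alpha> s \<noteq> 0" for s using that by (auto split: if_splits)
    have \<beta>nz: "r = s2" if "?\<beta> r \<noteq> 0" for r using that by (auto split: if_splits)
    show ?thesis
    proof (rule splits_rk1[where b = b and \<alpha> = ?\<alpha> and \<beta> = ?\<beta>])
      show "(\<Sum>s\<in>UNIV. ?\<alpha> s * ?\<beta> s) = 1" unfolding SD using lab by simp
      fix X z assume X: "X \<in> (\<lambda>i. dset (a i)) ` {..5} \<union> {y, y'}" and z: "z \<in> X"
      consider i where "i \<le> 5" "X = dset (a i)" | "X = y" | "X = y'" using X by auto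
      then show "rk1 b ?\<alpha> ?\<beta> z \<in> X"
      proof cases
        case 1
        then show ?thesis using z c unfolding b_def
          by (auto intro!: rk1_dset[of z "a i"] dest: \<alpha>nz \<beta>nz split: if_splits)
      next
        case 2
        let ?f = "tp (- b s2) * z $ s2"
        have rk: "rk1 b ?\<alpha> ?\<beta> z = ?f *s (\<chi> s. tp (b s) * fls_const (?\<alpha> s))"
          unfolding rk1_def SF using lab by (simp add: vec_eq_iff mult_ac)
        show ?thesis
          using \<kappa>
        proof
          assume "\<forall>z\<in>y. ?z z s2 = 0"
          then have "ordge 1 ?f" using z 2 zO by (simp only: ordge_1_iff)
          then have "rk1 b ?\<alpha> ?\<beta> z \<in> dset (\<lambda>s. b s + 1)"
            unfolding rk by (rule smult_dset) (simp add: dset_def)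
          then show ?thesis using base 2 by blast
        next
          assume "\<exists>z\<in>y. ?z z s2 \<noteq> 0 \<and> \<kappa> = ?z z s1 / ?z z s2"
          then obtain z0 where z0: "z0 \<in> y" "?z z0 s2 \<noteq> 0" "\<kappa> = ?z z0 s1 / ?z z0 s2" by blast
          let ?w = "fls_const (1 / ?z z0 s2) *s z0"
          have "?w \<in> y" using z0 y(1) by (intro OmodD)
          have zw: "?z ?w s = ?z z0 s / ?z z0 s2" for s by (simp add: tp_nth)
          let ?e = "(\<chi> s. tp (b s) * fls_const (?\<alpha> s)) :: V"
          have ze: "?z ?e s = ?\<alpha> s" for s
            by (simp add: mult.assoc[symmetric] tp_mult_tp)
          have "?e \<in> y"
          proof (rule res[OF _ \<open>?w \<in> y\<close>])
            show "?e \<in> dset b" by (simp add: dset_def)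
            show "?z ?e s1 = ?z ?w s1" unfolding zw ze using lab z0(3) by simp
            show "?z ?e s2 = ?z ?w s2" unfolding zw ze using z0(2) by simp
          qed
          then show ?thesis unfolding rk 2 using y(1) zO z 2 by (intro OmodD(3)) auto
        qed
      next
        case 3
        have "rk1 b ?\<alpha> ?\<beta> z \<in> dset (\<lambda>s. a j' s + 1)"
        proof (rule rk1_dset[of z "a (Suc j')"])
          show "z \<in> dset (a (Suc j'))" using z 3 y'(1) by blast
          fix r s assume "?\<alpha> s \<noteq> 0" "?\<beta> r \<noteq> 0"
          then have "s = s2 \<or> s = s1" "r = s2" using \<alpha>nz \<beta>nz by blast+
          \<comment> \<open>The label s2 rises in step j', and the comparison at j' carries this
            gain over to s1.\<close>
          then show "a j' s + 1 - b s \<le> a (Suc j') r - b r"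
            using d2 c[rule_format, of j'] j by (auto simp: b_def)
        qed
        then show ?thesis using y'(2) 3 by (auto simp: tim_dset)
      qed
    qed
  next
    assume c: "\<forall>i\<le>5. a i s2 - a (Suc j) s2 \<le> a i s1 - a (Suc j) s1"
    let ?\<alpha> = "\<lambda>s. if s = s2 then 1 else 0 :: complex"
    have \<alpha>nz: "s = s2" if "?\<alpha> s \<noteq> 0" for s using that by (auto split: if_splits)
    let ?e2 = "(\<chi> s. tp (b s) * fls_const (?\<alpha> s)) :: V"
    have e2: "?z ?e2 s = ?\<alpha> s" for s by (simp add: mult.assoc[symmetric] tp_mult_tp)
    have e2b: "?e2 \<in> dset b" by (simp add: dset_def)
    \<comment> \<open>Now only s1 may be moved to s2, so alpha is fixed and beta is corrected. If
      alpha is no residue of y, the residues in the plane of s1 and s2 form at most a line not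
      containing it, and beta can be made to vanish there.\<close>
    have "\<exists>\<kappa>. ?e2 \<in> y \<or> (\<forall>z\<in>y. ?z z s2 + \<kappa> * ?z z s1 = 0)"
    proof (cases "?e2 \<in> y")
      case False
      have only: "?z z s2 = 0" if z: "z \<in> y" and z1: "?z z s1 = 0" for z
      proof (rule ccontr)
        assume nz: "?z z s2 \<noteq> 0"
        let ?w = "fls_const (1 / ?z z s2) *s z"
        have "?w \<in> y" using z y(1) by (intro OmodD)
        have zw: "?z ?w s = ?z z s / ?z z s2" for s by (simp add: tp_nth)
        have "?e2 \<in> y"
        proof (rule res[OF e2b \<open>?w \<in> y\<close>])
          show "?z ?e2 s1 = ?z ?w s1" unfolding zw e2 using lab z1 by simp
          show "?z ?e2 s2 = ?z ?w s2" unfolding zw e2 using nz by simp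
        qed
        then show False using False by blast
      qed
      show ?thesis
      proof (cases "\<exists>z\<in>y. ?z z s1 \<noteq> 0")
        case False
        then show ?thesis using only by (intro exI[of _ 0]) auto
      next
        case True
        then obtain z0 where z0: "z0 \<in> y" "?z z0 s1 \<noteq> 0" by blast
        have "?z z s2 + (- ?z z0 s2 / ?z z0 s1) * ?z z s1 = 0" if "z \<in> y" for z
        proof -
          let ?c = "?z z s1 / ?z z0 s1"
          let ?w = "z - fls_const ?c *s z0"
          have w: "?z ?w s = ?z z s - ?c * ?z z0 s" for s by (simp add: tp_nth)
          have "?w \<in> y" using z0 that y(1) by (intro OmodD)
          moreover have "?z ?w s1 = 0" unfolding w using z0(2) by simp
          ultimately have "?z ?w s2 = 0" by (rule only)
          then show ?thesis unfolding w by (simp add: mult.commute)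
        qed
        then show ?thesis by blast
      qed
    qed auto
    then obtain \<kappa> where \<kappa>: "?e2 \<in> y \<or> (\<forall>z\<in>y. ?z z s2 + \<kappa> * ?z z s1 = 0)" by blast
    let ?\<beta> = "\<lambda>s. if s = s2 then 1 else if s = s1 then \<kappa> else 0"
    have \<beta>nz: "r = s2 \<or> r = s1" if "?\<beta> r \<noteq> 0" for r using that by (auto split: if_splits)
    show ?thesis
    proof (rule splits_rk1[where b = b and \<alpha> = ?\<alpha> and \<beta> = ?\<beta>])
      show "(\<Sum>s\<in>UNIV. ?\<alpha> s * ?\<beta> s) = 1" unfolding SD using lab by simp
      fix X z assume X: "X \<in> (\<lambda>i. dset (a i)) ` {..5} \<union> {y, y'}" and z: "z \<in> X"
      consider i where "i \<le> 5" "X = dset (a i)" | "X = y" | "X = y'" using X by auto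
      then show "rk1 b ?\<alpha> ?\<beta> z \<in> X"
      proof cases
        case 1
        then show ?thesis using z c unfolding b_def
          by (auto intro!: rk1_dset[of z "a i"] dest: \<alpha>nz \<beta>nz split: if_splits)
      next
        case 2
        let ?f = "fls_const \<kappa> * (tp (- b s1) * z $ s1) + tp (- b s2) * z $ s2"
        have rk: "rk1 b ?\<alpha> ?\<beta> z = ?f *s ?e2"
          unfolding rk1_def SF using lab by (simp add: vec_eq_iff mult_ac)
        have f0: "ordge 0 ?f" using z 2 zO by (intro ordge_add ordge_const_mult) auto
        show ?thesis
          using \<kappa>
        proof
          assume "?e2 \<in> y"
          then show ?thesis unfolding rk 2 using y(1) f0 by (intro OmodD(3)) auto
        next
          assume "\<forall>z\<in>y. ?z z s2 + \<kappa> * ?z z s1 = 0"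
          then have "?f $$ 0 = 0" using z 2 by (simp add: add.commute)
          then have "ordge 1 ?f" using f0 by (simp only: ordge_1_iff)
          then have "rk1 b ?\<alpha> ?\<beta> z \<in> dset (\<lambda>s. b s + 1)"
            unfolding rk by (rule smult_dset[OF _ e2b])
          then show ?thesis using base 2 by blast
        qed
      next
        case 3
        have "rk1 b ?\<alpha> ?\<beta> z \<in> dset (\<lambda>s. a j' s + 1)"
        proof (rule rk1_dset[of z "a (Suc j')"])
          show "z \<in> dset (a (Suc j'))" using z 3 y'(1) by blast
          fix r s assume "?\<alpha> s \<noteq> 0" "?\<beta> r \<noteq> 0"
          then have "s = s2" "r = s2 \<or> r = s1" using \<alpha>nz \<beta>nz by blast+
          then show "a j' s + 1 - b s \<le> a (Suc j') r - b r"
            using d2 c[rule_format, of "Suc j'"] j by (auto simp: b_def)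
        qed
        then show ?thesis using y'(2) 3 by (auto simp: tim_dset)
      qed
    qed
  qed
qed

text \<open>Cut open at j, the cycle of five steps leaves four positions, and each label is a
  two-element subset of them. Only {j+1, j+4} and {j+2, j+3} are incomparable, and modulo 5 both
  have the sum 2j. The proof is a finite check.\<close>

lemma two_step_comparable:
  assumes "p1 < q1" "q1 < (5::nat)" "p2 < q2" "q2 < 5" "j < 5" "j \<notin> {p1, q1, p2, q2}"
    "(p1 + q1) mod 5 \<noteq> (2 * j) mod 5"
    and a: "\<And>i. a i = (if p1 < i then 1 else 0) + (if q1 < i then 1 else (0::int))"
      "\<And>i. a' i = (if p2 < i then 1 else 0) + (if q2 < i then 1 else (0::int))"
  shows "(\<forall>i\<le>5. a i - a (Suc j) \<le> a' i - a' (Suc j)) \<or> (\<forall>i\<le>5. a' i - a' (Suc j) \<le> a i - a (Suc j))"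
proof -
  have le5: "(\<forall>i\<le>(5::nat). P i) \<longleftrightarrow> P 0 \<and> P 1 \<and> P 2 \<and> P 3 \<and> P 4 \<and> P 5" for P
    by (simp add: numeral_eq_Suc le_Suc_eq all_conj_distrib)
  have pairs: "(p, q) \<in> {(0,1),(0,2),(0,3),(0,4),(1,2),(1,3),(1,4),(2,3),(2,4),(3,4)}"
    if "p < q" "q < (5::nat)" for p q
  proof -
    have "q = 1 \<or> q = 2 \<or> q = 3 \<or> q = 4" "p = 0 \<or> p = 1 \<or> p = 2 \<or> p = 3" using that by arith+
    then show ?thesis using that(1) by (elim disjE) simp_all
  qed
  have j: "j = 0 \<or> j = 1 \<or> j = 2 \<or> j = 3 \<or> j = 4" using assms(5) by arith
  note 1 = pairs[OF assms(1,2)] and 2 = pairs[OF assms(3,4)]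
  show ?thesis
    using j 1 2 assms(6,7) unfolding le5 a insert_iff prod.inject empty_iff
    by (elim disjE conjE) (simp_all only: simp_thms; simp)+
qed

text \<open>A label that rises both in step j and in step j' can be split off by a projection. If
  two labels rise in one of these steps, the label left over can. Otherwise j belongs to s3 alone
  and j' to s2 alone, and s1 is available for gluing.\<close>

lemma splits_two_insertions:
  fixes p q :: "3 \<Rightarrow> nat"
  defines "a \<equiv> two_step p q"
  assumes pq: "\<And>s. p s < q s \<and> q s < 5"
    and y: "Omod y" "y \<subseteq> dset (a (Suc j))" "tim 1 (dset (a j)) \<subseteq> y"
    and y': "Omod y'" "y' \<subseteq> dset (a (Suc j'))" "tim 1 (dset (a j')) \<subseteq> y'"
    and j: "j < 5" "j' < 5" "j \<noteq> j'"
    and proper: "\<And>i. i < 5 \<Longrightarrow> dset (a i) \<noteq> dset (a (Suc i))"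
  shows "splits ((\<lambda>i. dset (a i)) ` {..5} \<union> {y, y'})"
proof -
  have drop_iff: "a (Suc i) s = (if p s = i \<or> q s = i then a i s + 1 else a i s)" for i s
    using pq[of s] by (auto simp: a_def two_step_def)
  have ex: "\<exists>s. p s = i \<or> q s = i" if "i < 5" for i
  proof (rule ccontr)
    assume "\<not> ?thesis"
    then have "a (Suc i) = a i" using drop_iff by (auto simp: fun_eq_iff)
    then show False using proper[OF that] by simp
  qed
  have O: "Omod Y \<and> (\<exists>b c. Y \<subseteq> dset b \<and> dset c \<subseteq> Y \<and> (c s \<le> b s \<or> (\<forall>r. r \<noteq> s \<longrightarrow> c r \<le> b r)))"
    if Y: "Y \<in> (\<lambda>i. dset (a i)) ` {..5} \<union> {y, y'}"
      and c: "a j s + 1 \<le> a (Suc j) s \<or> (\<forall>r. r \<noteq> s \<longrightarrow> a j r + 1 \<le> a (Suc j) r)"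
        "a j' s + 1 \<le> a (Suc j') s \<or> (\<forall>r. r \<noteq> s \<longrightarrow> a j' r + 1 \<le> a (Suc j') r)" for s Y
  proof -
    consider i where "Y = dset (a i)" | "Y = y" | "Y = y'" using Y by auto
    then show ?thesis
    proof cases
      case 1 then show ?thesis by (metis Omod_dset order_refl)
    next
      case 2 then show ?thesis using y c(1) unfolding tim_dset by blast
    next
      case 3 then show ?thesis using y' c(2) unfolding tim_dset by blast
    qed
  qed
  obtain s3 where s3: "p s3 = j \<or> q s3 = j" using ex j(1) by blast
  obtain s2 where s2: "p s2 = j' \<or> q s2 = j'" using ex j(2) by blast
  show ?thesis
  proof (cases "\<exists>s. (p s = j \<or> q s = j) \<and> (p s = j' \<or> q s = j')")
    case True
    then obtain s where s: "p s = j \<or> q s = j" "p s = j' \<or> q s = j'" by blast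
    show ?thesis
      by (rule splits_projection[where s = s], rule O) (use s in \<open>auto simp: drop_iff\<close>)
  next
    case disj: False
    then have "s2 \<noteq> s3" using s2 s3 by blast
    then obtain s1 where lab: "UNIV = {s2, s3, s1}" "s2 \<noteq> s1" "s3 \<noteq> s1" by (rule third_label)
    have c3: "r = s1 \<or> r = s2 \<or> r = s3" for r using lab(1) by (metis UNIV_I insertE singletonD)
    consider "p s1 = j \<or> q s1 = j" | "p s1 = j' \<or> q s1 = j'"
      | "j \<notin> {p s1, q s1}" "j' \<notin> {p s1, q s1}" by auto
    then show ?thesis
    proof cases
      case 1
      have "r = s1 \<or> r = s3" if "r \<noteq> s2" for r using c3 that by blast
      then show ?thesis
        by (intro splits_projection[where s = s2], intro O) (use s2 s3 1 in \<open>auto simp: drop_iff\<close>)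
    next
      case 2
      have "r = s1 \<or> r = s2" if "r \<noteq> s3" for r using c3 that by blast
      then show ?thesis
        by (intro splits_projection[where s = s3], intro O) (use s2 s3 2 in \<open>auto simp: drop_iff\<close>)
    next
      case 3
      have d3: "a (Suc j) s3 = a j s3 + 1" and d2: "a (Suc j') s2 = a j' s2 + 1"
        using s2 s3 by (auto simp: drop_iff)
      have nj: "j \<notin> {p s1, q s1, p s2, q s2}" "j' \<notin> {p s1, q s1, p s3, q s3}"
      proof -
        have "p s2 \<noteq> j \<and> q s2 \<noteq> j" using disj s2 by blast
        moreover have "p s3 \<noteq> j' \<and> q s3 \<noteq> j'" using disj s3 by blast
        ultimately show "j \<notin> {p s1, q s1, p s2, q s2}" "j' \<notin> {p s1, q s1, p s3, q s3}"
          using 3 by simp_all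
      qed
      have "j = 0 \<or> j = 1 \<or> j = 2 \<or> j = 3 \<or> j = 4" "j' = 0 \<or> j' = 1 \<or> j' = 2 \<or> j' = 3 \<or> j' = 4"
        using j by arith+
      \<comment> \<open>As 2 is invertible modulo 5, the exceptional sum of
        \<open>two_step_comparable\<close> occurs for at most one of j and j'. The roles of y and y'
        are exchanged accordingly.\<close>
      then have "(2 * j) mod 5 \<noteq> (2 * j') mod 5" using j(3) by (elim disjE) simp_all
      then have ne: "(p s1 + q s1) mod 5 \<noteq> (2 * j') mod 5" if "(p s1 + q s1) mod 5 = (2 * j) mod 5"
        using that by argo
      show ?thesis
      proof (cases "(p s1 + q s1) mod 5 = (2 * j) mod 5")
        case 1: False
        have "(\<forall>i\<le>5. a i s1 - a (Suc j) s1 \<le> a i s2 - a (Suc j) s2) \<or>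
          (\<forall>i\<le>5. a i s2 - a (Suc j) s2 \<le> a i s1 - a (Suc j) s1)"
          by (rule two_step_comparable[OF _ _ _ _ j(1) nj(1) 1]) (use pq in \<open>auto simp: a_def two_step_def\<close>)
        then show ?thesis
          unfolding a_def using lab
          by (intro splits_glued[of s1 s2 s3 y p q j y' j'])
             (use y y' j d2 d3 \<open>s2 \<noteq> s3\<close> in \<open>auto simp: a_def\<close>)
      next
        case True
        note 2 = ne[OF True]
        have "(\<forall>i\<le>5. a i s1 - a (Suc j') s1 \<le> a i s3 - a (Suc j') s3) \<or>
          (\<forall>i\<le>5. a i s3 - a (Suc j') s3 \<le> a i s1 - a (Suc j') s1)"
          by (rule two_step_comparable[OF _ _ _ _ j(2) nj(2) 2]) (use pq in \<open>auto simp: a_def two_step_def\<close>)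
        then have "splits ((\<lambda>i. dset (a i)) ` {..5} \<union> {y', y})"
          unfolding a_def using lab
          by (intro splits_glued[of s1 s3 s2 y' p q j' y j])
             (use y y' j d2 d3 \<open>s2 \<noteq> s3\<close> in \<open>auto simp: a_def\<close>)
        then show ?thesis by (simp add: insert_commute)
      qed
    qed
  qed
qed

text \<open>Reading the chain backwards exchanges its two inclusions. With Z i = t^i X (-i), the
  sequence Z decreases because tX i lies in X (i + 1), and t Z i lies in Z (i + 1) because X
  decreases. Five steps lead to t^5 t^(-3) Z 0 = t^2 Z 0, which is why five-chains are pairs of
  flags.\<close>

lemma splits_five_chain:
  assumes X: "chain 5 X" and proper: "\<And>i. X (i + 1) \<noteq> tim 1 (X i)"
    and u: "u \<in> {0..4}" "u' \<in> {0..4}" "u \<noteq> u'"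
    and Y: "Omod Y" "Y \<subseteq> X u" "X (u + 1) \<subseteq> Y"
    and Y': "Omod Y'" "Y' \<subseteq> X u'" "X (u' + 1) \<subseteq> Y'"
  shows "splits (range X \<union> {Y, Y'})"
proof -
  define Z where "Z i = tim (int i) (X (- int i))" for i :: nat
  have Xm: "X (w - 5) = tim (- 3) (X w)" for w
    using chain_period[OF X, of w "- 1"] by simp
  have Z5: "Z 5 = tim 2 (Z 0)" using Xm[of 0] by (simp add: Z_def)
  obtain g h :: "complex fls ^ 3 ^ 3" and p q where gh: "g ** h = mat 1" "h ** g = mat 1"
    and pq: "\<forall>s. p s < q s \<and> q s < 5" and D: "\<forall>i\<le>5. (*v) h ` Z i = dset (two_step p q i)"
  proof -
    have "\<exists>g h p q. g ** h = mat 1 \<and> h ** g = mat 1 \<and> (\<forall>s. p s < q s \<and> q s < 5) \<and>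
      (\<forall>i\<le>5. (*v) h ` Z i = dset (two_step p q i))"
    proof (rule two_flag_coordinates[of Z 5])
      show "lattice (Z 0)" using chainD(1)[OF X] by (simp add: Z_def)
      show "Omod (Z i)" for i unfolding Z_def by (intro Omod_tim chainD(2)[OF X])
      show "Z (Suc i) \<subseteq> Z i" for i
        using tim_mono[OF chainD(4)[OF X, of "- int (Suc i)"], of "int i"] by (simp add: Z_def algebra_simps)
      show "tim 1 (Z i) \<subseteq> Z (Suc i)" for i
        using tim_mono[OF chainD(3)[OF X, of "- int (Suc i)"], of "int (Suc i)"] by (simp add: Z_def algebra_simps)
    qed (rule Z5)
    then show ?thesis using that by blast
  qed
  \<comment> \<open>Since X (u - 5) = t^(-3) X u, a lattice between X u and X (u + 1) shows up in
    the gap j = 4 - u of the reversed chain after scaling by t^(j - 2).\<close>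
  have ins: "Omod ((*v) h ` tim (j - 2) Y) \<and> (*v) h ` tim (j - 2) Y \<subseteq> dset (two_step p q (Suc (nat j))) \<and>
      tim 1 (dset (two_step p q (nat j))) \<subseteq> (*v) h ` tim (j - 2) Y"
    if u: "u \<in> {0..4}" and j: "j = 4 - u" and Y: "Omod Y" "Y \<subseteq> X u" "X (u + 1) \<subseteq> Y" for u j Y
  proof -
    have j5: "nat j < 5" "0 \<le> j" using u j by auto
    have "Z (Suc (nat j)) = tim (j + 1) (X (u - 5))" using j5(2) by (simp add: Z_def j algebra_simps)
    then have ZS: "Z (Suc (nat j)) = tim (j - 2) (X u)" by (simp add: Xm)
    have "Z (nat j) = tim j (X ((u + 1) - 5))" using j5(2) by (simp add: Z_def j algebra_simps)
    then have Zj: "tim 1 (Z (nat j)) = tim (j - 2) (X (u + 1))" unfolding Xm by simp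
    have "(*v) h ` tim (j - 2) Y \<subseteq> (*v) h ` Z (Suc (nat j))"
      unfolding ZS by (intro image_mono tim_mono Y)
    moreover have "(*v) h ` tim 1 (Z (nat j)) \<subseteq> (*v) h ` tim (j - 2) Y"
      unfolding Zj by (intro image_mono tim_mono Y)
    ultimately show ?thesis
      using D j5 Omod_image[OF Omod_tim[OF Y(1)]] by (auto simp flip: tim_image)
  qed
  have "splits ((\<lambda>i. dset (two_step p q i)) ` {..5} \<union> {(*v) h ` tim ((4 - u) - 2) Y, (*v) h ` tim ((4 - u') - 2) Y'})"
  proof (rule splits_two_insertions[where j = "nat (4 - u)" and j' = "nat (4 - u')"])
    show "p s < q s \<and> q s < 5" for s using pq by blast
    show "nat (4 - u) < 5" "nat (4 - u') < 5" "nat (4 - u) \<noteq> nat (4 - u')" using u by auto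
    show "dset (two_step p q i) \<noteq> dset (two_step p q (Suc i))" if i: "i < 5" for i
    proof
      assume "dset (two_step p q i) = dset (two_step p q (Suc i))"
      then have e: "(*v) h ` Z i = (*v) h ` Z (Suc i)" using D i by simp
      have "inj ((*v) h)"
        by (rule inj_on_inverseI[of _ "(*v) g"]) (simp only: matrix_vector_mul_assoc gh matrix_vector_mul_lid)
      then have "Z i = Z (Suc i)" using e by (simp add: inj_image_eq_iff)
      then have "tim (int i) (X (- int i)) = tim (int i) (tim 1 (X (- int (Suc i))))" by (simp add: Z_def add.commute)
      then have "X (- int i) = tim 1 (X (- int (Suc i)))" by (simp only: tim_eq_iff)
      then show False using proper[of "- int (Suc i)"] by simp
    qed
  qed (use ins[OF u(1) refl Y] ins[OF u(2) refl Y'] in auto)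
  moreover have "(\<lambda>i. dset (two_step p q i)) ` {..5} = (\<lambda>i. (*v) h ` Z i) ` {..5}"
    using D by (intro image_cong) auto
  ultimately have "splits ((\<lambda>X. (*v) h ` X) ` (Z ` {..5} \<union> {tim ((4 - u) - 2) Y, tim ((4 - u') - 2) Y'}))"
    by (simp add: image_Un image_image)
  then have s: "splits (Z ` {..5} \<union> {tim ((4 - u) - 2) Y, tim ((4 - u') - 2) Y'})" by (rule splits_conj[OF gh(2,1)])
  have "splits (X ` {-4..<-4 + 5} \<union> {Y, Y'})"
  proof (rule splits_tim[OF s])
    fix W assume "W \<in> X ` {-4..<-4 + 5} \<union> {Y, Y'}"
    then consider i where "-4 \<le> i" "i \<le> 0" "W = X i" | "W = Y" | "W = Y'" by auto
    then show "\<exists>Y\<in>Z ` {..5} \<union> {tim ((4 - u) - 2) Y, tim ((4 - u') - 2) Y'}. \<exists>k. W = tim k Y"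
    proof cases
      case 1
      then have "W = tim i (Z (nat (- i)))" "nat (- i) \<in> {..5}" by (auto simp: Z_def)
      then show ?thesis by blast
    next
      case 2
      then have "W = tim (- ((4 - u) - 2)) (tim ((4 - u) - 2) Y)" by simp
      then show ?thesis by blast
    next
      case 3
      then have "W = tim (- ((4 - u') - 2)) (tim ((4 - u') - 2) Y')" by simp
      then show ?thesis by blast
    qed
  qed
  from chain_splits[OF X _ this, of "{Y, Y'}"] show ?thesis
    by (metis tim_0 zero_less_numeral)
qed

subsection \<open>Generators of chains without removable members\<close>

lemma foldr_adj_least: "csub S \<Longrightarrow> Y \<subseteq> S \<Longrightarrow> set qs \<subseteq> S \<Longrightarrow> foldr adj qs Y \<subseteq> S"
proof (induction qs)
  case (Cons q qs)
  then have "foldr adj qs Y \<subseteq> S" "q \<in> S" by auto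
  then show ?case using adj_least[OF Cons.prems(1)] by simp
qed simp

lemma foldr_adj_in: "0 \<in> Y \<Longrightarrow> q \<in> set qs \<Longrightarrow> q \<in> foldr adj qs Y"
proof (induction qs)
  case (Cons p qs)
  have "0 \<in> foldr adj qs Y" using Cons.prems(1) adjs_superset[of Y qs] by blast
  then show ?case using Cons adj_in[of "foldr adj qs Y" p] adj_superset[of "foldr adj qs Y" p] by auto
qed simp

lemma csub_tim: "csub S \<Longrightarrow> csub (tim k S)"
  unfolding csub_def tim_def
proof (intro conjI ballI allI; elim conjE)
  assume S: "0 \<in> S" "\<forall>x\<in>S. \<forall>y\<in>S. x + y \<in> S" "\<forall>c. \<forall>x\<in>S. fls_const c *s x \<in> S"
  show "0 \<in> {z. tp (- k) *s z \<in> S}" using S(1) by simp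
  fix x y c assume x: "x \<in> {z. tp (- k) *s z \<in> S}"
  have "fls_const c *s (tp (- k) *s x) \<in> S" using x S(3) by blast
  then show "fls_const c *s x \<in> {z. tp (- k) *s z \<in> S}"
    by (simp add: vector_smult_assoc mult.commute)
  assume "y \<in> {z. tp (- k) *s z \<in> S}"
  then show "x + y \<in> {z. tp (- k) *s z \<in> S}" using x S(2) by (simp add: vector_add_ldistrib)
qed

lemma adj_tim: "adj (tp k *s q) (tim k Y) = tim k (adj q Y)"
proof -
  have sub: "adj (tp k *s q) (tim k Y) \<subseteq> tim k (adj q Y)" for k q Y
  proof
    fix z assume "z \<in> adj (tp k *s q) (tim k Y)"
    then obtain y c where y: "tp (- k) *s y \<in> Y" "z = y + fls_const c *s (tp k *s q)"
      by (auto simp: adj_def tim_def)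
    have "tp (- k) * (fls_const c * tp k) = fls_const c"
      by (simp add: mult.left_commute tp_mult_tp)
    then have "tp (- k) *s (fls_const c *s (tp k *s q)) = fls_const c *s q"
      by (simp only: vector_smult_assoc)
    then have "tp (- k) *s z = tp (- k) *s y + fls_const c *s q" unfolding y(2) vector_add_ldistrib by simp
    then show "z \<in> tim k (adj q Y)" using y(1) by (auto simp: tim_def adj_def)
  qed
  have "adj (tp (- k) *s (tp k *s q)) (tim (- k) (tim k Y)) = adj q Y"
    by (simp add: vector_smult_assoc tp_mult_tp)
  have "tim k (adj q Y) \<subseteq> adj (tp k *s q) (tim k Y)"
  proof
    fix z assume "z \<in> tim k (adj q Y)"
    then obtain y c where y: "y \<in> Y" "tp (- k) *s z = y + fls_const c *s q" by (auto simp: adj_def tim_def)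
    have "z = tp k *s (tp (- k) *s z)" by (simp add: vector_smult_assoc tp_mult_tp)
    also have "\<dots> = tp k *s y + fls_const c *s (tp k *s q)"
      unfolding y(2) by (simp add: vector_add_ldistrib vector_smult_assoc mult.commute)
    finally show "z \<in> adj (tp k *s q) (tim k Y)" using y(1) unfolding adj_def by auto
  qed
  with sub show ?thesis by blast
qed

lemma foldr_adj_tim: "foldr adj (map ((*s) (tp k)) qs) (tim k Y) = tim k (foldr adj qs Y)"
  by (induction qs) (simp_all add: adj_tim)

text \<open>The part of X i that is reached from its neighbours, by x from X (i - 1) and by y from X
  (i + 1). What X i needs beyond it are the generators at this place.\<close>

definition corner :: "(int \<Rightarrow> V set) \<Rightarrow> int \<Rightarrow> V set" where
  "corner X i = {x + y | x y. x \<in> tim 1 (X (i - 1)) \<and> y \<in> X (i + 1)}"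

lemma Omod_plus:
  assumes "Omod X" "Omod Y" shows "Omod {x + y | x y. x \<in> X \<and> y \<in> Y}"
  unfolding Omod_def
proof (intro conjI ballI allI impI)
  show "0 \<in> {x + y | x y. x \<in> X \<and> y \<in> Y}" using assms OmodD(1) by force
  fix z w c assume z: "z \<in> {x + y | x y. x \<in> X \<and> y \<in> Y}"
  then obtain x y where xy: "x \<in> X" "y \<in> Y" "z = x + y" by blast
  { assume "w \<in> {x + y | x y. x \<in> X \<and> y \<in> Y}"
    then obtain x' y' where "x' \<in> X" "y' \<in> Y" "w = x' + y'" by blast
    then have "z + w = (x + x') + (y + y')" "x + x' \<in> X" "y + y' \<in> Y"
      using xy assms by (auto intro: OmodD(2))
    then show "z + w \<in> {x + y | x y. x \<in> X \<and> y \<in> Y}" by blast }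
  { assume "ordge 0 c"
    then have "c *s z = c *s x + c *s y" "c *s x \<in> X" "c *s y \<in> Y"
      using xy assms by (auto simp: vector_add_ldistrib intro: OmodD(3))
    then show "c *s z \<in> {x + y | x y. x \<in> X \<and> y \<in> Y}" by blast }
qed

lemma corner_props:
  assumes X: "chain n X"
  shows "lattice (corner X i)" "X (i + 1) \<subseteq> corner X i" "tim 1 (X (i - 1)) \<subseteq> corner X i" "corner X i \<subseteq> X i"
proof -
  note O = chainD(2)[OF X]
  show 1: "X (i + 1) \<subseteq> corner X i" using OmodD(1)[OF Omod_tim[OF O]] unfolding corner_def by force
  show 2: "tim 1 (X (i - 1)) \<subseteq> corner X i" using OmodD(1)[OF O] unfolding corner_def by force
  have "tim 1 (X (i - 1)) \<subseteq> X i" using chainD(4)[OF X, of "i - 1"] by simp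
  then show 3: "corner X i \<subseteq> X i"
    unfolding corner_def using chainD(3)[OF X, of i] OmodD(2)[OF O] by blast
  show "lattice (corner X i)"
    by (rule lattice_between[OF chainD(1)[OF X] chainD(1)[OF X] 1 3])
       (unfold corner_def, intro Omod_plus O Omod_tim)
qed

lemma corner_period:
  assumes X: "chain n X"
  shows "corner X (i + n * k) = tim (3 * k) (corner X i)"
proof -
  have e: "X (i + n * k - 1) = tim (3 * k) (X (i - 1))" "X (i + n * k + 1) = tim (3 * k) (X (i + 1))"
    using chain_period[OF X, of "i - 1" k] chain_period[OF X, of "i + 1" k] by (simp_all add: algebra_simps)
  have plus: "{x + y | x y. x \<in> tim k A \<and> y \<in> tim k B} = tim k {x + y | x y. x \<in> A \<and> y \<in> B}" for k A B
  proof -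
    have "\<exists>u v. z = u + v \<and> tp (- k) *s u \<in> A \<and> tp (- k) *s v \<in> B"
      if xy: "x \<in> A" "y \<in> B" "tp (- k) *s z = x + y" for z x y
    proof -
      have "z = tp k *s (tp (- k) *s z)" by (simp add: vector_smult_assoc tp_mult_tp)
      then have "z = tp k *s x + tp k *s y" unfolding xy(3) vector_add_ldistrib .
      moreover have "tp (- k) *s (tp k *s x) = x" "tp (- k) *s (tp k *s y) = y"
        by (simp_all add: vector_smult_assoc tp_mult_tp)
      ultimately show ?thesis using xy by metis
    qed
    then show ?thesis unfolding tim_def by (auto simp: vector_add_ldistrib) blast
  qed
  have "tim 1 (X (i + n * k - 1)) = tim (3 * k) (tim 1 (X (i - 1)))" unfolding e by (simp add: add.commute)
  then show ?thesis unfolding corner_def e(2) by (simp only: plus)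
qed

text \<open>The generators of one period, from j - 2 to j + n - 3, generate X j over tX j. From X (j
  + n - 2) = t^3 X (j - 2), which lies in tX j, one comes down to X (j + 1). From t^3 X (j - 3) = X
  (j + n - 3) one comes up to t X (j - 1). These two make the corner at j.\<close>

lemma chain_generated:
  assumes X: "chain n X" and n: "6 \<le> n" "n \<le> 7"
    and gen: "\<And>i. X i \<subseteq> foldr adj (gs i) (corner X i)"
    and S: "csub S" "tim 1 (X j) \<subseteq> S"
    and d: "\<And>d. 0 \<le> d \<Longrightarrow> d \<le> n - 3 \<Longrightarrow> set (gs (j + d)) \<subseteq> S"
    and e: "\<And>e g. e \<in> {1, 2} \<Longrightarrow> g \<in> set (gs (j - e)) \<Longrightarrow> tp e *s g \<in> S"
  shows "X j \<subseteq> S"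
proof -
  have plusS: "corner X i \<subseteq> S" if "tim 1 (X (i - 1)) \<subseteq> S" "X (i + 1) \<subseteq> S" "csub S" for i S
    using that unfolding corner_def csub_def by blast
  have A: "X (j + (n - 2) - int m) \<subseteq> S" if "int m \<le> n - 3" for m
    using that
  proof (induction m)
    case 0
    have "X (j + (n - 2)) = tim 1 (tim 2 (X (j - 2)))"
      using chainD(5)[OF X, of "j - 2"] by (simp add: algebra_simps)
    also have "\<dots> \<subseteq> tim 1 (X j)" using chain_tim[OF X, of 2 "j - 2"] by (intro tim_mono) simp
    finally show ?case using S(2) by simp
  next
    case (Suc m)
    let ?i = "j + (n - 2) - int (Suc m)"
    have "tim 1 (X (?i - 1)) \<subseteq> tim 1 (X j)"
      using Suc.prems by (intro tim_mono chain_anti[OF X]) simp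
    moreover have "X (?i + 1) \<subseteq> S" using Suc by (simp add: algebra_simps)
    ultimately have "corner X ?i \<subseteq> S" using S by (intro plusS) auto
    moreover have "set (gs ?i) \<subseteq> S" using d[of "(n - 2) - int (Suc m)"] Suc.prems by (simp add: algebra_simps)
    ultimately show ?case using gen[of ?i] foldr_adj_least[OF S(1)] by blast
  qed
  have A': "X (j + d) \<subseteq> S" if "1 \<le> d" "d \<le> n - 2" for d
  proof -
    have "X (j + (n - 2) - int (nat (n - 2 - d))) \<subseteq> S" using that by (intro A) simp
    then show ?thesis using that by simp
  qed
  have B3: "tim 3 (X (j - 3)) \<subseteq> S"
  proof -
    have "tim 3 (X (j - 3)) = X (j + (n - 3))" using chainD(5)[OF X, of "j - 3"] by (simp add: algebra_simps)
    then show ?thesis using A'[of "n - 3"] n by simp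
  qed
  have B: "tim k (X (j - k)) \<subseteq> S" if k: "k \<in> {1, 2}" and up: "tim (k + 1) (X (j - (k + 1))) \<subseteq> S" for k
  proof -
    let ?S = "tim (- k) S"
    have cS: "csub ?S" using S(1) by (rule csub_tim)
    have "tim 1 (X (j - k - 1)) \<subseteq> ?S"
      using tim_mono[OF up, of "- k"] by (simp add: algebra_simps)
    moreover have "X (j - k + 1) \<subseteq> ?S"
    proof -
      have "tim k (X (j - k + 1)) = tim 1 (tim (k - 1) (X (j - (k - 1))))" by (simp add: algebra_simps)
      also have "\<dots> \<subseteq> tim 1 (X j)" using chain_tim[OF X, of "k - 1" "j - (k - 1)"] k by (intro tim_mono) auto
      finally have "tim k (X (j - k + 1)) \<subseteq> S" using S(2) by blast
      from tim_mono[OF this, of "- k"] show ?thesis by simp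
    qed
    ultimately have "corner X (j - k) \<subseteq> ?S" using cS by (intro plusS)
    moreover have "set (gs (j - k)) \<subseteq> ?S" using e[OF k] by (auto simp: tim_def)
    ultimately have "X (j - k) \<subseteq> ?S" using gen[of "j - k"] foldr_adj_least[OF cS] by blast
    from tim_mono[OF this, of k] show ?thesis by simp
  qed
  have "tim 2 (X (j - 2)) \<subseteq> S" using B[of 2] B3 by simp
  then have "tim 1 (X (j - 1)) \<subseteq> S" using B[of 1] by simp
  moreover have "X (j + 1) \<subseteq> S" using A'[of 1] n by simp
  ultimately have "corner X j \<subseteq> S" using S by (intro plusS)
  moreover have "set (gs j) \<subseteq> S" using d[of 0] n by simp
  ultimately show ?thesis using gen[of j] foldr_adj_least[OF S(1)] by blast
qed

lemma lidx_chain_sum: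
  assumes X: "chain n X"
  shows "lidx (X a) (X (a + int m)) = (\<Sum>k<m. lidx (X (a + int k)) (X (a + int k + 1)))"
proof (induction m)
  case (Suc m)
  have "lidx (X a) (X (a + int (Suc m))) = lidx (X a) (X (a + int m)) + lidx (X (a + int m)) (X (a + int (Suc m)))"
    by (rule lidx_add[OF chainD(1)[OF X] chainD(1)[OF X] chainD(1)[OF X]]) (rule chain_anti[OF X]; simp)+
  then show ?case using Suc by (simp add: algebra_simps)
qed (simp add: lidx_def)

lemma lidx_chain_total:
  assumes X: "chain n X" shows "lidx (X a) (X (a + n)) = 9"
proof -
  have L: "lattice (tim k (X a))" for k by (intro lattice_tim chainD(1)[OF X])
  have s: "tim (k + 1) (X a) \<subseteq> tim k (X a)" for k
    using lattice_tim1_subset[OF L, of 1 k] by (simp add: add.commute)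
  have 1: "lidx (tim k (X a)) (tim (k + 1) (X a)) = 3" for k
    using lidx_tim[of k "X a" "tim 1 (X a)"] lidx_tim1[OF chainD(1)[OF X]] by simp
  have "lidx (tim 0 (X a)) (tim 2 (X a)) = 6"
    using lidx_add[OF L[of 0] L[of 1] L[of 2]] s[of 0] s[of 1] 1[of 0] 1[of 1] by simp
  moreover have "tim 2 (X a) \<subseteq> tim 0 (X a)" using s[of 0] s[of 1] by simp
  ultimately have "lidx (tim 0 (X a)) (tim 3 (X a)) = 9"
    using lidx_add[OF L L L, of 2 0 3] s[of 2] 1[of 2] by simp
  then show ?thesis using chainD(5)[OF X] by simp
qed

text \<open>When t X (i - 1) is not inside X (i + 1), the corner is strictly larger than X (i + 1),
  so one unit of the index of this step needs no generator. Generators are chosen on one period and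
  carried on by t^3.\<close>

lemma chain_generators:
  assumes X: "chain n X" and n: "0 < n" and no: "\<And>i. \<not> tim 1 (X (i - 1)) \<subseteq> X (i + 1)"
  shows "\<exists>gs. (\<forall>i. set (gs i) \<subseteq> X i \<and> X i \<subseteq> foldr adj (gs i) (corner X i)) \<and>
    (\<forall>i k. gs (i + n * k) = map ((*s) (tp (3 * k))) (gs i)) \<and>
    (\<forall>a. (\<Sum>k<nat n. length (gs (a + int k))) + nat n \<le> 9)"
proof -
  have ex: "\<exists>qs. set qs \<subseteq> X i \<and> foldr adj qs (corner X i) = X i \<and> length qs + 1 \<le> lidx (X i) (X (i + 1))" for i
  proof -
    note c = corner_props[OF X, of i]
    obtain qs where qs: "set qs \<subseteq> X i" "length qs \<le> lidx (X i) (corner X i)" "foldr adj qs (corner X i) = X i"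
      using lidx_generators[OF chainD(1)[OF X] c(1) c(4)] by blast
    have "X (i + 1) \<noteq> corner X i" using no[of i] c(3) by blast
    then have "0 < lidx (corner X i) (X (i + 1))"
      using c(2) by (intro lidx_pos c(1) chainD(1)[OF X]) blast
    moreover have "lidx (X i) (X (i + 1)) = lidx (X i) (corner X i) + lidx (corner X i) (X (i + 1))"
      by (rule lidx_add[OF chainD(1)[OF X] c(1) chainD(1)[OF X] c(4) c(2)])
    ultimately show ?thesis using qs by (intro exI[of _ qs]) simp
  qed
  then obtain G where G: "\<And>i. set (G i) \<subseteq> X i" "\<And>i. foldr adj (G i) (corner X i) = X i"
    "\<And>i. length (G i) + 1 \<le> lidx (X i) (X (i + 1))" by metis
  define gs where "gs i = map ((*s) (tp (3 * (i div n)))) (G (i mod n))" for i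
  have i: "i = i mod n + n * (i div n)" for i by simp
  have Xi: "X i = tim (3 * (i div n)) (X (i mod n))" for i
    using chain_period[OF X, of "i mod n" "i div n"] i[of i] by metis
  have Ci: "corner X i = tim (3 * (i div n)) (corner X (i mod n))" for i
    using corner_period[OF X, of "i mod n" "i div n"] i[of i] by metis
  have 1: "set (gs i) \<subseteq> X i" for i
    using G(1)[of "i mod n"] Xi[of i] by (auto simp: gs_def)
  have 2: "X i \<subseteq> foldr adj (gs i) (corner X i)" for i
    using Xi[of i] by (simp add: gs_def Ci[of i] foldr_adj_tim G(2))
  have 3: "gs (i + n * k) = map ((*s) (tp (3 * k))) (gs i)" for i k
    using n by (simp add: gs_def vector_smult_assoc tp_mult_tp algebra_simps flip: fun_eq_iff)
  have len: "length (gs i) + 1 \<le> lidx (X i) (X (i + 1))" for i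
  proof -
    have "X (i + 1) = tim (3 * (i div n)) (X (i mod n + 1))"
      using chain_period[OF X, of "i mod n + 1" "i div n"] by (simp add: algebra_simps)
    then show ?thesis using G(3)[of "i mod n"] by (subst Xi) (simp add: gs_def lidx_tim)
  qed
  have 4: "(\<Sum>k<nat n. length (gs (a + int k))) + nat n \<le> 9" for a
  proof -
    have "(\<Sum>k<nat n. length (gs (a + int k))) + nat n = (\<Sum>k<nat n. length (gs (a + int k)) + 1)"
      unfolding sum.distrib by simp
    also have "\<dots> \<le> (\<Sum>k<nat n. lidx (X (a + int k)) (X (a + int k + 1)))"
      by (rule sum_mono) (rule len)
    also have "\<dots> = lidx (X a) (X (a + int (nat n)))" by (rule lidx_chain_sum[OF X, symmetric])
    also have "\<dots> = 9" using n lidx_chain_total[OF X] by simp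
    finally show ?thesis .
  qed
  show ?thesis using 1 2 3 4 by blast
qed

text \<open>Nine minus seven leaves two generators for the three-dimensional X 0 / tX 0.\<close>

lemma seven_chain_removable:
  assumes X: "chain 7 X" shows "\<exists>i. tim 1 (X (i - 1)) \<subseteq> X (i + 1)"
proof (rule ccontr)
  assume "\<not> ?thesis"
  then obtain gs where gs: "\<And>i. X i \<subseteq> foldr adj (gs i) (corner X i)"
    "\<And>a. (\<Sum>k<7. length (gs (a + int k))) \<le> 2"
    using chain_generators[OF X] by (auto simp: numeral_eq_Suc) blast
  let ?L = "concat (map gs [0, 1, 2, 3, 4]) @ map ((*s) (tp 1)) (gs (- 1)) @ map ((*s) (tp 2)) (gs (- 2))"
  let ?S = "foldr adj ?L (tim 1 (X 0))"
  have OX: "Omod (tim 1 (X 0))" by (intro Omod_tim chainD(2)[OF X])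
  have "X 0 \<subseteq> ?S"
  proof (rule chain_generated[OF X _ _ gs(1)])
    show "csub ?S" using Omod_csub[OF OX] by (rule csub_adjs)
    show "tim 1 (X 0) \<subseteq> ?S" by (rule adjs_superset)
    have inS: "g \<in> ?S" if "g \<in> set ?L" for g using foldr_adj_in[OF OmodD(1)[OF OX] that] .
    show "set (gs (0 + d)) \<subseteq> ?S" if "0 \<le> d" "d \<le> 7 - 3" for d
    proof -
      have "d = 0 \<or> d = 1 \<or> d = 2 \<or> d = 3 \<or> d = 4" using that by arith
      then have "set (gs (0 + d)) \<subseteq> set ?L" by auto
      then show ?thesis using inS by blast
    qed
    show "tp e *s g \<in> ?S" if "e \<in> {1, 2}" "g \<in> set (gs (0 - e))" for e g
      using that by (intro inS) auto
  qed simp_all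
  then have "lidx (X 0) (tim 1 (X 0)) \<le> length ?L"
    by (intro lidx_le_length chainD(1)[OF X] lattice_tim)
  moreover have "length ?L \<le> 2"
    using gs(2)[of "- 2"] by (simp add: numeral_eq_Suc lessThan_Suc)
  ultimately show False using lidx_tim1[OF chainD(1)[OF X, of 0]] by simp
qed


lemma length_three_cover:
  assumes "length F \<le> 3" shows "\<exists>f :: 3 \<Rightarrow> 'a. (\<forall>s. f s \<in> set F \<union> {z}) \<and> set F \<subseteq> range f"
proof -
  let ?q = "\<lambda>i. if i < length F then F ! i else z"
  obtain f :: "3 \<Rightarrow> 'a" where f: "f 1 = ?q 0" "f 2 = ?q 1" "f 3 = ?q 2"
    using ex_fun_3[of "?q 0" "?q 1" "?q 2"] by blast
  have "\<forall>s. f s \<in> set F \<union> {z}" unfolding forall_3 f by auto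
  moreover have "x \<in> range f" if x: "x \<in> set F" for x
  proof -
    obtain i where i: "i < length F" "x = F ! i" using x by (metis in_set_conv_nth)
    then have "i = 0 \<or> i = 1 \<or> i = 2" using assms by arith
    then have "x = f 1 \<or> x = f 2 \<or> x = f 3" using i f by auto
    then show ?thesis by blast
  qed
  ultimately show ?thesis by blast
qed

text \<open>Nine minus six leaves at most three generators. With suitable powers of t in front they
  lie in X j and span it modulo t, for every j at once. So v j is a basis of X j that differs from v
  0 only by powers of t, and in the basis v 0 all members are diagonal.\<close>

lemma six_chain_rigid:
  assumes X: "chain 6 X" and no: "\<And>i. \<not> tim 1 (X (i - 1)) \<subseteq> X (i + 1)"
  shows "\<exists>g h E. g ** h = mat 1 \<and> h ** g = mat 1 \<and> (\<forall>j. (*v) h ` X j = dset (E j))"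
proof -
  obtain gs where gs: "\<And>i. set (gs i) \<subseteq> X i" "\<And>i. X i \<subseteq> foldr adj (gs i) (corner X i)"
    "\<And>i k. gs (i + 6 * k) = map ((*s) (tp (3 * k))) (gs i)"
    "\<And>a. (\<Sum>k<6. length (gs (a + int k))) \<le> 3"
    using chain_generators[OF X _ no] by (auto simp: numeral_eq_Suc)
  let ?F = "concat (map (\<lambda>r. map (Pair r) (gs r)) [0, 1, 2, 3, 4, 5])"
  have "length ?F \<le> 3" using gs(4)[of 0] by (simp add: numeral_eq_Suc lessThan_Suc)
  from length_three_cover[OF this, of "(0, 0)"]
  obtain f :: "3 \<Rightarrow> int \<times> V" where f: "\<And>s. f s \<in> set ?F \<union> {(0, 0)}" "set ?F \<subseteq> range f" by blast
  txt \<open>A generator of class \<open>r\<close> modulo 6 is moved into \<open>X j\<close> along the shorter way round.\<close>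
  define e where "e j r = (3 * ((j + (r - j) mod 6 - r) div 6)
     + (if (r - j) mod 6 = 4 then - 1 else if (r - j) mod 6 = 5 then - 2 else 0) :: int)" for j r :: int
  define v where "v j s = tp (e j (fst (f s))) *s snd (f s)" for j s
  have gen: "gs i = map ((*s) (tp (3 * ((i - i mod 6) div 6)))) (gs (i mod 6))" for i
  proof -
    have "i = i mod 6 + 6 * (i div 6)" by simp
    moreover have "(i - i mod 6) div 6 = i div 6" by (simp add: minus_mod_eq_mult_div)
    ultimately show ?thesis using gs(3)[of "i mod 6" "i div 6"] by metis
  qed
  have mem: "(r, g) \<in> set ?F \<longleftrightarrow> r \<in> {0..5} \<and> g \<in> set (gs r)" for r g
  proof -
    have "{0..5::int} = {0, 1, 2, 3, 4, 5}" by auto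
    then show ?thesis by auto
  qed
  have i6: "(i - i mod 6) div 6 = i div 6" "i = 6 * (i div 6) + i mod 6" for i :: int
    by (simp_all add: minus_mod_eq_mult_div)
  have short: "tp (e j (i mod 6)) = tp (3 * ((i - i mod 6) div 6))" if "i = j + d" "0 \<le> d" "d \<le> 3" for i j d
  proof -
    have "(i mod 6 - j) mod 6 = (i - j) mod 6" by (rule mod_diff_left_eq)
    then have "(i mod 6 - j) mod 6 = d" using that by simp
    then show ?thesis using that by (simp add: e_def)
  qed
  have long: "tp (e j (i mod 6)) = tp (k + 3 * ((i - i mod 6) div 6))" if "i = j - k" "k \<in> {1, 2}" for i j k
  proof -
    have "(i mod 6 - j) mod 6 = (i - j) mod 6" by (rule mod_diff_left_eq)
    then have d: "(i mod 6 - j) mod 6 = 6 - k" using that by auto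
    have "j + (6 - k) - i mod 6 = (i - i mod 6) + 6" using that(1) by simp
    also have "\<dots> = 6 * (i div 6 + 1)" by (simp add: minus_mod_eq_mult_div)
    finally have "j + (6 - k) - i mod 6 = 6 * (i div 6 + 1)" .
    then have "(j + (6 - k) - i mod 6) div 6 = 1 + (i - i mod 6) div 6" by (simp add: i6(1))
    then show ?thesis using that(2) d by (auto simp: e_def)
  qed
  have gin: "tp (e j (i mod 6)) *s g \<in> range (v j)" if "g \<in> set (gs (i mod 6))" for i j g
  proof -
    have "i mod 6 \<in> {0..5}" using pos_mod_bound[of 6 i] by simp
    then have "(i mod 6, g) \<in> range f" using mem f(2) that by blast
    then obtain s where "f s = (i mod 6, g)" by (metis imageE)
    then have "v j s = tp (e j (i mod 6)) *s g" by (simp add: v_def)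
    then show ?thesis by (metis rangeI)
  qed
  have vX: "v j s \<in> X j" for j s
  proof (cases "f s = (0, 0)")
    case True then show ?thesis using OmodD(1)[OF chainD(2)[OF X]] by (simp add: v_def)
  next
    case False
    then have fF: "f s \<in> set ?F" using f(1)[of s] by blast
    obtain r g where fs: "f s = (r, g)" by (cases "f s")
    have "(r, g) \<in> set ?F" using fF unfolding fs .
    then have rg: "f s = (r, g)" "r \<in> {0..5}" "g \<in> set (gs r)" using mem fs by blast+
    have r: "r mod 6 = r" using rg(2) by simp
    let ?d = "(r - j) mod 6"
    show ?thesis
    proof (cases "?d \<le> 3")
      case True
      let ?i = "j + ?d"
      have im: "?i mod 6 = r" using r by (simp add: mod_add_right_eq)
      have "tp (3 * ((?i - ?i mod 6) div 6)) *s g \<in> set (gs ?i)"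
        using gen[of ?i] rg(3) im by simp
      moreover have "tp (e j r) = tp (3 * ((?i - ?i mod 6) div 6))"
        using short[of ?i j ?d] True im by simp
      ultimately have "v j s \<in> set (gs ?i)" by (simp add: v_def rg(1))
      then have "v j s \<in> X ?i" using gs(1) by blast
      moreover have "X ?i \<subseteq> X j" by (rule chain_anti[OF X]) simp
      ultimately show ?thesis by blast
    next
      case False
      let ?k = "6 - ?d"
      have "?k = 1 \<or> ?k = 2" using False pos_mod_bound[of 6 "r - j"] by linarith
      then have k: "?k \<in> {1, 2}" by blast
      let ?i = "j - ?k"
      have "?i = (j + ?d) + (- 1) * 6" by simp
      then have "?i mod 6 = (j + ?d) mod 6" by (metis mod_mult_self1)
      then have im: "?i mod 6 = r" using r by (simp add: mod_add_right_eq)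
      have "tp (3 * ((?i - ?i mod 6) div 6)) *s g \<in> set (gs ?i)"
        using gen[of ?i] rg(3) im by simp
      then have "tp (3 * ((?i - ?i mod 6) div 6)) *s g \<in> X ?i" using gs(1) by blast
      then have "tp ?k *s (tp (3 * ((?i - ?i mod 6) div 6)) *s g) \<in> tim ?k (X ?i)"
        unfolding tp_smult_in_tim by (simp only: diff_self tp_0 vector_smult_lid)
      moreover have "tim ?k (X ?i) \<subseteq> X j" using chain_tim[OF X, of ?k ?i] k by auto
      moreover have "tp (e j r) = tp (?k + 3 * ((?i - ?i mod 6) div 6))"
        using long[of ?i j ?k] k im by simp
      ultimately show ?thesis by (auto simp: v_def rg(1) vector_smult_assoc tp_mult_tp)
    qed
  qed
  have A: "adapted_vectors (X j) (v j)" for j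
  proof
    show "lattice (X j)" by (rule chainD(1)[OF X])
    show "v j s \<in> X j" for s by (rule vX)
    fix z assume z: "z \<in> X j"
    let ?S = "{z. \<exists>\<alpha>. z - vlin (\<lambda>s. fls_const (\<alpha> s)) (v j) \<in> tim 1 (X j)}"
    have Ot: "Omod (tim 1 (X j))" by (intro Omod_tim chainD(2)[OF X])
    have vl: "vlin (\<lambda>s. fls_const (\<alpha> s + \<beta> s)) w = vlin (\<lambda>s. fls_const (\<alpha> s)) w + vlin (\<lambda>s. fls_const (\<beta> s)) w"
      "vlin (\<lambda>s. fls_const (c * \<alpha> s)) w = fls_const c *s vlin (\<lambda>s. fls_const (\<alpha> s)) w"
      "vlin (\<lambda>s. fls_const 0) w = 0" for \<alpha> \<beta> c w
      by (simp_all add: vlin_def vec.scale_sum_right vec.scale_left_distrib sum.distrib flip: fls_plus_const)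
    have cS: "csub ?S"
      unfolding csub_def
    proof (intro conjI ballI allI)
      show "0 \<in> ?S" using OmodD(1)[OF Ot] by (intro CollectI exI[of _ "\<lambda>_. 0"]) (simp add: vlin_def)
      fix x y c assume "x \<in> ?S"
      then obtain \<alpha> where \<alpha>: "x - vlin (\<lambda>s. fls_const (\<alpha> s)) (v j) \<in> tim 1 (X j)" by blast
      have "fls_const c *s (x - vlin (\<lambda>s. fls_const (\<alpha> s)) (v j)) \<in> tim 1 (X j)"
        by (rule OmodD(6)[OF Ot \<alpha>])
      then show "fls_const c *s x \<in> ?S"
        by (intro CollectI exI[of _ "\<lambda>s. c * \<alpha> s"]) (simp only: vl vec.scale_right_diff_distrib)
      assume "y \<in> ?S"
      then obtain \<beta> where "y - vlin (\<lambda>s. fls_const (\<beta> s)) (v j) \<in> tim 1 (X j)" by blast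
      from OmodD(2)[OF Ot \<alpha> this]
      have "x + y - vlin (\<lambda>s. fls_const (\<alpha> s + \<beta> s)) (v j) \<in> tim 1 (X j)"
        unfolding vl by (simp add: algebra_simps)
      then show "x + y \<in> ?S" by (intro CollectI exI)
    qed
    have tS: "tim 1 (X j) \<subseteq> ?S"
    proof
      fix x assume "x \<in> tim 1 (X j)"
      then have "x - vlin (\<lambda>s. fls_const 0) (v j) \<in> tim 1 (X j)" unfolding vl(3) by simp
      then show "x \<in> ?S" by (intro CollectI exI[of _ "\<lambda>_. 0"])
    qed
    have vS: "v j r \<in> ?S" for r
    proof -
      have "vlin (\<lambda>s. fls_const (if s = r then 1 else 0)) (v j) = (\<Sum>s\<in>UNIV. if s = r then v j s else 0)"
        unfolding vlin_def by (rule sum.cong) auto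
      then have "v j r - vlin (\<lambda>s. fls_const (if s = r then 1 else 0)) (v j) = 0" by simp
      then show ?thesis using OmodD(1)[OF Ot] by (intro CollectI exI[of _ "\<lambda>s. if s = r then 1 else 0"]) (simp only:)
    qed
    have "X j \<subseteq> ?S"
    proof (rule chain_generated[OF X _ _ gs(2) cS tS])
      show "set (gs (j + d)) \<subseteq> ?S" if "0 \<le> d" "d \<le> 6 - 3" for d
      proof
        fix g assume "g \<in> set (gs (j + d))"
        then obtain g' where g': "g' \<in> set (gs ((j + d) mod 6))"
          "g = tp (3 * ((j + d - (j + d) mod 6) div 6)) *s g'" using gen[of "j + d"] by auto
        then have "g = tp (e j ((j + d) mod 6)) *s g'" using short[of "j + d" j d] that by simp
        then have "g \<in> range (v j)" using gin[OF g'(1)] by metis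
        then obtain r where "g = v j r" by blast
        then show "g \<in> ?S" using vS[of r] by (simp only:)
      qed
      show "tp k *s g \<in> ?S" if k: "k \<in> {1, 2}" and g: "g \<in> set (gs (j - k))" for k g
      proof -
        obtain g' where g': "g' \<in> set (gs ((j - k) mod 6))"
          "g = tp (3 * ((j - k - (j - k) mod 6) div 6)) *s g'" using gen[of "j - k"] g by auto
        then have "tp k *s g = tp (e j ((j - k) mod 6)) *s g'"
          using long[of "j - k" j k] k by (simp add: vector_smult_assoc tp_mult_tp)
        then have "tp k *s g \<in> range (v j)" using gin[OF g'(1)] by metis
        then obtain r where "tp k *s g = v j r" by blast
        then show ?thesis using vS[of r] by (simp only:)
      qed
    qed simp_all
    then show "\<exists>\<alpha>. z - vlin (\<lambda>s. fls_const (\<alpha> s)) (v j) \<in> tim 1 (X j)" using z by blast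
  qed
  interpret A0: adapted_vectors "X 0" "v 0" by (rule A)
  define E where "E j s = e j (fst (f s)) - e 0 (fst (f s))" for j s
  have "z \<in> X j \<longleftrightarrow> A0.h *v z \<in> dset (E j)" for z j
  proof -
    interpret Aj: adapted_vectors "X j" "v j" by (rule A)
    define c where "c = A0.h *v z"
    have "z = vlin (\<lambda>s. c $ s) (v 0)" unfolding c_def by (simp flip: A0.g_mult)
    also have "\<dots> = vlin (\<lambda>s. tp (- E j s) * c $ s) (v j)"
    proof -
      have "c $ s *s v 0 s = (tp (- E j s) * c $ s) *s v j s" for s
      proof -
        have "tp (- E j s) * c $ s * tp (e j (fst (f s))) = c $ s * tp (e 0 (fst (f s)))"
          by (simp add: mult.commute[of _ "c $ s"] mult.assoc tp_mult_tp E_def)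
        then show ?thesis by (simp only: v_def vector_smult_assoc)
      qed
      then show ?thesis unfolding vlin_def by simp
    qed
    also have "\<dots> = Aj.g *v (\<chi> s. tp (- E j s) * c $ s)" by (simp add: Aj.g_mult)
    finally have "Aj.h *v z = (\<chi> s. tp (- E j s) * c $ s)" by simp
    then have "z \<in> X j \<longleftrightarrow> (\<chi> s. tp (- E j s) * c $ s) \<in> std 0" using Aj.mem_iff by simp
    then show ?thesis by (simp add: std_def dset_def c_def)
  qed
  then have "(*v) A0.h ` X j = dset (E j)" for j
    by (auto simp: image_iff intro!: bexI[of _ "A0.g *v _"])
  then show ?thesis using A0.gh by blast
qed

text \<open>Since X (u + 1) differs from tX u, some diagonal exponent does not rise there. At this
  label Y is squeezed between equal exponents, so the projection onto it preserves Y along with the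
  diagonal members.\<close>

lemma splits_rigid_insertion:
  assumes X: "chain 6 X" and no: "\<And>i. \<not> tim 1 (X (i - 1)) \<subseteq> X (i + 1)"
    and Y: "Omod Y" "Y \<subseteq> X u" "X (u + 1) \<subseteq> Y" and proper: "X (u + 1) \<noteq> tim 1 (X u)"
  shows "splits (range X \<union> {Y})"
proof -
  obtain g h :: "complex fls ^ 3 ^ 3" and E where gh: "g ** h = mat 1" "h ** g = mat 1"
    and E: "\<And>j. (*v) h ` X j = dset (E j)" using six_chain_rigid[OF X no] by blast
  have "\<exists>s. E (u + 1) s \<le> E u s"
  proof (rule ccontr)
    assume "\<not> ?thesis"
    then have "E u s < E (u + 1) s" for s by (meson not_le)
    then have "E u s + 1 \<le> E (u + 1) s" for s by (simp add: zless_imp_add1_zle)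
    then have "dset (E (u + 1)) \<subseteq> dset (\<lambda>s. E u s + 1)" by (intro dset_mono)
    then have "(*v) h ` X (u + 1) \<subseteq> (*v) h ` tim 1 (X u)" by (simp add: E tim_dset flip: tim_image)
    moreover have "inj ((*v) h)"
      by (rule inj_on_inverseI[of _ "(*v) g"]) (simp only: matrix_vector_mul_assoc gh matrix_vector_mul_lid)
    ultimately have "X (u + 1) \<subseteq> tim 1 (X u)" by (simp add: inj_image_subset_iff)
    then show False using chainD(4)[OF X, of u] proper by blast
  qed
  then obtain s where s: "E (u + 1) s \<le> E u s" by blast
  have "splits ((\<lambda>X. (*v) h ` X) ` (range X \<union> {Y}))"
  proof (rule splits_projection[where s = s])
    fix W assume "W \<in> (\<lambda>X. (*v) h ` X) ` (range X \<union> {Y})"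
    then consider j where "W = dset (E j)" | "W = (*v) h ` Y" using E by auto
    then show "Omod W \<and> (\<exists>a b. W \<subseteq> dset a \<and> dset b \<subseteq> W \<and> (b s \<le> a s \<or> (\<forall>r. r \<noteq> s \<longrightarrow> b r \<le> a r)))"
    proof cases
      case 1 then show ?thesis by (metis Omod_dset order_refl)
    next
      case 2
      have "W \<subseteq> dset (E u)" "dset (E (u + 1)) \<subseteq> W"
        unfolding 2 E[symmetric] using Y by (auto intro: image_mono)
      then show ?thesis using s 2 Omod_image[OF Y(1)] by blast
    qed
  qed
  then show ?thesis by (rule splits_conj[OF gh(2,1)])
qed


subsection \<open>Chains of seven lattices\<close>

lemma div_mod_succ:
  fixes j n :: int
  assumes n: "0 < n"
  shows "if j mod n = n - 1 then (j + 1) div n = j div n + 1 \<and> (j + 1) mod n = 0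
    else (j + 1) div n = j div n \<and> (j + 1) mod n = j mod n + 1"
proof (cases "j mod n = n - 1")
  case True
  have "j + 1 = n * (j div n) + (j mod n + 1)" by simp
  then have "j + 1 = n * (j div n + 1)" unfolding True by (simp add: algebra_simps)
  then show ?thesis using True n by simp
next
  case False
  let ?q = "j div n" and ?r = "j mod n + 1"
  have j: "j + 1 = n * ?q + ?r" by simp
  have "0 \<le> ?r" "?r < n" using False pos_mod_bound[OF n, of j] pos_mod_sign[OF n, of j] by linarith+
  moreover have "(n * q + r) div n = q \<and> (n * q + r) mod n = r" if "0 \<le> r" "r < n" for q r
    using that n by simp
  ultimately have "(n * ?q + ?r) div n = ?q" "(n * ?q + ?r) mod n = ?r" by blast+
  then show ?thesis using False j by metis
qed

text \<open>X/tX has dimension 3 and X'/tX is nonzero, so at most two proper steps lead from X to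
  X'.\<close>

lemma dense_pair:
  assumes X: "lattice X" "lattice Ya" "lattice Yb" "lattice X'"
    and sub: "Ya \<subseteq> X" "Yb \<subseteq> Ya" "X' \<subseteq> Yb" "tim 1 X \<subseteq> X'" and proper: "X' \<noteq> tim 1 X"
  shows "Ya = X \<or> Yb = Ya \<or> Yb = X'"
proof (rule ccontr)
  assume "\<not> ?thesis"
  then have "0 < lidx X Ya" "0 < lidx Ya Yb" "0 < lidx Yb X'"
    using lidx_pos[OF X(1,2)] lidx_pos[OF X(2,3)] lidx_pos[OF X(3,4)] sub by blast+
  moreover have "0 < lidx X' (tim 1 X)" using lidx_pos[OF X(4) lattice_tim[OF X(1)]] sub proper by blast
  moreover have "lidx X (tim 1 X) = lidx X X' + lidx X' (tim 1 X)"
    using sub by (intro lidx_add X lattice_tim) blast+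
  moreover have "lidx X X' = lidx X Yb + lidx Yb X'"
    using sub by (intro lidx_add X) blast+
  moreover have "lidx X Yb = lidx X Ya + lidx Ya Yb"
    using sub by (intro lidx_add X) blast+
  ultimately show False using lidx_tim1[OF X(1)] by linarith
qed

text \<open>One or two members are taken out and put back as inserted lattices. After a rotation the
  first is X 6. If the remaining six-chain has nothing more to remove, it is diagonal. Otherwise W 5
  is taken out too; the two lie in different gaps of the five-chain, or in the same gap, where
  \<open>dense_pair\<close> reduces them to one genuine insertion.\<close>

theorem seven_chain_splits:
  assumes X0: "chain 7 X0"
  shows "splits (range X0)"
proof (cases "\<exists>a. \<exists>b\<in>{1, 2, 3}. X0 (a + b) = tim 1 (X0 a)")
  case True
  then show ?thesis using splits_homothetic[OF X0] by blast
next
  case noT: False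
  obtain i where i: "tim 1 (X0 (i - 1)) \<subseteq> X0 (i + 1)" using seven_chain_removable[OF X0] by blast
  define X where "X k = X0 (k + (i + 1))" for k
  have X: "chain 7 X" unfolding X_def by (rule chain_rotate[OF X0])
  have range: "range X0 = range X"
  proof -
    have "X0 k = X (k - (i + 1))" for k by (simp add: X_def)
    then show ?thesis unfolding X_def by (metis (no_types, lifting) image_cong image_image range_subsetD rangeI subsetI subset_antisym image_subsetI)
  qed
  \<comment> \<open>Distances up to 3 are excluded because taking out two members may stretch one
    step of the chain to length 3. So consecutive members of the shorter chains are not homothetic
    either.\<close>
  have noX: "X (a + b) \<noteq> tim 1 (X a)" if "b \<in> {1, 2, 3}" for a b
    using noT that unfolding X_def by (metis add.assoc add.commute)
  have rem: "tim 1 (X 5) \<subseteq> X 7"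
  proof -
    have "X 5 = tim 3 (X0 (i - 1))" using chainD(5)[OF X0, of "i - 1"] by (simp add: X_def algebra_simps)
    moreover have "X 7 = tim 3 (X0 (i + 1))" using chainD(5)[OF X0, of "i + 1"] by (simp add: X_def algebra_simps)
    ultimately show ?thesis using tim_mono[OF i, of 3] by (simp add: add.commute)
  qed
  note O = chainD(2)[OF X]
  define f where "f k = (if k = 6 then X 7 else X (int k))" for k :: nat
  define X6 where "X6 = per 6 f"
  have k6: "k = 5 \<or> k < 5" if "k < 6" for k :: nat using that by arith
  have X6: "chain 6 X6" and X66: "X6 6 = X 7"
  proof -
    have "chain (int 6) (per 6 f)"
    proof (rule chain_per)
      show "lattice (f k)" for k using chainD(1)[OF X] by (simp add: f_def)
      show "f (Suc k) \<subseteq> f k" if "k < 6" for k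
        using k6[OF that] chain_anti[OF X, of 5 7] chain_anti[OF X, of "int k" "1 + int k"] by (auto simp: f_def)
      show "tim 1 (f k) \<subseteq> f (Suc k)" if "k < 6" for k
        using k6[OF that]
      proof
        assume "k = 5" then show ?thesis using rem by (simp add: f_def)
      next
        assume "k < 5" then show ?thesis using chainD(4)[OF X, of "int k"] by (simp add: f_def add.commute)
      qed
      show "f 6 = tim 3 (f 0)" using chainD(5)[OF X, of 0] by (simp add: f_def)
    qed simp
    then show "chain 6 X6" by (simp add: X6_def)
    show "X6 6 = X 7" using chainD(5)[OF X, of 0] by (simp add: X6_def per_def f_def)
  qed
  \<comment> \<open>The position in X of the j-th member of the six-chain: places congruent to 6
    modulo 7 are skipped.\<close>
  define idx where "idx j = 7 * (j div 6) + j mod 6" for j :: int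
  have X6_idx: "X6 j = X (idx j)" for j
  proof -
    have "X (j mod 6 + 7 * (j div 6)) = tim (3 * (j div 6)) (X (j mod 6))"
      by (rule chain_period[OF X])
    moreover have "f (nat (j mod 6)) = X (j mod 6)"
    proof -
      have "nat (j mod 6) \<noteq> 6" using pos_mod_bound[of 6 j] pos_mod_bound[of 5 j] by (simp add: nat_eq_iff)
      then show ?thesis by (simp add: f_def)
    qed
    ultimately show ?thesis by (simp add: X6_def per_def idx_def add.commute)
  qed
  have succ: "idx (j + 1) = (if j mod 6 = 5 then idx j + 2 else idx j + 1)"
    "(j + 1) mod 6 = (if j mod 6 = 5 then 0 else j mod 6 + 1)" for j
    using div_mod_succ[of 6 j] by (auto simp: idx_def split: if_splits)
  have idx1: "idx (j + 1) - idx j \<in> {1, 2}" for j by (simp add: succ)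
  have "idx (j + 1 + 1) - idx j \<in> {2, 3}" for j unfolding succ by auto
  then have idx2: "idx (j + 2) - idx j \<in> {2, 3}" for j by (metis add.assoc one_add_one)
  have no1: "X6 (j + 1) \<noteq> tim 1 (X6 j)" and no2: "X6 (j + 2) \<noteq> tim 1 (X6 j)" for j
    using noX[of "idx (j + 1) - idx j" "idx j"] noX[of "idx (j + 2) - idx j" "idx j"] idx1[of j] idx2[of j]
    by (auto simp: X6_idx)
  have X6k: "X6 k = X k" if "k \<in> {0..5}" for k
  proof -
    have "idx k = k" using that by (simp add: idx_def)
    then show ?thesis by (simp add: X6_idx)
  qed
  have Y: "Omod (X 6)" "X 6 \<subseteq> X6 5" "X6 6 \<subseteq> X 6"
    using O X6k[of 5] X66 chain_anti[OF X, of 5 6] chain_anti[OF X, of 6 7] by auto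
  have goal: "splits (range X)" if "splits (range X6 \<union> {X 6})"
  proof -
    have "splits (X ` {0..<0 + 7} \<union> {})"
    proof (rule splits_tim[OF that])
      fix W assume "W \<in> X ` {0..<0 + 7} \<union> {}"
      then obtain k where k: "0 \<le> k" "k < 7" "W = X k" by auto
      show "\<exists>Y\<in>range X6 \<union> {X 6}. \<exists>k. W = tim k Y"
      proof (cases "k = 6")
        case True then have "W = tim 0 (X 6)" using k by simp
        then show ?thesis by blast
      next
        case False then have "W = tim 0 (X6 k)" using k X6k[of k] by simp
        then show ?thesis by blast
      qed
    qed
    from chain_splits[OF X _ this, of "{}"] show ?thesis by simp
  qed
  have "splits (range X6 \<union> {X 6})"
  proof (cases "\<exists>l. tim 1 (X6 (l - 1)) \<subseteq> X6 (l + 1)")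
    case False
    then show ?thesis using splits_rigid_insertion[OF X6 _ Y(1), of 5] Y no1[of 5] by auto
  next
    case True
    then obtain l0 where l0: "tim 1 (X6 (l0 - 1)) \<subseteq> X6 (l0 + 1)" by blast
    define l where "l = l0 mod 6"
    have l: "l \<in> {0..5}" unfolding l_def using pos_mod_bound[of 6 l0] by simp
    have remL: "tim 1 (X6 (l - 1)) \<subseteq> X6 (l + 1)"
    proof -
      have "l0 = l + 6 * (l0 div 6)" by (simp add: l_def)
      then have e: "l0 - 1 = (l - 1) + 6 * (l0 div 6)" "l0 + 1 = (l + 1) + 6 * (l0 div 6)" by simp_all
      have "tim (3 * (l0 div 6)) (tim 1 (X6 (l - 1))) \<subseteq> tim (3 * (l0 div 6)) (X6 (l + 1))"
        using l0 unfolding e chain_period[OF X6] by (simp add: add.commute)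
      then show ?thesis by (simp only: tim_subset_iff)
    qed
    have remW: "tim 1 (X6 (l + 5)) \<subseteq> X6 (l + 7)"
      using tim_mono[OF remL, of 3] chainD(5)[OF X6, of "l - 1"] chainD(5)[OF X6, of "l + 1"]
      by (simp add: algebra_simps)
    define W where "W k = X6 (k + (l + 1))" for k
    have W: "chain 6 W" unfolding W_def by (rule chain_rotate[OF X6])
    define f' where "f' k = (if k = 5 then W 6 else W (int k))" for k :: nat
    define X5 where "X5 = per 5 f'"
    have k5: "k = 4 \<or> k < 4" if "k < 5" for k :: nat using that by arith
    have rem': "tim 1 (W 4) \<subseteq> W 6" using remW by (simp add: W_def algebra_simps)
    have X5: "chain 5 X5" and X55: "X5 5 = W 6"
    proof -
      have "chain (int 5) (per 5 f')"
      proof (rule chain_per)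
        show "lattice (f' k)" for k using chainD(1)[OF W] by (simp add: f'_def)
        show "f' (Suc k) \<subseteq> f' k" if "k < 5" for k
          using k5[OF that] chain_anti[OF W, of 4 6] chain_anti[OF W, of "int k" "1 + int k"] by (auto simp: f'_def)
        show "tim 1 (f' k) \<subseteq> f' (Suc k)" if "k < 5" for k
          using k5[OF that]
        proof
          assume "k = 4" then show ?thesis using rem' by (simp add: f'_def)
        next
          assume "k < 4" then show ?thesis using chainD(4)[OF W, of "int k"] by (simp add: f'_def add.commute)
        qed
        show "f' 5 = tim 3 (f' 0)" using chainD(5)[OF W, of 0] by (simp add: f'_def)
      qed simp
      then show "chain 5 X5" by (simp add: X5_def)
      show "X5 5 = W 6" using chainD(5)[OF W, of 0] by (simp add: X5_def per_def f'_def)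
    qed
    define jdx where "jdx j = 6 * (j div 5) + j mod 5" for j :: int
    have X5_jdx: "X5 j = W (jdx j)" for j
    proof -
      have "W (j mod 5 + 6 * (j div 5)) = tim (3 * (j div 5)) (W (j mod 5))"
        by (rule chain_period[OF W])
      moreover have "f' (nat (j mod 5)) = W (j mod 5)"
      proof -
        have "nat (j mod 5) \<noteq> 5" using pos_mod_bound[of 6 j] pos_mod_bound[of 5 j] by (simp add: nat_eq_iff)
        then show ?thesis by (simp add: f'_def)
      qed
      ultimately show ?thesis by (simp add: X5_def per_def jdx_def add.commute)
    qed
    have X5k: "X5 k = W k" if "k \<in> {0..4}" for k
    proof -
      have "jdx k = k" using that by (simp add: jdx_def)
      then show ?thesis by (simp add: X5_jdx)
    qed
    have proper: "X5 (j + 1) \<noteq> tim 1 (X5 j)" for j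
    proof -
      have "jdx (j + 1) = jdx j + 1 \<or> jdx (j + 1) = jdx j + 2"
        using div_mod_succ[of 5 j] by (auto simp: jdx_def split: if_splits)
      then show ?thesis
        using no1[of "jdx j + (l + 1)"] no2[of "jdx j + (l + 1)"] unfolding X5_jdx W_def
        by (metis add.assoc add.commute)
    qed
    have OW: "Omod (W k)" for k by (rule chainD(2)[OF W])
    have W5: "W 5 \<subseteq> X5 4" "X5 5 \<subseteq> W 5"
      using X5k[of 4] X55 chain_anti[OF W, of 4 5] chain_anti[OF W, of 5 6] by auto
    have goal': "splits (range X6 \<union> {X 6})" if s: "splits (range X5 \<union> {W 5, tim k (X 6)})" for k
    proof -
      have "splits (W ` {0..<0 + 6} \<union> {tim k (X 6)})"
      proof (rule splits_tim[OF s])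
        fix U assume "U \<in> W ` {0..<0 + 6} \<union> {tim k (X 6)}"
        then consider j where "0 \<le> j" "j < 6" "U = W j" | "U = tim k (X 6)" by auto
        then show "\<exists>Y\<in>range X5 \<union> {W 5, tim k (X 6)}. \<exists>k. U = tim k Y"
        proof cases
          case 1
          show ?thesis
          proof (cases "j = 5")
            case True then have "U = tim 0 (W 5)" using 1 by simp
            then show ?thesis by blast
          next
            case False then have "U = tim 0 (X5 j)" using 1 X5k[of j] by simp
            then show ?thesis by blast
          qed
        next
          case 2 then have "U = tim 0 (tim k (X 6))" by simp
          then show ?thesis by blast
        qed
      qed
      then have "splits (range W \<union> {X 6})"
      proof (rule chain_splits[OF W, rotated])
        fix Z assume "Z \<in> {X 6}"
        then have "Z = tim (- k) (tim k (X 6))" by simp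
        then show "\<exists>Y\<in>{tim k (X 6)}. \<exists>k. Z = tim k Y" by blast
      qed simp
      moreover have "range X6 \<subseteq> range W"
      proof
        fix U assume "U \<in> range X6"
        then obtain j where "U = X6 j" by blast
        then have "U = W (j - (l + 1))" by (simp add: W_def)
        then show "U \<in> range W" by blast
      qed
      then have "range X6 \<union> {X 6} \<subseteq> range W \<union> {X 6}" by (rule Un_mono) (rule subset_refl)
      ultimately show ?thesis by (rule splits_subset)
    qed
    \<comment> \<open>With one genuine insertion the second slot of \<open>splits_five_chain\<close>
      is filled by a member of the chain, here X5 0 in the gap 0.\<close>
    have one: "splits (range X5 \<union> {Y, Y'})"
      if Y: "Omod Y" "Y \<subseteq> X5 4" "X5 5 \<subseteq> Y" and Y': "Y' = Y \<or> Y' = X5 4 \<or> Y' = X5 5" for Y Y'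
    proof -
      have "splits (range X5 \<union> {Y, X5 0})"
        by (rule splits_five_chain[OF X5 proper, of 4 0])
           (use Y chainD(2)[OF X5] chainD(3)[OF X5, of 0] in auto)
      then show ?thesis by (rule splits_subset) (use Y' in auto)
    qed
    \<comment> \<open>\<open>X 6\<close> lies between \<open>X6 5\<close> and \<open>X6 6\<close>.
      Up to a power of t, one of these is the removed \<open>W 5\<close> just for l = 0 and l = 5;
      then both insertions fall into the same gap.\<close>
    consider "l = 0" | "l = 5" | "1 \<le> l" "l \<le> 4" using l by force
    then show ?thesis
    proof cases
      case 1
      have e: "X5 4 = X6 5" "W 5 = X6 6" using X5k[of 4] by (simp_all add: W_def 1)
      have "X 6 = X5 4 \<or> W 5 = X 6 \<or> W 5 = X5 5"
        by (rule dense_pair[OF chainD(1)[OF X5] chainD(1)[OF X] chainD(1)[OF W] chainD(1)[OF X5]])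
           (use Y e W5 chainD(4)[OF X5, of 4] proper[of 4] in auto)
      then have "splits (range X5 \<union> {W 5, X 6})"
      proof (elim disjE)
        assume "W 5 = X5 5"
        then show ?thesis using one[of "X 6" "W 5"] Y e W5 by (simp add: insert_commute)
      qed (use one[of "W 5" "X 6"] OW[of 5] W5 in auto)
      then show ?thesis using goal'[of 0] by simp
    next
      case 2
      have e: "X5 5 = tim 3 (X6 6)" "W 5 = tim 3 (X6 5)"
        using chainD(5)[OF X6, of 6] chainD(5)[OF X6, of 5] X55 by (simp_all add: W_def 2)
      have t: "tim 3 (X 6) \<subseteq> W 5" "X5 5 \<subseteq> tim 3 (X 6)" unfolding e using Y by (auto intro: tim_mono[THEN subsetD])
      have "W 5 = X5 4 \<or> tim 3 (X 6) = W 5 \<or> tim 3 (X 6) = X5 5"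
        by (rule dense_pair[OF chainD(1)[OF X5] chainD(1)[OF W] lattice_tim[OF chainD(1)[OF X]] chainD(1)[OF X5]])
           (use t W5 chainD(4)[OF X5, of 4] proper[of 4] in auto)
      then have "splits (range X5 \<union> {W 5, tim 3 (X 6)})"
      proof (elim disjE)
        assume "W 5 = X5 4"
        then show ?thesis using one[of "tim 3 (X 6)" "W 5"] Omod_tim[OF Y(1)] t W5
          by (simp add: insert_commute)
      qed (use one[of "W 5" "tim 3 (X 6)"] OW[of 5] W5 in auto)
      then show ?thesis by (rule goal')
    next
      case 3
      have e: "X5 (4 - l) = X6 5" using X5k[of "4 - l"] 3 by (simp add: W_def)
      have e': "X5 (4 - l + 1) = X6 6" using X5k[of "4 - l + 1"] 3 by (simp add: W_def)
      have "splits (range X5 \<union> {W 5, X 6})"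
        by (rule splits_five_chain[OF X5 proper, of 4 "4 - l"])
           (use 3 Y OW W5 e e' in auto)
      then show ?thesis using goal'[of 0] by simp
    qed
  qed
  then show ?thesis using goal range by simp
qed

subsection \<open>Modules of rank three as chains of lattices\<close>

text \<open>The recursion determines one coefficient after the other. It takes the place of t-adic
  continuity.\<close>

lemma fps_eq_mult_of_shift:
  assumes "\<And>f. p f = fps_const (fps_nth f 0) * u + fps_X * p (fps_shift 1 f)"
  shows "p f = f * (u :: complex fps)"
proof -
  have "fps_nth (p f) l = fps_nth (f * u) l" for l f
  proof (induction l arbitrary: f rule: less_induct)
    case (less l)
    have "f * u = fps_const (fps_nth f 0) * u + fps_X * (fps_shift 1 f * u)"
      by (subst fps_split[of f]) (simp add: algebra_simps)
    then have "fps_nth (f * u) l = fps_nth (fps_const (fps_nth f 0) * u) l + fps_nth (fps_X * (fps_shift 1 f * u)) l"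
      by (metis fps_add_nth)
    moreover have "fps_nth (p f) l = fps_nth (fps_const (fps_nth f 0) * u) l + fps_nth (fps_X * p (fps_shift 1 f)) l"
      by (subst assms) simp
    ultimately show ?case using less[of "l - 1" "fps_shift 1 f"] by (cases "l = 0") (simp_all add: fps_X_mult_nth)
  qed
  then show ?thesis by (simp add: fps_eq_iff)
qed

context B_mod
begin

lemma additive_zero: "additive h \<Longrightarrow> h \<zero>\<^bsub>M\<^esub> = \<zero>\<^bsub>M\<^esub>"
proof -
  assume h: "additive h"
  then have c: "h \<zero>\<^bsub>M\<^esub> \<in> C" unfolding additive_def by blast
  have "h (\<zero>\<^bsub>M\<^esub> \<boxplus> \<zero>\<^bsub>M\<^esub>) = h \<zero>\<^bsub>M\<^esub> \<boxplus> h \<zero>\<^bsub>M\<^esub>" using h unfolding additive_def by blast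
  then have "h \<zero>\<^bsub>M\<^esub> \<boxplus> h \<zero>\<^bsub>M\<^esub> = h \<zero>\<^bsub>M\<^esub>" by simp
  then show ?thesis using M.add.l_cancel_one[OF c c] by simp
qed

lemma additive_finsum:
  assumes "additive h" "finite A" "F \<in> A \<rightarrow> C"
  shows "h (finsum M F A) = (\<Oplus>\<^bsub>M\<^esub>a\<in>A. h (F a))"
  using assms(2,3)
proof (induction A rule: finite_induct)
  case empty
  then show ?case using additive_zero[OF assms(1)] by simp
next
  case (insert a A)
  then have "F \<in> A \<rightarrow> C" "F a \<in> C" "(\<lambda>a. h (F a)) \<in> A \<rightarrow> C" "h (F a) \<in> C"
    using assms(1) unfolding additive_def by blast+
  then show ?case using insert assms(1) by (simp add: additive_def)
qed

text \<open>Coordinates of the component at vertex i, composed with the idempotent so as to be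
  defined on all of M. Compatibility with t and with scalars is all that is recorded; that with
  power series follows by recursion.\<close>

lemma coordinates:
  assumes i: "i < n" and free: "free_over_Z k n M (vertex_space k n M i) r"
  shows "\<exists>\<phi> :: 'm \<Rightarrow> nat \<Rightarrow> complex fps.
    (\<forall>m\<in>C. \<forall>m'\<in>C. \<forall>j<r. \<phi> (m \<boxplus> m') j = \<phi> m j + \<phi> m' j) \<and>
    (\<forall>m\<in>C. \<forall>j<r. \<phi> (T m) j = fps_X * \<phi> m j) \<and>
    (\<forall>m\<in>C. \<forall>c. \<forall>j<r. \<phi> (D (\<lambda>_. c) m) j = fps_const c * \<phi> m j) \<and>
    (\<forall>m\<in>C. \<forall>m'\<in>C. (\<forall>j<r. \<phi> m j = \<phi> m' j) \<longrightarrow> E i m = E i m') \<and>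
    (\<forall>m\<in>C. \<phi> (E i m) = \<phi> m) \<and>
    (\<forall>f. \<exists>m\<in>C. \<forall>j<r. \<phi> m j = f j)"
proof -
  obtain b where b: "b \<in> {..<r} \<rightarrow> vertex_space k n M i"
    and bij: "bij_betw (\<lambda>f. \<Oplus>\<^bsub>M\<^esub>j\<in>{..<r}. Z (f j) (b j)) ({..<r} \<rightarrow>\<^sub>E UNIV) (vertex_space k n M i)"
    using free unfolding free_over_Z_def Z_elem_def act_def by blast
  define L where "L f = (\<Oplus>\<^bsub>M\<^esub>j\<in>{..<r}. Z (f j) (b j))" for f
  have bij': "bij_betw L ({..<r} \<rightarrow>\<^sub>E UNIV) (vertex_space k n M i)"
    using bij unfolding L_def[abs_def] .
  have V: "vertex_space k n M i = E i ` C" by (simp add: vertex_space_def act_def)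
  have bC: "b j \<in> C" if "j < r" for j
  proof -
    have "b j \<in> E i ` C" using b that unfolding V by (auto simp: Pi_iff)
    then show ?thesis using i by auto
  qed
  have LC [simp]: "L f \<in> C" for f unfolding L_def by (rule M.finsum_closed) (use bC in auto)
  have LV: "L f \<in> vertex_space k n M i" for f
  proof -
    have "L f = L (restrict f {..<r})" unfolding L_def by (rule M.finsum_cong') (use bC in auto)
    also have "\<dots> \<in> vertex_space k n M i" using bij_betw_apply[OF bij, of "restrict f {..<r}"] unfolding L_def by simp
    finally show ?thesis .
  qed
  have inj: "f j = g j" if "L f = L g" "j < r" for f g j
  proof -
    have r: "L f = L (restrict f {..<r})" for f unfolding L_def by (rule M.finsum_cong') (use bC in auto)
    have "L (restrict f {..<r}) = L (restrict g {..<r})" using that(1) r by metis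
    then have "restrict f {..<r} = restrict g {..<r}"
      by (rule inj_onD[OF bij_betw_imp_inj_on[OF bij']]) auto
    then show ?thesis using that(2) by (metis restrict_apply' lessThan_iff)
  qed
  have EV: "E i v = v" if "v \<in> vertex_space k n M i" for v using that i unfolding V by (auto simp: E_E)
  define \<phi> where "\<phi> m = (SOME f. L f = E i m)" for m
  have \<phi>: "L (\<phi> m) = E i m" if "m \<in> C" for m
  proof -
    have "E i m \<in> vertex_space k n M i" unfolding V using that by blast
    then have "\<exists>f. L f = E i m" using bij_betw_imp_surj_on[OF bij] unfolding L_def by (metis (no_types, lifting) imageE)
    then show ?thesis unfolding \<phi>_def by (rule someI_ex)
  qed
  have \<phi>I: "\<phi> m j = f j" if "m \<in> C" "E i m = L f" "j < r" for m f j
    using inj[of "\<phi> m" f j] \<phi> that by simp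
  have hL: "h (L f) = L g" if "additive h" "\<And>j. j < r \<Longrightarrow> h (Z (f j) (b j)) = Z (g j) (b j)" for h f g
    unfolding L_def using that bC
    by (subst additive_finsum) (auto intro!: M.finsum_cong')
  show ?thesis
  proof (intro exI[of _ \<phi>] conjI ballI allI impI)
    fix m m' j assume m: "m \<in> C" "m' \<in> C" and j: "j < r"
    have "E i (m \<boxplus> m') = L (\<phi> m) \<boxplus> L (\<phi> m')" using m i \<phi> by (simp add: act_add_right)
    also have "\<dots> = (\<Oplus>\<^bsub>M\<^esub>j\<in>{..<r}. Z (\<phi> m j) (b j) \<boxplus> Z (\<phi> m' j) (b j))"
      unfolding L_def by (rule M.finsum_addf[symmetric]) (use bC in auto)
    also have "\<dots> = L (\<lambda>j. \<phi> m j + \<phi> m' j)"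
      unfolding L_def by (rule M.finsum_cong') (use bC in \<open>auto simp: Z_add\<close>)
    finally show "\<phi> (m \<boxplus> m') j = \<phi> m j + \<phi> m' j" by (intro \<phi>I) (use m j in auto)
  next
    fix m j assume m: "m \<in> C" and j: "j < r"
    have "E i (T m) = T (L (\<phi> m))" using m i \<phi> by (simp add: E_T)
    also have "\<dots> = L (\<lambda>j. fps_X * \<phi> m j)" by (rule hL) (auto simp: additive_act Z_X_mult bC)
    finally show "\<phi> (T m) j = fps_X * \<phi> m j" by (intro \<phi>I) (use m j in auto)
  next
    fix m c j assume m: "m \<in> C" and j: "j < r"
    have "E i (D (\<lambda>_. c) m) = D (\<lambda>_. c) (L (\<phi> m))" using m i \<phi> by (simp add: E_D)
    also have "\<dots> = L (\<lambda>j. fps_const c * \<phi> m j)" by (rule hL) (auto simp: additive_act Z_const_mult bC)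
    finally show "\<phi> (D (\<lambda>_. c) m) j = fps_const c * \<phi> m j" by (intro \<phi>I) (use m j in auto)
  next
    fix m m' assume m: "m \<in> C" "m' \<in> C" and eq: "\<forall>j<r. \<phi> m j = \<phi> m' j"
    have "L (\<phi> m) = L (\<phi> m')" unfolding L_def by (rule M.finsum_cong') (use eq bC in auto)
    then show "E i m = E i m'" using \<phi> m by simp
  next
    fix m assume "m \<in> C"
    then show "\<phi> (E i m) = \<phi> m" unfolding \<phi>_def using i by (simp add: E_E)
  next
    fix f
    show "\<exists>m\<in>C. \<forall>j<r. \<phi> m j = f j"
      by (rule bexI[of _ "L f"]) (use EV[OF LV] \<phi>I[OF LC] in auto)
  qed
qed

lemma eq_of_E:
  assumes m: "m \<in> C" "m' \<in> C" and E: "\<And>i. i < n \<Longrightarrow> E i m = E i m'"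
  shows "m = m'"
proof -
  let ?d = "m \<boxplus> \<ominus>\<^bsub>M\<^esub> m'"
  have "?d = \<zero>\<^bsub>M\<^esub>"
  proof (rule eq_zero_of_E)
    fix i assume i: "i < n"
    have "E i ?d = E i (m' \<boxplus> \<ominus>\<^bsub>M\<^esub> m')" using m i E[OF i] by (simp add: act_add_right)
    then show "E i ?d = \<zero>\<^bsub>M\<^esub>" using m i by (simp add: M.r_neg)
  qed (use m in simp)
  then have "m = \<ominus>\<^bsub>M\<^esub> (\<ominus>\<^bsub>M\<^esub> m')" using m M.minus_equality[of m "\<ominus>\<^bsub>M\<^esub> m'"] by simp
  then show ?thesis using m by simp
qed

end

locale CM_mod = B_mod k n M for k n and M :: "'m B_module" (structure) +
  assumes free: "\<And>i. i < n \<Longrightarrow> free_over_Z k n M (vertex_space k n M i) 3"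
begin

lemma T_inj:
  assumes m: "m \<in> C" "m' \<in> C" "T m = T m'"
  shows "m = m'"
proof (rule eq_of_E[OF m(1,2)])
  fix i assume i: "i < n"
  obtain \<phi> :: "'m \<Rightarrow> nat \<Rightarrow> complex fps"
    where 1: "\<forall>m\<in>C. \<forall>j<3. \<phi> (T m) j = fps_X * \<phi> m j"
      and 2: "\<forall>m\<in>C. \<forall>m'\<in>C. (\<forall>j<3. \<phi> m j = \<phi> m' j) \<longrightarrow> E i m = E i m'"
    using coordinates[OF i free[OF i]] by blast
  have "\<phi> m j = \<phi> m' j" if "j < 3" for j
    using 1 m that by (metis fps_X_neq_zero mult_left_cancel)
  then show "E i m = E i m'" using 2 m by blast
qed

lemma T_pow_inj: "m \<in> C \<Longrightarrow> m' \<in> C \<Longrightarrow> (T ^^ j) m = (T ^^ j) m' \<Longrightarrow> m = m'"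
  by (induction j) (auto dest: T_inj[rotated 2])

lemma exists_frame:
  "\<exists>\<psi> :: 'm \<Rightarrow> V.
    (\<forall>m\<in>C. \<forall>m'\<in>C. \<psi> (m \<boxplus> m') = \<psi> m + \<psi> m') \<and>
    (\<forall>m\<in>C. \<psi> (T m) = tp 1 *s \<psi> m) \<and>
    (\<forall>m\<in>C. \<forall>c. \<psi> (D (\<lambda>_. c) m) = fls_const c *s \<psi> m) \<and>
    (\<forall>m\<in>C. \<forall>m'\<in>C. \<psi> m = \<psi> m' \<longrightarrow> E 0 m = E 0 m') \<and>
    (\<forall>m\<in>C. \<psi> (E 0 m) = \<psi> m) \<and>
    \<psi> ` C = std 0"
proof -
  have n: "0 < n" using k by simp
  obtain \<phi> :: "'m \<Rightarrow> nat \<Rightarrow> complex fps"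
    where a: "\<forall>m\<in>C. \<forall>m'\<in>C. \<forall>j<3. \<phi> (m \<boxplus> m') j = \<phi> m j + \<phi> m' j"
      and t: "\<forall>m\<in>C. \<forall>j<3. \<phi> (T m) j = fps_X * \<phi> m j"
      and d: "\<forall>m\<in>C. \<forall>c. \<forall>j<3. \<phi> (D (\<lambda>_. c) m) j = fps_const c * \<phi> m j"
      and i: "\<forall>m\<in>C. \<forall>m'\<in>C. (\<forall>j<3. \<phi> m j = \<phi> m' j) \<longrightarrow> E 0 m = E 0 m'"
      and e: "\<forall>m\<in>C. \<phi> (E 0 m) = \<phi> m"
      and s: "\<forall>f. \<exists>m\<in>C. \<forall>j<3. \<phi> m j = f j"
    using coordinates[OF n free[OF n]] by blast
  obtain ix :: "3 \<Rightarrow> nat" where ix: "bij_betw ix UNIV {0..<3}"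
    using ex_bij_betw_finite_nat[OF finite[of "UNIV :: 3 set"]] by auto
  have lt: "ix l < 3" for l using bij_betw_apply[OF ix, of l] by simp
  define \<psi> :: "'m \<Rightarrow> V" where "\<psi> m = (\<chi> l. fps_to_fls (\<phi> m (ix l)))" for m
  have X: "fps_to_fls fps_X = tp 1" by (rule fls_eqI) (simp add: tp_def)
  show ?thesis
  proof (intro exI[of _ \<psi>] conjI ballI allI impI)
    fix m m' assume "m \<in> C" "m' \<in> C"
    then show "\<psi> (m \<boxplus> m') = \<psi> m + \<psi> m'" using a lt by (simp add: \<psi>_def vec_eq_iff)
  next
    fix m assume "m \<in> C"
    then show "\<psi> (T m) = tp 1 *s \<psi> m" using t lt by (simp add: \<psi>_def vec_eq_iff fls_times_fps_to_fls flip: X)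
  next
    fix m c assume "m \<in> C"
    then show "\<psi> (D (\<lambda>_. c) m) = fls_const c *s \<psi> m"
      using d lt by (simp add: \<psi>_def vec_eq_iff fls_times_fps_to_fls flip: fps_const_to_fls)
  next
    fix m m' assume m: "m \<in> C" "m' \<in> C" and eq: "\<psi> m = \<psi> m'"
    have "\<phi> m j = \<phi> m' j" if "j < 3" for j
    proof -
      have "j \<in> range ix" unfolding bij_betw_imp_surj_on[OF ix] using that by simp
      then obtain l where l: "ix l = j" by blast
      have "\<psi> m $ l = \<psi> m' $ l" using eq by simp
      then show ?thesis unfolding \<psi>_def vec_lambda_beta l by simp
    qed
    then show "E 0 m = E 0 m'" using i m by blast
  next
    fix m assume "m \<in> C"
    then show "\<psi> (E 0 m) = \<psi> m" using e by (simp add: \<psi>_def)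
  next
    show "\<psi> ` C = std 0"
    proof
      show "\<psi> ` C \<subseteq> std 0" by (auto simp: \<psi>_def std_def ordge_def)
      show "std 0 \<subseteq> \<psi> ` C"
      proof
        fix z :: V assume z: "z \<in> std 0"
        obtain m where m: "m \<in> C" "\<forall>j<3. \<phi> m j = fls_regpart (z $ inv_into UNIV ix j)"
          using s[rule_format, of "\<lambda>j. fls_regpart (z $ inv_into UNIV ix j)"] by blast
        have "\<psi> m = z"
          unfolding vec_eq_iff
        proof
          fix l
          have "inv_into UNIV ix (ix l) = l" using ix by (simp add: bij_betw_def)
          then have "\<psi> m $ l = fps_to_fls (fls_regpart (z $ l))" using m(2) lt by (simp add: \<psi>_def)
          also have "\<dots> = z $ l" using z by (auto simp: fls_eq_iff std_def ordge_def)
          finally show "\<psi> m $ l = z $ l" .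
        qed
        then show "z \<in> \<psi> ` C" using m(1) by blast
      qed
    qed
  qed
qed

end

section \<open>The lattices of a module, and kernels of matrices on it\<close>

context CM_mod
begin

definition frame :: "'m \<Rightarrow> V" where
  "frame = (SOME \<psi>.
    (\<forall>m\<in>C. \<forall>m'\<in>C. \<psi> (m \<boxplus> m') = \<psi> m + \<psi> m') \<and>
    (\<forall>m\<in>C. \<psi> (T m) = tp 1 *s \<psi> m) \<and>
    (\<forall>m\<in>C. \<forall>c. \<psi> (D (\<lambda>_. c) m) = fls_const c *s \<psi> m) \<and>
    (\<forall>m\<in>C. \<forall>m'\<in>C. \<psi> m = \<psi> m' \<longrightarrow> E 0 m = E 0 m') \<and>
    (\<forall>m\<in>C. \<psi> (E 0 m) = \<psi> m) \<and>
    \<psi> ` C = std 0)"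

lemma frame:
  shows frame_add: "m \<in> C \<Longrightarrow> m' \<in> C \<Longrightarrow> frame (m \<boxplus> m') = frame m + frame m'"
    and frame_T: "m \<in> C \<Longrightarrow> frame (T m) = tp 1 *s frame m"
    and frame_D: "m \<in> C \<Longrightarrow> frame (D (\<lambda>_. c) m) = fls_const c *s frame m"
    and frame_inj: "m \<in> C \<Longrightarrow> m' \<in> C \<Longrightarrow> frame m = frame m' \<Longrightarrow> E 0 m = E 0 m'"
    and frame_E: "m \<in> C \<Longrightarrow> frame (E 0 m) = frame m"
    and frame_image: "frame ` C = std 0"
  using someI_ex[OF exists_frame, folded frame_def] by blast+

definition Phi :: "nat \<Rightarrow> 'm \<Rightarrow> V" where
  "Phi i m = frame ((Y ^^ i) m)"

definition Lam :: "nat \<Rightarrow> V set" where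
  "Lam i = Phi i ` C"

lemma additive_pow: "additive h \<Longrightarrow> additive (h ^^ j)"
  by (induction j) (auto simp: additive_def)

lemma Phi_add: "m \<in> C \<Longrightarrow> m' \<in> C \<Longrightarrow> Phi i (m \<boxplus> m') = Phi i m + Phi i m'"
  using additive_pow[OF additive_act[OF closed(2)], of i]
  by (simp add: Phi_def additive_def frame_add)

lemma Phi_T: "m \<in> C \<Longrightarrow> Phi i (T m) = tp 1 *s Phi i m"
  unfolding Phi_def
  by (subst pow_commute[of Y T, symmetric]) (simp_all add: additive_act T_commute frame_T)

lemma Phi_T_pow: "m \<in> C \<Longrightarrow> Phi i ((T ^^ j) m) = tp (int j) *s Phi i m"
  by (induction j) (simp_all add: Phi_T vector_smult_assoc tp_mult_tp)

lemma Phi_Y: "Phi i (Y m) = Phi (Suc i) m"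
  by (simp add: Phi_def funpow_swap1)

lemma Phi_X: "m \<in> C \<Longrightarrow> Phi (Suc i) (X m) = tp 1 *s Phi i m"
  unfolding Phi_Y[symmetric] by (simp add: X_Y Phi_T)

lemma Phi_n: "m \<in> C \<Longrightarrow> Phi (i + n) m = tp (int k) *s Phi i m"
proof -
  assume m: "m \<in> C"
  have "Phi (i + n) m = Phi i ((Y ^^ n) m)" by (simp add: Phi_def funpow_add)
  then show ?thesis using m by (simp add: Y_pow_n Phi_T_pow)
qed

lemma Y_D: "m \<in> C \<Longrightarrow> Y (D (\<lambda>_. c) m) = D (\<lambda>_. c) (Y m)"
  using D_Y[of m "\<lambda>_. c"] by simp

lemma Phi_D_const: "m \<in> C \<Longrightarrow> Phi i (D (\<lambda>_. c) m) = fls_const c *s Phi i m"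
  unfolding Phi_def
  by (subst pow_commute[of Y "D (\<lambda>_. c)", symmetric]) (simp_all add: additive_act Y_D frame_D)

lemma E_Y_pow: "m \<in> C \<Longrightarrow> E 0 ((Y ^^ i) m) = (Y ^^ i) (E (i mod n) m)"
proof (induction i arbitrary: m)
  case (Suc i)
  have "E 0 ((Y ^^ i) (Y m)) = (Y ^^ i) (E (i mod n) (Y m))" using Suc by simp
  also have "E (i mod n) (Y m) = Y (E (Suc i mod n) m)"
    using E_Y[of "i mod n" m] Suc.prems k by (simp add: mod_Suc_eq)
  finally show ?case by (simp add: funpow_swap1)
qed simp

lemma Phi_E: "i < n \<Longrightarrow> m \<in> C \<Longrightarrow> Phi i (E i m) = Phi i m"
  using E_Y_pow[of m i] frame_E[of "(Y ^^ i) m"] by (simp add: Phi_def)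

lemma Phi_zero: "Phi i \<zero>\<^bsub>M\<^esub> = 0"
  using Phi_add[of "\<zero>\<^bsub>M\<^esub>" "\<zero>\<^bsub>M\<^esub>" i] by simp

lemma Phi_D: "i < n \<Longrightarrow> m \<in> C \<Longrightarrow> Phi i (D d m) = fls_const (d i) *s Phi i m"
  using Phi_E[of i "D d m"] by (simp add: E_D Phi_D_const Phi_E)

text \<open>On the component at vertex i the map y^i is injective, because continuing it to y^n
  yields t^k.\<close>

lemma Phi_inj:
  assumes i: "i < n" and m: "m \<in> C" "m' \<in> C" and eq: "Phi i m = Phi i m'"
  shows "E i m = E i m'"
proof -
  have "E 0 ((Y ^^ i) m) = E 0 ((Y ^^ i) m')" using eq m by (intro frame_inj) (simp_all add: Phi_def)
  then have Y: "(Y ^^ i) (E i m) = (Y ^^ i) (E i m')" using i m by (simp add: E_Y_pow)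
  have "(T ^^ k) (E i m) = (Y ^^ (n - i)) ((Y ^^ i) (E i m))" if "m \<in> C" for m
    using i that by (simp flip: Y_pow_n comp_apply[of "Y ^^ (n - i)"] funpow_add)
  then have "(T ^^ k) (E i m) = (T ^^ k) (E i m')" using Y m by simp
  then show ?thesis using m i by (intro T_pow_inj[of "E i m"]) auto
qed

lemma Lam_0: "Lam 0 = std 0"
  using frame_image by (simp add: Lam_def Phi_def)

lemma Lam_Suc: "Lam (Suc i) \<subseteq> Lam i"
  unfolding Lam_def by (auto simp flip: Phi_Y)

lemma Phi_std: "m \<in> C \<Longrightarrow> Phi i m \<in> std 0"
proof -
  have "Lam i \<subseteq> Lam 0"
  proof (induction i)
    case (Suc i)
    then show ?case using Lam_Suc[of i] by (rule order_trans[rotated])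
  qed simp
  moreover assume "m \<in> C"
  then have "Phi i m \<in> Lam i" unfolding Lam_def by (rule imageI)
  ultimately show ?thesis unfolding Lam_0 by (rule subsetD)
qed

lemma tim1_Lam: "tim 1 (Lam i) \<subseteq> Lam (Suc i)"
proof
  fix z assume "z \<in> tim 1 (Lam i)"
  then obtain m where m: "m \<in> C" "tp (- 1) *s z = Phi i m" unfolding tim_def Lam_def by auto
  have "tp 1 *s (tp (- 1) *s z) = z" by (simp add: vector_smult_assoc tp_mult_tp)
  then have "z = Phi (Suc i) (X m)" using m by (simp add: Phi_X)
  then show "z \<in> Lam (Suc i)" unfolding Lam_def using m(1) by simp
qed

lemma Lam_n: "Lam (i + n) = tim (int k) (Lam i)"
proof -
  have "z \<in> tim (int k) (Lam i) \<longleftrightarrow> (\<exists>m\<in>C. z = tp (int k) *s Phi i m)" for z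
  proof -
    have inv: "tp (int k) *s (tp (- int k) *s w) = w" "tp (- int k) *s (tp (int k) *s w) = w" for w
      by (simp_all add: vector_smult_assoc tp_mult_tp)
    have "tp (- int k) *s z = w \<longleftrightarrow> z = tp (int k) *s w" for w
      using inv by metis
    then show ?thesis unfolding tim_def Lam_def image_iff mem_Collect_eq by simp
  qed
  then show ?thesis unfolding Lam_def[of "i + n"] by (auto simp: Phi_n)
qed

lemma Phi_Z:
  assumes m: "m \<in> C"
  shows "Phi i (Z f m) = fps_to_fls f *s Phi i m"
proof -
  have "Phi i (Z f m) $ s = fps_to_fls f * Phi i m $ s" for s
  proof -
    define P where "P f = fls_regpart (Phi i (Z f m) $ s)" for f
    define u where "u = fls_regpart (Phi i m $ s)"
    have reg: "fps_to_fls (fls_regpart c) = c" if "ordge 0 c" for c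
      using that by (auto simp: fls_eq_iff ordge_def)
    have P: "fps_to_fls (P f) = Phi i (Z f m) $ s" for f
      unfolding P_def by (rule reg) (use Phi_std[of "Z f m" i] m in \<open>simp add: std_def\<close>)
    have u: "fps_to_fls u = Phi i m $ s"
      unfolding u_def by (rule reg) (use Phi_std[of m i] m in \<open>simp add: std_def\<close>)
    have X: "tp 1 = fls_X" by (rule fls_eqI) (simp add: tp_def)
    have "P f = fps_const (fps_nth f 0) * u + fps_X * P (fps_shift 1 f)" for f
    proof -
      have "Phi i (Z f m) = fls_const (fps_nth f 0) *s Phi i m + tp 1 *s Phi i (Z (fps_shift 1 f) m)"
        using m Z_split[OF m, of f] by (simp add: Phi_add Phi_D_const Phi_T)
      then have "fps_to_fls (P f) = fps_to_fls (fps_const (fps_nth f 0) * u + fps_X * P (fps_shift 1 f))"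
        by (simp add: P u X fls_times_fps_to_fls fps_const_to_fls)
      then show ?thesis by (simp only: fps_to_fls_eq_iff)
    qed
    then have "P f = f * u" by (rule fps_eq_mult_of_shift)
    then show ?thesis using P[of f] by (simp add: fls_times_fps_to_fls u)
  qed
  then show ?thesis by (simp add: vec_eq_iff)
qed

lemma Omod_Lam: "Omod (Lam i)"
  unfolding Omod_def
proof (intro conjI ballI allI impI)
  show "0 \<in> Lam i" unfolding Lam_def using Phi_zero[of i] by (metis M.zero_closed imageI)
  fix x assume "x \<in> Lam i"
  then obtain m where m: "m \<in> C" "x = Phi i m" unfolding Lam_def by blast
  show "c *s x \<in> Lam i" if c: "ordge 0 c" for c
  proof -
    have "c = fps_to_fls (fls_regpart c)" using c by (auto simp: fls_eq_iff ordge_def)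
    then have "c *s x = Phi i (Z (fls_regpart c) m)" using m by (simp add: Phi_Z)
    then show ?thesis unfolding Lam_def using m(1) by simp
  qed
  fix y assume "y \<in> Lam i"
  then obtain m' where "m' \<in> C" "y = Phi i m'" unfolding Lam_def by blast
  then have "x + y = Phi i (m \<boxplus> m')" "m \<boxplus> m' \<in> C" using m by (simp_all add: Phi_add)
  then show "x + y \<in> Lam i" unfolding Lam_def by blast
qed

lemma lattice_Lam: "lattice (Lam i)"
proof (induction i)
  case 0
  show ?case unfolding Lam_0 lattice_def by (intro conjI exI[of _ 0]) simp_all
next
  case (Suc i)
  show ?case
    by (rule lattice_between[OF lattice_tim[OF Suc] Suc tim1_Lam Lam_Suc Omod_Lam])
qed

text \<open>
  \<open>X\<close> and \<open>Y\<close> raise the order of \<open>A *v Phi i m\<close>, suitably scaled, while every element of the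
  completed path algebra is a diagonal element plus a left multiple of \<open>x\<close> and of \<open>y\<close>. So the
  order of \<open>A *v Phi i (act a m)\<close> is unbounded when \<open>m\<close> lies in the kernel.
\<close>

definition ker :: "complex fls ^ 3 ^ 3 \<Rightarrow> 'm set" where
  "ker A = {m \<in> C. \<forall>i<n. A *v Phi i m = 0}"

text \<open>Orders at vertex i are counted in units of 1/n and shifted by k i / n, in accordance
  with y^n = t^k. On this scale y gains k and x gains n - k, so each arrow gains at least
  one.\<close>

definition deep :: "complex fls ^ 3 ^ 3 \<Rightarrow> int \<Rightarrow> 'm set" where
  "deep A N = {m \<in> C. \<forall>i<n. \<exists>l. N + int (k * i) \<le> int n * l \<and> A *v Phi i m \<in> std l}"

lemma smult_std: "z \<in> std l \<Longrightarrow> tp j *s z \<in> std (l + j)"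
  by (simp add: std_def)

lemma matrix_std: "\<exists>c. \<forall>z\<in>std 0. (A :: complex fls ^ 3 ^ 3) *v z \<in> std (- c)"
proof -
  let ?c = "\<lambda>s r. \<bar>fls_subdegree (A $ s $ r)\<bar>"
  let ?m = "\<Sum>s\<in>UNIV. \<Sum>r\<in>UNIV. ?c s r"
  have le: "?c s r \<le> ?m" for s r
  proof -
    have "?c s r \<le> (\<Sum>r\<in>UNIV. ?c s r)" by (rule member_le_sum) auto
    also have "\<dots> \<le> ?m" by (rule member_le_sum) (auto intro: sum_nonneg)
    finally show ?thesis .
  qed
  have o: "ordge (- ?m) (A $ s $ r)" for s r
    using le[of s r] unfolding ordge_iff by linarith
  have "A *v z \<in> std (- ?m)" if z: "z \<in> std 0" for z
    unfolding std_def
  proof (intro CollectI allI)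
    fix s
    have "ordge (- ?m) (A $ s $ r * z $ r)" for r
      using ordge_mult[OF o, of 0 "z $ r" s r] z by (simp add: std_def)
    then show "ordge (- ?m) ((A *v z) $ s)"
      unfolding matrix_vector_mult_def vec_lambda_beta sum_3 by (intro ordge_add)
  qed
  then show ?thesis by blast
qed

lemma deep_add: "m \<in> deep A N \<Longrightarrow> m' \<in> deep A N \<Longrightarrow> m \<boxplus> m' \<in> deep A N"
proof -
  assume m: "m \<in> deep A N" "m' \<in> deep A N"
  have "\<exists>l. N + int (k * i) \<le> int n * l \<and> A *v Phi i (m \<boxplus> m') \<in> std l" if i: "i < n" for i
  proof -
    obtain l l' where l: "N + int (k * i) \<le> int n * l" "A *v Phi i m \<in> std l"
      "N + int (k * i) \<le> int n * l'" "A *v Phi i m' \<in> std l'"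
      using m i unfolding deep_def by blast
    have "A *v Phi i m \<in> std (min l l')" "A *v Phi i m' \<in> std (min l l')"
      using l(2,4) std_mono[of "min l l'" l] std_mono[of "min l l'" l'] by auto
    then have "A *v Phi i (m \<boxplus> m') \<in> std (min l l')"
      using m OmodD(2)[OF Omod_std] by (simp add: deep_def Phi_add matrix_vector_right_distrib)
    moreover have "N + int (k * i) \<le> int n * min l l'" using l by (simp add: min_def)
    ultimately show ?thesis by blast
  qed
  then show ?thesis using m unfolding deep_def by simp
qed

lemma deep_X: "m \<in> deep A N \<Longrightarrow> X m \<in> deep A (N + 1)"
proof -
  assume m: "m \<in> deep A N"
  then have mC: "m \<in> C" by (simp add: deep_def)
  have "\<exists>l. N + 1 + int (k * i) \<le> int n * l \<and> A *v Phi i (X m) \<in> std l" if i: "i < n" for i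
  proof (cases i)
    case 0
    have "n - 1 < n" using k by simp
    then obtain l where l: "N + int (k * (n - 1)) \<le> int n * l" "A *v Phi (n - 1) m \<in> std l"
      using m unfolding deep_def by blast
    have "tp (int k) *s Phi 0 (X m) = tp 1 *s Phi (n - 1) m"
      using Phi_n[of "X m" 0] Phi_X[OF mC, of "n - 1"] mC k by simp
    then have "tp (- int k) *s (tp (int k) *s Phi 0 (X m)) = tp (- int k) *s (tp 1 *s Phi (n - 1) m)" by simp
    then have "Phi 0 (X m) = tp (1 - int k) *s Phi (n - 1) m"
      by (simp add: vector_smult_assoc tp_mult_tp)
    then have "A *v Phi 0 (X m) \<in> std (l + (1 - int k))"
      using smult_std[OF l(2)] by (simp add: vec.scale)
    moreover have "N + 1 \<le> int n * (l + (1 - int k))"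
    proof -
      have "int (k * (n - 1)) = int k * int n - int k" using k by (simp add: of_nat_diff algebra_simps)
      moreover have "int k < int n" using k by simp
      ultimately show ?thesis using l(1) by (simp add: algebra_simps)
    qed
    ultimately show ?thesis using 0 by auto
  next
    case (Suc j)
    then have "j < n" using i by simp
    then obtain l where l: "N + int (k * j) \<le> int n * l" "A *v Phi j m \<in> std l"
      using m unfolding deep_def by blast
    have "A *v Phi i (X m) \<in> std (l + 1)"
      using smult_std[OF l(2), of 1] by (simp add: Suc Phi_X mC vec.scale)
    moreover have "N + 1 + int (k * i) \<le> int n * (l + 1)"
      using l(1) k by (simp add: Suc algebra_simps)
    ultimately show ?thesis by blast
  qed
  then show ?thesis using mC unfolding deep_def by simp
qed

lemma deep_Y: "m \<in> deep A N \<Longrightarrow> Y m \<in> deep A (N + 1)"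
proof -
  assume m: "m \<in> deep A N"
  then have mC: "m \<in> C" by (simp add: deep_def)
  have "\<exists>l. N + 1 + int (k * i) \<le> int n * l \<and> A *v Phi i (Y m) \<in> std l" if i: "i < n" for i
  proof (cases "Suc i = n")
    case True
    have "0 < n" using k by simp
    then obtain l where l: "N + int (k * 0) \<le> int n * l" "A *v Phi 0 m \<in> std l"
      using m unfolding deep_def by blast
    have "Phi i (Y m) = tp (int k) *s Phi 0 m"
      using Phi_n[OF mC, of 0] unfolding Phi_Y True by simp
    then have "A *v Phi i (Y m) \<in> std (l + int k)" using smult_std[OF l(2)] by (simp add: vec.scale)
    moreover have "N + 1 + int (k * i) \<le> int n * (l + int k)"
    proof -
      have "int k * int i = int k * int n - int k" using True by (simp add: algebra_simps flip: True)
      then show ?thesis using l(1) k by (simp add: algebra_simps)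
    qed
    ultimately show ?thesis by blast
  next
    case False
    then have "Suc i < n" using i by simp
    then obtain l where l: "N + int (k * Suc i) \<le> int n * l" "A *v Phi (Suc i) m \<in> std l"
      using m unfolding deep_def by blast
    then have "A *v Phi i (Y m) \<in> std l" by (simp add: Phi_Y)
    moreover have "N + 1 + int (k * i) \<le> int n * l" using l(1) k by (simp add: algebra_simps)
    ultimately show ?thesis by blast
  qed
  then show ?thesis using mC unfolding deep_def by simp
qed

lemma exists_level: "\<exists>l. a \<le> int n * l"
proof -
  have "\<bar>a\<bar> * 1 \<le> \<bar>a\<bar> * int n" by (rule mult_left_mono) (use k in auto)
  moreover have "a \<le> \<bar>a\<bar>" by (rule abs_ge_self)
  ultimately have "a \<le> int n * \<bar>a\<bar>" unfolding mult_1_right by (simp only: mult.commute)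
  then show ?thesis ..
qed

lemma ker_act:
  assumes m: "m \<in> ker A" and a: "a \<in> carrier (CPA n)"
  shows "act a m \<in> ker A"
proof -
  have mC: "m \<in> C" using m by (simp add: ker_def)
  obtain c where c: "\<forall>z\<in>std 0. A *v z \<in> std (- c)" using matrix_std by blast
  \<comment> \<open>A depth shared by all elements of M: on \<open>std 0\<close> the matrix lowers
    orders by at most c.\<close>
  define N0 where "N0 = - (int n * c) - int (k * n)"
  have deep0: "m \<in> deep A N0" if "m \<in> C" for m
  proof -
    have "N0 + int (k * i) \<le> int n * (- c)" if "i < n" for i
    proof -
      have "int (k * i) \<le> int (k * n)" using that by (intro zle_int[THEN iffD2] mult_le_mono2) simp
      then show ?thesis unfolding N0_def by simp
    qed
    then show ?thesis unfolding deep_def using c Phi_std that by blast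
  qed
  have "act a m \<in> deep A (N0 + int j)" for j
    using a
  proof (induction j arbitrary: a)
    case 0
    then show ?case using deep0 mC by simp
  next
    case (Suc j)
    obtain b c where bc: "b \<in> carrier (CPA n)" "c \<in> carrier (CPA n)"
      and e: "a = diag_elem n (\<lambda>v. a (v, [])) \<oplus>\<^bsub>CPA n\<^esub> (x_elem n \<otimes>\<^bsub>CPA n\<^esub> b \<oplus>\<^bsub>CPA n\<^esub> y_elem n \<otimes>\<^bsub>CPA n\<^esub> c)"
      using cpa_decompose[OF Suc.prems] by blast
    interpret R: ring "CPA n" by (rule ring_CPA)
    have "act a m = D (\<lambda>v. a (v, [])) m \<boxplus> (X (act b m) \<boxplus> Y (act c m))"
      by (subst e) (simp add: act_add act_mult bc mC)
    moreover have "D (\<lambda>v. a (v, [])) m \<in> deep A (N0 + int j + 1)"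
    proof -
      have "A *v Phi i (D (\<lambda>v. a (v, [])) m) = 0" if "i < n" for i
        using m that by (simp add: Phi_D mC vec.scale ker_def)
      moreover have "\<exists>l. N0 + int j + 1 + int (k * i) \<le> int n * l \<and> 0 \<in> std l" for i
        using exists_level OmodD(1)[OF Omod_std] by blast
      ultimately show ?thesis using mC by (simp add: deep_def)
    qed
    ultimately show ?case
      using deep_add[OF _ deep_add[OF deep_X[OF Suc.IH[OF bc(1)]] deep_Y[OF Suc.IH[OF bc(2)]]]]
      by (simp add: algebra_simps)
  qed
  note deep = this
  have "A *v Phi i (act a m) = 0" if i: "i < n" for i
  proof -
    have "((A *v Phi i (act a m)) $ s) $$ e = 0" for s e
    proof -
      \<comment> \<open>The depth is taken so large that the order at vertex i exceeds e.\<close>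
      obtain l where l: "N0 + int (nat (int n * (\<bar>e\<bar> + 1) - N0)) + int (k * i) \<le> int n * l" "A *v Phi i (act a m) \<in> std l"
        using deep[of "nat (int n * (\<bar>e\<bar> + 1) - N0)"] i unfolding deep_def by blast
      have "int n * (\<bar>e\<bar> + 1) \<le> int n * l" using l(1) by linarith
      then have "\<bar>e\<bar> + 1 \<le> l" using k by simp
      then show ?thesis using l(2) unfolding std_def ordge_def by simp
    qed
    then show ?thesis by (simp add: vec_eq_iff fls_eq_iff)
  qed
  then show ?thesis using mC a by (simp add: ker_def)
qed

end

lemma B_classE:
  assumes "b \<in> carrier (B k n)"
  obtains a where "a \<in> carrier (CPA n)" "b = B_class k n a"
  using assms unfolding B_def B_class_def FactRing_def A_RCOSETS_def' by auto

section \<open>Decomposition of a module by an idempotent matrix\<close>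

context CM_mod
begin

lemma Phi_minus: "m \<in> C \<Longrightarrow> Phi i (\<ominus>\<^bsub>M\<^esub> m) = - Phi i m"
  using Phi_add[of m "\<ominus>\<^bsub>M\<^esub> m" i] by (simp add: M.r_neg Phi_zero eq_neg_iff_add_eq_0 add.commute)

lemma eq_of_Phi:
  assumes "m \<in> C" "m' \<in> C" "\<And>i. i < n \<Longrightarrow> Phi i m = Phi i m'"
  shows "m = m'"
proof (rule eq_of_E[OF assms(1,2)])
  fix i assume i: "i < n"
  show "E i m = E i m'" by (rule Phi_inj[OF i assms(1,2) assms(3)[OF i]])
qed

lemma ker_submodule: "submodule (ker A) (B k n) M"
proof (rule submodule.intro)
  show "subgroup (ker A) (add_monoid M)"
  proof (rule subgroup.intro)
    show "ker A \<subseteq> carrier (add_monoid M)" by (auto simp: ker_def)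
    show "x \<otimes>\<^bsub>add_monoid M\<^esub> y \<in> ker A" if "x \<in> ker A" "y \<in> ker A" for x y
      using that by (simp add: ker_def Phi_add matrix_vector_right_distrib)
    show "\<one>\<^bsub>add_monoid M\<^esub> \<in> ker A" by (simp add: ker_def Phi_zero)
    show "inv\<^bsub>add_monoid M\<^esub> x \<in> ker A" if "x \<in> ker A" for x
    proof -
      have "A *v (- Phi i x) = 0" if "i < n" for i
        using \<open>x \<in> ker A\<close> that by (simp add: ker_def vec.neg)
      moreover have "inv\<^bsub>add_monoid M\<^esub> x = \<ominus>\<^bsub>M\<^esub> x" by (simp add: a_inv_def)
      ultimately show ?thesis using that by (simp add: ker_def Phi_minus)
    qed
  qed
  show "submodule_axioms (ker A) (B k n) M"
  proof (rule submodule_axioms.intro)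
    fix b x assume b: "b \<in> carrier (B k n)" and x: "x \<in> ker A"
    obtain a where a: "a \<in> carrier (CPA n)" "b = B_class k n a" by (rule B_classE[OF b])
    show "b \<odot>\<^bsub>M\<^esub> x \<in> ker A" using ker_act[OF x a(1)] by (simp add: act_def a(2))
  qed
qed

text \<open>The vertex idempotents make the components independent, so they can be prescribed one
  vertex at a time.\<close>

lemma glue:
  assumes f: "\<And>i. i < n \<Longrightarrow> f i \<in> C"
  shows "\<exists>u\<in>C. \<forall>i<n. Phi i u = Phi i (f i)"
proof -
  have "\<exists>u\<in>C. \<forall>i<n. Phi i u = (if i < j then Phi i (f i) else 0)" if "j \<le> n" for j
    using that
  proof (induction j)
    case 0
    then show ?case by (intro bexI[of _ "\<zero>\<^bsub>M\<^esub>"]) (simp_all add: Phi_zero)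
  next
    case (Suc j)
    then obtain u where u: "u \<in> C" "\<forall>i<n. Phi i u = (if i < j then Phi i (f i) else 0)" by auto
    have j: "j < n" "f j \<in> C" using Suc f by auto
    have E: "Phi i (E j (f j)) = (if i = j then Phi i (f i) else 0)" if "i < n" for i
      using Phi_D[OF that j(2), of "\<lambda>v. if v = j then 1 else 0"] by (simp add: E_eq_D[OF j(1)])
    have "Phi i (u \<boxplus> E j (f j)) = (if i < Suc j then Phi i (f i) else 0)" if "i < n" for i
      using u that j E[OF that] by (auto simp: Phi_add)
    moreover have "u \<boxplus> E j (f j) \<in> C" using u j by simp
    ultimately show ?case by blast
  qed
  from this[of n] show ?thesis by auto
qed

lemma axis_in_std: "axis s 1 \<in> std 0"
  by (simp add: std_def axis_def)

lemma matrix_eq_of_std: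
  assumes "\<And>z. z \<in> std 0 \<Longrightarrow> (A :: complex fls ^ 3 ^ 3) *v z = A' *v z"
  shows "A = A'"
proof -
  have c: "(A *v axis s 1) $ i = A $ i $ s" for A :: "complex fls ^ 3 ^ 3" and s i
  proof -
    have "A $ i $ j * axis s 1 $ j = (if j = s then A $ i $ s else 0)" for j by (simp add: axis_def)
    then show ?thesis unfolding matrix_vector_mult_def vec_lambda_beta by simp
  qed
  have "A $ i $ s = A' $ i $ s" for i s
    unfolding c[symmetric] using assms[OF axis_in_std[of s]] by simp
  then show ?thesis unfolding vec_eq_iff by blast
qed

text \<open>The summands are the kernels of 1 - A and of A. Because A preserves each lattice, A
  applied to \<open>Phi i m\<close> lifts back to M at every vertex, and the lifts are glued to the
  component of m in the first summand.\<close>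

lemma splits_decomposes:
  assumes "splits (Lam ` {..<n})"
  shows "\<not> indecomposable_module (B k n) M"
proof
  assume ind: "indecomposable_module (B k n) M"
  obtain A :: "complex fls ^ 3 ^ 3" where A: "A ** A = A" "A \<noteq> 0" "A \<noteq> mat 1"
    and inv: "\<And>i z. i < n \<Longrightarrow> z \<in> Lam i \<Longrightarrow> A *v z \<in> Lam i"
    using assms unfolding splits_def by auto
  let ?U = "ker (mat 1 - A)" and ?V = "ker A"
  have U: "(mat 1 - A) *v z = z - A *v z" for z
    by (simp add: matrix_vector_mult_diff_rdistrib)
  have AA: "A *v (A *v z) = A *v z" for z by (simp add: matrix_vector_mul_assoc A(1))
  have zero: "\<zero>\<^bsub>M\<^esub> \<in> ker A'" for A' by (simp add: ker_def Phi_zero)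
  have proj: "\<exists>u\<in>?U. \<forall>i<n. Phi i u = A *v Phi i m" if m: "m \<in> C" for m
  proof -
    have "\<exists>m'. m' \<in> C \<and> Phi i m' = A *v Phi i m" if i: "i < n" for i
    proof -
      have "A *v Phi i m \<in> Lam i" using inv[OF i] m unfolding Lam_def by blast
      then show ?thesis unfolding Lam_def by force
    qed
    then obtain f where f: "\<And>i. i < n \<Longrightarrow> f i \<in> C \<and> Phi i (f i) = A *v Phi i m" by metis
    then obtain u where "u \<in> C" "\<forall>i<n. Phi i u = A *v Phi i m" using glue[of f] by auto
    then show ?thesis by (intro bexI[of _ u]) (auto simp: ker_def U AA)
  qed
  have int: "?U \<inter> ?V = {\<zero>\<^bsub>M\<^esub>}"
  proof
    show "?U \<inter> ?V \<subseteq> {\<zero>\<^bsub>M\<^esub>}"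
    proof
      fix m assume "m \<in> ?U \<inter> ?V"
      then have "m = \<zero>\<^bsub>M\<^esub>" by (intro eq_of_Phi) (auto simp: ker_def U Phi_zero)
      then show "m \<in> {\<zero>\<^bsub>M\<^esub>}" by simp
    qed
  qed (use zero in auto)
  have sum: "?U <+>\<^bsub>M\<^esub> ?V = C"
  proof
    show "?U <+>\<^bsub>M\<^esub> ?V \<subseteq> C" unfolding set_add_def' by (auto simp: ker_def)
    show "C \<subseteq> ?U <+>\<^bsub>M\<^esub> ?V"
    proof
      fix m assume m: "m \<in> C"
      obtain u where u: "u \<in> ?U" "\<forall>i<n. Phi i u = A *v Phi i m" using proj[OF m] by blast
      then have uC: "u \<in> C" by (simp add: ker_def)
      let ?v = "m \<boxplus> \<ominus>\<^bsub>M\<^esub> u"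
      have "?v \<in> ?V"
        using m uC u(2) by (simp add: ker_def Phi_add Phi_minus AA matrix_vector_mult_diff_distrib)
      moreover have "m = u \<boxplus> ?v"
        using m uC by (intro eq_of_Phi) (auto simp: Phi_add Phi_minus)
      ultimately show "m \<in> ?U <+>\<^bsub>M\<^esub> ?V" unfolding set_add_def' using u(1) by blast
    qed
  qed
  have "?U = {\<zero>\<^bsub>M\<^esub>} \<or> ?V = {\<zero>\<^bsub>M\<^esub>}"
    using ind int sum ker_submodule unfolding indecomposable_module_def by blast
  then show False
  proof
    assume U0: "?U = {\<zero>\<^bsub>M\<^esub>}"
    have "A *v z = 0 *v z" if "z \<in> std 0" for z
    proof -
      obtain m where m: "m \<in> C" "z = Phi 0 m" using \<open>z \<in> std 0\<close> unfolding Lam_0[symmetric] Lam_def by blast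
      then show ?thesis using proj[OF m(1)] U0 k by (auto simp: Phi_zero)
    qed
    then show False using matrix_eq_of_std[of A 0] A(2) by blast
  next
    assume V0: "?V = {\<zero>\<^bsub>M\<^esub>}"
    have "A *v z = mat 1 *v z" if "z \<in> std 0" for z
    proof -
      obtain m where m: "m \<in> C" "z = Phi 0 m" using \<open>z \<in> std 0\<close> unfolding Lam_0[symmetric] Lam_def by blast
      have "m \<in> ?U <+>\<^bsub>M\<^esub> ?V" unfolding sum by (rule m(1))
      then have "m \<in> ?U" unfolding V0 set_add_def' by (auto simp: ker_def)
      then show ?thesis using k unfolding m(2) by (auto simp: ker_def U)
    qed
    then show False using matrix_eq_of_std[of A "mat 1"] A(3) by blast
  qed
qed

lemma Lam_eqI:
  assumes i: "0 < i" "i \<le> n" and sur: "\<And>m. m \<in> C \<Longrightarrow> \<exists>m'\<in>C. E (i - 1) m = Y m'"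
  shows "Lam i = Lam (i - 1)"
proof
  show "Lam i \<subseteq> Lam (i - 1)" using Lam_Suc[of "i - 1"] i by simp
  show "Lam (i - 1) \<subseteq> Lam i"
  proof
    fix z assume "z \<in> Lam (i - 1)"
    then obtain m where m: "m \<in> C" "z = Phi (i - 1) m" unfolding Lam_def by blast
    obtain m' where m': "m' \<in> C" "E (i - 1) m = Y m'" using sur[OF m(1)] by blast
    have "z = Phi (i - 1) (E (i - 1) m)" using m i Phi_E[of "i - 1" m] by simp
    also have "\<dots> = Phi i m'" unfolding m'(2) Phi_Y using i by simp
    finally show "z \<in> Lam i" unfolding Lam_def using m'(1) by simp
  qed
qed

end

text \<open>Repetitions are squeezed out: Z s is the last lattice reached within s proper steps.
  With fewer than seven proper steps Z becomes constant before 7, so a chain of length seven results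
  in any case.\<close>

lemma few_steps_splits:
  fixes L :: "nat \<Rightarrow> V set"
  assumes lat: "\<And>i. lattice (L i)" and dec: "\<And>i. L (Suc i) \<subseteq> L i" and t: "\<And>i. tim 1 (L i) \<subseteq> L (Suc i)"
    and n: "L n = tim 3 (L 0)" and few: "card {i\<in>{1..n}. L i \<noteq> L (i - 1)} \<le> 7"
  shows "splits (L ` {..<n})"
proof -
  define cnt where "cnt i = card {j\<in>{1..i}. L j \<noteq> L (j - 1)}" for i
  have cnt_Suc: "cnt (Suc i) = (if L (Suc i) = L i then cnt i else Suc (cnt i))" for i
  proof -
    have "{j\<in>{1..Suc i}. L j \<noteq> L (j - 1)}
        = (if L (Suc i) = L i then {j\<in>{1..i}. L j \<noteq> L (j - 1)} else insert (Suc i) {j\<in>{1..i}. L j \<noteq> L (j - 1)})"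
      by (auto simp: le_Suc_eq)
    then show ?thesis unfolding cnt_def by simp
  qed
  have cnt_mono: "cnt i \<le> cnt j" if "i \<le> j" for i j
    by (rule lift_Suc_mono_le[OF _ that]) (simp add: cnt_Suc)
  have cnt_eq: "L i = L j" if "i \<le> j" "cnt i = cnt j" for i j
    using that
  proof (induction j rule: dec_induct)
    case (step j)
    then have "cnt j = cnt i" "cnt (Suc j) = cnt j" using cnt_mono[of i j] cnt_mono[of j "Suc j"] by simp_all
    then show ?case using step by (metis cnt_Suc n_not_Suc_n)
  qed simp
  have cn: "cnt n \<le> 7" using few by (simp add: cnt_def)
  have c0: "cnt 0 = 0" by (simp add: cnt_def)
  define g where "g s = Max {i. i \<le> n \<and> cnt i \<le> s}" for s
  have g: "g s \<le> n" "cnt (g s) \<le> s" and g_max: "\<And>i. i \<le> n \<Longrightarrow> cnt i \<le> s \<Longrightarrow> i \<le> g s" for s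
  proof -
    have fin: "finite {i. i \<le> n \<and> cnt i \<le> s}" by simp
    have "0 \<in> {i. i \<le> n \<and> cnt i \<le> s}" by (simp add: c0)
    then have "g s \<in> {i. i \<le> n \<and> cnt i \<le> s}" unfolding g_def by (intro Max_in fin) blast
    then show "g s \<le> n" "cnt (g s) \<le> s" by auto
    show "\<And>i. i \<le> n \<Longrightarrow> cnt i \<le> s \<Longrightarrow> i \<le> g s" unfolding g_def by (rule Max_ge[OF fin]) simp
  qed
  have Lg: "L i = L (g (cnt i))" if "i \<le> n" for i
    using that g_max[OF that, of "cnt i"] g(2)[of "cnt i"] cnt_mono[of i "g (cnt i)"] by (intro cnt_eq) auto
  have gn: "g 7 = n" using g(1)[of 7] g_max[of n 7] cn by simp
  define Z where "Z s = L (g s)" for s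
  have Z0: "Z 0 = L 0" using Lg[of 0] by (simp add: Z_def c0)
  have step: "Z (Suc s) = L (g s) \<or> Z (Suc s) = L (Suc (g s))" for s
  proof (cases "g s = n")
    case True
    then have "g (Suc s) = n" using g_max[of n "Suc s"] g(1)[of "Suc s"] g(2)[of s] by simp
    then show ?thesis using True by (simp add: Z_def)
  next
    case False
    then have lt: "Suc (g s) \<le> n" using g(1)[of s] by simp
    then have "s < cnt (Suc (g s))" using g_max[OF lt, of s] by fastforce
    moreover have "cnt (Suc (g s)) \<le> Suc (cnt (g s))" by (simp add: cnt_Suc)
    ultimately have "cnt (Suc (g s)) = Suc s" using g(2)[of s] by linarith
    then show ?thesis using Lg[OF lt] by (simp add: Z_def)
  qed
  have ch: "chain (int 7) (per 7 Z)"
  proof (rule chain_per(1))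
    fix s :: nat
    show "lattice (Z s)" unfolding Z_def by (rule lat)
    show "Z (Suc s) \<subseteq> Z s" using step[of s] dec[of "g s"] unfolding Z_def[of s] by auto
    show "tim 1 (Z s) \<subseteq> Z (Suc s)"
      using step[of s] t[of "g s"] dec[of "g s"] unfolding Z_def[of s] by auto
    show "Z 7 = tim 3 (Z 0)" unfolding Z0 n[symmetric] by (simp add: Z_def gn)
  qed simp
  have "splits (range (per 7 Z))" by (rule seven_chain_splits) (use ch in simp)
  then show ?thesis
  proof (rule splits_tim)
    fix U assume "U \<in> L ` {..<n}"
    then obtain i where i: "i < n" "U = L i" by blast
    have c: "cnt i \<le> 7" using cnt_mono[of i n] i cn by simp
    show "\<exists>Y\<in>range (per 7 Z). \<exists>k. U = tim k Y"
    proof (cases "cnt i = 7")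
      case False
      then have "per 7 Z (int (cnt i)) = Z (cnt i)" using c by (intro per_nat) simp
      then have "U = tim 0 (per 7 Z (int (cnt i)))" using Lg[of i] i by (simp add: Z_def)
      then show ?thesis by blast
    next
      case True
      then have "U = L n" using Lg[of i] i gn by simp
      then have "U = tim 3 (per 7 Z (int 0))" using per_nat[of 0 7 Z] Z0 n by simp
      then show ?thesis by blast
    qed
  qed
qed

theorem eight_nonsurjective:
  assumes CM: "CM_of_rank 3 n 3 M" and n: "3 < n" and ind: "indecomposable_module (B 3 n) M"
  defines "a \<equiv> \<lambda>a m. B_class 3 n a \<odot>\<^bsub>M\<^esub> m"
  shows "8 \<le> card {i\<in>{1..n}. \<not> (\<forall>m\<in>carrier M. \<exists>m'\<in>carrier M. a (vertex_idem (i - 1)) m = a (y_elem n) m')}"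
proof -
  interpret lm: left_module "B 3 n" M using CM unfolding CM_of_rank_def by blast
  interpret CM_mod 3 n M
    by unfold_locales (use n CM in \<open>auto simp: CM_of_rank_def\<close>)
  have "\<not> card {i\<in>{1..n}. Lam i \<noteq> Lam (i - 1)} \<le> 7"
  proof
    assume "card {i\<in>{1..n}. Lam i \<noteq> Lam (i - 1)} \<le> 7"
    moreover have "Lam n = tim 3 (Lam 0)" using Lam_n[of 0] by simp
    ultimately have "splits (Lam ` {..<n})" by (intro few_steps_splits lattice_Lam Lam_Suc tim1_Lam)
    then show False using splits_decomposes ind by blast
  qed
  moreover have "card {i\<in>{1..n}. Lam i \<noteq> Lam (i - 1)}
      \<le> card {i\<in>{1..n}. \<not> (\<forall>m\<in>carrier M. \<exists>m'\<in>carrier M. a (vertex_idem (i - 1)) m = a (y_elem n) m')}"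
  proof (rule card_mono)
    have "Lam i = Lam (i - 1)" if "i \<in> {1..n}"
      "\<forall>m\<in>carrier M. \<exists>m'\<in>carrier M. a (vertex_idem (i - 1)) m = a (y_elem n) m'" for i
      using Lam_eqI[of i] that unfolding a_def act_def by simp
    then show "{i\<in>{1..n}. Lam i \<noteq> Lam (i - 1)}
      \<subseteq> {i\<in>{1..n}. \<not> (\<forall>m\<in>carrier M. \<exists>m'\<in>carrier M. a (vertex_idem (i - 1)) m = a (y_elem n) m')}"
      by blast
  qed simp
  ultimately show ?thesis by linarith
qed

subsection \<open>Filtrations\<close>

context B_mod
begin

definition factor :: "'m set \<Rightarrow> 'm set \<Rightarrow> nat set \<Rightarrow> ('m \<Rightarrow> nat \<Rightarrow> complex fps) \<Rightarrow> bool" where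
  "factor N N' I h \<longleftrightarrow> I \<subseteq> {1..n} \<and> card I = k \<and> submodule N (B k n) M \<and> submodule N' (B k n) M \<and>
     h \<in> left_module_hom (B k n) (M\<lparr>carrier := N'\<rparr>) (L_module n I) \<and>
     h ` N' = carrier (L_module n I) \<and> {m \<in> N'. h m = \<zero>\<^bsub>L_module n I\<^esub>} = N"

lemma submodule_closed:
  assumes "submodule N (B k n) M"
  shows "N \<subseteq> C" "\<zero>\<^bsub>M\<^esub> \<in> N" "m \<in> N \<Longrightarrow> m' \<in> N \<Longrightarrow> m \<boxplus> m' \<in> N" "m \<in> N \<Longrightarrow> \<ominus>\<^bsub>M\<^esub> m \<in> N"
    "a \<in> carrier (CPA n) \<Longrightarrow> m \<in> N \<Longrightarrow> act a m \<in> N"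
proof -
  have g: "subgroup N (add_monoid M)" using assms by (rule submodule.axioms(1))
  show "N \<subseteq> C" "\<zero>\<^bsub>M\<^esub> \<in> N" "m \<in> N \<Longrightarrow> m' \<in> N \<Longrightarrow> m \<boxplus> m' \<in> N"
    using subgroup.subset[OF g] subgroup.one_closed[OF g] subgroup.m_closed[OF g, of m m'] by simp_all
  show "m \<in> N \<Longrightarrow> \<ominus>\<^bsub>M\<^esub> m \<in> N"
    using subgroup.m_inv_closed[OF g, of m] by (simp add: a_inv_def)
  show "a \<in> carrier (CPA n) \<Longrightarrow> m \<in> N \<Longrightarrow> act a m \<in> N"
    unfolding act_def by (intro submodule.smult_closed[OF assms] ring_hom_closed[OF class_hom])
qed

lemma factor_L_mod: "factor N N' I h \<Longrightarrow> L_mod k n I"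
  unfolding factor_def L_mod_def using k by blast

lemma factorD:
  assumes "factor N N' I h"
  shows factor_sub: "submodule N (B k n) M" "submodule N' (B k n) M"
    and factor_add: "m \<in> N' \<Longrightarrow> m' \<in> N' \<Longrightarrow> h (m \<boxplus> m') j = h m j + h m' j"
    and factor_act: "a \<in> carrier (CPA n) \<Longrightarrow> m \<in> N' \<Longrightarrow> h (act a m) = L_action n I a (h m)"
    and factor_surj: "u \<in> carrier (L_module n I) \<Longrightarrow> \<exists>m\<in>N'. h m = u"
    and factor_carrier: "m \<in> N' \<Longrightarrow> h m \<in> carrier (L_module n I)"
    and factor_ker: "m \<in> N \<longleftrightarrow> m \<in> N' \<and> h m = (\<lambda>_. 0)"
proof -
  interpret L_mod k n I by (rule factor_L_mod[OF assms])
  have hom: "h \<in> left_module_hom (B k n) (M\<lparr>carrier := N'\<rparr>) (L_module n I)"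
    and im: "h ` N' = carrier (L_module n I)" and ker: "{m \<in> N'. h m = \<zero>\<^bsub>L_module n I\<^esub>} = N"
    using assms unfolding factor_def by blast+
  show "submodule N (B k n) M" "submodule N' (B k n) M" using assms unfolding factor_def by blast+
  show c: "m \<in> N' \<Longrightarrow> h m \<in> carrier (L_module n I)" for m using im by blast
  show "m \<in> N' \<Longrightarrow> m' \<in> N' \<Longrightarrow> h (m \<boxplus> m') j = h m j + h m' j"
    using hom by (simp add: left_module_hom_def L_module_def)
  show "u \<in> carrier (L_module n I) \<Longrightarrow> \<exists>m\<in>N'. h m = u" using im by (metis imageE)
  show "m \<in> N \<longleftrightarrow> m \<in> N' \<and> h m = (\<lambda>_. 0)" using ker by (auto simp: L_module_def)
  show "h (act a m) = L_action n I a (h m)" if a: "a \<in> carrier (CPA n)" and m: "m \<in> N'"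
  proof -
    have "B_class k n a \<in> carrier (B k n)" by (rule ring_hom_closed[OF class_hom a])
    then have "h (B_class k n a \<odot>\<^bsub>M\<^esub> m) = B_class k n a \<odot>\<^bsub>L_module n I\<^esub> h m"
      using hom m by (simp add: left_module_hom_def)
    then show ?thesis unfolding act_def L_module_smult[OF a c[OF m]] .
  qed
qed

lemma factor_minus:
  assumes F: "factor N N' I h" and m: "m \<in> N'" "m' \<in> N'"
  shows "h (m \<boxplus> \<ominus>\<^bsub>M\<^esub> m') j = h m j - h m' j"
proof -
  note N' = submodule_closed[OF factor_sub(2)[OF F]]
  have "m \<in> C" "m' \<in> C" using m N'(1) by blast+
  then have e: "(m \<boxplus> \<ominus>\<^bsub>M\<^esub> m') \<boxplus> m' = m" by (simp add: M.a_assoc M.l_neg)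
  have "h ((m \<boxplus> \<ominus>\<^bsub>M\<^esub> m') \<boxplus> m') j = h (m \<boxplus> \<ominus>\<^bsub>M\<^esub> m') j + h m' j"
    by (rule factor_add[OF F]) (use m N' in blast)+
  then show ?thesis unfolding e by simp
qed

lemma factor_vertex:
  assumes F: "factor N N' I h" and m: "m \<in> N'" and i: "i < n" and j: "j < n"
  shows "h (E i m) j = (if j = i then h m j else 0)"
proof -
  interpret L_mod k n I by (rule factor_L_mod[OF F])
  show ?thesis
    unfolding factor_act[OF F vertex_closed[OF i] m] unfolding vertex_idem_eq[OF i] L_diag[OF j] by simp
qed

text \<open>For \<open>i \<notin> I\<close> the arrow \<open>y\<^sub>i\<close> acts invertibly on the factor, so surjectivity of \<open>y\<^sub>i\<close> lifts.\<close>

lemma factor_Y_surj: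
  assumes F: "factor N N' I h" and i: "i \<in> {1..n}" "i \<notin> I"
    and sur: "\<And>m. m \<in> N \<Longrightarrow> \<exists>m'\<in>C. E (i - 1) m = Y m'" and m: "m \<in> N'"
  shows "\<exists>m'\<in>C. E (i - 1) m = Y m'"
proof -
  interpret L_mod k n I by (rule factor_L_mod[OF F])
  note N' = submodule_closed[OF factor_sub(2)[OF F]]
  have i1: "i - 1 < n" "Suc (i - 1) mod n = i mod n" and im: "i mod n < n" using i k by auto
  \<comment> \<open>As i is not in I, the arrow y from vertex i mod n to i - 1 acts on the factor as
    1; so u is the preimage of the component of h m at i - 1. Subtracting the image of a lift of u
    moves that component into N.\<close>
  define u where "u = (\<lambda>j. if j = i mod n then h m (i - 1) else 0)"
  have "u \<in> carrier (L_module n I)" using im by (auto simp: CL u_def)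
  then obtain m1 where m1: "m1 \<in> N'" "h m1 = u" using factor_surj[OF F] by blast
  have C: "m \<in> C" "m1 \<in> C" using m m1 N'(1) by blast+
  let ?d = "m \<boxplus> \<ominus>\<^bsub>M\<^esub> (Y m1)"
  have Ym1: "Y m1 \<in> N'" using N'(5) m1(1) by simp
  have d: "?d \<in> N'" using N' m Ym1 by blast
  have Ed: "E (i - 1) ?d \<in> N'" using N'(5)[OF vertex_closed[OF i1(1)] d] .
  have "h (E (i - 1) ?d) j = 0" for j
  proof (cases "j < n")
    case True
    have "h (Y m1) (i - 1) = h m (i - 1)"
      unfolding factor_act[OF F closed(2) m1(1)] using L_y[OF i(1), of "h m1"] i(2) m1(2) by (simp add: u_def)
    then show ?thesis
      unfolding factor_vertex[OF F d i1(1) True] factor_minus[OF F m Ym1] by simp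
  next
    case False
    then show ?thesis using factor_carrier[OF F Ed] by (simp add: CL)
  qed
  then have "E (i - 1) ?d \<in> N" using factor_ker[OF F] Ed by blast
  then obtain m2 where m2: "m2 \<in> C" "E (i - 1) (E (i - 1) ?d) = Y m2" using sur by blast
  have dC: "?d \<in> C" using d N'(1) by blast
  then have 2: "E (i - 1) ?d = Y m2" using m2(2) i1(1) by (simp add: E_E)
  have e: "?d \<boxplus> Y m1 = m" using C by (simp add: M.a_assoc M.l_neg)
  have "E (i - 1) (?d \<boxplus> Y m1) = E (i - 1) ?d \<boxplus> E (i - 1) (Y m1)"
    by (rule act_add_right) (use dC C i1 in auto)
  also have "E (i - 1) (Y m1) = Y (E (i mod n) m1)" using E_Y[OF i1(1) C(2)] i1(2) by simp
  also have "E (i - 1) ?d \<boxplus> Y (E (i mod n) m1) = Y (m2 \<boxplus> E (i mod n) m1)"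
    unfolding 2 using m2(1) C im by (simp add: act_add_right)
  finally show ?thesis unfolding e using m2(1) C im by (intro bexI[of _ "m2 \<boxplus> E (i mod n) m1"]) auto
qed

lemma factor_T:
  assumes F: "factor N N' I h" and m: "m \<in> N'"
  shows "h (T m) 0 = fps_X * h m 0"
proof -
  interpret L_mod k n I by (rule factor_L_mod[OF F])
  show ?thesis unfolding factor_act[OF F closed(4) m] L_mult L_xy using k by simp
qed

lemma factor_Z:
  assumes F: "factor N N' I h" and m: "m \<in> N'"
  shows "h (Z f m) 0 = f * h m 0"
proof (rule fps_eq_mult_of_shift)
  fix f
  interpret L_mod k n I by (rule factor_L_mod[OF F])
  note N' = submodule_closed[OF factor_sub(2)[OF F]]
  have C: "m \<in> C" using m N'(1) by blast
  have Zm: "Z (fps_shift 1 f) m \<in> N'" by (rule N'(5)) (simp_all add: m)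
  have "h (Z f m) 0 = h (D (\<lambda>_. fps_nth f 0) m) 0 + h (T (Z (fps_shift 1 f) m)) 0"
    unfolding Z_split[OF C, of f] by (rule factor_add[OF F]; rule N'(5)) (use m Zm in auto)
  also have "h (D (\<lambda>_. fps_nth f 0) m) 0 = fps_const (fps_nth f 0) * h m 0"
    unfolding factor_act[OF F closed(3) m] using L_diag[of 0] k by simp
  finally show "h (Z f m) 0 = fps_const (fps_nth f 0) * h m 0 + fps_X * h (Z (fps_shift 1 f) m) 0"
    unfolding factor_T[OF F Zm] .
qed

end

section \<open>The length of a filtration\<close>

context CM_mod
begin

text \<open>The K-subspace of K^3 spanned by N at vertex 0, with denominators cleared by a power of
  t. \<open>L_filtration\<close> does not prescribe the length of the list; the dimension of this
  space counts the factors.\<close>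

definition kspan :: "'m set \<Rightarrow> V set" where
  "kspan N = {z. \<exists>m\<in>N. \<exists>e::nat. tp (int e) *s z = frame m}"

lemma frame_eq_Phi: "frame = Phi 0"
  by (simp add: fun_eq_iff Phi_def)

lemma subspace_kspan:
  assumes "submodule N (B k n) M"
  shows "vec.subspace (kspan N)"
proof -
  note N = submodule_closed[OF assms]
  have NC: "m \<in> C" if "m \<in> N" for m using N(1) that by blast
  show ?thesis
    unfolding vec.subspace_def
  proof (intro conjI ballI allI)
    show "0 \<in> kspan N" unfolding kspan_def frame_eq_Phi using N(2) Phi_zero[of 0] by auto
    fix x assume "x \<in> kspan N"
    then obtain m e where m: "m \<in> N" "tp (int e) *s x = frame m" unfolding kspan_def by blast
    show "c *s x \<in> kspan N" for c
    proof -
      define a where "a = nat (- fls_subdegree c)"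
      have "ordge 0 (tp (int a) * c)" unfolding ordge_tp unfolding ordge_iff a_def by auto
      then have reg: "fps_to_fls (fls_regpart (tp (int a) * c)) = tp (int a) * c"
        by (auto simp: fls_eq_iff ordge_def)
      have "tp (int (e + a)) *s (c *s x) = (tp (int a) * c) *s (tp (int e) *s x)"
        by (simp add: vector_smult_assoc tp_add mult.commute mult.left_commute)
      also have "\<dots> = frame (Z (fls_regpart (tp (int a) * c)) m)"
        unfolding m(2) frame_eq_Phi Phi_Z[OF NC[OF m(1)]] reg ..
      finally show ?thesis unfolding kspan_def using N(5)[OF closed(5) m(1)] by blast
    qed
    fix y assume "y \<in> kspan N"
    then obtain m' e' where m': "m' \<in> N" "tp (int e') *s y = frame m'" unfolding kspan_def by blast
    have up: "(T ^^ j) m \<in> N \<and> frame ((T ^^ j) m) = tp (int j) *s frame m" if "m \<in> N" for j m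
    proof
      show "(T ^^ j) m \<in> N" using N(5)[OF closed(4)] that by (induction j) auto
      show "frame ((T ^^ j) m) = tp (int j) *s frame m"
        unfolding frame_eq_Phi by (rule Phi_T_pow[OF NC[OF that]])
    qed
    have "tp (int (e + e')) *s (x + y) = tp (int e') *s (tp (int e) *s x) + tp (int e) *s (tp (int e') *s y)"
      by (simp add: vector_smult_assoc tp_mult_tp vector_add_ldistrib add.commute)
    also have "\<dots> = frame ((T ^^ e') m \<boxplus> (T ^^ e) m')"
      unfolding m(2) m'(2) using up[OF m(1), of e'] up[OF m'(1), of e] NC by (simp add: frame_add)
    finally show "x + y \<in> kspan N"
      unfolding kspan_def using up[OF m(1), of e'] up[OF m'(1), of e] N(3) by blast
  qed
qed

text \<open>A lift g of the generator of the factor at vertex 0 gives the new direction: subtracting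
  the multiple of g by h m 0 brings m into N at vertex 0. The direction is new because h sends t^e g
  to t^e at vertex 0, which is never zero.\<close>

lemma factor_kspan:
  assumes F: "factor N N' I h"
  shows "\<exists>v. v \<notin> kspan N \<and> kspan N' = vec.span (insert v (kspan N))"
proof -
  interpret L_mod k n I by (rule factor_L_mod[OF F])
  note N = submodule_closed[OF factor_sub(1)[OF F]] and N' = submodule_closed[OF factor_sub(2)[OF F]]
  have n0: "0 < n" using k by simp
  have NC: "m \<in> C" if "m \<in> N'" for m using N'(1) that by blast
  define u where "u = (\<lambda>j::nat. if j = 0 then 1 :: complex fps else 0)"
  have "u \<in> carrier (L_module n I)" using n0 by (simp add: CL u_def)
  then obtain g where g: "g \<in> N'" "h g = u" using factor_surj[OF F] by blast
  have E0: "E 0 m \<in> N" if m: "m \<in> N'" "h m 0 = 0" for m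
  proof -
    have Em: "E 0 m \<in> N'" by (rule N'(5)[OF vertex_closed[OF n0] m(1)])
    have "h (E 0 m) j = 0" for j
      using factor_vertex[OF F m(1) n0, of j] factor_carrier[OF F Em] m(2) by (cases "j < n") (auto simp: CL)
    then show ?thesis using factor_ker[OF F] Em by blast
  qed
  have notin: "frame g \<notin> kspan N"
  proof
    assume "frame g \<in> kspan N"
    then obtain m e where m: "m \<in> N" "tp (int e) *s frame g = frame m" unfolding kspan_def by blast
    have T: "(T ^^ e) g \<in> N' \<and> h ((T ^^ e) g) 0 = fps_X ^ e" for e
      by (induction e) (simp_all add: g u_def N'(5) factor_T[OF F])
    have mN': "m \<in> N'" using m(1) factor_ker[OF F] by blast
    have "frame ((T ^^ e) g) = frame m"
      using m(2) Phi_T_pow[OF NC[OF g(1)], of 0 e] by (simp add: frame_eq_Phi)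
    then have "E 0 ((T ^^ e) g) = E 0 m" using T NC mN' by (intro frame_inj) auto
    then have "h (E 0 ((T ^^ e) g)) 0 = h (E 0 m) 0" by simp
    then have "h ((T ^^ e) g) 0 = h m 0"
      using factor_vertex[OF F _ n0 n0] T mN' by simp
    then show False using T m(1) factor_ker[OF F] by auto
  qed
  have "kspan N' \<subseteq> vec.span (insert (frame g) (kspan N))"
  proof
    fix z assume "z \<in> kspan N'"
    then obtain m e where m: "m \<in> N'" "tp (int e) *s z = frame m" unfolding kspan_def by blast
    let ?f = "h m 0"
    let ?m = "m \<boxplus> \<ominus>\<^bsub>M\<^esub> (Z ?f g)"
    have Zg: "Z ?f g \<in> N'" by (rule N'(5)[OF closed(5) g(1)])
    have m': "?m \<in> N'" using N' m(1) Zg by blast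
    have "h ?m 0 = 0" unfolding factor_minus[OF F m(1) Zg] factor_Z[OF F g(1)] by (simp add: g u_def)
    then have "E 0 ?m \<in> N" by (rule E0[OF m'])
    moreover have "tp (int 0) *s frame ?m = frame (E 0 ?m)" using frame_E[OF NC[OF m']] by simp
    ultimately have 1: "frame ?m \<in> kspan N" unfolding kspan_def by blast
    have "?m \<boxplus> Z ?f g = m" using NC[OF m(1)] NC[OF Zg] by (simp add: M.a_assoc M.l_neg)
    then have "frame m = frame ?m + fps_to_fls ?f *s frame g"
      using frame_add[OF NC[OF m'] NC[OF Zg]] Phi_Z[OF NC[OF g(1)], of 0 ?f] by (simp add: frame_eq_Phi)
    moreover have "frame ?m \<in> vec.span (insert (frame g) (kspan N))"
      by (rule vec.span_base) (use 1 in simp)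
    moreover have "fps_to_fls ?f *s frame g \<in> vec.span (insert (frame g) (kspan N))"
      by (intro vec.span_scale vec.span_base) simp
    ultimately have "frame m \<in> vec.span (insert (frame g) (kspan N))" by (simp only: vec.span_add)
    then have "tp (- int e) *s (tp (int e) *s z) \<in> vec.span (insert (frame g) (kspan N))"
      unfolding m(2) by (rule vec.span_scale)
    then show "z \<in> vec.span (insert (frame g) (kspan N))" by (simp add: vector_smult_assoc tp_mult_tp)
  qed
  moreover have "vec.span (insert (frame g) (kspan N)) \<subseteq> kspan N'"
  proof (rule vec.span_minimal)
    show "vec.subspace (kspan N')" by (rule subspace_kspan[OF factor_sub(2)[OF F]])
    have "N \<subseteq> N'" using factor_ker[OF F] by blast
    then have "kspan N \<subseteq> kspan N'" unfolding kspan_def by blast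
    moreover have "tp (int 0) *s frame g = frame g" by simp
    then have "frame g \<in> kspan N'" unfolding kspan_def using g(1) by blast
    ultimately show "insert (frame g) (kspan N) \<subseteq> kspan N'" by blast
  qed
  ultimately show ?thesis using notin by blast
qed

lemma kspan_zero: "kspan {\<zero>\<^bsub>M\<^esub>} = {0}"
  using Phi_zero[of 0] by (auto simp: kspan_def frame_eq_Phi)

lemma kspan_UNIV: "kspan C = UNIV"
proof -
  have "z \<in> kspan C" for z
  proof -
    define e where "e = (\<Sum>s\<in>UNIV. nat \<bar>fls_subdegree (z $ s)\<bar>)"
    have "tp (int e) *s z \<in> std 0"
      unfolding std_def
    proof (intro CollectI allI)
      fix s
      have "nat \<bar>fls_subdegree (z $ s)\<bar> \<le> e" unfolding e_def by (rule member_le_sum) auto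
      then have "- int e \<le> fls_subdegree (z $ s)" by linarith
      then show "ordge 0 ((tp (int e) *s z) $ s)"
        unfolding vector_smult_component ordge_tp unfolding ordge_iff by auto
    qed
    then have "tp (int e) *s z \<in> frame ` C" unfolding frame_image .
    then obtain m where "m \<in> C" "tp (int e) *s z = frame m" by blast
    then show ?thesis unfolding kspan_def by blast
  qed
  then show ?thesis by blast
qed

lemma filtration_length:
  assumes N0: "N 0 = {\<zero>\<^bsub>M\<^esub>}" and Nr: "N r = C" and F: "\<And>j. j < r \<Longrightarrow> factor (N j) (N (Suc j)) (I j) (h j)"
  shows "r = 3"
proof -
  have "\<exists>S. finite S \<and> vec.independent S \<and> card S = j \<and> vec.span S = kspan (N j)" if "j \<le> r" for j
    using that
  proof (induction j)
    case 0
    show ?case unfolding N0 kspan_zero by (intro exI[of _ "{}"]) (simp add: vec.independent_empty)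
  next
    case (Suc j)
    then obtain S where S: "finite S" "vec.independent S" "card S = j" "vec.span S = kspan (N j)" by auto
    obtain v where v: "v \<notin> kspan (N j)" "kspan (N (Suc j)) = vec.span (insert v (kspan (N j)))"
      using factor_kspan[OF F[of j]] Suc by auto
    have vS: "v \<notin> S" using v(1) vec.span_base[of v S] S(4) by blast
    have "vec.span (insert v S) = kspan (N (Suc j))"
    proof
      have "S \<subseteq> kspan (N j)" unfolding S(4)[symmetric] by (rule vec.span_superset)
      then show "vec.span (insert v S) \<subseteq> kspan (N (Suc j))"
        unfolding v(2) by (intro vec.span_mono insert_mono)
      have "insert v (kspan (N j)) \<subseteq> vec.span (insert v S)"
        unfolding S(4)[symmetric] using vec.span_base[of v "insert v S"] vec.span_mono[of S "insert v S"] by blast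
      then show "kspan (N (Suc j)) \<subseteq> vec.span (insert v S)"
        unfolding v(2) by (intro vec.span_minimal vec.subspace_span)
    qed
    then show ?case
      using S vS v(1) by (intro exI[of _ "insert v S"]) (simp add: vec.independent_insert)
  qed
  from this[of r] obtain S where S: "vec.independent S" "card S = r" "vec.span S = (UNIV :: V set)"
    unfolding Nr kspan_UNIV by blast
  have "vec.dim (UNIV :: V set) = card S" unfolding S(3)[symmetric] vec.dim_span by (rule vec.dim_eq_card_independent[OF S(1)])
  then show ?thesis unfolding vec_dim_card S(2) by simp
qed

end

theorem theorem5p6:
  fixes n :: nat and M :: "'m B_module"
  assumes "n \<ge> 6"
    and "CM_of_rank 3 n 3 M"
    and "indecomposable_module (B 3 n) M"
  shows "\<forall>Is. L_filtration 3 n M Is \<longrightarrow>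
     q_form 3 n (x_vector n Is) \<in> {0, 2} \<and>
     (J_real_root 3 n (root_lattice_elem 3 n (x_vector n Is)) \<or>
      J_imaginary_root 3 n (root_lattice_elem 3 n (x_vector n Is)))"
proof (intro allI impI)
  fix Is assume L: "L_filtration 3 n M Is"
  have n: "3 < n" using assms(1) by simp
  interpret lm: left_module "B 3 n" M using assms(2) unfolding CM_of_rank_def by blast
  interpret CM_mod 3 n M
    by unfold_locales (use n assms(2) in \<open>auto simp: CM_of_rank_def\<close>)
  have Is: "I \<subseteq> {1..n}" "card I = 3" if "I \<in> set Is" for I
    using L that unfolding L_filtration_def by blast+
  obtain N where N': "N 0 = {\<zero>\<^bsub>M\<^esub>} \<and> N (length Is) = carrier M \<and>
        (\<forall>j\<le>length Is. submodule (N j) (B 3 n) M) \<and>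
        (\<forall>j<length Is. N j \<subseteq> N (Suc j) \<and>
           (\<exists>h \<in> left_module_hom (B 3 n) (M\<lparr>carrier := N (Suc j)\<rparr>) (L_module n (Is ! j)).
              h ` N (Suc j) = carrier (L_module n (Is ! j)) \<and>
              {m \<in> N (Suc j). h m = \<zero>\<^bsub>L_module n (Is ! j)\<^esub>} = N j))"
    using L[unfolded L_filtration_def, THEN conjunct2] by (elim exE that)
  then have N: "N 0 = {\<zero>\<^bsub>M\<^esub>}" "N (length Is) = carrier M"
    and sub: "\<And>j. j \<le> length Is \<Longrightarrow> submodule (N j) (B 3 n) M" by blast+
  have "\<exists>h. factor (N j) (N (Suc j)) (Is ! j) h" if "j < length Is" for j
  proof -
    have "submodule (N j) (B 3 n) M" "submodule (N (Suc j)) (B 3 n) M" using sub that by simp_all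
    then show ?thesis unfolding factor_def using Is[OF nth_mem[OF that]] N' that by blast
  qed
  then obtain h where F: "\<And>j. j < length Is \<Longrightarrow> factor (N j) (N (Suc j)) (Is ! j) (h j)" by metis
  have len: "length Is = 3" by (rule filtration_length[OF N(1,2) F])
  let ?x = "x_vector n Is"
  have "\<exists>m'\<in>carrier M. E (i - 1) m = Y m'"
    if i: "i \<in> {1..n}" "?x i = 0" and m: "m \<in> carrier M" for i m
  proof -
    have notin: "i \<notin> Is ! j" if "j < length Is" for j
      using i that by (auto simp: x_vector_def)
    \<comment> \<open>The surjectivity of y climbs from N 0 = 0 through the factors, since i lies in
      none of the sets.\<close>
    have "\<forall>m\<in>N j. \<exists>m'\<in>carrier M. E (i - 1) m = Y m'" if "j \<le> length Is" for j
      using that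
    proof (induction j)
      case 0
      have "i - 1 < n" using i by auto
      then have "E (i - 1) \<zero>\<^bsub>M\<^esub> = Y \<zero>\<^bsub>M\<^esub>"
        by (simp only: act_zero_right vertex_closed closed)
      then show ?case unfolding N(1) by blast
    next
      case (Suc j)
      then show ?case using factor_Y_surj[OF F[of j] i(1) notin[of j]] by auto
    qed
    then show ?thesis using N(2) m by auto
  qed
  \<comment> \<open>By contraposition, each place where y fails to be surjective belongs to the
    support of x(M).\<close>
  then have steps: "{i\<in>{1..n}. \<not> (\<forall>m\<in>carrier M. \<exists>m'\<in>carrier M. E (i - 1) m = Y m')} \<subseteq> {i\<in>{1..n}. ?x i \<noteq> 0}"
    by blast
  have "8 \<le> card {i\<in>{1..n}. \<not> (\<forall>m\<in>carrier M. \<exists>m'\<in>carrier M. E (i - 1) m = Y m')}"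
    unfolding act_def by (rule eight_nonsurjective[OF assms(2) n assms(3)])
  also have "\<dots> \<le> card {i\<in>{1..n}. ?x i \<noteq> 0}" by (rule card_mono[OF _ steps]) simp
  finally have supp: "8 \<le> card {i\<in>{1..n}. ?x i \<noteq> 0}" .
  \<comment> \<open>Double counting of the pairs (i, j) with i in \<open>Is ! j\<close>.\<close>
  have "(\<Sum>i\<in>{1..n}. ?x i) = (\<Sum>i\<in>{1..n}. \<Sum>j<length Is. if i \<in> Is ! j then 1 else 0)"
    by (rule sum.cong) (auto simp: x_vector_def lessThan_def Collect_conj_eq simp flip: sum.inter_filter)
  also have "\<dots> = (\<Sum>j<length Is. \<Sum>i\<in>{1..n}. if i \<in> Is ! j then 1 else 0)" by (rule sum.swap)
  also have "\<dots> = (\<Sum>j<length Is. 3)"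
  proof (rule sum.cong)
    fix j assume "j \<in> {..<length Is}"
    then have j: "Is ! j \<subseteq> {1..n}" "card (Is ! j) = 3" using Is by auto
    have "(\<Sum>i\<in>{1..n}. if i \<in> Is ! j then 1 else 0) = (\<Sum>i\<in>Is ! j. 1 :: int)"
      using j by (intro sum.mono_neutral_cong_right) auto
    then show "(\<Sum>i\<in>{1..n}. if i \<in> Is ! j then 1 else 0) = (3 :: int)" using j by simp
  qed simp
  finally have s: "(\<Sum>i\<in>{1..n}. ?x i) = 9" using len by simp
  show "q_form 3 n ?x \<in> {0, 2} \<and>
     (J_real_root 3 n (root_lattice_elem 3 n ?x) \<or> J_imaginary_root 3 n (root_lattice_elem 3 n ?x))"
    by (rule root_of_large_support[OF n _ _ s supp]) (auto simp: x_vector_def)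
qed

end
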